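(* Let $G$ be a finite group, $H\subset G$ a subgroup, and $k$ an $H$-Tambara functor. Then coinduction induces an equivalence of categories $$H\text{-}\mathrm{Tamb}_{k/}\;\simeq\; G\text{-}\mathrm{Tamb}_{\mathrm{Coind}_H^G k/}$$ between the slice category of $H$-Tambara functors under $k$ and the slice category of $G$-Tambara functors under $\mathrm{Coind}_H^G k$.
   Context: Let $\mathrm{bispan}(G\text{-}\mathrm{Set}^{\mathrm{fin}})$ be the category whose objects are finite $G$-sets and whose morphisms from $X$ to $Y$ are isomorphism classes of diagrams $X\leftarrow A\to B\to Y$ of finite $G$-sets, with the usual composition of bispans (polynomials), defined via pullbacks and exponential diagrams. A $G$-Tambara functor is a product-preserving functor $R:\mathrm{bispan}(G\text{-}\mathrm{Set}^{\mathrm{fin}})\to \mathrm{Set}$ such that the additive monoid $R(X)$ (with addition the transfer along the fold map $X\sqcup X\to X$) is a group for each finite $G$-set $X$; morphisms are natural transformations; the category is $G\text{-}\mathrm{Tamb}$. The same definitions apply to every finite group. For $H\subset G$ and an $H$-Tambara functor $T$, $\mathrm{Coind}_H^G T:=T\circ\mathrm{res}_H^G$, i.e. $(\mathrm{Coind}_H^G T)(X)=T(\mathrm{res}_H^G X)$, where $\mathrm{res}_H^G$ sends a $G$-set to its underlying $H$-set. The functor in the statement sends $(k\to R)$ to $(\mathrm{Coind}_H^G k\to \mathrm{Coind}_H^G R)$. *)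

theory Defs
  imports "HOL-Algebra.Group_Action" "HOL-Library.Infinite_Typeclass"
begin

text \<open>
  Morphisms are not tagged with their domain and codomain: a morphism is always read relative to
  a pair of objects, so \<open>Comp C X Y Z g f\<close> is the composite of \<open>f : X \<rightarrow> Y\<close> and \<open>g : Y \<rightarrow> Z\<close>.
\<close>

record ('o, 'm) cat =
  Obj :: "'o set"
  Hom :: "'o \<Rightarrow> 'o \<Rightarrow> 'm set"
  Ident :: "'o \<Rightarrow> 'm"
  Comp :: "'o \<Rightarrow> 'o \<Rightarrow> 'o \<Rightarrow> 'm \<Rightarrow> 'm \<Rightarrow> 'm"

definition category :: "('o, 'm) cat \<Rightarrow> bool" where
  "category C \<longleftrightarrow>
     (\<forall>X\<in>Obj C. Ident C X \<in> Hom C X X) \<and>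
     (\<forall>X\<in>Obj C. \<forall>Y\<in>Obj C. \<forall>Z\<in>Obj C. \<forall>f\<in>Hom C X Y. \<forall>g\<in>Hom C Y Z.
        Comp C X Y Z g f \<in> Hom C X Z) \<and>
     (\<forall>X\<in>Obj C. \<forall>Y\<in>Obj C. \<forall>f\<in>Hom C X Y.
        Comp C X X Y f (Ident C X) = f \<and> Comp C X Y Y (Ident C Y) f = f) \<and>
     (\<forall>W\<in>Obj C. \<forall>X\<in>Obj C. \<forall>Y\<in>Obj C. \<forall>Z\<in>Obj C.
        \<forall>f\<in>Hom C W X. \<forall>g\<in>Hom C X Y. \<forall>h\<in>Hom C Y Z.
          Comp C W X Z (Comp C X Y Z h g) f = Comp C W Y Z h (Comp C W X Y g f))"

definition is_iso :: "('o, 'm) cat \<Rightarrow> 'o \<Rightarrow> 'o \<Rightarrow> 'm \<Rightarrow> bool" where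
  "is_iso C X Y f \<longleftrightarrow> f \<in> Hom C X Y \<and>
     (\<exists>g\<in>Hom C Y X. Comp C X Y X g f = Ident C X \<and> Comp C Y X Y f g = Ident C Y)"

definition is_terminal :: "('o, 'm) cat \<Rightarrow> 'o \<Rightarrow> bool" where
  "is_terminal C T \<longleftrightarrow> T \<in> Obj C \<and> (\<forall>X\<in>Obj C. \<exists>!f. f \<in> Hom C X T)"

definition is_initial :: "('o, 'm) cat \<Rightarrow> 'o \<Rightarrow> bool" where
  "is_initial C I \<longleftrightarrow> I \<in> Obj C \<and> (\<forall>X\<in>Obj C. \<exists>!f. f \<in> Hom C I X)"

definition is_product :: "('o, 'm) cat \<Rightarrow> 'o \<Rightarrow> 'o \<Rightarrow> 'o \<Rightarrow> 'm \<Rightarrow> 'm \<Rightarrow> bool" where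
  "is_product C X Y P p q \<longleftrightarrow>
     X \<in> Obj C \<and> Y \<in> Obj C \<and> P \<in> Obj C \<and> p \<in> Hom C P X \<and> q \<in> Hom C P Y \<and>
     (\<forall>T\<in>Obj C. \<forall>a\<in>Hom C T X. \<forall>b\<in>Hom C T Y.
        \<exists>!u. u \<in> Hom C T P \<and> Comp C T P X p u = a \<and> Comp C T P Y q u = b)"

definition is_coproduct :: "('o, 'm) cat \<Rightarrow> 'o \<Rightarrow> 'o \<Rightarrow> 'o \<Rightarrow> 'm \<Rightarrow> 'm \<Rightarrow> bool" where
  "is_coproduct C X Y S i j \<longleftrightarrow>
     X \<in> Obj C \<and> Y \<in> Obj C \<and> S \<in> Obj C \<and> i \<in> Hom C X S \<and> j \<in> Hom C Y S \<and>
     (\<forall>T\<in>Obj C. \<forall>a\<in>Hom C X T. \<forall>b\<in>Hom C Y T.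
        \<exists>!u. u \<in> Hom C S T \<and> Comp C X S T u i = a \<and> Comp C Y S T u j = b)"

definition is_pullback ::
    "('o, 'm) cat \<Rightarrow> 'o \<Rightarrow> 'o \<Rightarrow> 'o \<Rightarrow> 'm \<Rightarrow> 'm \<Rightarrow> 'o \<Rightarrow> 'm \<Rightarrow> 'm \<Rightarrow> bool" where
  "is_pullback C X Y Z f g P p q \<longleftrightarrow>
     X \<in> Obj C \<and> Y \<in> Obj C \<and> Z \<in> Obj C \<and> P \<in> Obj C \<and>
     f \<in> Hom C X Z \<and> g \<in> Hom C Y Z \<and> p \<in> Hom C P X \<and> q \<in> Hom C P Y \<and>
     Comp C P X Z f p = Comp C P Y Z g q \<and>
     (\<forall>T\<in>Obj C. \<forall>a\<in>Hom C T X. \<forall>b\<in>Hom C T Y. Comp C T X Z f a = Comp C T Y Z g b \<longrightarrow>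
        (\<exists>!u. u \<in> Hom C T P \<and> Comp C T P X p u = a \<and> Comp C T P Y q u = b))"

record ('o, 'm, 'p, 'n) cfunctor =
  on_obj :: "'o \<Rightarrow> 'p"
  on_hom :: "'o \<Rightarrow> 'o \<Rightarrow> 'm \<Rightarrow> 'n"

definition is_functor ::
    "('o, 'm) cat \<Rightarrow> ('p, 'n) cat \<Rightarrow> ('o, 'm, 'p, 'n) cfunctor \<Rightarrow> bool" where
  "is_functor C D F \<longleftrightarrow>
     (\<forall>X\<in>Obj C. on_obj F X \<in> Obj D) \<and>
     (\<forall>X\<in>Obj C. \<forall>Y\<in>Obj C. \<forall>f\<in>Hom C X Y. on_hom F X Y f \<in> Hom D (on_obj F X) (on_obj F Y)) \<and>
     (\<forall>X\<in>Obj C. on_hom F X X (Ident C X) = Ident D (on_obj F X)) \<and>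
     (\<forall>X\<in>Obj C. \<forall>Y\<in>Obj C. \<forall>Z\<in>Obj C. \<forall>f\<in>Hom C X Y. \<forall>g\<in>Hom C Y Z.
        on_hom F X Z (Comp C X Y Z g f) =
          Comp D (on_obj F X) (on_obj F Y) (on_obj F Z) (on_hom F Y Z g) (on_hom F X Y f))"

definition functor_id :: "('o, 'm, 'o, 'm) cfunctor" where
  "functor_id = \<lparr>on_obj = (\<lambda>X. X), on_hom = (\<lambda>X Y f. f)\<rparr>"

definition functor_comp ::
    "('p, 'n, 'q, 'l) cfunctor \<Rightarrow> ('o, 'm, 'p, 'n) cfunctor \<Rightarrow> ('o, 'm, 'q, 'l) cfunctor" where
  "functor_comp F E =
     \<lparr>on_obj = (\<lambda>X. on_obj F (on_obj E X)),
      on_hom = (\<lambda>X Y f. on_hom F (on_obj E X) (on_obj E Y) (on_hom E X Y f))\<rparr>"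

text \<open>Functors that form the objects of a category are normalised to be \<open>undefined\<close> off the source.\<close>

definition extensional_functor :: "('o, 'm) cat \<Rightarrow> ('o, 'm, 'p, 'n) cfunctor \<Rightarrow> bool" where
  "extensional_functor C F \<longleftrightarrow>
     on_obj F \<in> extensional (Obj C) \<and>
     (\<forall>X Y. on_hom F X Y \<in> extensional (if X \<in> Obj C \<and> Y \<in> Obj C then Hom C X Y else {}))"

definition restrict_functor ::
    "('o, 'm) cat \<Rightarrow> ('o, 'm, 'p, 'n) cfunctor \<Rightarrow> ('o, 'm, 'p, 'n) cfunctor" where
  "restrict_functor C F =
     \<lparr>on_obj = restrict (on_obj F) (Obj C),
      on_hom = (\<lambda>X Y. restrict (on_hom F X Y)
                  (if X \<in> Obj C \<and> Y \<in> Obj C then Hom C X Y else {}))\<rparr>"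

definition nat_trans ::
    "('o, 'm) cat \<Rightarrow> ('p, 'n) cat \<Rightarrow> ('o, 'm, 'p, 'n) cfunctor \<Rightarrow> ('o, 'm, 'p, 'n) cfunctor \<Rightarrow>
     ('o \<Rightarrow> 'n) \<Rightarrow> bool" where
  "nat_trans C D F F' \<eta> \<longleftrightarrow>
     (\<forall>X\<in>Obj C. \<eta> X \<in> Hom D (on_obj F X) (on_obj F' X)) \<and>
     (\<forall>X\<in>Obj C. \<forall>Y\<in>Obj C. \<forall>f\<in>Hom C X Y.
        Comp D (on_obj F X) (on_obj F Y) (on_obj F' Y) (\<eta> Y) (on_hom F X Y f) =
        Comp D (on_obj F X) (on_obj F' X) (on_obj F' Y) (on_hom F' X Y f) (\<eta> X))"

definition naturally_isomorphic ::
    "('o, 'm) cat \<Rightarrow> ('p, 'n) cat \<Rightarrow> ('o, 'm, 'p, 'n) cfunctor \<Rightarrow> ('o, 'm, 'p, 'n) cfunctor \<Rightarrow> bool"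
  where
  "naturally_isomorphic C D F F' \<longleftrightarrow>
     (\<exists>\<eta>. nat_trans C D F F' \<eta> \<and> (\<forall>X\<in>Obj C. is_iso D (on_obj F X) (on_obj F' X) (\<eta> X)))"

definition is_equivalence ::
    "('o, 'm) cat \<Rightarrow> ('p, 'n) cat \<Rightarrow> ('o, 'm, 'p, 'n) cfunctor \<Rightarrow> bool" where
  "is_equivalence C D F \<longleftrightarrow>
     category C \<and> category D \<and> is_functor C D F \<and>
     (\<exists>F'. is_functor D C F' \<and>
        naturally_isomorphic C C (functor_comp F' F) functor_id \<and>
        naturally_isomorphic D D (functor_comp F F') functor_id)"

definition preserves_finite_products ::
    "('o, 'm) cat \<Rightarrow> ('p, 'n) cat \<Rightarrow> ('o, 'm, 'p, 'n) cfunctor \<Rightarrow> bool" where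
  "preserves_finite_products C D F \<longleftrightarrow>
     (\<forall>T. is_terminal C T \<longrightarrow> is_terminal D (on_obj F T)) \<and>
     (\<forall>X Y P p q. is_product C X Y P p q \<longrightarrow>
        is_product D (on_obj F X) (on_obj F Y) (on_obj F P) (on_hom F P X p) (on_hom F P Y q))"

definition functor_cat ::
    "('o, 'm) cat \<Rightarrow> ('p, 'n) cat \<Rightarrow> (('o, 'm, 'p, 'n) cfunctor, 'o \<Rightarrow> 'n) cat" where
  "functor_cat C D =
     \<lparr>Obj = {F. is_functor C D F \<and> extensional_functor C F},
      Hom = (\<lambda>F F'. {\<eta> \<in> extensional (Obj C). nat_trans C D F F' \<eta>}),
      Ident = (\<lambda>F. \<lambda>X\<in>Obj C. Ident D (on_obj F X)),
      Comp = (\<lambda>F F' F'' \<theta> \<eta>. \<lambda>X\<in>Obj C.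
                Comp D (on_obj F X) (on_obj F' X) (on_obj F'' X) (\<theta> X) (\<eta> X))\<rparr>"

definition full_subcat :: "('o, 'm) cat \<Rightarrow> ('o \<Rightarrow> bool) \<Rightarrow> ('o, 'm) cat" where
  "full_subcat C S = C\<lparr>Obj := {X \<in> Obj C. S X}\<rparr>"

definition under_cat :: "('o, 'm) cat \<Rightarrow> 'o \<Rightarrow> ('o \<times> 'm, 'm) cat" where
  "under_cat C k =
     \<lparr>Obj = {(R, \<phi>). R \<in> Obj C \<and> \<phi> \<in> Hom C k R},
      Hom = (\<lambda>(R, \<phi>) (R', \<phi>'). {\<psi> \<in> Hom C R R'. Comp C k R R' \<psi> \<phi> = \<phi>'}),
      Ident = (\<lambda>(R, \<phi>). Ident C R),
      Comp = (\<lambda>(R, \<phi>) (R', \<phi>') (R'', \<phi>''). Comp C R R' R'')\<rparr>"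

text \<open>Sets are the subsets of a type \<open>'v\<close>, which stays arbitrary and so plays the role of the universe.\<close>

definition set_cat :: "('v set, 'v \<Rightarrow> 'v) cat" where
  "set_cat =
     \<lparr>Obj = UNIV,
      Hom = (\<lambda>A B. A \<rightarrow>\<^sub>E B),
      Ident = (\<lambda>A. \<lambda>x\<in>A. x),
      Comp = (\<lambda>A B C g f. compose A g f)\<rparr>"

text \<open>
  A \<open>G\<close>-set is a carrier set together with an action map. Carriers are subsets of a type \<open>'u\<close>; when \<open>'u\<close>
  is infinite, every finite \<open>G\<close>-set is isomorphic to one of these, so that finite coproducts,
  pullbacks and exponential diagrams all exist.
\<close>

type_synonym ('g, 'u) gset = "'u set \<times> ('g \<Rightarrow> 'u \<Rightarrow> 'u)"

abbreviation elts :: "('g, 'u) gset \<Rightarrow> 'u set" where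
  "elts X \<equiv> fst X"

abbreviation act :: "('g, 'u) gset \<Rightarrow> 'g \<Rightarrow> 'u \<Rightarrow> 'u" where
  "act X \<equiv> snd X"

definition finite_gsets :: "'g monoid \<Rightarrow> ('g, 'u) gset set" where
  "finite_gsets G =
     {X. finite (elts X) \<and> group_action G (elts X) (act X) \<and> act X \<in> extensional (carrier G)}"

definition equivariant_maps :: "'g monoid \<Rightarrow> ('g, 'u) gset \<Rightarrow> ('g, 'w) gset \<Rightarrow> ('u \<Rightarrow> 'w) set" where
  "equivariant_maps G X Y =
     {f \<in> elts X \<rightarrow>\<^sub>E elts Y. \<forall>g\<in>carrier G. \<forall>x\<in>elts X. f (act X g x) = act Y g (f x)}"

definition gset_cat :: "'g monoid \<Rightarrow> (('g, 'u) gset, 'u \<Rightarrow> 'u) cat" where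
  "gset_cat G =
     \<lparr>Obj = finite_gsets G,
      Hom = equivariant_maps G,
      Ident = (\<lambda>X. \<lambda>x\<in>elts X. x),
      Comp = (\<lambda>X Y Z g f. compose (elts X) g f)\<rparr>"

text \<open>
  For \<open>p : A \<rightarrow> X\<close> and \<open>f : X \<rightarrow> Y\<close>, the dependent product of \<open>p\<close> along \<open>f\<close>: pairs of a point \<open>y\<close> of
  \<open>Y\<close> and a section \<open>s\<close> of \<open>p\<close> over the fibre of \<open>f\<close> at \<open>y\<close>, with \<open>G\<close> acting by conjugation.
\<close>

definition dependent_product ::
    "'g monoid \<Rightarrow> ('g, 'u) gset \<Rightarrow> ('g, 'u) gset \<Rightarrow> ('g, 'u) gset \<Rightarrow> ('u \<Rightarrow> 'u) \<Rightarrow> ('u \<Rightarrow> 'u) \<Rightarrow>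
     ('g, 'u \<times> ('u \<Rightarrow> 'u)) gset" where
  "dependent_product G A X Y p f =
     (let fib = (\<lambda>y. {x \<in> elts X. f x = y});
          E = {(y, s). y \<in> elts Y \<and> s \<in> fib y \<rightarrow>\<^sub>E elts A \<and> (\<forall>x\<in>fib y. p (s x) = x)}
      in (E, \<lambda>g\<in>carrier G. \<lambda>(y, s)\<in>E.
               (act Y g y, \<lambda>x\<in>fib (act Y g y). act A g (s (act X (inv\<^bsub>G\<^esub> g) x)))))"

text \<open>
  The diagram with \<open>p : A \<rightarrow> X\<close>, \<open>f : X \<rightarrow> Y\<close>, \<open>e : B \<rightarrow> A\<close>, \<open>n : B \<rightarrow> E\<close>, \<open>q : E \<rightarrow> Y\<close> is exponential if
  it is isomorphic to the one in which \<open>E\<close> is the dependent product, \<open>B\<close> is its pullback along \<open>f\<close>,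
  and \<open>e\<close> is the evaluation \<open>(x, (y, s)) \<mapsto> s x\<close>. The projection \<open>B \<rightarrow> X\<close> is then \<open>p \<circ> e\<close>.
\<close>

definition exponential_diagram ::
    "'g monoid \<Rightarrow> ('g, 'u) gset \<Rightarrow> ('g, 'u) gset \<Rightarrow> ('g, 'u) gset \<Rightarrow> ('u \<Rightarrow> 'u) \<Rightarrow> ('u \<Rightarrow> 'u) \<Rightarrow>
     ('g, 'u) gset \<Rightarrow> ('g, 'u) gset \<Rightarrow> ('u \<Rightarrow> 'u) \<Rightarrow> ('u \<Rightarrow> 'u) \<Rightarrow> ('u \<Rightarrow> 'u) \<Rightarrow> bool" where
  "exponential_diagram G A X Y p f B E e n q \<longleftrightarrow>
     A \<in> finite_gsets G \<and> p \<in> equivariant_maps G A X \<and> e \<in> equivariant_maps G B A \<and>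
     is_pullback (gset_cat G) X E Y f q B (compose (elts B) p e) n \<and>
     (\<exists>\<phi> \<in> equivariant_maps G E (dependent_product G A X Y p f).
        bij_betw \<phi> (elts E) (elts (dependent_product G A X Y p f)) \<and>
        (\<forall>w\<in>elts E. fst (\<phi> w) = q w) \<and>
        (\<forall>b\<in>elts B. e b = snd (\<phi> (n b)) (p (e b))))"

text \<open>\<open>\<lparr>bsrc = A, btgt = B, bres = r, bnorm = n, btran = t\<rparr>\<close> is the diagram whose maps are
  \<open>r : A \<rightarrow> X\<close>, \<open>n : A \<rightarrow> B\<close> and \<open>t : B \<rightarrow> Y\<close>.\<close>

record ('g, 'u) bispan =
  bsrc :: "('g, 'u) gset"
  btgt :: "('g, 'u) gset"
  bres :: "'u \<Rightarrow> 'u"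
  bnorm :: "'u \<Rightarrow> 'u"
  btran :: "'u \<Rightarrow> 'u"

definition bispans :: "'g monoid \<Rightarrow> ('g, 'u) gset \<Rightarrow> ('g, 'u) gset \<Rightarrow> ('g, 'u) bispan set" where
  "bispans G X Y =
     {b. bsrc b \<in> finite_gsets G \<and> btgt b \<in> finite_gsets G \<and>
         bres b \<in> equivariant_maps G (bsrc b) X \<and>
         bnorm b \<in> equivariant_maps G (bsrc b) (btgt b) \<and>
         btran b \<in> equivariant_maps G (btgt b) Y}"

definition bispan_iso ::
    "'g monoid \<Rightarrow> ('g, 'u) gset \<Rightarrow> ('g, 'u) gset \<Rightarrow> ('g, 'u) bispan rel" where
  "bispan_iso G X Y =
     {(b, c). b \<in> bispans G X Y \<and> c \<in> bispans G X Y \<and>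
        (\<exists>\<alpha> \<beta>. is_iso (gset_cat G) (bsrc b) (bsrc c) \<alpha> \<and> is_iso (gset_cat G) (btgt b) (btgt c) \<beta> \<and>
           compose (elts (bsrc b)) (bres c) \<alpha> = bres b \<and>
           compose (elts (bsrc b)) (bnorm c) \<alpha> = compose (elts (bsrc b)) \<beta> (bnorm b) \<and>
           compose (elts (btgt b)) (btran c) \<beta> = btran b)}"

text \<open>
  The composite of \<open>b = (X \<leftarrow> A \<rightarrow> B \<rightarrow> Y)\<close> and \<open>c = (Y \<leftarrow> C \<rightarrow> D \<rightarrow> Z)\<close>: pull \<open>B \<rightarrow> Y \<leftarrow> C\<close> back to \<open>P\<close>,
  form the exponential diagram on \<open>P \<rightarrow> C \<rightarrow> D\<close> with evaluation \<open>e : Q \<rightarrow> P\<close> and \<open>m : Q \<rightarrow> E\<close>, and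
  pull \<open>A \<rightarrow> B\<close> back along \<open>Q \<rightarrow> P \<rightarrow> B\<close>. (Pulling back first to \<open>P\<close> and then to \<open>Q\<close> gives the same by
  pasting.) Since pullbacks and exponential diagrams are determined up to isomorphism only, this
  is a relation.
\<close>

definition is_bispan_composite ::
    "'g monoid \<Rightarrow> ('g, 'u) gset \<Rightarrow> ('g, 'u) gset \<Rightarrow> ('g, 'u) gset \<Rightarrow>
     ('g, 'u) bispan \<Rightarrow> ('g, 'u) bispan \<Rightarrow> ('g, 'u) bispan \<Rightarrow> bool" where
  "is_bispan_composite G X Y Z b c d \<longleftrightarrow>
     (\<exists>P p\<^sub>B p\<^sub>C Q e m q a l.
        is_pullback (gset_cat G) (btgt b) (bsrc c) Y (btran b) (bres c) P p\<^sub>B p\<^sub>C \<and>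
        exponential_diagram G P (bsrc c) (btgt c) p\<^sub>C (bnorm c) Q (btgt d) e m q \<and>
        is_pullback (gset_cat G) (bsrc b) Q (btgt b) (bnorm b) (compose (elts Q) p\<^sub>B e) (bsrc d) a l \<and>
        bres d = compose (elts (bsrc d)) (bres b) a \<and>
        bnorm d = compose (elts (bsrc d)) m l \<and>
        btran d = compose (elts (btgt d)) (btran c) q)"

definition bispan_class ::
    "'g monoid \<Rightarrow> ('g, 'u) gset \<Rightarrow> ('g, 'u) gset \<Rightarrow> ('g, 'u) bispan \<Rightarrow> ('g, 'u) bispan set" where
  "bispan_class G X Y b = bispan_iso G X Y `` {b}"

definition bispan_cat :: "'g monoid \<Rightarrow> (('g, 'u) gset, ('g, 'u) bispan set) cat" where
  "bispan_cat G =
     \<lparr>Obj = finite_gsets G,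
      Hom = (\<lambda>X Y. bispans G X Y // bispan_iso G X Y),
      Ident = (\<lambda>X. bispan_class G X X
                 \<lparr>bsrc = X, btgt = X, bres = (\<lambda>x\<in>elts X. x), bnorm = (\<lambda>x\<in>elts X. x),
                  btran = (\<lambda>x\<in>elts X. x)\<rparr>),
      Comp = (\<lambda>X Y Z \<C> \<B>. {d \<in> bispans G X Z. \<exists>b\<in>\<B>. \<exists>c\<in>\<C>. is_bispan_composite G X Y Z b c d})\<rparr>"

text \<open>For \<open>f : X \<rightarrow> Y\<close>: the restriction \<open>Y \<leftarrow> X = X = X\<close> and the transfer \<open>X = X = X \<rightarrow> Y\<close>.\<close>

definition restriction ::
    "'g monoid \<Rightarrow> ('g, 'u) gset \<Rightarrow> ('g, 'u) gset \<Rightarrow> ('u \<Rightarrow> 'u) \<Rightarrow> ('g, 'u) bispan set" where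
  "restriction G X Y f = bispan_class G Y X
     \<lparr>bsrc = X, btgt = X, bres = f, bnorm = (\<lambda>x\<in>elts X. x), btran = (\<lambda>x\<in>elts X. x)\<rparr>"

definition transfer ::
    "'g monoid \<Rightarrow> ('g, 'u) gset \<Rightarrow> ('g, 'u) gset \<Rightarrow> ('u \<Rightarrow> 'u) \<Rightarrow> ('g, 'u) bispan set" where
  "transfer G X Y f = bispan_class G X Y
     \<lparr>bsrc = X, btgt = X, bres = (\<lambda>x\<in>elts X. x), bnorm = (\<lambda>x\<in>elts X. x), btran = f\<rparr>"

type_synonym ('g, 'u, 'v) tambara =
  "(('g, 'u) gset, ('g, 'u) bispan set, 'v set, 'v \<Rightarrow> 'v) cfunctor"

text \<open>
  The sum of \<open>a\<close> and \<open>b\<close> is the transfer along the fold map \<open>X \<squnion> X \<rightarrow> X\<close> of the element \<open>s\<close> of \<open>R(X \<squnion> X)\<close>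
  whose restrictions to the two summands are \<open>a\<close> and \<open>b\<close>; zero is the transfer along \<open>\<emptyset> \<rightarrow> X\<close>.
  Coproducts exist only up to isomorphism inside the carrier type, and the values do not depend
  on their choice.
\<close>

definition tambara_add :: "'g monoid \<Rightarrow> ('g, 'u, 'v) tambara \<Rightarrow> ('g, 'u) gset \<Rightarrow> 'v \<Rightarrow> 'v \<Rightarrow> 'v" where
  "tambara_add G R X a b =
     (THE c. \<exists>S i j h s.
        is_coproduct (gset_cat G) X X S i j \<and>
        h \<in> equivariant_maps G S X \<and>
        compose (elts X) h i = (\<lambda>x\<in>elts X. x) \<and> compose (elts X) h j = (\<lambda>x\<in>elts X. x) \<and>
        s \<in> on_obj R S \<and>
        on_hom R S X (restriction G X S i) s = a \<and> on_hom R S X (restriction G X S j) s = b \<and>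
        c = on_hom R S X (transfer G S X h) s)"

definition tambara_zero :: "'g monoid \<Rightarrow> ('g, 'u, 'v) tambara \<Rightarrow> ('g, 'u) gset \<Rightarrow> 'v" where
  "tambara_zero G R X =
     (THE z. \<exists>I h s. is_initial (gset_cat G) I \<and> h \<in> equivariant_maps G I X \<and>
        s \<in> on_obj R I \<and> z = on_hom R I X (transfer G I X h) s)"

definition additive_monoid :: "'g monoid \<Rightarrow> ('g, 'u, 'v) tambara \<Rightarrow> ('g, 'u) gset \<Rightarrow> 'v monoid" where
  "additive_monoid G R X =
     \<lparr>carrier = on_obj R X, mult = tambara_add G R X, one = tambara_zero G R X\<rparr>"

definition tambara_cat ::
    "'g monoid \<Rightarrow> (('g, 'u, 'v) tambara, ('g, 'u) gset \<Rightarrow> 'v \<Rightarrow> 'v) cat" where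
  "tambara_cat G =
     full_subcat (functor_cat (bispan_cat G) set_cat)
       (\<lambda>R. preserves_finite_products (bispan_cat G) set_cat R \<and>
            (\<forall>X\<in>finite_gsets G. group (additive_monoid G R X)))"

definition res_gset :: "'g set \<Rightarrow> ('g, 'u) gset \<Rightarrow> ('g, 'u) gset" where
  "res_gset H X = (elts X, restrict (act X) H)"

definition res_bispan :: "'g set \<Rightarrow> ('g, 'u) bispan \<Rightarrow> ('g, 'u) bispan" where
  "res_bispan H b = b\<lparr>bsrc := res_gset H (bsrc b), btgt := res_gset H (btgt b)\<rparr>"

text \<open>An isomorphism class of bispans of \<open>G\<close>-sets restricts to only a part of one for \<open>H\<close>, hence
  the closure under isomorphism.\<close>

definition res_functor ::
    "'g monoid \<Rightarrow> 'g set \<Rightarrow>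
     (('g, 'u) gset, ('g, 'u) bispan set, ('g, 'u) gset, ('g, 'u) bispan set) cfunctor" where
  "res_functor G H =
     \<lparr>on_obj = res_gset H,
      on_hom = (\<lambda>X Y \<B>. bispan_iso (G\<lparr>carrier := H\<rparr>) (res_gset H X) (res_gset H Y)
                          `` (res_bispan H ` \<B>))\<rparr>"

definition coind :: "'g monoid \<Rightarrow> 'g set \<Rightarrow> ('g, 'u, 'v) tambara \<Rightarrow> ('g, 'u, 'v) tambara" where
  "coind G H T = restrict_functor (bispan_cat G) (functor_comp T (res_functor G H))"

definition coind_trans ::
    "'g monoid \<Rightarrow> 'g set \<Rightarrow> (('g, 'u) gset \<Rightarrow> 'v \<Rightarrow> 'v) \<Rightarrow> (('g, 'u) gset \<Rightarrow> 'v \<Rightarrow> 'v)" where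
  "coind_trans G H \<eta> = (\<lambda>X\<in>finite_gsets G. \<eta> (res_gset H X))"

definition coind_under ::
    "'g monoid \<Rightarrow> 'g set \<Rightarrow>
     (('g, 'u, 'v) tambara \<times> (('g, 'u) gset \<Rightarrow> 'v \<Rightarrow> 'v), ('g, 'u) gset \<Rightarrow> 'v \<Rightarrow> 'v,
      ('g, 'u, 'v) tambara \<times> (('g, 'u) gset \<Rightarrow> 'v \<Rightarrow> 'v), ('g, 'u) gset \<Rightarrow> 'v \<Rightarrow> 'v) cfunctor" where
  "coind_under G H =
     \<lparr>on_obj = (\<lambda>(R, \<phi>). (coind G H R, coind_trans G H \<phi>)),
      on_hom = (\<lambda>_ _. coind_trans G H)\<rparr>"

end

theory Submission
  imports Defs
begin

text \<open>
  Write \<open>K\<close> for \<open>G\<close> with carrier \<open>H\<close>. A coinduced functor \<open>Coind k\<close> sees only the objects \<open>res X\<close> with \<open>X\<close> a finite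
  \<open>G\<close>-set, and only the restrictions of bispans of \<open>G\<close>-sets between them. The theorem says that a map from
  \<open>Coind k\<close> to \<open>R\<close> supplies exactly what \<open>R\<close> lacks to be a functor on bispans of \<open>H\<close>-sets. Two things have to
  be supplied.

  The missing morphisms. Let \<open>w\<close> be a bispan \<open>res X \<leftarrow> A \<rightarrow> B \<rightarrow> res X'\<close> of \<open>H\<close>-sets. Inducing \<open>A\<close> and \<open>B\<close> up to \<open>G\<close>
  gives a bispan \<open>m\<close> of \<open>G\<close>-sets from \<open>X\<close> to \<open>X'\<close> with middle set \<open>B' = G \<times>\<^sub>H B\<close>, and \<open>w\<close> is the part of \<open>m\<close> over the
  subset \<open>B\<close> of \<open>B'\<close>. In a Tambara functor, cutting \<open>m\<close> down to \<open>B\<close> means to multiply, before the transfer, by the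
  indicator of \<open>B\<close>: the operation \<open>x \<mapsto> tran (b * norm (res x))\<close> of two variables belongs to a bispan of
  \<open>G\<close>-sets, and \<open>w\<close> is this operation with \<open>b\<close> held at the indicator, which is the value at a bispan
  \<open>\<emptyset> \<leftarrow> \<emptyset> \<rightarrow> B \<rightarrow> res B'\<close> of the unique element of \<open>k \<emptyset>\<close> (\<open>presents_factor\<close>). The indicator lives in \<open>k (res B')\<close>,
  so a map \<open>\<phi>\<close> from \<open>Coind k\<close> to \<open>R\<close> carries it to \<open>R B'\<close>, and the operation can be formed in \<open>R\<close>. This is \<open>ext\<close>. It
  depends only on the class of \<open>w\<close> because the induced presentation maps to every other one, and Frobenius reciprocity
  (\<open>hval_trn\<close>) shows that such a map leaves the value unchanged (\<open>hval_universal\<close>, \<open>ext_eq\<close>). It agrees with \<open>R\<close> on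
  restricted bispans and is functorial (\<open>ext_post\<close>, \<open>ext_res\<close>, \<open>ext_comp\<close>), it is preserved by natural transformations under
  \<open>k\<close> (\<open>under_coind_natural\<close>), and for \<open>R = Coind T\<close> it is the given functor \<open>T\<close> (\<open>ext_coind\<close>).

  The missing objects. Every finite \<open>H\<close>-set \<open>Y\<close> embeds in some \<open>res (U Y)\<close>; transfer along the embedding followed by
  restriction along it is the identity, so \<open>Y\<close> is a retract of \<open>res (U Y)\<close> in the bispan category. Hence a natural transformation of
  functors on bispans of \<open>H\<close>-sets is determined by its components at the objects \<open>res X\<close> (\<open>coind_faithful\<close>), one that is natural for
  all bispans between these objects extends to all objects (\<open>coind_full\<close>), and a functor defined on the
  objects \<open>res X\<close> extends to all objects by splitting idempotents. For \<open>R\<close> with the morphisms supplied by \<open>ext\<close> this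
  gives the functor \<open>L\<close>; it preserves products since a disjoint union of \<open>H\<close>-sets embeds in the disjoint union
  of the \<open>G\<close>-sets around them, its values are groups since they are additive quotients of values of
  \<open>R\<close>, and \<open>Coind L\<close> is isomorphic to \<open>R\<close> under \<open>Coind k\<close> (\<open>L_prod\<close>, \<open>L_additive_group\<close>, \<open>L_iso\<close>).

  Composition of bispans is a relation given by pullbacks and exponential diagrams that exist up to isomorphism only.
  All computations with it go through the locale \<open>comp_wit\<close>, which says in terms of elements that one bispan is the
  composite of two others: a point of its middle set is a point \<open>d\<close> of the second middle set with a section over the
  fibre of \<open>d\<close>. Its bispans live on arbitrary types, so that composites can be written down by explicit formulas with
  pairs, sums and functions, and are moved into the carrier type only at the end.
\<close>

text \<open>The prefix \<open>B\<close> refers to the bispan category.\<close>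
abbreviation (input) "Fin \<equiv> finite_gsets"
abbreviation (input) "EMap \<equiv> equivariant_maps"
abbreviation (input) "BHom G \<equiv> Hom (bispan_cat G)"
abbreviation (input) "BComp G \<equiv> Comp (bispan_cat G)"
abbreviation (input) "BId G \<equiv> Ident (bispan_cat G)"
abbreviation (input) "BFun G \<equiv> is_functor (bispan_cat G) set_cat"

section \<open>Categories and functors\<close>

lemma category_set_cat: "category set_cat"
  unfolding category_def set_cat_def
  by (auto simp: compose_def fun_eq_iff PiE_iff extensional_def)

lemma is_terminal_set_cat:
  fixes T :: "'v set"
  shows "is_terminal set_cat T \<longleftrightarrow> (\<exists>x. T = {x})"
proof
  assume T: "is_terminal set_cat T"
  then have "\<exists>!f. f \<in> {undefined :: 'v} \<rightarrow>\<^sub>E T"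
    by (simp add: is_terminal_def set_cat_def)
  then obtain f where f: "f \<in> {undefined :: 'v} \<rightarrow>\<^sub>E T"
    and uniq: "\<And>g. g \<in> {undefined} \<rightarrow>\<^sub>E T \<Longrightarrow> g = f" by blast
  have "x = f undefined" if "x \<in> T" for x
    using fun_cong[OF uniq[of "\<lambda>y\<in>{undefined}. x"], of undefined] that by auto
  with f show "\<exists>x. T = {x}" by auto
next
  assume "\<exists>x. T = {x}"
  then obtain x where T: "T = {x}" by blast
  have "\<exists>!f. f \<in> X \<rightarrow>\<^sub>E T" for X :: "'v set"
    unfolding T by (rule ex1I[of _ "\<lambda>_\<in>X. x"]) (auto simp: PiE_iff extensional_def fun_eq_iff)
  then show "is_terminal set_cat T" by (simp add: is_terminal_def set_cat_def)
qed

lemma is_product_set_cat: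
  fixes X Y P :: "'v set"
  shows "is_product set_cat X Y P p q \<longleftrightarrow>
     p \<in> P \<rightarrow>\<^sub>E X \<and> q \<in> P \<rightarrow>\<^sub>E Y \<and> (\<forall>x\<in>X. \<forall>y\<in>Y. \<exists>!z. z \<in> P \<and> p z = x \<and> q z = y)"
proof (intro iffI conjI ballI)
  assume prod: "is_product set_cat X Y P p q"
  then show p: "p \<in> P \<rightarrow>\<^sub>E X" and q: "q \<in> P \<rightarrow>\<^sub>E Y" by (auto simp: is_product_def set_cat_def)
  fix x y assume x: "x \<in> X" and y: "y \<in> Y"
  let ?T = "{undefined :: 'v}"
  have "\<exists>!u. u \<in> ?T \<rightarrow>\<^sub>E P \<and> compose ?T p u = (\<lambda>_\<in>?T. x) \<and> compose ?T q u = (\<lambda>_\<in>?T. y)"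
  proof -
    have "(\<lambda>_\<in>?T. x) \<in> ?T \<rightarrow>\<^sub>E X" "(\<lambda>_\<in>?T. y) \<in> ?T \<rightarrow>\<^sub>E Y" using x y by auto
    then show ?thesis using prod by (simp add: is_product_def set_cat_def)
  qed
  then obtain u where u: "u \<in> ?T \<rightarrow>\<^sub>E P" "compose ?T p u = (\<lambda>_\<in>?T. x)" "compose ?T q u = (\<lambda>_\<in>?T. y)"
    and uniq: "\<And>v. v \<in> ?T \<rightarrow>\<^sub>E P \<and> compose ?T p v = (\<lambda>_\<in>?T. x) \<and> compose ?T q v = (\<lambda>_\<in>?T. y) \<Longrightarrow> v = u"
    by blast
  show "\<exists>!z. z \<in> P \<and> p z = x \<and> q z = y"
  proof (rule ex1I[of _ "u undefined"])
    show "u undefined \<in> P \<and> p (u undefined) = x \<and> q (u undefined) = y"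
      using u(1) fun_cong[OF u(2), of undefined] fun_cong[OF u(3), of undefined] by (auto simp: compose_def)
    show "z = u undefined" if "z \<in> P \<and> p z = x \<and> q z = y" for z
    proof -
      have "(\<lambda>_\<in>?T. z) = u"
        using that by (intro uniq) (auto simp: compose_def fun_eq_iff)
      from fun_cong[OF this, of undefined] show ?thesis by simp
    qed
  qed
next
  assume *: "p \<in> P \<rightarrow>\<^sub>E X \<and> q \<in> P \<rightarrow>\<^sub>E Y \<and> (\<forall>x\<in>X. \<forall>y\<in>Y. \<exists>!z. z \<in> P \<and> p z = x \<and> q z = y)"
  have "\<exists>!u. u \<in> T \<rightarrow>\<^sub>E P \<and> compose T p u = a \<and> compose T q u = b"
    if a: "a \<in> T \<rightarrow>\<^sub>E X" and b: "b \<in> T \<rightarrow>\<^sub>E Y" for T :: "'v set" and a b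
  proof -
    have "\<forall>t\<in>T. \<exists>z. z \<in> P \<and> p z = a t \<and> q z = b t" using * a b by (meson PiE_mem)
    then obtain v where v: "\<And>t. t \<in> T \<Longrightarrow> v t \<in> P \<and> p (v t) = a t \<and> q (v t) = b t" by metis
    show ?thesis
    proof (rule ex1I[of _ "restrict v T"])
      show "restrict v T \<in> T \<rightarrow>\<^sub>E P \<and> compose T p (restrict v T) = a \<and> compose T q (restrict v T) = b"
        using v a b by (auto simp: compose_def fun_eq_iff PiE_iff extensional_def)
      show "u = restrict v T" if u: "u \<in> T \<rightarrow>\<^sub>E P \<and> compose T p u = a \<and> compose T q u = b" for u
      proof
        fix t
        show "u t = restrict v T t"
        proof (cases "t \<in> T")
          case True
          then have "u t \<in> P" "p (u t) = a t" "q (u t) = b t" using u by (auto simp: compose_def)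
          then show ?thesis using * v[OF True] True a b by (metis PiE_mem restrict_apply')
        next
          case False
          then show ?thesis using u by (auto simp: PiE_iff extensional_def)
        qed
      qed
    qed
  qed
  then show "is_product set_cat X Y P p q" using * by (simp add: is_product_def set_cat_def)
qed

lemma category_comp_in: "\<lbrakk>category C; X \<in> Obj C; Y \<in> Obj C; Z \<in> Obj C; f \<in> Hom C X Y; g \<in> Hom C Y Z\<rbrakk>
    \<Longrightarrow> Comp C X Y Z g f \<in> Hom C X Z"
  and category_ident_in: "\<lbrakk>category C; X \<in> Obj C\<rbrakk> \<Longrightarrow> Ident C X \<in> Hom C X X"
  and category_ident_right: "\<lbrakk>category C; X \<in> Obj C; Y \<in> Obj C; f \<in> Hom C X Y\<rbrakk>
    \<Longrightarrow> Comp C X X Y f (Ident C X) = f"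
  and category_ident_left: "\<lbrakk>category C; X \<in> Obj C; Y \<in> Obj C; f \<in> Hom C X Y\<rbrakk>
    \<Longrightarrow> Comp C X Y Y (Ident C Y) f = f"
  and category_assoc: "\<lbrakk>category C; W \<in> Obj C; X \<in> Obj C; Y \<in> Obj C; Z \<in> Obj C;
      f \<in> Hom C W X; g \<in> Hom C X Y; h \<in> Hom C Y Z\<rbrakk>
    \<Longrightarrow> Comp C W X Z (Comp C X Y Z h g) f = Comp C W Y Z h (Comp C W X Y g f)"
  unfolding category_def by blast+

lemma functor_obj: "\<lbrakk>is_functor C D F; X \<in> Obj C\<rbrakk> \<Longrightarrow> on_obj F X \<in> Obj D"
  and functor_hom: "\<lbrakk>is_functor C D F; X \<in> Obj C; Y \<in> Obj C; f \<in> Hom C X Y\<rbrakk>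
    \<Longrightarrow> on_hom F X Y f \<in> Hom D (on_obj F X) (on_obj F Y)"
  and functor_ident: "\<lbrakk>is_functor C D F; X \<in> Obj C\<rbrakk> \<Longrightarrow> on_hom F X X (Ident C X) = Ident D (on_obj F X)"
  and functor_compose: "\<lbrakk>is_functor C D F; X \<in> Obj C; Y \<in> Obj C; Z \<in> Obj C; f \<in> Hom C X Y; g \<in> Hom C Y Z\<rbrakk>
    \<Longrightarrow> on_hom F X Z (Comp C X Y Z g f) =
       Comp D (on_obj F X) (on_obj F Y) (on_obj F Z) (on_hom F Y Z g) (on_hom F X Y f)"
  unfolding is_functor_def by blast+

lemma category_functor_cat:
  assumes "category D" shows "category (functor_cat C D)"
proof -
  note [simp] = category_comp_in[OF assms] category_ident_in[OF assms] category_ident_left[OF assms]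
      category_ident_right[OF assms] category_assoc[OF assms] functor_obj functor_hom
  have nat: "nat_trans C D F F'' (\<lambda>X\<in>Obj C. Comp D (on_obj F X) (on_obj F' X) (on_obj F'' X) (\<theta> X) (\<eta> X))"
    if F: "is_functor C D F" "is_functor C D F'" "is_functor C D F''" and "nat_trans C D F F' \<eta>" "nat_trans C D F' F'' \<theta>"
    for F F' F'' \<eta> \<theta>
  proof -
    have \<eta>: "\<And>X. X \<in> Obj C \<Longrightarrow> \<eta> X \<in> Hom D (on_obj F X) (on_obj F' X)"
      "\<And>X Y f. \<lbrakk>X \<in> Obj C; Y \<in> Obj C; f \<in> Hom C X Y\<rbrakk> \<Longrightarrow> Comp D (on_obj F X) (on_obj F Y) (on_obj F' Y) (\<eta> Y) (on_hom F X Y f) =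
        Comp D (on_obj F X) (on_obj F' X) (on_obj F' Y) (on_hom F' X Y f) (\<eta> X)"
      and \<theta>: "\<And>X. X \<in> Obj C \<Longrightarrow> \<theta> X \<in> Hom D (on_obj F' X) (on_obj F'' X)"
      "\<And>X Y f. \<lbrakk>X \<in> Obj C; Y \<in> Obj C; f \<in> Hom C X Y\<rbrakk> \<Longrightarrow> Comp D (on_obj F' X) (on_obj F' Y) (on_obj F'' Y) (\<theta> Y) (on_hom F' X Y f) =
        Comp D (on_obj F' X) (on_obj F'' X) (on_obj F'' Y) (on_hom F'' X Y f) (\<theta> X)"
      using that unfolding nat_trans_def by blast+
    show ?thesis
      unfolding nat_trans_def
    proof (intro conjI ballI)
      fix X Y f assume X: "X \<in> Obj C" and Y: "Y \<in> Obj C" and f: "f \<in> Hom C X Y"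
      have "Comp D (on_obj F X) (on_obj F Y) (on_obj F'' Y) (Comp D (on_obj F Y) (on_obj F' Y) (on_obj F'' Y) (\<theta> Y) (\<eta> Y)) (on_hom F X Y f)
        = Comp D (on_obj F X) (on_obj F' Y) (on_obj F'' Y) (\<theta> Y) (Comp D (on_obj F X) (on_obj F' X) (on_obj F' Y) (on_hom F' X Y f) (\<eta> X))"
        using X Y f F \<eta> \<theta> by simp
      also have "\<dots> = Comp D (on_obj F X) (on_obj F' X) (on_obj F'' Y) (Comp D (on_obj F' X) (on_obj F' Y) (on_obj F'' Y) (\<theta> Y) (on_hom F' X Y f)) (\<eta> X)"
        using X Y f F \<eta>(1) \<theta>(1) by simp
      also have "\<dots> = Comp D (on_obj F X) (on_obj F'' X) (on_obj F'' Y) (on_hom F'' X Y f) (Comp D (on_obj F X) (on_obj F' X) (on_obj F'' X) (\<theta> X) (\<eta> X))"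
        using X Y f F \<eta>(1) \<theta> by simp
      finally show "Comp D (on_obj F X) (on_obj F Y) (on_obj F'' Y) ((\<lambda>X\<in>Obj C. Comp D (on_obj F X) (on_obj F' X) (on_obj F'' X) (\<theta> X) (\<eta> X)) Y) (on_hom F X Y f)
        = Comp D (on_obj F X) (on_obj F'' X) (on_obj F'' Y) (on_hom F'' X Y f) ((\<lambda>X\<in>Obj C. Comp D (on_obj F X) (on_obj F' X) (on_obj F'' X) (\<theta> X) (\<eta> X)) X)"
        using X Y by simp
    qed (use F \<eta> \<theta> in simp)
  qed
  have nat_D: "\<eta> X \<in> Hom D (on_obj F X) (on_obj F' X)" if "nat_trans C D F F' \<eta>" "X \<in> Obj C" for F F' \<eta> X
    using that unfolding nat_trans_def by blast
  show ?thesis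
    unfolding category_def functor_cat_def
    by (auto simp: nat nat_D fun_eq_iff extensional_def cong: restrict_cong)
      (auto simp: nat_trans_def)
qed

lemma category_full_subcat: "category C \<Longrightarrow> category (full_subcat C S)"
  unfolding category_def full_subcat_def by auto

lemma category_under_cat:
  assumes C: "category C" and k: "k \<in> Obj C" shows "category (under_cat C k)"
proof -
  have [simp]: "X \<in> Obj (under_cat C k) \<longleftrightarrow> fst X \<in> Obj C \<and> snd X \<in> Hom C k (fst X)" for X
    by (auto simp: under_cat_def split: prod.splits)
  have [simp]: "Hom (under_cat C k) X Y = {f \<in> Hom C (fst X) (fst Y). Comp C k (fst X) (fst Y) f (snd X) = snd Y}"
    and [simp]: "Ident (under_cat C k) X = Ident C (fst X)"
    and [simp]: "Comp (under_cat C k) X Y Z = Comp C (fst X) (fst Y) (fst Z)" for X Y Z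
    by (auto simp: under_cat_def split: prod.splits)
  show ?thesis unfolding category_def[of "under_cat C k"]
    using C k by (auto simp: category_comp_in category_ident_in category_ident_left category_ident_right category_assoc)
qed

text \<open>The inverse chooses, for each object \<open>Y\<close>, an object whose image is isomorphic to \<open>Y\<close>; on morphisms it conjugates by
  the chosen isomorphisms and takes the unique preimage. All its laws follow by applying the faithful functor.\<close>

lemma equivalence_if_fully_faithful_ess_surj:
  assumes C: "category C" and D: "category D" and F: "is_functor C D F"
    and faithful: "\<And>X Y f g. \<lbrakk>X \<in> Obj C; Y \<in> Obj C; f \<in> Hom C X Y; g \<in> Hom C X Y; on_hom F X Y f = on_hom F X Y g\<rbrakk> \<Longrightarrow> f = g"
    and full: "\<And>X Y h. \<lbrakk>X \<in> Obj C; Y \<in> Obj C; h \<in> Hom D (on_obj F X) (on_obj F Y)\<rbrakk> \<Longrightarrow> \<exists>f\<in>Hom C X Y. on_hom F X Y f = h"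
    and ess_surj: "\<And>Y. Y \<in> Obj D \<Longrightarrow> \<exists>X\<in>Obj C. \<exists>h. is_iso D (on_obj F X) Y h"
  shows "is_equivalence C D F"
proof -
  have "\<exists>A e e'. Y \<in> Obj D \<longrightarrow> A \<in> Obj C \<and> e \<in> Hom D (on_obj F A) Y \<and> e' \<in> Hom D Y (on_obj F A) \<and>
      Comp D (on_obj F A) Y (on_obj F A) e' e = Ident D (on_obj F A) \<and> Comp D Y (on_obj F A) Y e e' = Ident D Y" for Y
    using ess_surj[of Y] unfolding is_iso_def by blast
  then obtain A e e' where A: "\<And>Y. Y \<in> Obj D \<Longrightarrow> A Y \<in> Obj C" and e: "\<And>Y. Y \<in> Obj D \<Longrightarrow> e Y \<in> Hom D (on_obj F (A Y)) Y"
    and e': "\<And>Y. Y \<in> Obj D \<Longrightarrow> e' Y \<in> Hom D Y (on_obj F (A Y))"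
    and e'e: "\<And>Y. Y \<in> Obj D \<Longrightarrow> Comp D (on_obj F (A Y)) Y (on_obj F (A Y)) (e' Y) (e Y) = Ident D (on_obj F (A Y))"
    and ee': "\<And>Y. Y \<in> Obj D \<Longrightarrow> Comp D Y (on_obj F (A Y)) Y (e Y) (e' Y) = Ident D Y"
    by metis
  have "\<exists>f. X \<in> Obj C \<and> Y \<in> Obj C \<and> h \<in> Hom D (on_obj F X) (on_obj F Y) \<longrightarrow> f \<in> Hom C X Y \<and> on_hom F X Y f = h" for X Y h
    using full[of X Y h] by blast
  then obtain P where P: "\<And>X Y h. \<lbrakk>X \<in> Obj C; Y \<in> Obj C; h \<in> Hom D (on_obj F X) (on_obj F Y)\<rbrakk> \<Longrightarrow> P X Y h \<in> Hom C X Y"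
    and FP: "\<And>X Y h. \<lbrakk>X \<in> Obj C; Y \<in> Obj C; h \<in> Hom D (on_obj F X) (on_obj F Y)\<rbrakk> \<Longrightarrow> on_hom F X Y (P X Y h) = h"
    by metis
  note Fo = functor_obj[OF F] and Fh = functor_hom[OF F] and Fc = functor_compose[OF F] and Fi = functor_ident[OF F]
  note Cc = category_comp_in[OF C] and Dc = category_comp_in[OF D] and Da = category_assoc[OF D]
    and Dl = category_ident_left[OF D] and Dr = category_ident_right[OF D]
    and Ci = category_ident_in[OF C] and Di = category_ident_in[OF D]
  define tr where "tr Y Z g = Comp D (on_obj F (A Y)) Z (on_obj F (A Z)) (e' Z) (Comp D (on_obj F (A Y)) Y Z g (e Y))" for Y Z g
  have tr: "tr Y Z g \<in> Hom D (on_obj F (A Y)) (on_obj F (A Z))" if "Y \<in> Obj D" "Z \<in> Obj D" "g \<in> Hom D Y Z" for Y Z g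
    unfolding tr_def using that by (simp add: Dc Fo A e e')
  have e_tr: "Comp D (on_obj F (A Y)) (on_obj F (A Z)) Z (e Z) (tr Y Z g) = Comp D (on_obj F (A Y)) Y Z g (e Y)"
    if "Y \<in> Obj D" "Z \<in> Obj D" "g \<in> Hom D Y Z" for Y Z g
    unfolding tr_def using that by (simp add: Da[symmetric] Dc Fo A e e' ee' Dl)
  have e_cancel: "a = b" if "X \<in> Obj D" "Z \<in> Obj D" "a \<in> Hom D X (on_obj F (A Z))" "b \<in> Hom D X (on_obj F (A Z))"
     "Comp D X (on_obj F (A Z)) Z (e Z) a = Comp D X (on_obj F (A Z)) Z (e Z) b" for X Z a b
  proof -
    have "a = Comp D X Z (on_obj F (A Z)) (e' Z) (Comp D X (on_obj F (A Z)) Z (e Z) a)"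
      using that(1-4) by (simp add: Da[symmetric] Dc Fo A e e' e'e Dl)
    also have "\<dots> = Comp D X Z (on_obj F (A Z)) (e' Z) (Comp D X (on_obj F (A Z)) Z (e Z) b)"
      using that by simp
    also have "\<dots> = b" using that(1-4) by (simp add: Da[symmetric] Dc Fo A e e' e'e Dl)
    finally show ?thesis .
  qed
  define F' where "F' = \<lparr>on_obj = A, on_hom = (\<lambda>Y Z g. P (A Y) (A Z) (tr Y Z g))\<rparr>"
  have F': "is_functor D C F'"
    unfolding is_functor_def F'_def cfunctor.simps
  proof (intro conjI ballI)
    fix X assume X: "X \<in> Obj D"
    show "A X \<in> Obj C" using X by (rule A)
    have "tr X X (Ident D X) = Ident D (on_obj F (A X))"
      unfolding tr_def using X by (simp add: Fo A e e' e'e Dl)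
    then show "P (A X) (A X) (tr X X (Ident D X)) = Ident C (A X)"
      using X by (intro faithful[of "A X" "A X"]) (auto simp: A P FP Fi Ci Di Fo tr)
  next
    fix X Y f assume "X \<in> Obj D" "Y \<in> Obj D" "f \<in> Hom D X Y"
    then show "P (A X) (A Y) (tr X Y f) \<in> Hom C (A X) (A Y)" by (simp add: P A tr)
  next
    fix X Y Z f g assume *: "X \<in> Obj D" "Y \<in> Obj D" "Z \<in> Obj D" "f \<in> Hom D X Y" "g \<in> Hom D Y Z"
    have "tr X Z (Comp D X Y Z g f) = Comp D (on_obj F (A X)) (on_obj F (A Y)) (on_obj F (A Z)) (tr Y Z g) (tr X Y f)"
    proof (rule e_cancel[of "on_obj F (A X)" Z])
      have "Comp D (on_obj F (A X)) (on_obj F (A Z)) Z (e Z) (tr X Z (Comp D X Y Z g f))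
          = Comp D (on_obj F (A X)) X Z (Comp D X Y Z g f) (e X)"
        using * by (simp add: e_tr Dc)
      also have "\<dots> = Comp D (on_obj F (A X)) Y Z g (Comp D (on_obj F (A X)) (on_obj F (A Y)) Y (e Y) (tr X Y f))"
        using * by (simp add: e_tr Da Fo A e)
      also have "\<dots> = Comp D (on_obj F (A X)) (on_obj F (A Y)) Z (Comp D (on_obj F (A Y)) (on_obj F (A Z)) Z (e Z) (tr Y Z g)) (tr X Y f)"
        using * by (simp add: e_tr Da Fo A e tr)
      also have "\<dots> = Comp D (on_obj F (A X)) (on_obj F (A Z)) Z (e Z)
          (Comp D (on_obj F (A X)) (on_obj F (A Y)) (on_obj F (A Z)) (tr Y Z g) (tr X Y f))"
        using * by (simp add: Da Fo A e tr)
      finally show "Comp D (on_obj F (A X)) (on_obj F (A Z)) Z (e Z) (tr X Z (Comp D X Y Z g f)) = \<dots>" .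
    qed (use * in \<open>auto simp: Fo A tr Dc\<close>)
    then show "P (A X) (A Z) (tr X Z (Comp D X Y Z g f)) =
       Comp C (A X) (A Y) (A Z) (P (A Y) (A Z) (tr Y Z g)) (P (A X) (A Y) (tr X Y f))"
      using * by (intro faithful[of "A X" "A Z"]) (auto simp: A P FP Fc Fo tr Cc Dc)
  qed
  have "nat_trans D D (functor_comp F F') functor_id e"
    unfolding nat_trans_def functor_comp_def functor_id_def F'_def cfunctor.simps
    by (auto simp: e FP A Fo tr e_tr)
  moreover have "is_iso D (on_obj (functor_comp F F') Y) (on_obj functor_id Y) (e Y)" if "Y \<in> Obj D" for Y
    unfolding is_iso_def functor_comp_def functor_id_def F'_def cfunctor.simps
    using that by (intro conjI bexI[of _ "e' Y"]) (simp_all add: e e' ee' e'e)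
  ultimately have 1: "naturally_isomorphic D D (functor_comp F F') functor_id"
    unfolding naturally_isomorphic_def by blast
  define h where "h X = P (A (on_obj F X)) X (e (on_obj F X))" for X
  define h' where "h' X = P X (A (on_obj F X)) (e' (on_obj F X))" for X
  have h: "h X \<in> Hom C (A (on_obj F X)) X" "on_hom F (A (on_obj F X)) X (h X) = e (on_obj F X)"
    "h' X \<in> Hom C X (A (on_obj F X))" "on_hom F X (A (on_obj F X)) (h' X) = e' (on_obj F X)" if "X \<in> Obj C" for X
    unfolding h_def h'_def using that by (simp_all add: P FP A Fo e e')
  have "nat_trans C C (functor_comp F' F) functor_id h"
    unfolding nat_trans_def functor_comp_def functor_id_def F'_def cfunctor.simps
  proof (intro conjI ballI)
    fix X Y f assume *: "X \<in> Obj C" "Y \<in> Obj C" "f \<in> Hom C X Y"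
    show "Comp C (A (on_obj F X)) (A (on_obj F Y)) Y (h Y) (P (A (on_obj F X)) (A (on_obj F Y)) (tr (on_obj F X) (on_obj F Y) (on_hom F X Y f))) =
       Comp C (A (on_obj F X)) X Y f (h X)"
      using * by (intro faithful[of "A (on_obj F X)" Y]) (auto simp: Fo A h Cc P tr Fh Fc FP e_tr)
  qed (auto simp: h)
  moreover have "is_iso C (on_obj (functor_comp F' F) X) (on_obj functor_id X) (h X)" if X: "X \<in> Obj C" for X
    unfolding is_iso_def functor_comp_def functor_id_def F'_def cfunctor.simps
  proof (intro conjI bexI[of _ "h' X"])
    show "Comp C (A (on_obj F X)) X (A (on_obj F X)) (h' X) (h X) = Ident C (A (on_obj F X))"
      using X by (intro faithful[of "A (on_obj F X)" "A (on_obj F X)"]) (auto simp: Fo A h Cc Ci Fc Fi e'e)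
    show "Comp C X (A (on_obj F X)) X (h X) (h' X) = Ident C X"
      using X by (intro faithful[of X X]) (auto simp: Fo A h Cc Ci Fc Fi ee')
  qed (use X h in auto)
  ultimately have 2: "naturally_isomorphic C C (functor_comp F' F) functor_id"
    unfolding naturally_isomorphic_def by blast
  show ?thesis unfolding is_equivalence_def using C D F F' 1 2 by blast
qed

text \<open>The comparison maps between two product cones, inverse to each other by uniqueness.\<close>

lemma product_comparison:
  assumes C: "category C" and P: "is_product C X Y P p q" and S: "is_product C X Y S p' q'"
  shows "\<exists>u v. u \<in> Hom C P S \<and> v \<in> Hom C S P \<and> Comp C P S X p' u = p \<and> Comp C P S Y q' u = q \<and>
     Comp C S P S u v = Ident C S \<and> Comp C P S P v u = Ident C P"
proof -
  have o: "X \<in> Obj C" "Y \<in> Obj C" "P \<in> Obj C" "S \<in> Obj C" "p \<in> Hom C P X" "q \<in> Hom C P Y" "p' \<in> Hom C S X" "q' \<in> Hom C S Y"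
    using P S unfolding is_product_def by auto
  have exP: "\<exists>!u. u \<in> Hom C T P \<and> Comp C T P X p u = a \<and> Comp C T P Y q u = b"
    if "T \<in> Obj C" "a \<in> Hom C T X" "b \<in> Hom C T Y" for T a b using P that unfolding is_product_def by blast
  have exS: "\<exists>!u. u \<in> Hom C T S \<and> Comp C T S X p' u = a \<and> Comp C T S Y q' u = b"
    if "T \<in> Obj C" "a \<in> Hom C T X" "b \<in> Hom C T Y" for T a b using S that unfolding is_product_def by blast
  obtain u where u: "u \<in> Hom C P S" "Comp C P S X p' u = p" "Comp C P S Y q' u = q" using exS[of P p q] o by blast
  obtain v where v: "v \<in> Hom C S P" "Comp C S P X p v = p'" "Comp C S P Y q v = q'" using exP[of S p' q'] o by blast
  have "Comp C S P S u v = Ident C S"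
    using exS[of S p' q'] o u v category_assoc[OF C, of S P S X v u p'] category_assoc[OF C, of S P S Y v u q']
      category_comp_in[OF C, of S P S v u] category_ident_in[OF C, of S] category_ident_right[OF C] by metis
  moreover have "Comp C P S P v u = Ident C P"
    using exP[of P p q] o u v category_assoc[OF C, of P S P X u v p] category_assoc[OF C, of P S P Y u v q]
      category_comp_in[OF C, of P S P u v] category_ident_in[OF C, of P] category_ident_right[OF C] by metis
  ultimately show ?thesis using u v by blast
qed

text \<open>Product cones on the same objects are isomorphic and functors preserve isomorphisms, so preservation of products
  has to be tested on a single product cone for each pair of objects.\<close>

lemma set_functor_product_transfer:
  assumes C: "category C" and F: "is_functor C set_cat F"
    and S: "is_product C X Y S p' q'" and FS: "is_product set_cat (on_obj F X) (on_obj F Y) (on_obj F S) (on_hom F S X p') (on_hom F S Y q')"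
    and P: "is_product C X Y P p q"
  shows "is_product set_cat (on_obj F X) (on_obj F Y) (on_obj F P) (on_hom F P X p) (on_hom F P Y q)"
proof -
  obtain u v where u: "u \<in> Hom C P S" "v \<in> Hom C S P" "Comp C P S X p' u = p" "Comp C P S Y q' u = q"
     "Comp C S P S u v = Ident C S" "Comp C P S P v u = Ident C P" using product_comparison[OF C P S] by blast
  have o: "X \<in> Obj C" "Y \<in> Obj C" "P \<in> Obj C" "S \<in> Obj C" "p \<in> Hom C P X" "q \<in> Hom C P Y" "p' \<in> Hom C S X" "q' \<in> Hom C S Y"
    using P S unfolding is_product_def by auto
  define U V where "U = on_hom F P S u" and "V = on_hom F S P v"
  have UV: "U \<in> on_obj F P \<rightarrow>\<^sub>E on_obj F S" "V \<in> on_obj F S \<rightarrow>\<^sub>E on_obj F P"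
    using functor_hom[OF F] o u unfolding U_def V_def by (simp_all add: set_cat_def)
  have c: "compose (on_obj F P) (on_hom F S X p') U = on_hom F P X p"
    using functor_compose[OF F, of P S X u p'] o u unfolding U_def by (simp add: set_cat_def)
  have c': "compose (on_obj F P) (on_hom F S Y q') U = on_hom F P Y q"
    using functor_compose[OF F, of P S Y u q'] o u unfolding U_def by (simp add: set_cat_def)
  have uv: "compose (on_obj F S) U V = (\<lambda>x\<in>on_obj F S. x)"
    using functor_compose[OF F, of S P S v u] functor_ident[OF F] o u unfolding U_def V_def by (simp add: set_cat_def)
  have vu: "compose (on_obj F P) V U = (\<lambda>x\<in>on_obj F P. x)"
    using functor_compose[OF F, of P S P u v] functor_ident[OF F] o u unfolding U_def V_def by (simp add: set_cat_def)
  have e: "on_hom F S X p' (U z) = on_hom F P X p z" "on_hom F S Y q' (U z) = on_hom F P Y q z" "V (U z) = z"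
    if "z \<in> on_obj F P" for z
    using fun_cong[OF c, of z] fun_cong[OF c', of z] fun_cong[OF vu, of z] that by (simp_all add: compose_def)
  have e': "U (V z) = z" if "z \<in> on_obj F S" for z
    using fun_cong[OF uv, of z] that by (simp add: compose_def)
  have "on_hom F P X p \<in> on_obj F P \<rightarrow>\<^sub>E on_obj F X" "on_hom F P Y q \<in> on_obj F P \<rightarrow>\<^sub>E on_obj F Y"
    using functor_hom[OF F] o by (simp_all add: set_cat_def)
  moreover have "\<exists>!z. z \<in> on_obj F P \<and> on_hom F P X p z = x \<and> on_hom F P Y q z = y"
    if "x \<in> on_obj F X" "y \<in> on_obj F Y" for x y
  proof -
    have "\<exists>!z. z \<in> on_obj F S \<and> on_hom F S X p' z = x \<and> on_hom F S Y q' z = y"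
      using FS that unfolding is_product_set_cat by blast
    then obtain s where s: "s \<in> on_obj F S" "on_hom F S X p' s = x" "on_hom F S Y q' s = y"
      and uniq: "\<And>t. \<lbrakk>t \<in> on_obj F S; on_hom F S X p' t = x; on_hom F S Y q' t = y\<rbrakk> \<Longrightarrow> t = s" by blast
    have U: "\<And>z. z \<in> on_obj F P \<Longrightarrow> U z \<in> on_obj F S" and V: "V s \<in> on_obj F P"
      using PiE_mem[OF UV(1)] PiE_mem[OF UV(2) s(1)] by simp_all
    show ?thesis
    proof (rule ex1I[of _ "V s"])
      show "V s \<in> on_obj F P \<and> on_hom F P X p (V s) = x \<and> on_hom F P Y q (V s) = y"
        using V s e(1)[OF V] e(2)[OF V] e'[OF s(1)] by simp
      fix z assume z: "z \<in> on_obj F P \<and> on_hom F P X p z = x \<and> on_hom F P Y q z = y"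
      then have "U z = s" by (intro uniq) (simp_all add: U e(1,2))
      then show "z = V s" using e(3)[of z] z by simp
    qed
  qed
  ultimately show ?thesis unfolding is_product_set_cat by simp
qed

section \<open>Finite G-sets\<close>

text \<open>Fibre products and induced sets live on product and set types, and their actions are given by formulas that do not
  vanish off the carrier. So actions and maps are compared on carriers only here, in contrast to \<open>finite_gsets\<close> and
  \<open>equivariant_maps\<close>, where they are extensional.\<close>

definition is_gset :: "'g monoid \<Rightarrow> ('g, 'a) gset \<Rightarrow> bool" where
  "is_gset G X \<longleftrightarrow> finite (elts X) \<and>
     (\<forall>g\<in>carrier G. \<forall>x\<in>elts X. act X g x \<in> elts X) \<and>
     (\<forall>x\<in>elts X. act X \<one>\<^bsub>G\<^esub> x = x) \<and>
     (\<forall>g\<in>carrier G. \<forall>h\<in>carrier G. \<forall>x\<in>elts X. act X (g \<otimes>\<^bsub>G\<^esub> h) x = act X g (act X h x))"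

definition eqv :: "'g monoid \<Rightarrow> ('g, 'a) gset \<Rightarrow> ('g, 'b) gset \<Rightarrow> ('a \<Rightarrow> 'b) \<Rightarrow> bool" where
  "eqv G X Y f \<longleftrightarrow> (\<forall>x\<in>elts X. f x \<in> elts Y) \<and>
     (\<forall>g\<in>carrier G. \<forall>x\<in>elts X. f (act X g x) = act Y g (f x))"

definition fibre_product :: "('g, 'a) gset \<Rightarrow> ('g, 'b) gset \<Rightarrow> ('a \<Rightarrow> 'c) \<Rightarrow> ('b \<Rightarrow> 'c) \<Rightarrow> ('g, 'a \<times> 'b) gset" where
  "fibre_product X Y f g =
     ({(x, y). x \<in> elts X \<and> y \<in> elts Y \<and> f x = g y}, \<lambda>h (x, y). (act X h x, act Y h y))"

definition gset_sum :: "('g, 'a) gset \<Rightarrow> ('g, 'b) gset \<Rightarrow> ('g, 'a + 'b) gset" where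
  "gset_sum X Y = (elts X <+> elts Y, \<lambda>g. map_sum (act X g) (act Y g))"

definition joint_bij :: "'a set \<Rightarrow> 'b set \<Rightarrow> 'c set \<Rightarrow> ('a \<Rightarrow> 'c) \<Rightarrow> ('b \<Rightarrow> 'c) \<Rightarrow> bool" where
  "joint_bij X Y S i j \<longleftrightarrow>
     inj_on i X \<and> inj_on j Y \<and> i ` X \<inter> j ` Y = {} \<and> i ` X \<union> j ` Y = S"

abbreviation (input) "is_sum X Y S \<equiv> joint_bij (elts X) (elts Y) (elts S)"

lemma is_gsetD:
  assumes "is_gset G X"
  shows is_gset_finite: "finite (elts X)"
    and is_gset_closed: "\<And>g x. \<lbrakk>g \<in> carrier G; x \<in> elts X\<rbrakk> \<Longrightarrow> act X g x \<in> elts X"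
    and is_gset_one: "\<And>x. x \<in> elts X \<Longrightarrow> act X \<one>\<^bsub>G\<^esub> x = x"
    and is_gset_mult: "\<And>g h x. \<lbrakk>g \<in> carrier G; h \<in> carrier G; x \<in> elts X\<rbrakk> \<Longrightarrow> act X (g \<otimes>\<^bsub>G\<^esub> h) x = act X g (act X h x)"
  using assms unfolding is_gset_def by blast+

lemma eqv_in: "\<lbrakk>eqv G X Y f; x \<in> elts X\<rbrakk> \<Longrightarrow> f x \<in> elts Y"
  and eqv_act: "\<lbrakk>eqv G X Y f; g \<in> carrier G; x \<in> elts X\<rbrakk> \<Longrightarrow> f (act X g x) = act Y g (f x)"
  unfolding eqv_def by blast+

lemma eqv_comp: "\<lbrakk>eqv G X Y f; eqv G Y Z g\<rbrakk> \<Longrightarrow> eqv G X Z (g \<circ> f)"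
  unfolding eqv_def by auto

lemma eqv_id: "eqv G X X (\<lambda>x. x)" and eqv_id': "eqv G X X id"
  unfolding eqv_def by auto

lemma eqv_cong:
  assumes "is_gset G X" and "\<And>x. x \<in> elts X \<Longrightarrow> f x = f' x"
  shows "eqv G X Y f \<longleftrightarrow> eqv G X Y f'"
  using assms unfolding eqv_def is_gset_def by auto

lemma EMap_eqv: "f \<in> EMap G X Y \<Longrightarrow> eqv G X Y f"
  unfolding equivariant_maps_def eqv_def by auto

lemma equivariant_maps_extensional: "f \<in> EMap G X Y \<Longrightarrow> f \<in> extensional (elts X)"
  unfolding equivariant_maps_def by (auto simp: PiE_def)

lemma restrict_equivariant_maps: "\<lbrakk>is_gset G X; eqv G X Y f\<rbrakk> \<Longrightarrow> restrict f (elts X) \<in> EMap G X Y"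
  unfolding equivariant_maps_def eqv_def is_gset_def by auto

lemma equivariant_maps_eqI:
  "\<lbrakk>f \<in> EMap G X Y; f' \<in> EMap G X Y'; \<And>x. x \<in> elts X \<Longrightarrow> f x = f' x\<rbrakk> \<Longrightarrow> f = f'"
  by (rule extensionalityI[OF equivariant_maps_extensional equivariant_maps_extensional])

lemma compose_equivariant_maps:
  "\<lbrakk>is_gset G X; eqv G X Y f; eqv G Y Z g\<rbrakk> \<Longrightarrow> compose (elts X) g f \<in> EMap G X Z"
  unfolding equivariant_maps_def compose_def eqv_def is_gset_def by auto

lemma ident_equivariant_maps: "is_gset G X \<Longrightarrow> (\<lambda>x\<in>elts X. x) \<in> EMap G X X"
  unfolding equivariant_maps_def is_gset_def by auto

lemma compose_apply: "x \<in> A \<Longrightarrow> compose A g f x = g (f x)"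
  by (simp add: compose_def)

lemma bij_betw_restrict: "bij_betw f A B \<Longrightarrow> bij_betw (restrict f A) A B"
  by (simp cong: bij_betw_cong)

lemma ex1_in_fibreD: "\<lbrakk>\<exists>!z. P z; P z; P z'\<rbrakk> \<Longrightarrow> z = z'" by blast

lemma gset_sum_simps [simp]:
  "Inl x \<in> elts (gset_sum X Y) \<longleftrightarrow> x \<in> elts X" "Inr y \<in> elts (gset_sum X Y) \<longleftrightarrow> y \<in> elts Y"
  "act (gset_sum X Y) g (Inl x) = Inl (act X g x)" "act (gset_sum X Y) g (Inr y) = Inr (act Y g y)"
  by (auto simp: gset_sum_def)

lemma gset_sum_ball: "(\<forall>z\<in>elts (gset_sum X Y). P z) \<longleftrightarrow> (\<forall>x\<in>elts X. P (Inl x)) \<and> (\<forall>y\<in>elts Y. P (Inr y))"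
  by (auto simp: gset_sum_def)

lemma fibre_product_simps [simp]:
  "(x, y) \<in> elts (fibre_product X Y f g) \<longleftrightarrow> x \<in> elts X \<and> y \<in> elts Y \<and> f x = g y"
  "act (fibre_product X Y f g) h (x, y) = (act X h x, act Y h y)"
  by (auto simp: fibre_product_def)

lemma fibre_product_elts: "z \<in> elts (fibre_product X Y f g) \<longleftrightarrow> fst z \<in> elts X \<and> snd z \<in> elts Y \<and> f (fst z) = g (snd z)"
  by (cases z) simp

lemma fibre_product_act: "act (fibre_product X Y f g) h z = (act X h (fst z), act Y h (snd z))"
  by (cases z) simp

lemma is_gset_sum: "\<lbrakk>is_gset G X; is_gset G Y\<rbrakk> \<Longrightarrow> is_gset G (gset_sum X Y)"
  unfolding is_gset_def gset_sum_ball by (auto simp: gset_sum_def)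

lemma is_gset_fibre_product:
  assumes "is_gset G X" "is_gset G Y" "eqv G X Z f" "eqv G Y Z g"
  shows "is_gset G (fibre_product X Y f g)"
  using assms unfolding is_gset_def eqv_def
  by (auto simp: fibre_product_elts fibre_product_act intro: finite_subset[of _ "elts X \<times> elts Y"])

lemma eqv_gset_sum: "eqv G (gset_sum X Y) Z f \<longleftrightarrow> eqv G X Z (\<lambda>x. f (Inl x)) \<and> eqv G Y Z (\<lambda>y. f (Inr y))"
  unfolding eqv_def gset_sum_ball by auto

lemma eqv_Inl: "eqv G X (gset_sum X Y) Inl" and eqv_Inr: "eqv G Y (gset_sum X Y) Inr"
  unfolding eqv_def by auto

lemma eqv_fst: "eqv G (fibre_product X Y f g) X fst" and eqv_snd: "eqv G (fibre_product X Y f g) Y snd"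
  unfolding eqv_def by (auto simp: fibre_product_elts fibre_product_act)

lemma is_gset_empty: "is_gset G ({}, a)" unfolding is_gset_def by simp

lemma Fin_gset:
  assumes "X \<in> Fin G" shows "is_gset G X"
proof -
  have a: "group_action G (elts X) (act X)" and f: "finite (elts X)" using assms by (auto simp: finite_gsets_def)
  show ?thesis unfolding is_gset_def
    using f group_action.element_image[OF a] group_action.id_eq_one[OF a] group_action.composition_rule[OF a]
    by (metis restrict_apply')
qed

locale plain_group = group G for G :: "'g monoid" (structure)
begin

lemma is_gset_inv:
  assumes "is_gset G X" "g \<in> carrier G" "x \<in> elts X"
  shows "act X (inv g) (act X g x) = x" "act X g (act X (inv g) x) = x"
  using is_gsetD[OF assms(1)] assms by (metis inv_closed l_inv r_inv)+

lemma is_gset_inj: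
  assumes "is_gset G X" "g \<in> carrier G" "x \<in> elts X" "y \<in> elts X" "act X g x = act X g y" shows "x = y"
  using is_gset_inv(1)[OF assms(1,2)] assms by metis

lemma finite_gsets_of_is_gset:
  assumes X: "is_gset G X"
  shows "(elts X, \<lambda>g\<in>carrier G. \<lambda>x\<in>elts X. act X g x) \<in> Fin G"
proof -
  note D = is_gsetD[OF X]
  let ?a = "\<lambda>g\<in>carrier G. \<lambda>x\<in>elts X. act X g x"
  have bij: "bij_betw (\<lambda>x\<in>elts X. act X g x) (elts X) (elts X)" if g: "g \<in> carrier G" for g
    by (rule bij_betw_byWitness[of _ "act X (inv g)"]) (use D g is_gset_inv[OF X] in auto)
  have "?a \<in> hom G (BijGroup (elts X))"
  proof (rule homI)
    fix g assume g: "g \<in> carrier G"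
    show "?a g \<in> carrier (BijGroup (elts X))" using bij[OF g] g by (auto simp: BijGroup_def Bij_def)
  next
    fix g h assume g: "g \<in> carrier G" and h: "h \<in> carrier G"
    show "?a (g \<otimes> h) = ?a g \<otimes>\<^bsub>BijGroup (elts X)\<^esub> ?a h"
      using bij[OF g] bij[OF h] g h D by (auto simp: BijGroup_def Bij_def compose_def fun_eq_iff)
  qed
  then have "group_action G (elts X) ?a"
    unfolding group_action_def group_hom_def group_hom_axioms_def using group_axioms group_BijGroup by blast
  then show ?thesis using D(1) by (simp add: finite_gsets_def)
qed

text \<open>An infinite carrier type has room for every finite set, and the action can be moved along a bijection.\<close>

lemma transport_finite_gset:
  assumes X: "is_gset G (X :: ('g, 'a) gset)"
  shows "\<exists>Y :: ('g, 'u::infinite) gset. \<exists>f. Y \<in> Fin G \<and> bij_betw f (elts X) (elts Y) \<and> eqv G X Y f"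
proof -
  note D = is_gsetD[OF X]
  obtain E :: "'u set" where E: "card E = card (elts X)" "finite E"
    using infinite_arbitrarily_large[OF infinite_UNIV] by metis
  then obtain f where f: "bij_betw f (elts X) E" using finite_same_card_bij D(1) by metis
  define f' where "f' = inv_into (elts X) f"
  have f': "\<And>x. x \<in> elts X \<Longrightarrow> f' (f x) = x" "\<And>y. y \<in> E \<Longrightarrow> f' y \<in> elts X" "\<And>y. y \<in> E \<Longrightarrow> f (f' y) = y"
    and fE: "\<And>x. x \<in> elts X \<Longrightarrow> f x \<in> E"
    using f bij_betw_inv_into_left[OF f] bij_betw_inv_into_right[OF f] bij_betw_apply[OF bij_betw_inv_into[OF f]] bij_betw_apply[OF f]
    unfolding f'_def by auto
  define Y0 where "Y0 = (E, \<lambda>g y. f (act X g (f' y)))"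
  have "is_gset G Y0" unfolding is_gset_def Y0_def using E(2) D f' fE by simp
  from finite_gsets_of_is_gset[OF this]
  have "(E, \<lambda>g\<in>carrier G. \<lambda>x\<in>E. act Y0 g x) \<in> Fin G" by (simp add: Y0_def)
  moreover have "eqv G X (E, \<lambda>g\<in>carrier G. \<lambda>x\<in>E. act Y0 g x) f"
    unfolding eqv_def using f' fE by (auto simp: Y0_def)
  ultimately show ?thesis using f by (metis fst_conv)
qed

lemma eqv_inv_into:
  assumes X: "is_gset G X" and f: "bij_betw f (elts X) (elts Y)" "eqv G X Y f"
  shows "eqv G Y X (inv_into (elts X) f)"
  unfolding eqv_def
proof (intro conjI ballI)
  fix y assume "y \<in> elts Y" then show "inv_into (elts X) f y \<in> elts X"
    using bij_betw_apply[OF bij_betw_inv_into[OF f(1)]] by auto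
next
  fix g y assume g: "g \<in> carrier G" and y: "y \<in> elts Y"
  then obtain x where x: "x \<in> elts X" "y = f x" using f(1) by (auto simp: bij_betw_def)
  then have "act Y g y = f (act X g x)" using f(2) g by (simp add: eqv_def)
  then show "inv_into (elts X) f (act Y g y) = act X g (inv_into (elts X) f y)"
    using x f(1) is_gsetD(2)[OF X g x(1)] by (simp add: bij_betw_inv_into_left)
qed

lemma is_iso_gset_cat:
  assumes X: "X \<in> Fin G" and Y: "Y \<in> Fin G"
  shows "is_iso (gset_cat G) X Y f \<longleftrightarrow> f \<in> EMap G X Y \<and> bij_betw f (elts X) (elts Y)"
proof
  assume "is_iso (gset_cat G) X Y f"
  then obtain h where f: "f \<in> EMap G X Y" and h: "h \<in> EMap G Y X"
    and fh: "compose (elts X) h f = (\<lambda>x\<in>elts X. x)" "compose (elts Y) f h = (\<lambda>x\<in>elts Y. x)"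
    by (auto simp: is_iso_def gset_cat_def)
  from fh[THEN fun_cong] have "\<And>x. x \<in> elts X \<Longrightarrow> h (f x) = x" "\<And>x. x \<in> elts Y \<Longrightarrow> f (h x) = x"
    by (metis compose_apply restrict_apply')+
  then show "f \<in> EMap G X Y \<and> bij_betw f (elts X) (elts Y)"
    using f h by (auto intro!: bij_betw_byWitness[of _ h] simp: equivariant_maps_def)
next
  assume f: "f \<in> EMap G X Y \<and> bij_betw f (elts X) (elts Y)"
  let ?h = "restrict (inv_into (elts X) f) (elts Y)"
  have "?h \<in> EMap G Y X"
    using f X Y by (intro restrict_equivariant_maps Fin_gset eqv_inv_into) (auto intro: EMap_eqv Fin_gset)
  moreover have "compose (elts X) ?h f = (\<lambda>x\<in>elts X. x)" "compose (elts Y) f ?h = (\<lambda>x\<in>elts Y. x)"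
    using f bij_betw_inv_into_left bij_betw_inv_into_right bij_betw_apply by (fastforce simp: compose_def fun_eq_iff)+
  ultimately show "is_iso (gset_cat G) X Y f" using f by (auto simp: is_iso_def gset_cat_def)
qed

text \<open>A copy of the concrete fibre product inside the carrier type, used as a test object, shows that every
  pullback square of finite \<open>G\<close>-sets is one of sets; the converse defines the comparison map pointwise.\<close>

lemma is_pullback_gset_cat:
  fixes X Y Z P :: "('g, 'u::infinite) gset"
  shows "is_pullback (gset_cat G) X Y Z f g P p q \<longleftrightarrow>
    X \<in> Fin G \<and> Y \<in> Fin G \<and> Z \<in> Fin G \<and> P \<in> Fin G \<and>
    f \<in> EMap G X Z \<and> g \<in> EMap G Y Z \<and> p \<in> EMap G P X \<and> q \<in> EMap G P Y \<and>
    (\<forall>z\<in>elts P. f (p z) = g (q z)) \<and>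
    (\<forall>x\<in>elts X. \<forall>y\<in>elts Y. f x = g y \<longrightarrow> (\<exists>!z. z \<in> elts P \<and> p z = x \<and> q z = y))"
  (is "?L \<longleftrightarrow> (?o1 \<and> ?o2 \<and> ?o3 \<and> ?o4 \<and> ?m1 \<and> ?m2 \<and> ?m3 \<and> ?m4 \<and> ?C \<and> ?U)")
proof (cases "?o1 \<and> ?o2 \<and> ?o3 \<and> ?o4 \<and> ?m1 \<and> ?m2 \<and> ?m3 \<and> ?m4")
  case False
  then show ?thesis unfolding is_pullback_def gset_cat_def by auto
next
  case o: True
  then have gs: "is_gset G X" "is_gset G Y" "is_gset G Z" "is_gset G P" by (auto intro: Fin_gset)
  have eq: "eqv G X Z f" "eqv G Y Z g" "eqv G P X p" "eqv G P Y q" using o by (auto intro: EMap_eqv)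
  have comm: "compose (elts T) f a = compose (elts T) g b \<longleftrightarrow> (\<forall>z\<in>elts T. f (a z) = g (b z))" for T :: "('g, 'u) gset" and a b
    by (auto simp: compose_def fun_eq_iff)
  have pb: "?L \<longleftrightarrow> ?C \<and> (\<forall>T::('g, 'u) gset\<in>Fin G. \<forall>a\<in>EMap G T X. \<forall>b\<in>EMap G T Y.
       (\<forall>z\<in>elts T. f (a z) = g (b z)) \<longrightarrow>
        (\<exists>!u. u \<in> EMap G T P \<and> compose (elts T) p u = a \<and> compose (elts T) q u = b))"
    using o by (simp add: is_pullback_def gset_cat_def comm)
  have "?L \<longleftrightarrow> ?C \<and> ?U"
  proof
    assume L: ?L
    have C: ?C using L pb by blast
    have univ: "\<And>(T :: ('g, 'u) gset) a b. \<lbrakk>T \<in> Fin G; a \<in> EMap G T X; b \<in> EMap G T Y; \<forall>z\<in>elts T. f (a z) = g (b z)\<rbrakk>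
       \<Longrightarrow> \<exists>!u. u \<in> EMap G T P \<and> compose (elts T) p u = a \<and> compose (elts T) q u = b"
      using L pb by blast
    let ?F = "fibre_product X Y f g"
    have F: "is_gset G ?F" using gs eq by (intro is_gset_fibre_product) auto
    obtain T :: "('g, 'u) gset" and t where T: "T \<in> Fin G" and t: "bij_betw t (elts ?F) (elts T)" "eqv G ?F T t"
      using transport_finite_gset[OF F] by blast
    define t' where "t' = inv_into (elts ?F) t"
    have t'e: "eqv G T ?F t'" unfolding t'_def by (rule eqv_inv_into[OF F t])
    have t'b: "\<And>z. z \<in> elts ?F \<Longrightarrow> t' (t z) = z" unfolding t'_def using t(1) by (simp add: bij_betw_inv_into_left)
    have Tg: "is_gset G T" using T by (rule Fin_gset)
    let ?a = "compose (elts T) fst t'" and ?b = "compose (elts T) snd t'"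
    have ab: "?a \<in> EMap G T X" "?b \<in> EMap G T Y"
      by (rule compose_equivariant_maps[OF Tg t'e] eqv_fst eqv_snd)+
    have "\<forall>z\<in>elts T. f (?a z) = g (?b z)" using eqv_in[OF t'e] by (auto simp: compose_apply fibre_product_elts)
    from univ[OF T ab this] obtain u where u: "u \<in> EMap G T P" "compose (elts T) p u = ?a" "compose (elts T) q u = ?b" by blast
    have ue: "eqv G T P u" using u(1) by (rule EMap_eqv)
    have pu: "p (u z) = fst (t' z)" "q (u z) = snd (t' z)" if "z \<in> elts T" for z
      using fun_cong[OF u(2), of z] fun_cong[OF u(3), of z] that by (auto simp: compose_apply)
    have pair: "eqv G P ?F (\<lambda>z. (p z, q z))" unfolding eqv_def using C eq by (auto simp: eqv_def)
    then have w: "eqv G P P (u \<circ> (t \<circ> (\<lambda>z. (p z, q z))))" by (intro eqv_comp[OF eqv_comp[OF _ t(2)] ue])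
    have w_id: "u (t (p z, q z)) = z" if z: "z \<in> elts P" for z
    proof -
      let ?w = "restrict (u \<circ> (t \<circ> (\<lambda>z. (p z, q z)))) (elts P)"
      have pm: "p \<in> EMap G P X" "q \<in> EMap G P Y" using o by auto
      have tp: "t (p z, q z) \<in> elts T" if "z \<in> elts P" for z
        using eqv_in[OF t(2) eqv_in[OF pair that]] .
      have "?w \<in> EMap G P P" by (rule restrict_equivariant_maps[OF gs(4) w])
      moreover have "compose (elts P) p ?w = p" "compose (elts P) q ?w = q"
        using pu t'b eqv_in[OF pair] tp equivariant_maps_extensional[OF pm(1)] equivariant_maps_extensional[OF pm(2)]
        by (auto simp: compose_def fun_eq_iff extensional_def)
      moreover have "(\<lambda>x\<in>elts P. x) \<in> EMap G P P" by (rule ident_equivariant_maps[OF gs(4)])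
      moreover have "compose (elts P) p (\<lambda>x\<in>elts P. x) = p" "compose (elts P) q (\<lambda>x\<in>elts P. x) = q"
        using equivariant_maps_extensional[OF pm(1)] equivariant_maps_extensional[OF pm(2)]
        by (auto simp: compose_def fun_eq_iff extensional_def)
      ultimately have "?w = (\<lambda>x\<in>elts P. x)"
        using univ[OF _ pm] o C by blast
      from fun_cong[OF this, of z] z show ?thesis by simp
    qed
    have ?U
    proof (intro ballI impI)
      fix x y assume x: "x \<in> elts X" "y \<in> elts Y" "f x = g y"
      then have xy: "(x, y) \<in> elts ?F" by simp
      then have tx: "t (x, y) \<in> elts T" by (rule eqv_in[OF t(2)])
      show "\<exists>!z. z \<in> elts P \<and> p z = x \<and> q z = y"
      proof (rule ex1I[of _ "u (t (x, y))"])
        show "u (t (x, y)) \<in> elts P \<and> p (u (t (x, y))) = x \<and> q (u (t (x, y))) = y"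
          using pu[OF tx] t'b[OF xy] eqv_in[OF ue tx] by simp
      qed (use w_id in auto)
    qed
    then show "?C \<and> ?U" using C by blast
  next
    assume CU: "?C \<and> ?U"
    have "\<exists>!u. u \<in> EMap G T P \<and> compose (elts T) p u = a \<and> compose (elts T) q u = b"
      if T: "T \<in> Fin G" and a: "a \<in> EMap G T X" and b: "b \<in> EMap G T Y"
        and c: "\<forall>z\<in>elts T. f (a z) = g (b z)" for T :: "('g, 'u) gset" and a b
    proof -
      have ae: "eqv G T X a" "eqv G T Y b" using a b by (auto intro: EMap_eqv)
      have Tg: "is_gset G T" using T by (rule Fin_gset)
      define u where "u z = (THE w. w \<in> elts P \<and> p w = a z \<and> q w = b z)" for z
      have ex: "\<exists>!w. w \<in> elts P \<and> p w = a z \<and> q w = b z" if "z \<in> elts T" for z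
        using CU c that eqv_in[OF ae(1) that] eqv_in[OF ae(2) that] by blast
      have u: "u z \<in> elts P \<and> p (u z) = a z \<and> q (u z) = b z" if "z \<in> elts T" for z
        unfolding u_def by (rule theI'[OF ex[OF that]])
      have "eqv G T P u" unfolding eqv_def
      proof (intro conjI ballI)
        fix h z assume h: "h \<in> carrier G" and z: "z \<in> elts T"
        have hz: "act T h z \<in> elts T" by (rule is_gsetD(2)[OF Tg h z])
        show "u (act T h z) = act P h (u z)"
        proof (rule ex1_in_fibreD[OF ex[OF hz] u[OF hz]])
          show "act P h (u z) \<in> elts P \<and> p (act P h (u z)) = a (act T h z) \<and> q (act P h (u z)) = b (act T h z)"
            using u[OF z] is_gsetD(2)[OF gs(4) h] eqv_act[OF eq(3) h] eqv_act[OF eq(4) h] eqv_act[OF ae(1) h z] eqv_act[OF ae(2) h z] by simp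
        qed
      qed (use u in auto)
      then have "restrict u (elts T) \<in> EMap G T P" by (rule restrict_equivariant_maps[OF Tg])
      moreover have "compose (elts T) p (restrict u (elts T)) = a" "compose (elts T) q (restrict u (elts T)) = b"
        using u equivariant_maps_extensional[OF a] equivariant_maps_extensional[OF b]
        by (auto simp: compose_def fun_eq_iff extensional_def)
      moreover have "v = restrict u (elts T)"
        if v: "v \<in> EMap G T P" "compose (elts T) p v = a" "compose (elts T) q v = b" for v
      proof (rule equivariant_maps_eqI[OF v(1) calculation(1)])
        fix z assume z: "z \<in> elts T"
        have "v z \<in> elts P \<and> p (v z) = a z \<and> q (v z) = b z"
          using v z by (auto simp: compose_apply equivariant_maps_def)
        from ex1_in_fibreD[OF ex[OF z] this u[OF z]] z show "v z = restrict u (elts T) z" by simp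
      qed
      ultimately show ?thesis by blast
    qed
    then show ?L using pb CU by blast
  qed
  then show ?thesis using o by blast
qed

lemma joint_bijE:
  assumes "joint_bij X Y S i j" "s \<in> S"
  obtains x where "x \<in> X" "s = i x" | y where "y \<in> Y" "s = j y"
  using assms unfolding joint_bij_def by blast

text \<open>As for pullbacks, the forward direction tests the universal property on a copy of the concrete disjoint union.\<close>

lemma is_coproduct_gset_cat:
  fixes X Y S :: "('g, 'u::infinite) gset"
  shows "is_coproduct (gset_cat G) X Y S i j \<longleftrightarrow>
    X \<in> Fin G \<and> Y \<in> Fin G \<and> S \<in> Fin G \<and>
    i \<in> EMap G X S \<and> j \<in> EMap G Y S \<and> is_sum X Y S i j"
  (is "?L \<longleftrightarrow> (?o1 \<and> ?o2 \<and> ?o3 \<and> ?m1 \<and> ?m2 \<and> ?U)")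
proof (cases "?o1 \<and> ?o2 \<and> ?o3 \<and> ?m1 \<and> ?m2")
  case False
  then show ?thesis unfolding is_coproduct_def gset_cat_def by auto
next
  case o: True
  then have gs: "is_gset G X" "is_gset G Y" "is_gset G S" by (auto intro: Fin_gset)
  have im: "i \<in> EMap G X S" "j \<in> EMap G Y S" using o by auto
  then have eq: "eqv G X S i" "eqv G Y S j" by (auto intro: EMap_eqv)
  have cp: "?L \<longleftrightarrow> (\<forall>T::('g, 'u) gset\<in>Fin G. \<forall>a\<in>EMap G X T. \<forall>b\<in>EMap G Y T.
        (\<exists>!u. u \<in> EMap G S T \<and> compose (elts X) u i = a \<and> compose (elts Y) u j = b))"
    using o by (simp add: is_coproduct_def gset_cat_def)
  have "?L \<longleftrightarrow> ?U"
  proof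
    assume ?L
    then have univ: "\<And>(T :: ('g, 'u) gset) a b. \<lbrakk>T \<in> Fin G; a \<in> EMap G X T; b \<in> EMap G Y T\<rbrakk> \<Longrightarrow>
       \<exists>!u. u \<in> EMap G S T \<and> compose (elts X) u i = a \<and> compose (elts Y) u j = b" using cp by blast
    let ?F = "gset_sum X Y"
    have F: "is_gset G ?F" using gs by (intro is_gset_sum)
    obtain T :: "('g, 'u) gset" and t where T: "T \<in> Fin G" and t: "bij_betw t (elts ?F) (elts T)" "eqv G ?F T t"
      using transport_finite_gset[OF F] by blast
    define t' where "t' = inv_into (elts ?F) t"
    have t'e: "eqv G T ?F t'" unfolding t'_def by (rule eqv_inv_into[OF F t])
    have t'b: "\<And>z. z \<in> elts ?F \<Longrightarrow> t' (t z) = z" unfolding t'_def using t(1) by (simp add: bij_betw_inv_into_left)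
    have te: "eqv G X T (t \<circ> Inl)" "eqv G Y T (t \<circ> Inr)" by (rule eqv_comp[OF _ t(2)] eqv_Inl eqv_Inr)+
    obtain u where u: "u \<in> EMap G S T" "compose (elts X) u i = restrict (t \<circ> Inl) (elts X)"
        "compose (elts Y) u j = restrict (t \<circ> Inr) (elts Y)"
      using univ[OF T restrict_equivariant_maps[OF gs(1) te(1)] restrict_equivariant_maps[OF gs(2) te(2)]] by blast
    have ui: "\<And>x. x \<in> elts X \<Longrightarrow> t' (u (i x)) = Inl x" "\<And>y. y \<in> elts Y \<Longrightarrow> t' (u (j y)) = Inr y"
    proof -
      fix x assume "x \<in> elts X" then show "t' (u (i x)) = Inl x" using fun_cong[OF u(2), of x] t'b[of "Inl x"] by (simp add: compose_def)
    next
      fix y assume "y \<in> elts Y" then show "t' (u (j y)) = Inr y" using fun_cong[OF u(3), of y] t'b[of "Inr y"] by (simp add: compose_def)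
    qed
    have v: "eqv G ?F S (case_sum i j)" unfolding eqv_gset_sum using eq by simp
    let ?w = "restrict (case_sum i j \<circ> (t' \<circ> u)) (elts S)"
    have "?w \<in> EMap G S S"
      by (rule restrict_equivariant_maps[OF gs(3) eqv_comp[OF eqv_comp[OF EMap_eqv[OF u(1)] t'e] v]])
    moreover have "compose (elts X) ?w i = i" "compose (elts Y) ?w j = j"
      using ui eqv_in[OF eq(1)] eqv_in[OF eq(2)] im[THEN equivariant_maps_extensional] by (auto simp: compose_def fun_eq_iff extensional_def)
    moreover have "(\<lambda>x\<in>elts S. x) \<in> EMap G S S" by (rule ident_equivariant_maps[OF gs(3)])
    moreover have "compose (elts X) (\<lambda>x\<in>elts S. x) i = i" "compose (elts Y) (\<lambda>x\<in>elts S. x) j = j"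
      using eqv_in[OF eq(1)] eqv_in[OF eq(2)] im[THEN equivariant_maps_extensional] by (auto simp: compose_def fun_eq_iff extensional_def)
    ultimately have "?w = (\<lambda>x\<in>elts S. x)" using univ[OF _ im] o by blast
    from fun_cong[OF this] have w: "case_sum i j (t' (u s)) = s" if "s \<in> elts S" for s using that by (metis comp_apply restrict_apply')
    have mem: "t' (u s) \<in> elts ?F" if "s \<in> elts S" for s
      using that eqv_in[OF t'e] eqv_in[OF EMap_eqv[OF u(1)]] by blast
    have "s \<in> i ` elts X \<union> j ` elts Y" if "s \<in> elts S" for s
    proof (cases "t' (u s)")
      case (Inl a)
      then show ?thesis using w[OF that] mem[OF that] by (simp add: image_eqI[of s i a])
    next
      case (Inr a)
      then show ?thesis using w[OF that] mem[OF that] by (simp add: image_eqI[of s j a])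
    qed
    then show ?U unfolding joint_bij_def using ui eqv_in[OF eq(1)] eqv_in[OF eq(2)]
      by (auto simp: inj_on_def) (metis sum.inject sum.distinct)+
  next
    assume U: ?U
    have "\<exists>!u. u \<in> EMap G S T \<and> compose (elts X) u i = a \<and> compose (elts Y) u j = b"
      if T: "T \<in> Fin G" and a: "a \<in> EMap G X T" and b: "b \<in> EMap G Y T" for T :: "('g, 'u) gset" and a b
    proof -
      have ae: "eqv G X T a" "eqv G Y T b" using a b by (auto intro: EMap_eqv)
      define u where "u s = (if s \<in> i ` elts X then a (inv_into (elts X) i s) else b (inv_into (elts Y) j s))" for s
      have ui: "u (i x) = a x" if "x \<in> elts X" for x using U that by (simp add: u_def joint_bij_def)
      have uj: "u (j y) = b y" if "y \<in> elts Y" for y using U that by (auto simp: u_def joint_bij_def)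
      have "eqv G S T u" unfolding eqv_def
      proof (intro conjI ballI)
        fix s assume "s \<in> elts S"
        with U show "u s \<in> elts T" by (cases rule: joint_bijE) (auto simp: ui uj eqv_in[OF ae(1)] eqv_in[OF ae(2)])
      next
        fix h s assume h: "h \<in> carrier G" and s: "s \<in> elts S"
        from U s show "u (act S h s) = act T h (u s)"
          by (cases rule: joint_bijE)
            (auto simp: ui uj eqv_act[OF eq(1) h, symmetric] eqv_act[OF eq(2) h, symmetric] eqv_act[OF ae(1) h] eqv_act[OF ae(2) h]
               is_gsetD(2)[OF gs(1) h] is_gsetD(2)[OF gs(2) h])
      qed
      then have 1: "restrict u (elts S) \<in> EMap G S T" by (rule restrict_equivariant_maps[OF gs(3)])
      moreover have "compose (elts X) (restrict u (elts S)) i = a" "compose (elts Y) (restrict u (elts S)) j = b"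
        using ui uj eqv_in[OF eq(1)] eqv_in[OF eq(2)] equivariant_maps_extensional[OF a] equivariant_maps_extensional[OF b]
        by (auto simp: compose_def fun_eq_iff extensional_def)
      moreover have "v = restrict u (elts S)"
        if v: "v \<in> EMap G S T" "compose (elts X) v i = a" "compose (elts Y) v j = b" for v
      proof (rule equivariant_maps_eqI[OF v(1) 1])
        fix s assume s: "s \<in> elts S"
        have vi: "v (i x) = a x" if "x \<in> elts X" for x using fun_cong[OF v(2), of x] that by (simp add: compose_def)
        have vj: "v (j y) = b y" if "y \<in> elts Y" for y using fun_cong[OF v(3), of y] that by (simp add: compose_def)
        show "v s = restrict u (elts S) s"
          by (rule joint_bijE[OF U s]) (use s in \<open>simp_all add: ui uj vi vj\<close>)
      qed
      ultimately show ?thesis by blast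
    qed
    then show ?L using cp by blast
  qed
  then show ?thesis using o by blast
qed

lemma ex_coproduct_gset_cat:
  fixes X Y :: "('g, 'u::infinite) gset"
  assumes X: "X \<in> Fin G" and Y: "Y \<in> Fin G"
  shows "\<exists>S i j. is_coproduct (gset_cat G) X Y S i j"
proof -
  have gs: "is_gset G X" "is_gset G Y" using X Y by (auto intro: Fin_gset)
  obtain S :: "('g, 'u) gset" and t where S: "S \<in> Fin G" and t: "bij_betw t (elts (gset_sum X Y)) (elts S)" "eqv G (gset_sum X Y) S t"
    using transport_finite_gset[OF is_gset_sum[OF gs]] by blast
  have te: "eqv G X S (t \<circ> Inl)" "eqv G Y S (t \<circ> Inr)" by (rule eqv_comp[OF _ t(2)] eqv_Inl eqv_Inr)+
  have inj: "inj_on t (elts X <+> elts Y)" and im: "t ` (elts X <+> elts Y) = elts S"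
    using t(1) by (auto simp: bij_betw_def gset_sum_def)
  have "inj_on (t \<circ> Inl) (elts X)" "inj_on (t \<circ> Inr) (elts Y)"
    using inj by (auto intro!: comp_inj_on elim: inj_on_subset)
  moreover have "(t \<circ> Inl) ` elts X \<inter> (t \<circ> Inr) ` elts Y = {}"
    using inj by (auto simp: inj_on_def)
  moreover have "(t \<circ> Inl) ` elts X \<union> (t \<circ> Inr) ` elts Y = elts S"
    unfolding im[symmetric] Plus_def by auto
  ultimately have "is_sum X Y S (restrict (t \<circ> Inl) (elts X)) (restrict (t \<circ> Inr) (elts Y))"
    unfolding joint_bij_def by (simp add: inj_on_restrict_eq)
  then have "is_coproduct (gset_cat G) X Y S (restrict (t \<circ> Inl) (elts X)) (restrict (t \<circ> Inr) (elts Y))"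
    unfolding is_coproduct_gset_cat using X Y S te gs by (simp add: restrict_equivariant_maps)
  then show ?thesis by blast
qed

lemma ex_empty_gset: "\<exists>E \<in> Fin G. elts E = {}"
  by (rule bexI[OF _ finite_gsets_of_is_gset[OF is_gset_empty]]) simp

lemma is_initial_gset_cat:
  fixes I :: "('g, 'u::infinite) gset"
  shows "is_initial (gset_cat G) I \<longleftrightarrow> I \<in> Fin G \<and> elts I = {}"
proof
  assume I: "is_initial (gset_cat G) I"
  then have "I \<in> Fin G" by (simp add: is_initial_def gset_cat_def)
  obtain E :: "('g, 'u) gset" where E: "E \<in> Fin G" "elts E = {}"
    by (rule bexE[OF ex_empty_gset])
  have "\<exists>!f. f \<in> EMap G I E" using I E(1) by (simp add: is_initial_def gset_cat_def)
  then obtain f where "f \<in> EMap G I E" by blast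
  then have "elts I = {}" using E(2) unfolding equivariant_maps_def by auto
  then show "I \<in> Fin G \<and> elts I = {}" using \<open>I \<in> Fin G\<close> by simp
next
  assume I: "I \<in> Fin G \<and> elts I = {}"
  have "\<exists>!f. f \<in> EMap G I X" for X :: "('g, 'u) gset"
    unfolding equivariant_maps_def using I by simp
  then show "is_initial (gset_cat G) I" using I by (simp add: is_initial_def gset_cat_def)
qed

end

section \<open>Bispans over arbitrary types\<close>

text \<open>The two inner sets may live on any types; \<open>cls\<close> below returns the isomorphism class of their copies in the
  carrier type.\<close>

record ('g, 'a, 'b, 'x, 'y) bisp =
  psrc :: "('g, 'a) gset"
  ptgt :: "('g, 'b) gset"
  pres :: "'a \<Rightarrow> 'x"
  pnorm :: "'a \<Rightarrow> 'b"
  ptran :: "'b \<Rightarrow> 'y"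

type_synonym ('g, 'u) ubisp = "('g, 'u, 'u, 'u, 'u) bisp"

abbreviation (input) "Src p \<equiv> elts (psrc p)"
abbreviation (input) "Tgt p \<equiv> elts (ptgt p)"

definition of_bispan :: "('g, 'u) bispan \<Rightarrow> ('g, 'u) ubisp" where
  "of_bispan b = \<lparr>psrc = bsrc b, ptgt = btgt b, pres = bres b, pnorm = bnorm b, ptran = btran b\<rparr>"

lemma of_bispan_simps [simp]:
  "psrc (of_bispan b) = bsrc b" "ptgt (of_bispan b) = btgt b" "pres (of_bispan b) = bres b"
  "pnorm (of_bispan b) = bnorm b" "ptran (of_bispan b) = btran b"
  by (simp_all add: of_bispan_def)

definition wf_bisp :: "'g monoid \<Rightarrow> ('g, 'x) gset \<Rightarrow> ('g, 'y) gset \<Rightarrow> ('g, 'a, 'b, 'x, 'y) bisp \<Rightarrow> bool" where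
  "wf_bisp G X Y p \<longleftrightarrow> is_gset G (psrc p) \<and> is_gset G (ptgt p) \<and>
     eqv G (psrc p) X (pres p) \<and> eqv G (psrc p) (ptgt p) (pnorm p) \<and> eqv G (ptgt p) Y (ptran p)"

definition bisp_iso_maps ::
    "'g monoid \<Rightarrow> ('g, 'a, 'b, 'x, 'y) bisp \<Rightarrow> ('g, 'c, 'd, 'x, 'y) bisp \<Rightarrow> ('a \<Rightarrow> 'c) \<Rightarrow> ('b \<Rightarrow> 'd) \<Rightarrow> bool" where
  "bisp_iso_maps G p p' \<alpha> \<beta> \<longleftrightarrow>
     bij_betw \<alpha> (Src p) (Src p') \<and> bij_betw \<beta> (Tgt p) (Tgt p') \<and>
     eqv G (psrc p) (psrc p') \<alpha> \<and> eqv G (ptgt p) (ptgt p') \<beta> \<and>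
     (\<forall>a\<in>Src p. pres p' (\<alpha> a) = pres p a \<and> pnorm p' (\<alpha> a) = \<beta> (pnorm p a)) \<and>
     (\<forall>b\<in>Tgt p. ptran p' (\<beta> b) = ptran p b)"

definition bisp_iso :: "'g monoid \<Rightarrow> ('g, 'a, 'b, 'x, 'y) bisp \<Rightarrow> ('g, 'c, 'd, 'x, 'y) bisp \<Rightarrow> bool" where
  "bisp_iso G p p' \<longleftrightarrow> (\<exists>\<alpha> \<beta>. bisp_iso_maps G p p' \<alpha> \<beta>)"

definition cls :: "'g monoid \<Rightarrow> ('g, 'u) gset \<Rightarrow> ('g, 'u) gset \<Rightarrow> ('g, 'a, 'b, 'u, 'u) bisp \<Rightarrow> ('g, 'u) bispan set" where
  "cls G X Y p = {b \<in> bispans G X Y. bisp_iso G p (of_bispan b)}"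

lemma wf_bispD:
  assumes "wf_bisp G X Y p"
  shows "is_gset G (psrc p)" "is_gset G (ptgt p)" "eqv G (psrc p) X (pres p)"
    "eqv G (psrc p) (ptgt p) (pnorm p)" "eqv G (ptgt p) Y (ptran p)"
  using assms by (auto simp: wf_bisp_def)

lemma wf_of_bispan: "b \<in> bispans G X Y \<Longrightarrow> wf_bisp G X Y (of_bispan b)"
  by (auto simp: bispans_def wf_bisp_def intro: Fin_gset EMap_eqv)

lemma bisp_iso_refl: "bisp_iso G p p"
  unfolding bisp_iso_def bisp_iso_maps_def by (intro exI[of _ "\<lambda>x. x"]) (auto simp: eqv_id bij_betw_def)

lemma bisp_iso_trans:
  assumes "bisp_iso G p p'" "bisp_iso G p' p''" and wf: "wf_bisp G X Y p" shows "bisp_iso G p p''"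
proof -
  obtain \<alpha> \<beta> \<alpha>' \<beta>' where 1: "bisp_iso_maps G p p' \<alpha> \<beta>" and 2: "bisp_iso_maps G p' p'' \<alpha>' \<beta>'"
    using assms unfolding bisp_iso_def by blast
  have "bisp_iso_maps G p p'' (\<alpha>' \<circ> \<alpha>) (\<beta>' \<circ> \<beta>)"
    using 1 2 wf_bispD(4)[OF wf] unfolding bisp_iso_maps_def by (auto intro: bij_betw_trans eqv_comp simp: eqv_in)
  then show ?thesis unfolding bisp_iso_def by blast
qed

context plain_group
begin

lemma bisp_isoE:
  assumes iso: "bisp_iso G p p'" and wf: "wf_bisp G X Y p"
  obtains \<alpha> \<beta> \<alpha>' \<beta>' where "bisp_iso_maps G p p' \<alpha> \<beta>" "bisp_iso_maps G p' p \<alpha>' \<beta>'"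
    "\<And>x. x \<in> Src p \<Longrightarrow> \<alpha>' (\<alpha> x) = x" "\<And>x. x \<in> Src p' \<Longrightarrow> \<alpha> (\<alpha>' x) = x"
    "\<And>x. x \<in> Tgt p \<Longrightarrow> \<beta>' (\<beta> x) = x" "\<And>x. x \<in> Tgt p' \<Longrightarrow> \<beta> (\<beta>' x) = x"
proof -
  obtain \<alpha> \<beta> where m: "bisp_iso_maps G p p' \<alpha> \<beta>" using iso unfolding bisp_iso_def by blast
  then have b: "bij_betw \<alpha> (Src p) (Src p')" "bij_betw \<beta> (Tgt p) (Tgt p')"
    and e: "eqv G (psrc p) (psrc p') \<alpha>" "eqv G (ptgt p) (ptgt p') \<beta>" unfolding bisp_iso_maps_def by auto
  define \<alpha>' \<beta>' where "\<alpha>' = inv_into (Src p) \<alpha>" and "\<beta>' = inv_into (Tgt p) \<beta>"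
  have i: "\<And>x. x \<in> Src p \<Longrightarrow> \<alpha>' (\<alpha> x) = x" "\<And>x. x \<in> Src p' \<Longrightarrow> \<alpha> (\<alpha>' x) = x"
    "\<And>x. x \<in> Tgt p \<Longrightarrow> \<beta>' (\<beta> x) = x" "\<And>x. x \<in> Tgt p' \<Longrightarrow> \<beta> (\<beta>' x) = x"
    using b unfolding \<alpha>'_def \<beta>'_def by (simp_all add: bij_betw_inv_into_left bij_betw_inv_into_right)
  have e': "eqv G (psrc p') (psrc p) \<alpha>'" "eqv G (ptgt p') (ptgt p) \<beta>'"
    unfolding \<alpha>'_def \<beta>'_def using wf_bispD[OF wf] b e by (auto intro: eqv_inv_into)
  have "bisp_iso_maps G p' p \<alpha>' \<beta>'"
    unfolding bisp_iso_maps_def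
  proof (intro conjI ballI)
    show "bij_betw \<alpha>' (Src p') (Src p)" "bij_betw \<beta>' (Tgt p') (Tgt p)"
      unfolding \<alpha>'_def \<beta>'_def using b by (auto intro: bij_betw_inv_into)
    fix a assume a: "a \<in> Src p'"
    let ?x = "\<alpha>' a"
    have x: "?x \<in> Src p" "\<alpha> ?x = a" using eqv_in[OF e'(1) a] i(2)[OF a] by auto
    then have *: "pres p' a = pres p ?x" "pnorm p' a = \<beta> (pnorm p ?x)" using m unfolding bisp_iso_maps_def by metis+
    then show "pres p (\<alpha>' a) = pres p' a" by simp
    show "pnorm p (\<alpha>' a) = \<beta>' (pnorm p' a)" using * i(3)[OF eqv_in[OF wf_bispD(4)[OF wf] x(1)]] by simp
  next
    fix b assume b: "b \<in> Tgt p'"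
    show "ptran p (\<beta>' b) = ptran p' b" using m eqv_in[OF e'(2) b] i(4)[OF b] unfolding bisp_iso_maps_def by metis
  qed (use e' in auto)
  then show ?thesis using that m i by blast
qed

lemma bisp_iso_sym: "\<lbrakk>bisp_iso G p p'; wf_bisp G X Y p\<rbrakk> \<Longrightarrow> bisp_iso G p' p"
  by (metis bisp_isoE bisp_iso_def)

lemma bispan_iso_iff:
  "(b, c) \<in> bispan_iso G X Y \<longleftrightarrow> b \<in> bispans G X Y \<and> c \<in> bispans G X Y \<and> bisp_iso G (of_bispan b) (of_bispan c)"
proof (cases "b \<in> bispans G X Y \<and> c \<in> bispans G X Y")
  case True
  then have o: "bsrc b \<in> Fin G" "btgt b \<in> Fin G" "bsrc c \<in> Fin G" "btgt c \<in> Fin G"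
    and m: "bres b \<in> EMap G (bsrc b) X" "bnorm b \<in> EMap G (bsrc b) (btgt b)" "btran b \<in> EMap G (btgt b) Y"
    by (auto simp: bispans_def)
  note gs = o[THEN Fin_gset]
  show ?thesis
  proof
    assume "(b, c) \<in> bispan_iso G X Y"
    then obtain \<alpha> \<beta> where ab: "is_iso (gset_cat G) (bsrc b) (bsrc c) \<alpha>" "is_iso (gset_cat G) (btgt b) (btgt c) \<beta>"
       and e: "compose (elts (bsrc b)) (bres c) \<alpha> = bres b"
           "compose (elts (bsrc b)) (bnorm c) \<alpha> = compose (elts (bsrc b)) \<beta> (bnorm b)"
           "compose (elts (btgt b)) (btran c) \<beta> = btran b" by (auto simp: bispan_iso_def)
    have "bres c (\<alpha> a) = bres b a \<and> bnorm c (\<alpha> a) = \<beta> (bnorm b a)" if "a \<in> elts (bsrc b)" for a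
      using fun_cong[OF e(1), of a] fun_cong[OF e(2), of a] that by (simp add: compose_def)
    moreover have "btran c (\<beta> a) = btran b a" if "a \<in> elts (btgt b)" for a
      using fun_cong[OF e(3), of a] that by (simp add: compose_def)
    ultimately have "bisp_iso_maps G (of_bispan b) (of_bispan c) \<alpha> \<beta>"
      using ab o unfolding bisp_iso_maps_def by (simp add: is_iso_gset_cat EMap_eqv)
    then show "b \<in> bispans G X Y \<and> c \<in> bispans G X Y \<and> bisp_iso G (of_bispan b) (of_bispan c)"
      using True unfolding bisp_iso_def by blast
  next
    assume "b \<in> bispans G X Y \<and> c \<in> bispans G X Y \<and> bisp_iso G (of_bispan b) (of_bispan c)"
    then obtain \<alpha> \<beta> where ab: "bisp_iso_maps G (of_bispan b) (of_bispan c) \<alpha> \<beta>" unfolding bisp_iso_def by blast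
    let ?\<alpha> = "restrict \<alpha> (elts (bsrc b))" and ?\<beta> = "restrict \<beta> (elts (btgt b))"
    have "is_iso (gset_cat G) (bsrc b) (bsrc c) ?\<alpha>" "is_iso (gset_cat G) (btgt b) (btgt c) ?\<beta>"
      using ab gs unfolding is_iso_gset_cat[OF o(1,3)] is_iso_gset_cat[OF o(2,4)] bisp_iso_maps_def
      by (auto intro: restrict_equivariant_maps bij_betw_restrict)
    moreover have "compose (elts (bsrc b)) (bres c) ?\<alpha> = bres b" "compose (elts (btgt b)) (btran c) ?\<beta> = btran b"
        "compose (elts (bsrc b)) (bnorm c) ?\<alpha> = compose (elts (bsrc b)) ?\<beta> (bnorm b)"
      using ab m[THEN equivariant_maps_extensional] eqv_in[OF EMap_eqv[OF m(2)]] unfolding bisp_iso_maps_def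
      by (auto simp: compose_def fun_eq_iff extensional_def)
    ultimately show "(b, c) \<in> bispan_iso G X Y" using True unfolding bispan_iso_def by blast
  qed
qed (auto simp: bispan_iso_def)

lemma bispan_class_eq_cls: "b \<in> bispans G X Y \<Longrightarrow> bispan_class G X Y b = cls G X Y (of_bispan b)"
  unfolding bispan_class_def cls_def by (auto simp: bispan_iso_iff)

lemma ex_bispan_iso:
  fixes X Y :: "('g, 'u::infinite) gset"
  assumes wf: "wf_bisp G X Y p"
  shows "\<exists>b\<in>bispans G X Y. bisp_iso G p (of_bispan b)"
proof -
  note W = wf_bispD[OF wf]
  obtain A :: "('g, 'u) gset" and \<alpha> where A: "A \<in> Fin G" and \<alpha>: "bij_betw \<alpha> (Src p) (elts A)" "eqv G (psrc p) A \<alpha>"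
    using transport_finite_gset[OF W(1)] by blast
  obtain B :: "('g, 'u) gset" and \<beta> where B: "B \<in> Fin G" and \<beta>: "bij_betw \<beta> (Tgt p) (elts B)" "eqv G (ptgt p) B \<beta>"
    using transport_finite_gset[OF W(2)] by blast
  define \<alpha>' \<beta>' where "\<alpha>' = inv_into (Src p) \<alpha>" and "\<beta>' = inv_into (Tgt p) \<beta>"
  have i: "\<And>x. x \<in> Src p \<Longrightarrow> \<alpha>' (\<alpha> x) = x" "\<And>x. x \<in> Tgt p \<Longrightarrow> \<beta>' (\<beta> x) = x"
    unfolding \<alpha>'_def \<beta>'_def using \<alpha> \<beta> by (simp_all add: bij_betw_inv_into_left)
  have e': "eqv G A (psrc p) \<alpha>'" "eqv G B (ptgt p) \<beta>'"
    unfolding \<alpha>'_def \<beta>'_def using W \<alpha> \<beta> by (auto intro: eqv_inv_into)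
  note gs = A[THEN Fin_gset] B[THEN Fin_gset]
  define b where "b = \<lparr>bsrc = A, btgt = B, bres = restrict (pres p \<circ> \<alpha>') (elts A),
     bnorm = restrict (\<beta> \<circ> (pnorm p \<circ> \<alpha>')) (elts A), btran = restrict (ptran p \<circ> \<beta>') (elts B)\<rparr>"
  have "b \<in> bispans G X Y"
    unfolding bispans_def b_def using A B gs W \<alpha> \<beta> e' by (auto intro!: restrict_equivariant_maps intro: eqv_comp)
  moreover have "bisp_iso_maps G p (of_bispan b) \<alpha> \<beta>"
    unfolding bisp_iso_maps_def b_def using \<alpha> \<beta> i eqv_in[OF \<alpha>(2)] eqv_in[OF \<beta>(2)] by simp
  ultimately show ?thesis unfolding bisp_iso_def by blast
qed

lemma cls_eq:
  fixes X Y :: "('g, 'u::infinite) gset"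
  assumes "wf_bisp G X Y p" "wf_bisp G X Y p'"
  shows "cls G X Y p = cls G X Y p' \<longleftrightarrow> bisp_iso G p p'"
proof
  assume eq: "cls G X Y p = cls G X Y p'"
  obtain b where "b \<in> bispans G X Y" "bisp_iso G p (of_bispan b)" using ex_bispan_iso[OF assms(1)] by blast
  then show "bisp_iso G p p'" using eq assms bisp_iso_sym bisp_iso_trans unfolding cls_def by blast
next
  assume iso: "bisp_iso G p p'"
  then show "cls G X Y p = cls G X Y p'" unfolding cls_def
    using bisp_iso_trans[OF iso _ assms(1)] bisp_iso_trans[OF bisp_iso_sym[OF iso assms(1)] _ assms(2)] by auto
qed

lemma Hom_bispan_cat:
  fixes X Y :: "('g, 'u::infinite) gset"
  shows "BHom G X Y = {f. \<exists>b\<in>bispans G X Y. f = cls G X Y (of_bispan b)}"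
  unfolding bispan_cat_def by (auto simp: quotient_def bispan_class_def[symmetric] bispan_class_eq_cls)

lemma cls_in_Hom:
  fixes X Y :: "('g, 'u::infinite) gset"
  assumes wf: "wf_bisp G X Y p" shows "cls G X Y p \<in> BHom G X Y"
proof -
  obtain b where b: "b \<in> bispans G X Y" "bisp_iso G p (of_bispan b)" using ex_bispan_iso[OF wf] by blast
  then have "cls G X Y p = cls G X Y (of_bispan b)" using cls_eq[OF wf wf_of_bispan] by blast
  then show ?thesis using b(1) unfolding Hom_bispan_cat by blast
qed

lemma Hom_bispan_catE:
  fixes X Y :: "('g, 'u::infinite) gset"
  assumes "f \<in> BHom G X Y"
  obtains p :: "('g, 'u) ubisp" where "wf_bisp G X Y p" "f = cls G X Y p" "psrc p \<in> Fin G" "ptgt p \<in> Fin G"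
proof -
  obtain b where b: "b \<in> bispans G X Y" "f = cls G X Y (of_bispan b)"
    using assms unfolding Hom_bispan_cat by blast
  show ?thesis by (rule that[OF wf_of_bispan[OF b(1)] b(2)]) (use b(1) in \<open>auto simp: bispans_def\<close>)
qed

end

section \<open>Composites of bispans in terms of elements\<close>

text \<open>\<open>p''\<close> is the composite of \<open>p = (X \<leftarrow> A \<rightarrow> B \<rightarrow> Y)\<close> and \<open>p' = (Y \<leftarrow> C \<rightarrow> D \<rightarrow> Z)\<close>. A point \<open>w\<close> of its middle set lies over
  \<open>q w\<close> in \<open>D\<close>, and \<open>ev w\<close> is a map from the fibre of \<open>C\<close> over \<open>q w\<close> to \<open>B\<close> that agrees with \<open>C \<rightarrow> Y\<close>; \<open>section_ex1\<close> says that the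
  points correspond bijectively to such pairs. A point of the source is a point \<open>w\<close>, a point \<open>l\<close> of the fibre over
  \<open>q w\<close>, and a point \<open>a\<close> of \<open>A\<close> over \<open>ev w l\<close>; this is \<open>point_ex1\<close>.\<close>

locale comp_wit = plain_group G for G :: "'g monoid" (structure) +
  fixes X :: "('g, 'x) gset" and Y :: "('g, 'y) gset" and Z :: "('g, 'z) gset"
    and p :: "('g, 'a, 'b, 'x, 'y) bisp" and p' :: "('g, 'c, 'd, 'y, 'z) bisp" and p'' :: "('g, 'e, 'f, 'x, 'z) bisp"
    and q :: "'f \<Rightarrow> 'd" and ev :: "'f \<Rightarrow> 'c \<Rightarrow> 'b" and l :: "'e \<Rightarrow> 'c" and a :: "'e \<Rightarrow> 'a"
  assumes wf1: "wf_bisp G X Y p" and wf2: "wf_bisp G Y Z p'" and wf3: "wf_bisp G X Z p''"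
    and q_eqv: "eqv G (ptgt p'') (ptgt p') q"
    and q_tran: "w \<in> Tgt p'' \<Longrightarrow> ptran p' (q w) = ptran p'' w"
    and ev_in: "\<lbrakk>w \<in> Tgt p''; c \<in> Src p'; pnorm p' c = q w\<rbrakk> \<Longrightarrow> ev w c \<in> Tgt p"
    and ev_tran: "\<lbrakk>w \<in> Tgt p''; c \<in> Src p'; pnorm p' c = q w\<rbrakk> \<Longrightarrow> ptran p (ev w c) = pres p' c"
    and ev_act: "\<lbrakk>g \<in> carrier G; w \<in> Tgt p''; c \<in> Src p'; pnorm p' c = q w\<rbrakk> \<Longrightarrow>
       ev (act (ptgt p'') g w) (act (psrc p') g c) = act (ptgt p) g (ev w c)"
    and section_ex1: "\<lbrakk>d \<in> Tgt p'; \<And>c. \<lbrakk>c \<in> Src p'; pnorm p' c = d\<rbrakk> \<Longrightarrow> s c \<in> Tgt p \<and> ptran p (s c) = pres p' c\<rbrakk> \<Longrightarrow>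
       \<exists>!w. w \<in> Tgt p'' \<and> q w = d \<and> (\<forall>c\<in>Src p'. pnorm p' c = d \<longrightarrow> ev w c = s c)"
    and l_eqv: "eqv G (psrc p'') (psrc p') l" and a_eqv: "eqv G (psrc p'') (psrc p) a"
    and l_norm: "x \<in> Src p'' \<Longrightarrow> pnorm p' (l x) = q (pnorm p'' x)"
    and a_norm: "x \<in> Src p'' \<Longrightarrow> pnorm p (a x) = ev (pnorm p'' x) (l x)"
    and a_res: "x \<in> Src p'' \<Longrightarrow> pres p (a x) = pres p'' x"
    and point_ex1: "\<lbrakk>w \<in> Tgt p''; c \<in> Src p'; a0 \<in> Src p; pnorm p' c = q w; pnorm p a0 = ev w c\<rbrakk> \<Longrightarrow>
       \<exists>!x. x \<in> Src p'' \<and> pnorm p'' x = w \<and> l x = c \<and> a x = a0"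
begin

lemma tgt_eqI:
  assumes "w \<in> Tgt p''" "w' \<in> Tgt p''" "q w' = q w"
    "\<And>c. \<lbrakk>c \<in> Src p'; pnorm p' c = q w\<rbrakk> \<Longrightarrow> ev w' c = ev w c"
  shows "w' = w"
proof -
  have "\<exists>!u. u \<in> Tgt p'' \<and> q u = q w \<and> (\<forall>c\<in>Src p'. pnorm p' c = q w \<longrightarrow> ev u c = ev w c)"
    using assms(1) by (intro section_ex1) (auto simp: ev_in ev_tran eqv_in[OF q_eqv])
  then show ?thesis using assms by auto
qed

lemma src_eqI:
  assumes "x \<in> Src p''" "x' \<in> Src p''" "pnorm p'' x' = pnorm p'' x" "l x' = l x" "a x' = a x"
  shows "x' = x"
proof -
  have "\<exists>!u. u \<in> Src p'' \<and> pnorm p'' u = pnorm p'' x \<and> l u = l x \<and> a u = a x"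
    using assms(1) by (intro point_ex1) (auto simp: l_norm a_norm eqv_in[OF l_eqv] eqv_in[OF a_eqv] eqv_in[OF wf_bispD(4)[OF wf3]])
  then show ?thesis using assms by auto
qed

lemma fibre_act_inv:
  assumes "g \<in> carrier G" "w \<in> Tgt p''" "c \<in> Src p'" "pnorm p' c = q (act (ptgt p'') g w)"
  shows "pnorm p' (act (psrc p') (inv g) c) = q w"
  using assms eqv_act[OF wf_bispD(4)[OF wf2], of "inv g"] eqv_act[OF q_eqv] eqv_in[OF q_eqv] is_gset_inv[OF wf_bispD(2)[OF wf2]]
  by simp

text \<open>Points of the middle set are determined by \<open>q\<close> and the evaluations, so equivariance of a map into it can be
  checked there.\<close>

lemma tgt_map_eqv:
  assumes T: "is_gset G T" and in': "\<And>t. t \<in> elts T \<Longrightarrow> \<beta> t \<in> Tgt p''" and qb: "eqv G T (ptgt p') (\<lambda>t. q (\<beta> t))"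
    and evb: "\<And>g t c. \<lbrakk>g \<in> carrier G; t \<in> elts T; c \<in> Src p'; pnorm p' c = q (\<beta> t)\<rbrakk> \<Longrightarrow>
      ev (\<beta> (act T g t)) (act (psrc p') g c) = act (ptgt p) g (ev (\<beta> t) c)"
  shows "eqv G T (ptgt p'') \<beta>"
  unfolding eqv_def
proof (intro conjI ballI)
  fix g t assume g: "g \<in> carrier G" and t: "t \<in> elts T"
  have gt: "act T g t \<in> elts T" by (rule is_gsetD(2)[OF T g t])
  show "\<beta> (act T g t) = act (ptgt p'') g (\<beta> t)"
  proof (rule tgt_eqI)
    show "q (\<beta> (act T g t)) = q (act (ptgt p'') g (\<beta> t))"
      using eqv_act[OF qb g t] eqv_act[OF q_eqv g in'[OF t]] by simp
    fix c assume c: "c \<in> Src p'" and nc: "pnorm p' c = q (act (ptgt p'') g (\<beta> t))"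
    let ?c = "act (psrc p') (inv g) c"
    have c': "?c \<in> Src p'" using c g by (simp add: is_gsetD(2)[OF wf_bispD(1)[OF wf2]])
    have n': "pnorm p' ?c = q (\<beta> t)" by (rule fibre_act_inv[OF g in'[OF t] c nc])
    have "c = act (psrc p') g ?c" using is_gset_inv(2)[OF wf_bispD(1)[OF wf2] g c] by simp
    then show "ev (\<beta> (act T g t)) c = ev (act (ptgt p'') g (\<beta> t)) c"
      using evb[OF g t c' n'] ev_act[OF g in'[OF t] c' n'] by simp
  qed (use in' gt t g is_gsetD(2)[OF wf_bispD(2)[OF wf3]] in auto)
qed (use in' in auto)

lemma src_map_eqv:
  assumes T: "is_gset G T" and in': "\<And>t. t \<in> elts T \<Longrightarrow> \<alpha> t \<in> Src p''"
    and "eqv G T (ptgt p'') (\<lambda>t. pnorm p'' (\<alpha> t))" "eqv G T (psrc p') (\<lambda>t. l (\<alpha> t))" "eqv G T (psrc p) (\<lambda>t. a (\<alpha> t))"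
  shows "eqv G T (psrc p'') \<alpha>"
  unfolding eqv_def
proof (intro conjI ballI)
  fix g t assume g: "g \<in> carrier G" and t: "t \<in> elts T"
  have gt: "act T g t \<in> elts T" by (rule is_gsetD(2)[OF T g t])
  show "\<alpha> (act T g t) = act (psrc p'') g (\<alpha> t)"
    by (rule src_eqI) (use in'[OF gt] in'[OF t] g t is_gsetD(2)[OF wf_bispD(1)[OF wf3]]
        assms(3-5)[THEN eqv_act, OF g t] eqv_act[OF wf_bispD(4)[OF wf3] g in'[OF t]] eqv_act[OF l_eqv g in'[OF t]] eqv_act[OF a_eqv g in'[OF t]] in auto)
qed (use in' in auto)

end

lemma comp_wit_compare:
  assumes "comp_wit G X Y Z p p' p1 q1 ev1 l1 a1" and "comp_wit G X Y Z p p' p2 q2 ev2 l2 a2"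
  shows "\<exists>\<alpha> \<beta>. (\<forall>w\<in>Tgt p1. \<beta> w \<in> Tgt p2 \<and> q2 (\<beta> w) = q1 w \<and> (\<forall>c\<in>Src p'. pnorm p' c = q1 w \<longrightarrow> ev2 (\<beta> w) c = ev1 w c)) \<and>
    (\<forall>x\<in>Src p1. \<alpha> x \<in> Src p2 \<and> pnorm p2 (\<alpha> x) = \<beta> (pnorm p1 x) \<and> l2 (\<alpha> x) = l1 x \<and> a2 (\<alpha> x) = a1 x)"
proof -
  interpret W1: comp_wit G X Y Z p p' p1 q1 ev1 l1 a1 by fact
  interpret W2: comp_wit G X Y Z p p' p2 q2 ev2 l2 a2 by fact
  have "\<exists>u. u \<in> Tgt p2 \<and> q2 u = q1 w \<and> (\<forall>c\<in>Src p'. pnorm p' c = q1 w \<longrightarrow> ev2 u c = ev1 w c)" if "w \<in> Tgt p1" for w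
    by (rule ex1_implies_ex, rule W2.section_ex1) (use that in \<open>auto simp: W1.ev_in W1.ev_tran eqv_in[OF W1.q_eqv]\<close>)
  then obtain \<beta> where \<beta>: "\<And>w. w \<in> Tgt p1 \<Longrightarrow> \<beta> w \<in> Tgt p2 \<and> q2 (\<beta> w) = q1 w \<and> (\<forall>c\<in>Src p'. pnorm p' c = q1 w \<longrightarrow> ev2 (\<beta> w) c = ev1 w c)"
    by metis
  have n1: "pnorm p1 x \<in> Tgt p1" if "x \<in> Src p1" for x using eqv_in[OF wf_bispD(4)[OF W1.wf3] that] .
  have "\<exists>u. u \<in> Src p2 \<and> pnorm p2 u = \<beta> (pnorm p1 x) \<and> l2 u = l1 x \<and> a2 u = a1 x" if "x \<in> Src p1" for x
    by (rule ex1_implies_ex, rule W2.point_ex1)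
      (use that \<beta>[OF n1[OF that]] in \<open>auto simp: W1.l_norm W1.a_norm eqv_in[OF W1.l_eqv] eqv_in[OF W1.a_eqv]\<close>)
  then obtain \<alpha> where "\<And>x. x \<in> Src p1 \<Longrightarrow> \<alpha> x \<in> Src p2 \<and> pnorm p2 (\<alpha> x) = \<beta> (pnorm p1 x) \<and> l2 (\<alpha> x) = l1 x \<and> a2 (\<alpha> x) = a1 x"
    by metis
  then show ?thesis using \<beta> by blast
qed

text \<open>Both composites have the same points: the unique existence clauses of each give maps in both directions, and
  uniqueness makes these inverse to each other and equivariant.\<close>

lemma comp_wit_unique:
  assumes w1: "comp_wit G X Y Z p p' p1 q1 ev1 l1 a1" and w2: "comp_wit G X Y Z p p' p2 q2 ev2 l2 a2"
  shows "bisp_iso G p1 p2"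
proof -
  interpret W1: comp_wit G X Y Z p p' p1 q1 ev1 l1 a1 by fact
  interpret W2: comp_wit G X Y Z p p' p2 q2 ev2 l2 a2 by fact
  obtain \<alpha> \<beta> where \<beta>: "\<And>w. w \<in> Tgt p1 \<Longrightarrow> \<beta> w \<in> Tgt p2 \<and> q2 (\<beta> w) = q1 w \<and> (\<forall>c\<in>Src p'. pnorm p' c = q1 w \<longrightarrow> ev2 (\<beta> w) c = ev1 w c)"
    and \<alpha>: "\<And>x. x \<in> Src p1 \<Longrightarrow> \<alpha> x \<in> Src p2 \<and> pnorm p2 (\<alpha> x) = \<beta> (pnorm p1 x) \<and> l2 (\<alpha> x) = l1 x \<and> a2 (\<alpha> x) = a1 x"
    using comp_wit_compare[OF w1 w2] by blast
  obtain \<alpha>' \<beta>' where \<beta>': "\<And>w. w \<in> Tgt p2 \<Longrightarrow> \<beta>' w \<in> Tgt p1 \<and> q1 (\<beta>' w) = q2 w \<and> (\<forall>c\<in>Src p'. pnorm p' c = q2 w \<longrightarrow> ev1 (\<beta>' w) c = ev2 w c)"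
    and \<alpha>': "\<And>x. x \<in> Src p2 \<Longrightarrow> \<alpha>' x \<in> Src p1 \<and> pnorm p1 (\<alpha>' x) = \<beta>' (pnorm p2 x) \<and> l1 (\<alpha>' x) = l2 x \<and> a1 (\<alpha>' x) = a2 x"
    using comp_wit_compare[OF w2 w1] by blast
  have n1: "pnorm p1 x \<in> Tgt p1" if "x \<in> Src p1" for x using eqv_in[OF wf_bispD(4)[OF W1.wf3] that] .
  have n2: "pnorm p2 x \<in> Tgt p2" if "x \<in> Src p2" for x using eqv_in[OF wf_bispD(4)[OF W2.wf3] that] .
  have bb: "\<beta>' (\<beta> w) = w" if w: "w \<in> Tgt p1" for w
    using \<beta>[OF w] \<beta>'[of "\<beta> w"] by (intro W1.tgt_eqI[OF w]) auto
  have bb': "\<beta> (\<beta>' w) = w" if w: "w \<in> Tgt p2" for w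
    using \<beta>'[OF w] \<beta>[of "\<beta>' w"] by (intro W2.tgt_eqI[OF w]) auto
  have aa: "\<alpha>' (\<alpha> x) = x" if x: "x \<in> Src p1" for x
    using \<alpha>[OF x] \<alpha>'[of "\<alpha> x"] bb[OF n1[OF x]] by (intro W1.src_eqI[OF x]) auto
  have aa': "\<alpha> (\<alpha>' x) = x" if x: "x \<in> Src p2" for x
    using \<alpha>'[OF x] \<alpha>[of "\<alpha>' x"] bb'[OF n2[OF x]] by (intro W2.src_eqI[OF x]) auto
  have be: "eqv G (ptgt p1) (ptgt p2) \<beta>"
  proof (rule W2.tgt_map_eqv)
    show "eqv G (ptgt p1) (ptgt p') (\<lambda>t. q2 (\<beta> t))"
      using W1.q_eqv \<beta> eqv_cong[OF wf_bispD(2)[OF W1.wf3], of "\<lambda>t. q2 (\<beta> t)" q1] by auto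
    fix g t c assume g: "g \<in> carrier G" and t: "t \<in> Tgt p1" and c: "c \<in> Src p'" and n: "pnorm p' c = q2 (\<beta> t)"
    have gt: "act (ptgt p1) g t \<in> Tgt p1" using is_gsetD(2)[OF wf_bispD(2)[OF W1.wf3] g t] .
    have gc: "act (psrc p') g c \<in> Src p'" using is_gsetD(2)[OF wf_bispD(1)[OF W1.wf2] g c] .
    have n1: "pnorm p' c = q1 t" using n \<beta>[OF t] by simp
    have "pnorm p' (act (psrc p') g c) = q1 (act (ptgt p1) g t)"
      using n1 eqv_act[OF wf_bispD(4)[OF W1.wf2] g c] eqv_act[OF W1.q_eqv g t] by simp
    then have "ev2 (\<beta> (act (ptgt p1) g t)) (act (psrc p') g c) = ev1 (act (ptgt p1) g t) (act (psrc p') g c)"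
      using \<beta>[OF gt] gc by simp
    also have "\<dots> = act (ptgt p) g (ev2 (\<beta> t) c)" using W1.ev_act[OF g t c n1] \<beta>[OF t] c n1 by simp
    finally show "ev2 (\<beta> (act (ptgt p1) g t)) (act (psrc p') g c) = act (ptgt p) g (ev2 (\<beta> t) c)" .
  qed (use \<beta> wf_bispD(2)[OF W1.wf3] in auto)
  have ae: "eqv G (psrc p1) (psrc p2) \<alpha>"
  proof (rule W2.src_map_eqv)
    note s1 = wf_bispD(1)[OF W1.wf3]
    show "eqv G (psrc p1) (ptgt p2) (\<lambda>t. pnorm p2 (\<alpha> t))"
      using eqv_comp[OF wf_bispD(4)[OF W1.wf3] be] \<alpha> eqv_cong[OF s1, of "\<lambda>t. pnorm p2 (\<alpha> t)" "\<beta> \<circ> pnorm p1"] by auto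
    show "eqv G (psrc p1) (psrc p') (\<lambda>t. l2 (\<alpha> t))"
      using W1.l_eqv \<alpha> eqv_cong[OF s1, of "\<lambda>t. l2 (\<alpha> t)" l1] by auto
    show "eqv G (psrc p1) (psrc p) (\<lambda>t. a2 (\<alpha> t))"
      using W1.a_eqv \<alpha> eqv_cong[OF s1, of "\<lambda>t. a2 (\<alpha> t)" a1] by auto
  qed (use \<alpha> wf_bispD(1)[OF W1.wf3] in auto)
  have "bisp_iso_maps G p1 p2 \<alpha> \<beta>" unfolding bisp_iso_maps_def
  proof (intro conjI ballI)
    show "bij_betw \<alpha> (Src p1) (Src p2)"
      by (rule bij_betw_byWitness[of _ \<alpha>']) (use aa aa' \<alpha> \<alpha>' in auto)
    show "bij_betw \<beta> (Tgt p1) (Tgt p2)"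
      by (rule bij_betw_byWitness[of _ \<beta>']) (use bb bb' \<beta> \<beta>' in auto)
    fix x assume x: "x \<in> Src p1"
    show "pres p2 (\<alpha> x) = pres p1 x" using W1.a_res[OF x] W2.a_res[of "\<alpha> x"] \<alpha>[OF x] by auto
    show "pnorm p2 (\<alpha> x) = \<beta> (pnorm p1 x)" using \<alpha>[OF x] by simp
  next
    fix w assume w: "w \<in> Tgt p1"
    show "ptran p2 (\<beta> w) = ptran p1 w" using W1.q_tran[OF w] W2.q_tran[of "\<beta> w"] \<beta>[OF w] by auto
  qed (use ae be in auto)
  then show ?thesis unfolding bisp_iso_def by blast
qed

text \<open>Being a composite is invariant under isomorphism in all three bispans, since the witnesses can be conjugated.\<close>

lemma comp_wit_transport:
  assumes W: "comp_wit G X Y Z p p' p'' q ev l a"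
    and iso: "bisp_iso G p r" "bisp_iso G p' r'" "bisp_iso G p'' r''"
    and wf: "wf_bisp G X Y r" "wf_bisp G Y Z r'" "wf_bisp G X Z r''"
  shows "\<exists>q ev l a. comp_wit G X Y Z r r' r'' q ev l a"
proof -
  interpret comp_wit G X Y Z p p' p'' q ev l a by fact
  obtain \<alpha> \<beta> \<alpha>i \<beta>i where m: "bisp_iso_maps G p r \<alpha> \<beta>" "bisp_iso_maps G r p \<alpha>i \<beta>i"
    and i: "\<And>x. x \<in> Src p \<Longrightarrow> \<alpha>i (\<alpha> x) = x" "\<And>x. x \<in> Src r \<Longrightarrow> \<alpha> (\<alpha>i x) = x"
    "\<And>x. x \<in> Tgt p \<Longrightarrow> \<beta>i (\<beta> x) = x" "\<And>x. x \<in> Tgt r \<Longrightarrow> \<beta> (\<beta>i x) = x"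
    using bisp_isoE[OF iso(1) wf1] by blast
  obtain \<alpha>' \<beta>' \<alpha>i' \<beta>i' where m': "bisp_iso_maps G p' r' \<alpha>' \<beta>'" "bisp_iso_maps G r' p' \<alpha>i' \<beta>i'"
    and i': "\<And>x. x \<in> Src p' \<Longrightarrow> \<alpha>i' (\<alpha>' x) = x" "\<And>x. x \<in> Src r' \<Longrightarrow> \<alpha>' (\<alpha>i' x) = x"
    "\<And>x. x \<in> Tgt p' \<Longrightarrow> \<beta>i' (\<beta>' x) = x" "\<And>x. x \<in> Tgt r' \<Longrightarrow> \<beta>' (\<beta>i' x) = x"
    using bisp_isoE[OF iso(2) wf2] by blast
  obtain \<alpha>'' \<beta>'' \<alpha>i'' \<beta>i'' where m'': "bisp_iso_maps G p'' r'' \<alpha>'' \<beta>''" "bisp_iso_maps G r'' p'' \<alpha>i'' \<beta>i''"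
    and i'': "\<And>x. x \<in> Src p'' \<Longrightarrow> \<alpha>i'' (\<alpha>'' x) = x" "\<And>x. x \<in> Src r'' \<Longrightarrow> \<alpha>'' (\<alpha>i'' x) = x"
    "\<And>x. x \<in> Tgt p'' \<Longrightarrow> \<beta>i'' (\<beta>'' x) = x" "\<And>x. x \<in> Tgt r'' \<Longrightarrow> \<beta>'' (\<beta>i'' x) = x"
    using bisp_isoE[OF iso(3) wf3] by blast
  note M = m[unfolded bisp_iso_maps_def] m'[unfolded bisp_iso_maps_def] m''[unfolded bisp_iso_maps_def]
  have E: "eqv G (psrc p) (psrc r) \<alpha>" "eqv G (ptgt p) (ptgt r) \<beta>" "eqv G (psrc r) (psrc p) \<alpha>i" "eqv G (ptgt r) (ptgt p) \<beta>i"
    "eqv G (psrc p') (psrc r') \<alpha>'" "eqv G (ptgt p') (ptgt r') \<beta>'" "eqv G (psrc r') (psrc p') \<alpha>i'" "eqv G (ptgt r') (ptgt p') \<beta>i'"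
    "eqv G (psrc p'') (psrc r'') \<alpha>''" "eqv G (ptgt p'') (ptgt r'') \<beta>''" "eqv G (psrc r'') (psrc p'') \<alpha>i''" "eqv G (ptgt r'') (ptgt p'') \<beta>i''"
    using M by auto
  note In = E[THEN eqv_in] eqv_in[OF q_eqv] eqv_in[OF l_eqv] eqv_in[OF a_eqv]
     eqv_in[OF wf_bispD(4)[OF wf1]] eqv_in[OF wf_bispD(4)[OF wf2]] eqv_in[OF wf_bispD(4)[OF wf3]]
     eqv_in[OF wf_bispD(4)[OF wf(1)]] eqv_in[OF wf_bispD(4)[OF wf(2)]] eqv_in[OF wf_bispD(4)[OF wf(3)]]
  have n: "\<And>x. x \<in> Src r \<Longrightarrow> pnorm p (\<alpha>i x) = \<beta>i (pnorm r x)" "\<And>x. x \<in> Src r' \<Longrightarrow> pnorm p' (\<alpha>i' x) = \<beta>i' (pnorm r' x)"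
     "\<And>x. x \<in> Src r'' \<Longrightarrow> pnorm p'' (\<alpha>i'' x) = \<beta>i'' (pnorm r'' x)"
     "\<And>x. x \<in> Src p \<Longrightarrow> pnorm r (\<alpha> x) = \<beta> (pnorm p x)" "\<And>x. x \<in> Src p' \<Longrightarrow> pnorm r' (\<alpha>' x) = \<beta>' (pnorm p' x)"
     "\<And>x. x \<in> Src p'' \<Longrightarrow> pnorm r'' (\<alpha>'' x) = \<beta>'' (pnorm p'' x)"
    and rs: "\<And>x. x \<in> Src r' \<Longrightarrow> pres p' (\<alpha>i' x) = pres r' x" "\<And>x. x \<in> Src p' \<Longrightarrow> pres r' (\<alpha>' x) = pres p' x"
      "\<And>x. x \<in> Src p \<Longrightarrow> pres r (\<alpha> x) = pres p x" "\<And>x. x \<in> Src r'' \<Longrightarrow> pres p'' (\<alpha>i'' x) = pres r'' x"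
    and t: "\<And>x. x \<in> Tgt p \<Longrightarrow> ptran r (\<beta> x) = ptran p x" "\<And>x. x \<in> Tgt r \<Longrightarrow> ptran p (\<beta>i x) = ptran r x"
     "\<And>x. x \<in> Tgt p' \<Longrightarrow> ptran r' (\<beta>' x) = ptran p' x" "\<And>x. x \<in> Tgt r'' \<Longrightarrow> ptran p'' (\<beta>i'' x) = ptran r'' x"
    using M by auto
  note [simp] = In i i' i'' n rs t
  have fib: "pnorm p' (\<alpha>i' c) = q (\<beta>i'' w)" if "w \<in> Tgt r''" "c \<in> Src r'" "pnorm r' c = \<beta>' (q (\<beta>i'' w))" for w c
    using that by simp
  have "comp_wit G X Y Z r r' r'' (\<beta>' \<circ> (q \<circ> \<beta>i'')) (\<lambda>w c. \<beta> (ev (\<beta>i'' w) (\<alpha>i' c))) (\<alpha>' \<circ> (l \<circ> \<alpha>i'')) (\<alpha> \<circ> (a \<circ> \<alpha>i''))"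
  proof (unfold_locales, rule wf(1), rule wf(2), rule wf(3))
    show "eqv G (ptgt r'') (ptgt r') (\<beta>' \<circ> (q \<circ> \<beta>i''))" "eqv G (psrc r'') (psrc r') (\<alpha>' \<circ> (l \<circ> \<alpha>i''))"
        "eqv G (psrc r'') (psrc r) (\<alpha> \<circ> (a \<circ> \<alpha>i''))"
      using E q_eqv l_eqv a_eqv by (auto intro!: eqv_comp)
  next
    fix w assume "w \<in> Tgt r''"
    then show "ptran r' ((\<beta>' \<circ> (q \<circ> \<beta>i'')) w) = ptran r'' w" by (simp add: q_tran)
  next
    fix w c assume w: "w \<in> Tgt r''" and c: "c \<in> Src r'" and nc: "pnorm r' c = (\<beta>' \<circ> (q \<circ> \<beta>i'')) w"
    have f: "pnorm p' (\<alpha>i' c) = q (\<beta>i'' w)" using fib w c nc by simp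
    have e: "ev (\<beta>i'' w) (\<alpha>i' c) \<in> Tgt p" using w c by (intro ev_in f) auto
    then show "\<beta> (ev (\<beta>i'' w) (\<alpha>i' c)) \<in> Tgt r" by simp
    show "ptran r (\<beta> (ev (\<beta>i'' w) (\<alpha>i' c))) = pres r' c" using ev_tran[OF _ _ f] w c e by simp
    fix g assume g: "g \<in> carrier G"
    show "\<beta> (ev (\<beta>i'' (act (ptgt r'') g w)) (\<alpha>i' (act (psrc r') g c))) = act (ptgt r) g (\<beta> (ev (\<beta>i'' w) (\<alpha>i' c)))"
      using w c e eqv_act[OF E(12) g w] eqv_act[OF E(7) g c] ev_act[OF g _ _ f] eqv_act[OF E(2) g e] by simp
  next
    fix d s assume d: "d \<in> Tgt r'" and s: "\<And>c. \<lbrakk>c \<in> Src r'; pnorm r' c = d\<rbrakk> \<Longrightarrow> s c \<in> Tgt r \<and> ptran r (s c) = pres r' c"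
    have s': "\<beta>i (s (\<alpha>' c)) \<in> Tgt p \<and> ptran p (\<beta>i (s (\<alpha>' c))) = pres p' c" if "c \<in> Src p'" "pnorm p' c = \<beta>i' d" for c
      using s[of "\<alpha>' c"] that d by simp
    have ex: "\<exists>!w. w \<in> Tgt p'' \<and> q w = \<beta>i' d \<and> (\<forall>c\<in>Src p'. pnorm p' c = \<beta>i' d \<longrightarrow> ev w c = \<beta>i (s (\<alpha>' c)))"
      by (rule section_ex1[OF _ s']) (use d in simp_all)
    then obtain w where w: "w \<in> Tgt p''" "q w = \<beta>i' d" "\<And>c. \<lbrakk>c \<in> Src p'; pnorm p' c = \<beta>i' d\<rbrakk> \<Longrightarrow> ev w c = \<beta>i (s (\<alpha>' c))" by blast
    show "\<exists>!w. w \<in> Tgt r'' \<and> (\<beta>' \<circ> (q \<circ> \<beta>i'')) w = d \<and> (\<forall>c\<in>Src r'. pnorm r' c = d \<longrightarrow> \<beta> (ev (\<beta>i'' w) (\<alpha>i' c)) = s c)"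
    proof (rule ex1I[of _ "\<beta>'' w"])
      show "\<beta>'' w \<in> Tgt r'' \<and> (\<beta>' \<circ> (q \<circ> \<beta>i'')) (\<beta>'' w) = d \<and> (\<forall>c\<in>Src r'. pnorm r' c = d \<longrightarrow> \<beta> (ev (\<beta>i'' (\<beta>'' w)) (\<alpha>i' c)) = s c)"
        using w d s by simp
      fix v assume v: "v \<in> Tgt r'' \<and> (\<beta>' \<circ> (q \<circ> \<beta>i'')) v = d \<and> (\<forall>c\<in>Src r'. pnorm r' c = d \<longrightarrow> \<beta> (ev (\<beta>i'' v) (\<alpha>i' c)) = s c)"
      have "\<beta>i'' v = w"
      proof (rule tgt_eqI[OF w(1)])
        show q: "q (\<beta>i'' v) = q w" using v w(2) by auto
        show "ev (\<beta>i'' v) c = ev w c" if c: "c \<in> Src p'" "pnorm p' c = q w" for c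
        proof -
          have "\<beta> (ev (\<beta>i'' v) c) = s (\<alpha>' c)" using v c w(2) d by (metis i'(1,4) n(5) In(5))
          moreover have "ev (\<beta>i'' v) c \<in> Tgt p" using ev_in[of "\<beta>i'' v" c] v c q by simp
          ultimately show ?thesis using w(2,3) c by (metis i(3))
        qed
      qed (use v in simp)
      then show "v = \<beta>'' w" using v by auto
    qed
  next
    fix x assume x: "x \<in> Src r''"
    show "pnorm r' ((\<alpha>' \<circ> (l \<circ> \<alpha>i'')) x) = (\<beta>' \<circ> (q \<circ> \<beta>i'')) (pnorm r'' x)" using x l_norm[of "\<alpha>i'' x"] by simp
    show "pnorm r ((\<alpha> \<circ> (a \<circ> \<alpha>i'')) x) = \<beta> (ev (\<beta>i'' (pnorm r'' x)) (\<alpha>i' ((\<alpha>' \<circ> (l \<circ> \<alpha>i'')) x)))"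
      using x a_norm[of "\<alpha>i'' x"] by simp
    show "pres r ((\<alpha> \<circ> (a \<circ> \<alpha>i'')) x) = pres r'' x" using x a_res[of "\<alpha>i'' x"] by simp
  next
    fix w c a0 assume w: "w \<in> Tgt r''" and c: "c \<in> Src r'" and a0: "a0 \<in> Src r"
      and nc: "pnorm r' c = (\<beta>' \<circ> (q \<circ> \<beta>i'')) w" and na: "pnorm r a0 = \<beta> (ev (\<beta>i'' w) (\<alpha>i' c))"
    have f: "pnorm p' (\<alpha>i' c) = q (\<beta>i'' w)" using fib w c nc by simp
    have e: "ev (\<beta>i'' w) (\<alpha>i' c) \<in> Tgt p" using w c by (intro ev_in f) auto
    have "\<exists>!x. x \<in> Src p'' \<and> pnorm p'' x = \<beta>i'' w \<and> l x = \<alpha>i' c \<and> a x = \<alpha>i a0"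
      by (rule point_ex1) (use w c a0 f na e in simp_all)
    then obtain x where x: "x \<in> Src p''" "pnorm p'' x = \<beta>i'' w" "l x = \<alpha>i' c" "a x = \<alpha>i a0" by blast
    show "\<exists>!x. x \<in> Src r'' \<and> pnorm r'' x = w \<and> (\<alpha>' \<circ> (l \<circ> \<alpha>i'')) x = c \<and> (\<alpha> \<circ> (a \<circ> \<alpha>i'')) x = a0"
    proof (rule ex1I[of _ "\<alpha>'' x"])
      show "\<alpha>'' x \<in> Src r'' \<and> pnorm r'' (\<alpha>'' x) = w \<and> (\<alpha>' \<circ> (l \<circ> \<alpha>i'')) (\<alpha>'' x) = c \<and> (\<alpha> \<circ> (a \<circ> \<alpha>i'')) (\<alpha>'' x) = a0"
        using x w c a0 by simp
      fix y assume y: "y \<in> Src r'' \<and> pnorm r'' y = w \<and> (\<alpha>' \<circ> (l \<circ> \<alpha>i'')) y = c \<and> (\<alpha> \<circ> (a \<circ> \<alpha>i'')) y = a0"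
      have "\<alpha>i'' y = x"
        by (rule src_eqI[OF x(1)]) (use x y w c a0 in auto)
      then show "y = \<alpha>'' x" using y by auto
    qed
  qed
  then show ?thesis by blast
qed

section \<open>Existence of composites\<close>

definition fibre :: "('g, 'a, 'b, 'x, 'y) bisp \<Rightarrow> 'b \<Rightarrow> 'a set" where
  "fibre p d = {c \<in> Src p. pnorm p c = d}"

text \<open>The action on sections is by conjugation, as in \<open>dependent_product\<close>.\<close>

definition comp_tgt :: "'g monoid \<Rightarrow> ('g, 'a, 'b, 'x, 'y) bisp \<Rightarrow> ('g, 'c, 'd, 'y, 'z) bisp \<Rightarrow> ('g, 'd \<times> ('c \<Rightarrow> 'b)) gset" where
  "comp_tgt G p p' =
     ({(d, s). d \<in> Tgt p' \<and> s \<in> fibre p' d \<rightarrow>\<^sub>E Tgt p \<and> (\<forall>c\<in>fibre p' d. ptran p (s c) = pres p' c)},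
      \<lambda>g (d, s). (act (ptgt p') g d, \<lambda>c\<in>fibre p' (act (ptgt p') g d). act (ptgt p) g (s (act (psrc p') (inv\<^bsub>G\<^esub> g) c))))"

definition comp_src :: "'g monoid \<Rightarrow> ('g, 'a, 'b, 'x, 'y) bisp \<Rightarrow> ('g, 'c, 'd, 'y, 'z) bisp \<Rightarrow> ('g, ('d \<times> ('c \<Rightarrow> 'b)) \<times> 'c \<times> 'a) gset" where
  "comp_src G p p' =
     ({(w, c, a). w \<in> elts (comp_tgt G p p') \<and> c \<in> fibre p' (fst w) \<and> a \<in> Src p \<and> pnorm p a = snd w c},
      \<lambda>g (w, c, a). (act (comp_tgt G p p') g w, act (psrc p') g c, act (psrc p) g a))"

definition comp_bisp :: "'g monoid \<Rightarrow> ('g, 'a, 'b, 'x, 'y) bisp \<Rightarrow> ('g, 'c, 'd, 'y, 'z) bisp \<Rightarrow> ('g, ('d \<times> ('c \<Rightarrow> 'b)) \<times> 'c \<times> 'a, 'd \<times> ('c \<Rightarrow> 'b), 'x, 'z) bisp" where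
  "comp_bisp G p p' = \<lparr>psrc = comp_src G p p', ptgt = comp_tgt G p p', pres = (\<lambda>(w, c, a). pres p a),
     pnorm = fst, ptran = (\<lambda>(d, s). ptran p' d)\<rparr>"

context plain_group
begin

lemma fibre_act: "\<lbrakk>wf_bisp G X Y p; g \<in> carrier G; c \<in> fibre p d\<rbrakk> \<Longrightarrow> act (psrc p) g c \<in> fibre p (act (ptgt p) g d)"
  unfolding fibre_def by (auto simp: wf_bisp_def is_gsetD eqv_act)

lemma fibre_act_inv:
  "\<lbrakk>wf_bisp G X Y p; g \<in> carrier G; d \<in> Tgt p; c \<in> fibre p (act (ptgt p) g d)\<rbrakk> \<Longrightarrow> act (psrc p) (inv g) c \<in> fibre p d"
  using fibre_act[of X Y p "inv g" c "act (ptgt p) g d"] is_gset_inv(1)[of "ptgt p" g d] by (auto simp: wf_bisp_def)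

lemma is_gset_comp_tgt:
  assumes wf: "wf_bisp G X Y p" "wf_bisp G Y Z p'"
  shows "is_gset G (comp_tgt G p p')"
proof -
  note D = is_gsetD(2-)[OF wf_bispD(1)[OF wf(1)]] is_gsetD(2-)[OF wf_bispD(2)[OF wf(1)]]
    is_gsetD(2-)[OF wf_bispD(1)[OF wf(2)]] is_gsetD(2-)[OF wf_bispD(2)[OF wf(2)]]
  have fD: "c \<in> Src p'" if "c \<in> fibre p' d" for c d using that by (simp add: fibre_def)
  have "finite (SIGMA d:Tgt p'. fibre p' d \<rightarrow>\<^sub>E Tgt p)"
    using wf unfolding fibre_def by (intro finite_SigmaI finite_PiE) (auto simp: wf_bisp_def is_gset_def)
  then have fin: "finite (elts (comp_tgt G p p'))"
    by (rule rev_finite_subset) (auto simp: comp_tgt_def)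
  have closed: "act (comp_tgt G p p') g w \<in> elts (comp_tgt G p p')" if g: "g \<in> carrier G" and w: "w \<in> elts (comp_tgt G p p')" for g w
  proof -
    obtain d s where [simp]: "w = (d, s)" by (cases w)
    have d: "d \<in> Tgt p'" and s: "\<And>c. c \<in> fibre p' d \<Longrightarrow> s c \<in> Tgt p" "\<And>c. c \<in> fibre p' d \<Longrightarrow> ptran p (s c) = pres p' c"
      using w by (auto simp: comp_tgt_def)
    have "act (ptgt p) g (s (act (psrc p') (inv g) c)) \<in> Tgt p \<and> ptran p (act (ptgt p) g (s (act (psrc p') (inv g) c))) = pres p' c"
      if c: "c \<in> fibre p' (act (ptgt p') g d)" for c
    proof -
      have c': "act (psrc p') (inv g) c \<in> fibre p' d" by (rule fibre_act_inv[OF wf(2) g d c])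
      have "ptran p (act (ptgt p) g (s (act (psrc p') (inv g) c))) = act Y g (pres p' (act (psrc p') (inv g) c))"
        using eqv_act[OF wf_bispD(5)[OF wf(1)] g s(1)[OF c']] s(2)[OF c'] by simp
      also have "\<dots> = pres p' c"
        using eqv_act[OF wf_bispD(3)[OF wf(2)] g fD[OF c']] is_gset_inv(2)[OF wf_bispD(1)[OF wf(2)] g fD[OF c]] by simp
      finally show ?thesis using D(4)[OF g s(1)[OF c']] by simp
    qed
    then show ?thesis using D(10)[OF g d] by (auto simp: comp_tgt_def)
  qed
  show ?thesis unfolding is_gset_def
  proof (intro conjI ballI fin closed)
    fix w assume w: "w \<in> elts (comp_tgt G p p')"
    obtain d s where [simp]: "w = (d, s)" by (cases w)
    have d: "d \<in> Tgt p'" and s: "s \<in> fibre p' d \<rightarrow>\<^sub>E Tgt p" using w by (auto simp: comp_tgt_def)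
    then show "act (comp_tgt G p p') \<one> w = w"
      using D fD by (auto simp: comp_tgt_def fun_eq_iff PiE_iff extensional_def)
    fix g h assume g: "g \<in> carrier G" and h: "h \<in> carrier G"
    have hd: "act (ptgt p') h d \<in> Tgt p'" using D(10) h d by simp
    have dd: "act (ptgt p') (g \<otimes> h) d = act (ptgt p') g (act (ptgt p') h d)" using D(12) g h d by simp
    have "act (ptgt p) (g \<otimes> h) (s (act (psrc p') (inv (g \<otimes> h)) c)) =
        act (ptgt p) g ((\<lambda>c\<in>fibre p' (act (ptgt p') h d). act (ptgt p) h (s (act (psrc p') (inv h) c))) (act (psrc p') (inv g) c))"
      if c: "c \<in> fibre p' (act (ptgt p') g (act (ptgt p') h d))" for c
    proof -
      have 1: "act (psrc p') (inv g) c \<in> fibre p' (act (ptgt p') h d)" by (rule fibre_act_inv[OF wf(2) g hd c])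
      have 2: "act (psrc p') (inv h) (act (psrc p') (inv g) c) \<in> fibre p' d" by (rule fibre_act_inv[OF wf(2) h d 1])
      have 3: "act (psrc p') (inv (g \<otimes> h)) c = act (psrc p') (inv h) (act (psrc p') (inv g) c)"
        using g h fD[OF c] by (simp add: inv_mult_group D)
      show ?thesis using 1 3 PiE_mem[OF s 2] g h by (simp add: D)
    qed
    then show "act (comp_tgt G p p') (g \<otimes> h) w = act (comp_tgt G p p') g (act (comp_tgt G p p') h w)"
      by (auto simp: comp_tgt_def dd)
  qed
qed

lemma comp_tgt_act_apply:
  assumes wf: "wf_bisp G X Y p" "wf_bisp G Y Z p'" and g: "g \<in> carrier G" and c: "c \<in> fibre p' (fst w)"
  shows "snd (act (comp_tgt G p p') g w) (act (psrc p') g c) = act (ptgt p) g (snd w c)"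
  using fibre_act[OF wf(2) g c] is_gset_inv(1)[OF wf_bispD(1)[OF wf(2)] g, of c] c
  by (cases w) (auto simp: comp_tgt_def fibre_def)

lemma comp_bisp_wit:
  assumes wf: "wf_bisp G X Y p" "wf_bisp G Y Z p'"
  shows "comp_wit G X Y Z p p' (comp_bisp G p p') fst snd (\<lambda>(w, c, a). c) (\<lambda>(w, c, a). a)"
proof -
  note D = is_gsetD(2-)[OF wf_bispD(1)[OF wf(1)]] is_gsetD(2-)[OF wf_bispD(2)[OF wf(1)]]
    is_gsetD(2-)[OF wf_bispD(1)[OF wf(2)]] is_gsetD(2-)[OF wf_bispD(2)[OF wf(2)]]
  note T = is_gset_comp_tgt[OF wf]
  have fD: "c \<in> Src p'" if "c \<in> fibre p' d" for c d using that by (simp add: fibre_def)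
  have tD: "fst w \<in> Tgt p'" "c \<in> fibre p' (fst w) \<Longrightarrow> snd w c \<in> Tgt p"
    "c \<in> fibre p' (fst w) \<Longrightarrow> ptran p (snd w c) = pres p' c" if "w \<in> elts (comp_tgt G p p')" for w c
    using that by (auto simp: comp_tgt_def)
  have tA: "fst (act (comp_tgt G p p') g w) = act (ptgt p') g (fst w)" for g w by (cases w) (simp add: comp_tgt_def)
  have S: "is_gset G (comp_src G p p')"
    unfolding is_gset_def
  proof (intro conjI ballI)
    have "finite (elts (comp_tgt G p p') \<times> Src p' \<times> Src p)"
      using is_gsetD(1)[OF T] wf by (auto simp: wf_bisp_def is_gset_def)
    then show "finite (elts (comp_src G p p'))"
      by (rule rev_finite_subset) (auto simp: comp_src_def fibre_def)
    fix g x assume g: "g \<in> carrier G" and x: "x \<in> elts (comp_src G p p')"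
    obtain w c a where [simp]: "x = (w, c, a)" by (cases x)
    have x': "w \<in> elts (comp_tgt G p p')" "c \<in> fibre p' (fst w)" "a \<in> Src p" "pnorm p a = snd w c"
      using x by (auto simp: comp_src_def)
    have "pnorm p (act (psrc p) g a) = snd (act (comp_tgt G p p') g w) (act (psrc p') g c)"
      using eqv_act[OF wf_bispD(4)[OF wf(1)] g x'(3)] comp_tgt_act_apply[OF wf g x'(2)] x'(4) by simp
    then show "act (comp_src G p p') g x \<in> elts (comp_src G p p')"
      using x' g D(1) fibre_act[OF wf(2) g x'(2)] is_gsetD(2)[OF T g x'(1)] by (simp add: comp_src_def tA)
  qed (use is_gsetD[OF T] D fD in \<open>auto simp: comp_src_def\<close>)
  have wf3: "wf_bisp G X Z (comp_bisp G p p')"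
    unfolding wf_bisp_def comp_bisp_def bisp.simps
    using S T wf by (auto simp: eqv_def wf_bisp_def comp_src_def comp_tgt_def)
  show ?thesis
  proof (unfold_locales, rule wf(1), rule wf(2), rule wf3, unfold comp_bisp_def bisp.simps)
    fix d s assume d: "d \<in> Tgt p'" and s: "\<And>c. \<lbrakk>c \<in> Src p'; pnorm p' c = d\<rbrakk> \<Longrightarrow> s c \<in> Tgt p \<and> ptran p (s c) = pres p' c"
    show "\<exists>!w. w \<in> elts (comp_tgt G p p') \<and> fst w = d \<and> (\<forall>c\<in>Src p'. pnorm p' c = d \<longrightarrow> snd w c = s c)"
      by (rule ex1I[of _ "(d, restrict s (fibre p' d))"])
        (use d s in \<open>auto simp: comp_tgt_def fibre_def fun_eq_iff PiE_iff extensional_def\<close>)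
  next
    show "eqv G (comp_tgt G p p') (ptgt p') fst" using tD(1) tA by (simp add: eqv_def)
    show "eqv G (comp_src G p p') (psrc p') (\<lambda>(w, c, a). c)" "eqv G (comp_src G p p') (psrc p) (\<lambda>(w, c, a). a)"
      by (auto simp: eqv_def comp_src_def fibre_def)
  next
    fix x assume "x \<in> elts (comp_src G p p')"
    then show "pnorm p' (case x of (w, c, a) \<Rightarrow> c) = fst (fst x)"
      "pnorm p (case x of (w, c, a) \<Rightarrow> a) = snd (fst x) (case x of (w, c, a) \<Rightarrow> c)"
      "pres p (case x of (w, c, a) \<Rightarrow> a) = (case x of (w, c, a) \<Rightarrow> pres p a)"
      by (auto simp: comp_src_def fibre_def)
  next
    fix w c a0 assume "w \<in> elts (comp_tgt G p p')" "c \<in> Src p'" "a0 \<in> Src p" "pnorm p' c = fst w" "pnorm p a0 = snd w c"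
    then show "\<exists>!x. x \<in> elts (comp_src G p p') \<and> fst x = w \<and> (case x of (w, c, a) \<Rightarrow> c) = c \<and> (case x of (w, c, a) \<Rightarrow> a) = a0"
      by (intro ex1I[of _ "(w, c, a0)"]) (auto simp: comp_src_def fibre_def)
  next
    fix w assume "w \<in> elts (comp_tgt G p p')"
    then show "ptran p' (fst w) = (case w of (d, s) \<Rightarrow> ptran p' d)" by (cases w) simp
  next
    fix w c assume w: "w \<in> elts (comp_tgt G p p')" and "c \<in> Src p'" "pnorm p' c = fst w"
    then have c: "c \<in> fibre p' (fst w)" by (simp add: fibre_def)
    show "snd w c \<in> Tgt p" "ptran p (snd w c) = pres p' c" using tD(2,3)[OF w c] by auto
    fix g assume "g \<in> carrier G"
    then show "snd (act (comp_tgt G p p') g w) (act (psrc p') g c) = act (ptgt p) g (snd w c)"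
      using comp_tgt_act_apply[OF wf _ c] by simp
  qed
qed

text \<open>A point of the dependent product is a section of \<open>P \<rightarrow> C\<close> over a fibre; since \<open>P\<close> is the pullback of \<open>B\<close> and \<open>C\<close>
  over \<open>Y\<close>, its first component is the evaluation, and conversely an evaluation determines the section.\<close>

lemma comp_wit_of_bispan_composite:
  fixes b c d :: "('g, 'u::infinite) bispan"
  assumes b: "b \<in> bispans G X Y" and c: "c \<in> bispans G Y Z" and d: "d \<in> bispans G X Z"
    and comp: "is_bispan_composite G X Y Z b c d"
  shows "\<exists>q ev l a. comp_wit G X Y Z (of_bispan b) (of_bispan c) (of_bispan d) q ev l a"
proof -
  obtain P pB pC Q e m q a l where
    P: "is_pullback (gset_cat G) (btgt b) (bsrc c) Y (btran b) (bres c) P pB pC"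
    and E: "exponential_diagram G P (bsrc c) (btgt c) pC (bnorm c) Q (btgt d) e m q"
    and A: "is_pullback (gset_cat G) (bsrc b) Q (btgt b) (bnorm b) (compose (elts Q) pB e) (bsrc d) a l"
    and r: "bres d = compose (elts (bsrc d)) (bres b) a" and n: "bnorm d = compose (elts (bsrc d)) m l"
    and t: "btran d = compose (elts (btgt d)) (btran c) q"
    using comp unfolding is_bispan_composite_def by metis
  note P' = P[unfolded is_pullback_gset_cat] and A' = A[unfolded is_pullback_gset_cat]
  let ?D = "dependent_product G P (bsrc c) (btgt c) pC (bnorm c)"
  obtain \<phi> where em: "e \<in> EMap G Q P" and Q: "is_pullback (gset_cat G) (bsrc c) (btgt d) (btgt c) (bnorm c) q Q (compose (elts Q) pC e) m"
    and \<phi>: "\<phi> \<in> EMap G (btgt d) ?D" "bij_betw \<phi> (elts (btgt d)) (elts ?D)" "\<And>w. w \<in> elts (btgt d) \<Longrightarrow> fst (\<phi> w) = q w"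
      "\<And>z. z \<in> elts Q \<Longrightarrow> e z = snd (\<phi> (m z)) (pC (e z))"
    using E unfolding exponential_diagram_def by blast
  note Q' = Q[unfolded is_pullback_gset_cat]
  have eqvs: "eqv G P (btgt b) pB" "eqv G P (bsrc c) pC" "eqv G Q P e" "eqv G Q (btgt d) m" "eqv G (btgt d) (btgt c) q"
     "eqv G (bsrc d) (bsrc b) a" "eqv G (bsrc d) Q l"
    using P' A' Q' em by (auto intro: EMap_eqv)
  have gs: "is_gset G (bsrc b)" "is_gset G (btgt b)" "is_gset G (bsrc c)" "is_gset G (btgt c)" "is_gset G (bsrc d)" "is_gset G (btgt d)" "is_gset G P" "is_gset G Q"
    using b c d P' Q' by (auto simp: bispans_def intro: Fin_gset)
  have wf: "wf_bisp G X Y (of_bispan b)" "wf_bisp G Y Z (of_bispan c)" "wf_bisp G X Z (of_bispan d)"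
    using b c d by (auto intro: wf_of_bispan)
  note bD = wf_bispD[OF wf(1), simplified] and cD = wf_bispD[OF wf(2), simplified] and dD = wf_bispD[OF wf(3), simplified]
  have D_elts: "(y, s) \<in> elts ?D \<longleftrightarrow> y \<in> elts (btgt c) \<and> s \<in> {x \<in> elts (bsrc c). bnorm c x = y} \<rightarrow>\<^sub>E elts P \<and>
      (\<forall>x. x \<in> elts (bsrc c) \<and> bnorm c x = y \<longrightarrow> pC (s x) = x)" for y s
    by (auto simp: dependent_product_def Let_def)
  have D_act: "act ?D g (y, s) = (act (btgt c) g y, \<lambda>x\<in>{x \<in> elts (bsrc c). bnorm c x = act (btgt c) g y}. act P g (s (act (bsrc c) (inv g) x)))"
    if "(y, s) \<in> elts ?D" "g \<in> carrier G" for g y s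
    using that unfolding D_elts by (simp add: dependent_product_def Let_def)
  define s where "s w = snd (\<phi> w)" for w
  have \<phi>s: "\<phi> w = (q w, s w)" if "w \<in> elts (btgt d)" for w
    using \<phi>(3)[OF that] by (simp add: s_def prod_eq_iff)
  have in_D: "(q w, s w) \<in> elts ?D" if "w \<in> elts (btgt d)" for w
    using bij_betw_apply[OF \<phi>(2) that] \<phi>s[OF that] by simp
  have s: "s w x \<in> elts P \<and> pC (s w x) = x" if "w \<in> elts (btgt d)" "x \<in> elts (bsrc c)" "bnorm c x = q w" for w x
    using in_D[OF that(1)] that(2,3) unfolding D_elts by blast
  have s_ext: "s w \<in> extensional {x \<in> elts (bsrc c). bnorm c x = q w}" if "w \<in> elts (btgt d)" for w
    using in_D[OF that] unfolding D_elts by (simp add: PiE_iff)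
  have P_eqI: "x = y" if "x \<in> elts P" "y \<in> elts P" "pB x = pB y" "pC x = pC y" for x y
    using P' that eqv_in[OF eqvs(1)] eqv_in[OF eqvs(2)] by metis
  have P_ex: "\<exists>x\<in>elts P. pB x = u \<and> pC x = v" if "u \<in> elts (btgt b)" "v \<in> elts (bsrc c)" "btran b u = bres c v" for u v
    using P' that by blast
  have P_comm: "btran b (pB x) = bres c (pC x)" if "x \<in> elts P" for x using P' that by blast
  have lz: "l x \<in> elts Q" "m (l x) = bnorm d x" "e (l x) \<in> elts P" "pC (e (l x)) \<in> elts (bsrc c)" if "x \<in> elts (bsrc d)" for x
    using eqv_in[OF eqvs(7) that] eqvs(2,3) that n by (auto simp: compose_apply eqv_in)
  have Qc: "bnorm c (pC (e z)) = q (m z)" if "z \<in> elts Q" for z using Q' that by (simp add: compose_apply)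
  have "comp_wit G X Y Z (of_bispan b) (of_bispan c) (of_bispan d) q (\<lambda>w x. pB (s w x)) (\<lambda>x. pC (e (l x))) a"
  proof (unfold_locales, rule wf(1), rule wf(2), rule wf(3), unfold of_bispan_simps)
    show "eqv G (btgt d) (btgt c) q" by (rule eqvs)
    show "eqv G (bsrc d) (bsrc c) (\<lambda>x. pC (e (l x)))" using eqv_comp[OF eqv_comp[OF eqvs(7,3)] eqvs(2)] by (simp add: comp_def)
    show "eqv G (bsrc d) (bsrc b) a" by (rule eqvs)
  next
    fix w assume "w \<in> elts (btgt d)" then show "btran c (q w) = btran d w" using t by (simp add: compose_apply)
  next
    fix w x assume w: "w \<in> elts (btgt d)" and x: "x \<in> elts (bsrc c)" and nx: "bnorm c x = q w"
    note sx = s[OF w x nx]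
    show "pB (s w x) \<in> elts (btgt b)" using sx eqv_in[OF eqvs(1)] by blast
    show "btran b (pB (s w x)) = bres c x" using sx P_comm by simp
    fix g assume g: "g \<in> carrier G"
    have gw: "act (btgt d) g w \<in> elts (btgt d)" using is_gsetD(2)[OF gs(6) g w] .
    have gx: "act (bsrc c) g x \<in> elts (bsrc c)" using is_gsetD(2)[OF gs(3) g x] .
    have "(q (act (btgt d) g w), s (act (btgt d) g w)) = act ?D g (q w, s w)"
      using \<phi>s[OF gw] \<phi>s[OF w] \<phi>(1) g w by (simp add: equivariant_maps_def)
    then have "s (act (btgt d) g w) (act (bsrc c) g x) = act P g (s w x)"
      using D_act[OF in_D[OF w] g] gx nx eqv_act[OF cD(4) g x] is_gset_inv(1)[OF gs(3) g x] by simp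
    then show "pB (s (act (btgt d) g w) (act (bsrc c) g x)) = act (btgt b) g (pB (s w x))"
      using eqv_act[OF eqvs(1) g] sx by simp
  next
    fix d0 \<sigma> assume d0: "d0 \<in> elts (btgt c)" and \<sigma>: "\<And>x. \<lbrakk>x \<in> elts (bsrc c); bnorm c x = d0\<rbrakk> \<Longrightarrow> \<sigma> x \<in> elts (btgt b) \<and> btran b (\<sigma> x) = bres c x"
    have "\<exists>u. x \<in> elts (bsrc c) \<and> bnorm c x = d0 \<longrightarrow> u \<in> elts P \<and> pB u = \<sigma> x \<and> pC u = x" for x
      using P_ex[of "\<sigma> x" x] \<sigma>[of x] by blast
    then obtain \<tau> where \<tau>: "\<And>x. \<lbrakk>x \<in> elts (bsrc c); bnorm c x = d0\<rbrakk> \<Longrightarrow> \<tau> x \<in> elts P \<and> pB (\<tau> x) = \<sigma> x \<and> pC (\<tau> x) = x"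
      by metis
    let ?\<tau> = "restrict \<tau> {x \<in> elts (bsrc c). bnorm c x = d0}"
    have "(d0, ?\<tau>) \<in> elts ?D" unfolding D_elts using d0 \<tau> by auto
    then have "(d0, ?\<tau>) \<in> \<phi> ` elts (btgt d)" using \<phi>(2) by (simp only: bij_betw_def)
    then obtain w where w': "(d0, ?\<tau>) = \<phi> w" and w0: "w \<in> elts (btgt d)" by (rule imageE)
    note w = w0 w'[symmetric]
    have qs: "q w = d0" "s w = ?\<tau>" using w \<phi>s[OF w(1)] by auto
    show "\<exists>!w. w \<in> elts (btgt d) \<and> q w = d0 \<and> (\<forall>x\<in>elts (bsrc c). bnorm c x = d0 \<longrightarrow> pB (s w x) = \<sigma> x)"
    proof (rule ex1I[of _ w])
      show "w \<in> elts (btgt d) \<and> q w = d0 \<and> (\<forall>x\<in>elts (bsrc c). bnorm c x = d0 \<longrightarrow> pB (s w x) = \<sigma> x)"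
        using w(1) qs \<tau> by simp
      fix v assume v: "v \<in> elts (btgt d) \<and> q v = d0 \<and> (\<forall>x\<in>elts (bsrc c). bnorm c x = d0 \<longrightarrow> pB (s v x) = \<sigma> x)"
      have "s v = s w"
      proof (rule extensionalityI)
        show "s v \<in> extensional {x \<in> elts (bsrc c). bnorm c x = d0}" "s w \<in> extensional {x \<in> elts (bsrc c). bnorm c x = d0}"
          using s_ext[of v] s_ext[of w] v w qs by auto
        fix x assume x: "x \<in> {x \<in> elts (bsrc c). bnorm c x = d0}"
        show "s v x = s w x"
          by (rule P_eqI) (use s[of v x] s[of w x] v w(1) qs(1) x \<tau>[of x] qs(2) in auto)
      qed
      then have "\<phi> v = \<phi> w" using \<phi>s[of v] \<phi>s[OF w(1)] v qs by simp
      then show "v = w" using \<phi>(2) v w(1) unfolding bij_betw_def inj_on_def by blast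
    qed
  next
    fix x assume x: "x \<in> elts (bsrc d)"
    note lx = lz[OF x]
    show "bnorm c (pC (e (l x))) = q (bnorm d x)" using Qc[OF lx(1)] lx(2) by simp
    have "bnorm b (a x) = pB (e (l x))" using A' x lx(1) by (simp add: compose_apply)
    then show "bnorm b (a x) = pB (s (bnorm d x) (pC (e (l x))))" using \<phi>(4)[OF lx(1)] lx(2) by (simp add: s_def)
    show "bres b (a x) = bres d x" using r x by (simp add: compose_apply)
  next
    fix w x a0 assume w: "w \<in> elts (btgt d)" and x: "x \<in> elts (bsrc c)" and a0: "a0 \<in> elts (bsrc b)"
      and nx: "bnorm c x = q w" and na: "bnorm b a0 = pB (s w x)"
    have "\<exists>!z. z \<in> elts Q \<and> compose (elts Q) pC e z = x \<and> m z = w" using Q' x w nx by blast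
    then obtain z where z': "z \<in> elts Q \<and> compose (elts Q) pC e z = x \<and> m z = w"
      and zu': "\<And>v. v \<in> elts Q \<and> compose (elts Q) pC e v = x \<and> m v = w \<Longrightarrow> v = z" by blast
    have z: "z \<in> elts Q" "pC (e z) = x" "m z = w" using z' by (auto simp: compose_apply)
    have zu: "v = z" if "v \<in> elts Q" "pC (e v) = x" "m v = w" for v
      using zu'[of v] that by (simp add: compose_apply)
    have "pB (e z) = bnorm b a0" using \<phi>(4)[OF z(1)] z na by (simp add: s_def)
    then have "bnorm b a0 = compose (elts Q) pB e z" by (simp add: compose_apply[OF z(1)])
    then have "\<exists>!y. y \<in> elts (bsrc d) \<and> a y = a0 \<and> l y = z" using A' a0 z(1) by blast
    then obtain y where y: "y \<in> elts (bsrc d)" "a y = a0" "l y = z" and yu: "\<And>v. \<lbrakk>v \<in> elts (bsrc d); a v = a0; l v = z\<rbrakk> \<Longrightarrow> v = y" by blast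
    show "\<exists>!y. y \<in> elts (bsrc d) \<and> bnorm d y = w \<and> pC (e (l y)) = x \<and> a y = a0"
    proof (rule ex1I[of _ y])
      show "y \<in> elts (bsrc d) \<and> bnorm d y = w \<and> pC (e (l y)) = x \<and> a y = a0"
        using y z lz[OF y(1)] by auto
      fix v assume v: "v \<in> elts (bsrc d) \<and> bnorm d v = w \<and> pC (e (l v)) = x \<and> a v = a0"
      then have "l v = z" using lz[of v] by (intro zu) auto
      then show "v = y" using v yu by blast
    qed
  qed
  then show ?thesis by blast
qed

end

context plain_group
begin

text \<open>The intermediate objects \<open>P\<close> and \<open>Q\<close> are copies of \<open>B \<times>\<^sub>Y C\<close> and of \<open>C \<times>\<^sub>D E\<close> in the carrier type, where \<open>E\<close> is the middle
  set of the composite. The point \<open>w\<close> then corresponds to the section \<open>c \<mapsto> (ev w c, c)\<close> of \<open>P \<rightarrow> C\<close>.\<close>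

lemma bispan_composite_of_comp_wit:
  fixes b c d :: "('g, 'u::infinite) bispan"
  assumes b: "b \<in> bispans G X Y" and c: "c \<in> bispans G Y Z" and d: "d \<in> bispans G X Z"
    and X: "X \<in> Fin G" and Y: "Y \<in> Fin G" and Z: "Z \<in> Fin G"
    and W: "comp_wit G X Y Z (of_bispan b) (of_bispan c) (of_bispan d) q ev l a"
  shows "is_bispan_composite G X Y Z b c d"
proof -
  interpret W: comp_wit G X Y Z "of_bispan b" "of_bispan c" "of_bispan d" q ev l a by (rule W)
  note bD = wf_bispD[OF W.wf1, simplified] and cD = wf_bispD[OF W.wf2, simplified] and dD = wf_bispD[OF W.wf3, simplified]
  note q_eqv = W.q_eqv[simplified] and l_eqv = W.l_eqv[simplified] and a_eqv = W.a_eqv[simplified]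
    and ev_in = W.ev_in[simplified] and ev_tran = W.ev_tran[simplified] and ev_act = W.ev_act[simplified]
  have bs: "bsrc b \<in> Fin G" "btgt b \<in> Fin G" "bres b \<in> EMap G (bsrc b) X"
      "bnorm b \<in> EMap G (bsrc b) (btgt b)" "btran b \<in> EMap G (btgt b) Y"
    and cs: "bsrc c \<in> Fin G" "btgt c \<in> Fin G" "bres c \<in> EMap G (bsrc c) Y"
      "bnorm c \<in> EMap G (bsrc c) (btgt c)" "btran c \<in> EMap G (btgt c) Z"
    and ds: "bsrc d \<in> Fin G" "btgt d \<in> Fin G" "bres d \<in> EMap G (bsrc d) X"
      "bnorm d \<in> EMap G (bsrc d) (btgt d)" "btran d \<in> EMap G (btgt d) Z"
    using b c d by (auto simp: bispans_def)
  let ?F = "fibre_product (btgt b) (bsrc c) (btran b) (bres c)"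
  have F: "is_gset G ?F" by (rule is_gset_fibre_product[OF bD(2) cD(1) bD(5) cD(3)])
  obtain P :: "('g, 'u) gset" and \<pi> where P: "P \<in> Fin G" and \<pi>: "bij_betw \<pi> (elts ?F) (elts P)" "eqv G ?F P \<pi>"
    using transport_finite_gset[OF F] by blast
  define \<iota> where "\<iota> = inv_into (elts ?F) \<pi>"
  have \<iota>: "eqv G P ?F \<iota>" unfolding \<iota>_def by (rule eqv_inv_into[OF F \<pi>])
  have \<iota>\<pi>: "\<iota> (\<pi> z) = z" if "z \<in> elts ?F" for z unfolding \<iota>_def by (rule bij_betw_inv_into_left[OF \<pi>(1) that])
  have \<pi>\<iota>: "\<pi> (\<iota> z) = z" if "z \<in> elts P" for z unfolding \<iota>_def by (rule bij_betw_inv_into_right[OF \<pi>(1) that])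
  have Pg: "is_gset G P" using P by (rule Fin_gset)
  define pB pC where "pB = restrict (fst \<circ> \<iota>) (elts P)" and "pC = restrict (snd \<circ> \<iota>) (elts P)"
  have pBC: "pB \<in> EMap G P (btgt b)" "pC \<in> EMap G P (bsrc c)"
    unfolding pB_def pC_def by (rule restrict_equivariant_maps[OF Pg] eqv_comp[OF \<iota>] eqv_fst eqv_snd)+
  have p\<pi>: "pB (\<pi> (x, y)) = x" "pC (\<pi> (x, y)) = y" "\<pi> (x, y) \<in> elts P" if "x \<in> elts (btgt b)" "y \<in> elts (bsrc c)" "btran b x = bres c y" for x y
  proof -
    have "(x, y) \<in> elts ?F" using that by simp
    then show "pB (\<pi> (x, y)) = x" "pC (\<pi> (x, y)) = y" "\<pi> (x, y) \<in> elts P"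
      using \<iota>\<pi> eqv_in[OF \<pi>(2)] by (auto simp: pB_def pC_def)
  qed
  have \<pi>p: "\<pi> (pB z, pC z) = z" "btran b (pB z) = bres c (pC z)" "pB z \<in> elts (btgt b)" "pC z \<in> elts (bsrc c)" if "z \<in> elts P" for z
    using \<pi>\<iota>[OF that] eqv_in[OF \<iota> that] that by (auto simp: pB_def pC_def fibre_product_elts)
  have 1: "is_pullback (gset_cat G) (btgt b) (bsrc c) Y (btran b) (bres c) P pB pC"
    unfolding is_pullback_gset_cat
  proof (intro conjI ballI impI)
    fix x y assume xy: "x \<in> elts (btgt b)" "y \<in> elts (bsrc c)" "btran b x = bres c y"
    show "\<exists>!z. z \<in> elts P \<and> pB z = x \<and> pC z = y"
      by (rule ex1I[of _ "\<pi> (x, y)"]) (use p\<pi>[OF xy] \<pi>p(1) in auto)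
  qed (use bs cs Y P pBC \<pi>p in auto)
  let ?F2 = "fibre_product (bsrc c) (btgt d) (bnorm c) q"
  have F2: "is_gset G ?F2" by (rule is_gset_fibre_product[OF cD(1) dD(2) cD(4) q_eqv])
  obtain Q :: "('g, 'u) gset" and \<kappa> where Q: "Q \<in> Fin G" and \<kappa>: "bij_betw \<kappa> (elts ?F2) (elts Q)" "eqv G ?F2 Q \<kappa>"
    using transport_finite_gset[OF F2] by blast
  define \<iota>' where "\<iota>' = inv_into (elts ?F2) \<kappa>"
  have \<iota>': "eqv G Q ?F2 \<iota>'" unfolding \<iota>'_def by (rule eqv_inv_into[OF F2 \<kappa>])
  have \<iota>'\<kappa>: "\<iota>' (\<kappa> z) = z" if "z \<in> elts ?F2" for z unfolding \<iota>'_def by (rule bij_betw_inv_into_left[OF \<kappa>(1) that])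
  have \<kappa>\<iota>': "\<kappa> (\<iota>' z) = z" if "z \<in> elts Q" for z unfolding \<iota>'_def by (rule bij_betw_inv_into_right[OF \<kappa>(1) that])
  have Qg: "is_gset G Q" using Q by (rule Fin_gset)
  define sec where "sec w x = \<pi> (ev w x, x)" for w x
  have sec: "pB (sec w x) = ev w x" "pC (sec w x) = x" "sec w x \<in> elts P"
    if "w \<in> elts (btgt d)" "x \<in> elts (bsrc c)" "bnorm c x = q w" for w x
    unfolding sec_def using p\<pi>[of "ev w x" x] ev_in[of w x] ev_tran[of w x] that by auto
  have P_eqI: "x = y" if "x \<in> elts P" "y \<in> elts P" "pB x = pB y" "pC x = pC y" for x y
    using \<pi>p(1)[OF that(1)] \<pi>p(1)[OF that(2)] unfolding that(3,4) by (rule subst)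
  have sec_act: "sec (act (btgt d) g w) (act (bsrc c) g x) = act P g (sec w x)"
    if g: "g \<in> carrier G" and w: "w \<in> elts (btgt d)" and x: "x \<in> elts (bsrc c)" "bnorm c x = q w" for g w x
  proof (rule P_eqI)
    have gw: "act (btgt d) g w \<in> elts (btgt d)" and gx: "act (bsrc c) g x \<in> elts (bsrc c)"
      and n: "bnorm c (act (bsrc c) g x) = q (act (btgt d) g w)"
      using is_gsetD(2)[OF dD(2) g w] is_gsetD(2)[OF cD(1) g x(1)] eqv_act[OF cD(4) g x(1)] eqv_act[OF q_eqv g w] x(2) by simp_all
    show "sec (act (btgt d) g w) (act (bsrc c) g x) \<in> elts P" using sec(3)[OF gw gx n] .
    show "act P g (sec w x) \<in> elts P" using is_gsetD(2)[OF Pg g] sec(3)[OF w x] by simp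
    show "pB (sec (act (btgt d) g w) (act (bsrc c) g x)) = pB (act P g (sec w x))"
      using sec(1)[OF gw gx n] eqv_act[OF EMap_eqv[OF pBC(1)] g sec(3)[OF w x]] sec(1)[OF w x] ev_act[OF g w x] by simp
    show "pC (sec (act (btgt d) g w) (act (bsrc c) g x)) = pC (act P g (sec w x))"
      using sec(2)[OF gw gx n] eqv_act[OF EMap_eqv[OF pBC(2)] g sec(3)[OF w x]] sec(2)[OF w x] by simp
  qed
  define e m where "e = restrict ((\<lambda>(x, w). sec w x) \<circ> \<iota>') (elts Q)" and "m = restrict (snd \<circ> \<iota>') (elts Q)"
  have sec_eqv: "eqv G ?F2 P (\<lambda>(x, w). sec w x)"
    unfolding eqv_def by (auto simp: fibre_product_elts fibre_product_act sec sec_act)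
  have e: "e \<in> EMap G Q P" unfolding e_def by (rule restrict_equivariant_maps[OF Qg eqv_comp[OF \<iota>' sec_eqv]])
  have m: "m \<in> EMap G Q (btgt d)" unfolding m_def by (rule restrict_equivariant_maps[OF Qg eqv_comp[OF \<iota>' eqv_snd]])
  have z: "\<kappa> (pC (e z), m z) = z" "e z = sec (m z) (pC (e z))" "e z \<in> elts P" "m z \<in> elts (btgt d)" "pC (e z) \<in> elts (bsrc c)" "bnorm c (pC (e z)) = q (m z)"
    if zQ: "z \<in> elts Q" for z
  proof -
    obtain x w where xw: "\<iota>' z = (x, w)" by (cases "\<iota>' z")
    then have i: "x \<in> elts (bsrc c)" "w \<in> elts (btgt d)" "bnorm c x = q w" using eqv_in[OF \<iota>' zQ] by auto
    have em: "e z = sec w x" "m z = w" using xw zQ by (auto simp: e_def m_def)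
    show "\<kappa> (pC (e z), m z) = z" "e z = sec (m z) (pC (e z))" "e z \<in> elts P" "m z \<in> elts (btgt d)" "pC (e z) \<in> elts (bsrc c)" "bnorm c (pC (e z)) = q (m z)"
      using em i sec[OF i(2,1,3)] \<kappa>\<iota>'[OF zQ] xw by auto
  qed
  have k: "\<kappa> (x, w) \<in> elts Q" "pC (e (\<kappa> (x, w))) = x" "m (\<kappa> (x, w)) = w" if "x \<in> elts (bsrc c)" "w \<in> elts (btgt d)" "bnorm c x = q w" for x w
  proof -
    have F: "(x, w) \<in> elts ?F2" using that by simp
    show kQ: "\<kappa> (x, w) \<in> elts Q" by (rule eqv_in[OF \<kappa>(2) F])
    show "pC (e (\<kappa> (x, w))) = x" "m (\<kappa> (x, w)) = w" using \<iota>'\<kappa>[OF F] kQ sec[OF that(2,1,3)] by (simp_all add: e_def m_def)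
  qed
  define q' where "q' = restrict q (elts (btgt d))"
  have q': "q' \<in> EMap G (btgt d) (btgt c)" unfolding q'_def by (rule restrict_equivariant_maps[OF dD(2) q_eqv])
  have 2: "is_pullback (gset_cat G) (bsrc c) (btgt d) (btgt c) (bnorm c) q' Q (compose (elts Q) pC e) m"
    unfolding is_pullback_gset_cat
  proof (intro conjI ballI impI)
    show "compose (elts Q) pC e \<in> EMap G Q (bsrc c)"
      by (rule compose_equivariant_maps[OF Qg EMap_eqv[OF e] EMap_eqv[OF pBC(2)]])
    fix x w assume xw: "x \<in> elts (bsrc c)" "w \<in> elts (btgt d)" "bnorm c x = q' w"
    then have n: "bnorm c x = q w" by (simp add: q'_def)
    show "\<exists>!z. z \<in> elts Q \<and> compose (elts Q) pC e z = x \<and> m z = w"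
    proof (rule ex1I[of _ "\<kappa> (x, w)"])
      show "\<kappa> (x, w) \<in> elts Q \<and> compose (elts Q) pC e (\<kappa> (x, w)) = x \<and> m (\<kappa> (x, w)) = w"
        using k[OF xw(1,2) n] by (simp add: compose_apply)
      fix v assume "v \<in> elts Q \<and> compose (elts Q) pC e v = x \<and> m v = w"
      then show "v = \<kappa> (x, w)" using z(1)[of v] by (auto simp: compose_apply)
    qed
  qed (use cs ds Q q' m z in \<open>auto simp: compose_apply q'_def\<close>)
  let ?D = "dependent_product G P (bsrc c) (btgt c) pC (bnorm c)"
  let ?fib = "\<lambda>y. {x \<in> elts (bsrc c). bnorm c x = y}"
  have D_elts: "(y, s) \<in> elts ?D \<longleftrightarrow> y \<in> elts (btgt c) \<and> s \<in> ?fib y \<rightarrow>\<^sub>E elts P \<and> (\<forall>x. x \<in> elts (bsrc c) \<and> bnorm c x = y \<longrightarrow> pC (s x) = x)" for y s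
    by (auto simp: dependent_product_def Let_def)
  have D_act: "act ?D g (y, s) = (act (btgt c) g y, \<lambda>x\<in>?fib (act (btgt c) g y). act P g (s (act (bsrc c) (inv g) x)))"
    if "(y, s) \<in> elts ?D" "g \<in> carrier G" for g y s
    using that unfolding D_elts by (simp add: dependent_product_def Let_def)
  define \<phi> where "\<phi> = (\<lambda>w\<in>elts (btgt d). (q w, restrict (sec w) (?fib (q w))))"
  have \<phi>D: "(q w, restrict (sec w) (?fib (q w))) \<in> elts ?D" if "w \<in> elts (btgt d)" for w
    unfolding D_elts using that sec eqv_in[OF q_eqv that] by auto
  have \<phi>: "\<phi> \<in> EMap G (btgt d) ?D"
    unfolding equivariant_maps_def
  proof (intro CollectI conjI ballI)
    show "\<phi> \<in> elts (btgt d) \<rightarrow>\<^sub>E elts ?D" using \<phi>D by (auto simp: \<phi>_def)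
    fix g w assume g: "g \<in> carrier G" and w: "w \<in> elts (btgt d)"
    have gw: "act (btgt d) g w \<in> elts (btgt d)" using is_gsetD(2)[OF dD(2) g w] .
    have qg: "q (act (btgt d) g w) = act (btgt c) g (q w)" by (rule eqv_act[OF q_eqv g w])
    have "sec (act (btgt d) g w) x = act P g (sec w (act (bsrc c) (inv g) x))" "act (bsrc c) (inv g) x \<in> ?fib (q w)"
      if x: "x \<in> ?fib (act (btgt c) g (q w))" for x
    proof -
      have 1: "act (bsrc c) (inv g) x \<in> elts (bsrc c)" using x g is_gsetD(2)[OF cD(1)] by simp
      have 2: "bnorm c (act (bsrc c) (inv g) x) = q w"
        using W.fibre_act_inv[OF g, of w x] w x qg by simp
      show "act (bsrc c) (inv g) x \<in> ?fib (q w)" using 1 2 by simp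
      show "sec (act (btgt d) g w) x = act P g (sec w (act (bsrc c) (inv g) x))"
        using sec_act[OF g w 1 2] is_gset_inv(2)[OF cD(1) g] x by simp
    qed
    then show "\<phi> (act (btgt d) g w) = act ?D g (\<phi> w)"
      using w gw D_act[OF \<phi>D[OF w] g] by (auto simp: \<phi>_def qg fun_eq_iff)
  qed
  have "inj_on \<phi> (elts (btgt d))"
  proof (rule inj_onI)
    fix w v assume w: "w \<in> elts (btgt d)" and v: "v \<in> elts (btgt d)" and eq: "\<phi> w = \<phi> v"
    have qq: "q w = q v" and ss: "restrict (sec w) (?fib (q w)) = restrict (sec v) (?fib (q v))" using eq w v by (auto simp: \<phi>_def)
    show "w = v"
    proof (rule W.tgt_eqI[simplified, OF v w qq])
      fix x assume x: "x \<in> elts (bsrc c)" "bnorm c x = q v"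
      have "sec w x = sec v x" using fun_cong[OF ss, of x] x qq by simp
      then show "ev w x = ev v x" using sec(1)[OF w x(1)] sec(1)[OF v x] x qq by simp
    qed
  qed
  moreover have "\<phi> ` elts (btgt d) = elts ?D"
  proof
    show "\<phi> ` elts (btgt d) \<subseteq> elts ?D" using \<phi>D by (auto simp: \<phi>_def)
    show "elts ?D \<subseteq> \<phi> ` elts (btgt d)"
    proof
      fix ys assume "ys \<in> elts ?D"
      then obtain y s where ys: "ys = (y, s)" and D: "(y, s) \<in> elts ?D" by (metis surj_pair)
      have y: "y \<in> elts (btgt c)" and s: "\<And>x. \<lbrakk>x \<in> elts (bsrc c); bnorm c x = y\<rbrakk> \<Longrightarrow> s x \<in> elts P \<and> pC (s x) = x"
        and sx: "s \<in> extensional (?fib y)" using D unfolding D_elts by (auto simp: PiE_def)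
      have "\<exists>!w. w \<in> elts (btgt d) \<and> q w = y \<and> (\<forall>x\<in>elts (bsrc c). bnorm c x = y \<longrightarrow> ev w x = pB (s x))"
        by (rule W.section_ex1[simplified, OF y]) (use s \<pi>p in fastforce)
      then obtain w where w: "w \<in> elts (btgt d)" "q w = y" "\<And>x. \<lbrakk>x \<in> elts (bsrc c); bnorm c x = y\<rbrakk> \<Longrightarrow> ev w x = pB (s x)" by blast
      have "sec w x = s x" if "x \<in> ?fib y" for x
        using that w(3)[of x] s[of x] \<pi>p(1)[of "s x"] by (simp add: sec_def)
      then have "restrict (sec w) (?fib y) = s" using sx by (auto simp: fun_eq_iff extensional_def)
      then have "\<phi> w = ys" using w ys by (simp add: \<phi>_def)
      then show "ys \<in> \<phi> ` elts (btgt d)" using w(1) by blast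
    qed
  qed
  ultimately have \<phi>b: "bij_betw \<phi> (elts (btgt d)) (elts ?D)" by (simp add: bij_betw_def)
  have "\<forall>z\<in>elts Q. e z = snd (\<phi> (m z)) (pC (e z))" using z by (simp add: \<phi>_def)
  moreover have "\<forall>w\<in>elts (btgt d). fst (\<phi> w) = q' w" by (simp add: \<phi>_def q'_def)
  ultimately have 3: "exponential_diagram G P (bsrc c) (btgt c) pC (bnorm c) Q (btgt d) e m q'"
    unfolding exponential_diagram_def using P pBC(2) e 2 \<phi> \<phi>b by blast
  define a' where "a' = restrict a (elts (bsrc d))"
  define l' where "l' = restrict (\<lambda>x. \<kappa> (l x, bnorm d x)) (elts (bsrc d))"
  have a': "a' \<in> EMap G (bsrc d) (bsrc b)" unfolding a'_def by (rule restrict_equivariant_maps[OF dD(1) a_eqv])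
  have ln: "bnorm c (l x) = q (bnorm d x)" "bnorm b (a x) = ev (bnorm d x) (l x)" "l x \<in> elts (bsrc c)" "bnorm d x \<in> elts (btgt d)"
    if "x \<in> elts (bsrc d)" for x
    using W.l_norm[simplified, OF that] W.a_norm[simplified, OF that] eqv_in[OF l_eqv that] eqv_in[OF dD(4) that] by auto
  have "eqv G (bsrc d) ?F2 (\<lambda>x. (l x, bnorm d x))"
    unfolding eqv_def using ln eqv_act[OF l_eqv] eqv_act[OF dD(4)] by simp
  from restrict_equivariant_maps[OF dD(1) eqv_comp[OF this \<kappa>(2)]]
  have l': "l' \<in> EMap G (bsrc d) Q" unfolding l'_def comp_def .
  have l'x: "l' x \<in> elts Q" "pC (e (l' x)) = l x" "m (l' x) = bnorm d x" "e (l' x) = sec (bnorm d x) (l x)" if "x \<in> elts (bsrc d)" for x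
  proof -
    have eq: "l' x = \<kappa> (l x, bnorm d x)" using that by (simp add: l'_def)
    show "l' x \<in> elts Q" "pC (e (l' x)) = l x" "m (l' x) = bnorm d x" unfolding eq using k ln[OF that] by auto
    then show "e (l' x) = sec (bnorm d x) (l x)" using z(2) by metis
  qed
  have pBe: "compose (elts Q) pB e \<in> EMap G Q (btgt b)"
    by (rule compose_equivariant_maps[OF Qg EMap_eqv[OF e] EMap_eqv[OF pBC(1)]])
  have 4: "is_pullback (gset_cat G) (bsrc b) Q (btgt b) (bnorm b) (compose (elts Q) pB e) (bsrc d) a' l'"
    unfolding is_pullback_gset_cat
  proof (intro conjI ballI impI)
    fix x assume x: "x \<in> elts (bsrc d)"
    show "bnorm b (a' x) = compose (elts Q) pB e (l' x)"
      using x l'x[OF x] ln[OF x] sec(1)[of "bnorm d x" "l x"] by (simp add: compose_apply a'_def)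
  next
    fix a0 v assume a0: "a0 \<in> elts (bsrc b)" and v: "v \<in> elts Q" and n: "bnorm b a0 = compose (elts Q) pB e v"
    have n': "bnorm b a0 = ev (m v) (pC (e v))"
      using n v z[OF v] sec(1)[of "m v" "pC (e v)"] by (simp add: compose_apply)
    have "\<exists>!x. x \<in> elts (bsrc d) \<and> bnorm d x = m v \<and> l x = pC (e v) \<and> a x = a0"
      by (rule W.point_ex1[simplified]) (use z[OF v] a0 n' in auto)
    then obtain x where x: "x \<in> elts (bsrc d) \<and> bnorm d x = m v \<and> l x = pC (e v) \<and> a x = a0"
      and xu: "\<And>y. y \<in> elts (bsrc d) \<and> bnorm d y = m v \<and> l y = pC (e v) \<and> a y = a0 \<Longrightarrow> y = x" by blast
    show "\<exists>!x. x \<in> elts (bsrc d) \<and> a' x = a0 \<and> l' x = v"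
    proof (rule ex1I[of _ x])
      show "x \<in> elts (bsrc d) \<and> a' x = a0 \<and> l' x = v" using x z(1)[OF v] by (simp add: a'_def l'_def)
      fix y assume y: "y \<in> elts (bsrc d) \<and> a' y = a0 \<and> l' y = v"
      show "y = x" by (rule xu) (use y l'x[of y] in \<open>auto simp: a'_def\<close>)
    qed
  qed (use bs ds Q a' l' pBe in auto)
  have "bres d = compose (elts (bsrc d)) (bres b) a'"
    using W.a_res[simplified] equivariant_maps_extensional[OF ds(3)] by (auto simp: a'_def compose_def fun_eq_iff extensional_def)
  moreover have "bnorm d = compose (elts (bsrc d)) m l'"
    using l'x equivariant_maps_extensional[OF ds(4)] by (auto simp: compose_def fun_eq_iff extensional_def)
  moreover have "btran d = compose (elts (btgt d)) (btran c) q'"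
    using W.q_tran[simplified] equivariant_maps_extensional[OF ds(5)] by (auto simp: q'_def compose_def fun_eq_iff extensional_def)
  ultimately show ?thesis
    unfolding is_bispan_composite_def using 1 3 4 by blast
qed

end

section \<open>The bispan category\<close>

definition id_bisp :: "('g, 'x) gset \<Rightarrow> ('g, 'x, 'x, 'x, 'x) bisp" where
  "id_bisp X = \<lparr>psrc = X, ptgt = X, pres = (\<lambda>x. x), pnorm = (\<lambda>x. x), ptran = (\<lambda>x. x)\<rparr>"

text \<open>A point of either iterated composite is a point \<open>d\<close> of the last middle set, a section over the fibre of \<open>d\<close> into
  the second middle set, and a section into the first middle set over all the fibres so described. The
  structure maps for the other bracketing are read off from the unique existence clauses.\<close>

lemma comp_wit_assoc:
  assumes w1: "comp_wit G W X Y b c x q1 ev1 l1 a1" and w2: "comp_wit G W Y Z x e y q2 ev2 l2 a2"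
    and w3: "comp_wit G X Y Z c e z q3 ev3 l3 a3"
  shows "\<exists>q ev l a. comp_wit G W X Z b z y q ev l a"
proof -
  interpret W1: comp_wit G W X Y b c x q1 ev1 l1 a1 by fact
  interpret W2: comp_wit G W Y Z x e y q2 ev2 l2 a2 by fact
  interpret W3: comp_wit G X Y Z c e z q3 ev3 l3 a3 by fact
  note yD = wf_bispD[OF W2.wf3] and zD = wf_bispD[OF W3.wf3] and bD = wf_bispD[OF W1.wf1] and cD = wf_bispD[OF W1.wf2]
    and xD = wf_bispD[OF W1.wf3] and eD = wf_bispD[OF W2.wf2]
  have "\<exists>u. w \<in> Tgt y \<longrightarrow> u \<in> Tgt z \<and> q3 u = q2 w \<and> (\<forall>e0\<in>Src e. pnorm e e0 = q2 w \<longrightarrow> ev3 u e0 = q1 (ev2 w e0))" for w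
  proof (cases "w \<in> Tgt y")
    case w: True
    have "\<exists>!u. u \<in> Tgt z \<and> q3 u = q2 w \<and> (\<forall>e0\<in>Src e. pnorm e e0 = q2 w \<longrightarrow> ev3 u e0 = q1 (ev2 w e0))"
      using w by (intro W3.section_ex1) (auto simp: W2.ev_in W2.ev_tran W1.q_tran eqv_in[OF W2.q_eqv] eqv_in[OF W1.q_eqv])
    then show ?thesis by blast
  qed simp
  then obtain \<beta> where \<beta>: "\<And>w. w \<in> Tgt y \<Longrightarrow> \<beta> w \<in> Tgt z" "\<And>w. w \<in> Tgt y \<Longrightarrow> q3 (\<beta> w) = q2 w"
    and \<beta>ev: "\<And>w e0. \<lbrakk>w \<in> Tgt y; e0 \<in> Src e; pnorm e e0 = q2 w\<rbrakk> \<Longrightarrow> ev3 (\<beta> w) e0 = q1 (ev2 w e0)"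
    by metis
  have \<beta>e: "eqv G (ptgt y) (ptgt z) \<beta>"
  proof (rule W3.tgt_map_eqv[OF yD(2) \<beta>(1)])
    show "eqv G (ptgt y) (ptgt e) (\<lambda>t. q3 (\<beta> t))" using W2.q_eqv eqv_cong[OF yD(2), of "\<lambda>t. q3 (\<beta> t)" q2] \<beta>(2) by simp
    fix g t e0 assume g: "g \<in> carrier G" and t: "t \<in> Tgt y" and e0: "e0 \<in> Src e" and n: "pnorm e e0 = q3 (\<beta> t)"
    have n': "pnorm e e0 = q2 t" using n \<beta>(2)[OF t] by simp
    have gt: "act (ptgt y) g t \<in> Tgt y" and ge: "act (psrc e) g e0 \<in> Src e"
      using is_gsetD(2)[OF yD(2) g t] is_gsetD(2)[OF eD(1) g e0] by auto
    have "pnorm e (act (psrc e) g e0) = q2 (act (ptgt y) g t)"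
      using n' eqv_act[OF eD(4) g e0] eqv_act[OF W2.q_eqv g t] by simp
    from \<beta>ev[OF gt ge this] show "ev3 (\<beta> (act (ptgt y) g t)) (act (psrc e) g e0) = act (ptgt c) g (ev3 (\<beta> t) e0)"
      using W2.ev_act[OF g t e0 n'] eqv_act[OF W1.q_eqv g W2.ev_in[OF t e0 n']] \<beta>ev[OF t e0 n'] by simp
  qed
  have "\<exists>u. y0 \<in> Src y \<longrightarrow> u \<in> Src z \<and> pnorm z u = \<beta> (pnorm y y0) \<and> l3 u = l2 y0 \<and> a3 u = l1 (a2 y0)" for y0
  proof (cases "y0 \<in> Src y")
    case y0: True
    have n: "pnorm y y0 \<in> Tgt y" and l: "l2 y0 \<in> Src e" and a: "a2 y0 \<in> Src x"
      using eqv_in[OF yD(4) y0] eqv_in[OF W2.l_eqv y0] eqv_in[OF W2.a_eqv y0] by auto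
    have "\<exists>!u. u \<in> Src z \<and> pnorm z u = \<beta> (pnorm y y0) \<and> l3 u = l2 y0 \<and> a3 u = l1 (a2 y0)"
      by (rule W3.point_ex1) (use \<beta>(1)[OF n] \<beta>(2)[OF n] l W2.l_norm[OF y0] \<beta>ev[OF n l W2.l_norm[OF y0]] W2.a_norm[OF y0] W1.l_norm[OF a] eqv_in[OF W1.l_eqv a] in auto)
    then show ?thesis by blast
  qed simp
  then obtain \<mu> where \<mu>: "\<And>y0. y0 \<in> Src y \<Longrightarrow> \<mu> y0 \<in> Src z" "\<And>y0. y0 \<in> Src y \<Longrightarrow> pnorm z (\<mu> y0) = \<beta> (pnorm y y0)"
     "\<And>y0. y0 \<in> Src y \<Longrightarrow> l3 (\<mu> y0) = l2 y0" "\<And>y0. y0 \<in> Src y \<Longrightarrow> a3 (\<mu> y0) = l1 (a2 y0)"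
    by metis
  have \<mu>e: "eqv G (psrc y) (psrc z) \<mu>"
  proof (rule W3.src_map_eqv[OF yD(1) \<mu>(1)])
    show "eqv G (psrc y) (ptgt z) (\<lambda>t. pnorm z (\<mu> t))"
      using eqv_comp[OF yD(4) \<beta>e] eqv_cong[OF yD(1), of "\<lambda>t. pnorm z (\<mu> t)" "\<beta> \<circ> pnorm y"] \<mu>(2) by simp
    show "eqv G (psrc y) (psrc e) (\<lambda>t. l3 (\<mu> t))" using W2.l_eqv eqv_cong[OF yD(1), of "\<lambda>t. l3 (\<mu> t)" l2] \<mu>(3) by simp
    show "eqv G (psrc y) (psrc c) (\<lambda>t. a3 (\<mu> t))"
      using eqv_comp[OF W2.a_eqv W1.l_eqv] eqv_cong[OF yD(1), of "\<lambda>t. a3 (\<mu> t)" "l1 \<circ> a2"] \<mu>(4) by simp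
  qed
  \<comment> \<open>The section over the fibre of \<open>z\<close> composes the sections of the two steps.\<close>
  define ev where "ev w z1 = ev1 (ev2 w (l3 z1)) (a3 z1)" for w z1
  have fib: "l3 z1 \<in> Src e" "a3 z1 \<in> Src c" "pnorm e (l3 z1) = q2 w" "ev2 w (l3 z1) \<in> Tgt x" "pnorm c (a3 z1) = q1 (ev2 w (l3 z1))"
    if w: "w \<in> Tgt y" and z1: "z1 \<in> Src z" and n: "pnorm z z1 = \<beta> w" for w z1
  proof -
    show l: "l3 z1 \<in> Src e" and "a3 z1 \<in> Src c" using eqv_in[OF W3.l_eqv z1] eqv_in[OF W3.a_eqv z1] by auto
    show ne: "pnorm e (l3 z1) = q2 w" using W3.l_norm[OF z1] n \<beta>(2)[OF w] by simp
    show "ev2 w (l3 z1) \<in> Tgt x" by (rule W2.ev_in[OF w l ne])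
    show "pnorm c (a3 z1) = q1 (ev2 w (l3 z1))" using W3.a_norm[OF z1] n \<beta>ev[OF w l ne] by simp
  qed
  have "comp_wit G W X Z b z y \<beta> ev \<mu> (a1 \<circ> a2)"
  proof (unfold_locales, rule W1.wf1, rule W3.wf3, rule W2.wf3, rule \<beta>e)
    fix w assume w: "w \<in> Tgt y"
    show "ptran z (\<beta> w) = ptran y w" using W3.q_tran[OF \<beta>(1)[OF w]] W2.q_tran[OF w] \<beta>(2)[OF w] by simp
  next
    fix w z1 assume w: "w \<in> Tgt y" and z1: "z1 \<in> Src z" and n: "pnorm z z1 = \<beta> w"
    note f = fib[OF w z1 n]
    show "ev w z1 \<in> Tgt b" unfolding ev_def by (rule W1.ev_in[OF f(4,2,5)])
    show "ptran b (ev w z1) = pres z z1" unfolding ev_def using W1.ev_tran[OF f(4,2,5)] W3.a_res[OF z1] by simp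
    fix g assume g: "g \<in> carrier G"
    show "ev (act (ptgt y) g w) (act (psrc z) g z1) = act (ptgt b) g (ev w z1)"
      unfolding ev_def eqv_act[OF W3.l_eqv g z1] eqv_act[OF W3.a_eqv g z1] W2.ev_act[OF g w f(1,3)]
      by (rule W1.ev_act[OF g f(4,2,5)])
  next
    fix d s assume d: "d \<in> Tgt z" and s: "\<And>z1. \<lbrakk>z1 \<in> Src z; pnorm z z1 = d\<rbrakk> \<Longrightarrow> s z1 \<in> Tgt b \<and> ptran b (s z1) = pres z z1"
    have "\<exists>z1. e0 \<in> Src e \<and> pnorm e e0 = q3 d \<and> c0 \<in> Src c \<and> pnorm c c0 = ev3 d e0 \<longrightarrow>
        z1 \<in> Src z \<and> pnorm z z1 = d \<and> l3 z1 = e0 \<and> a3 z1 = c0" for e0 c0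
      using W3.point_ex1[OF d, of e0 c0] by blast
    then obtain pt where pt: "\<And>e0 c0. \<lbrakk>e0 \<in> Src e; pnorm e e0 = q3 d; c0 \<in> Src c; pnorm c c0 = ev3 d e0\<rbrakk> \<Longrightarrow>
        pt e0 c0 \<in> Src z \<and> pnorm z (pt e0 c0) = d \<and> l3 (pt e0 c0) = e0 \<and> a3 (pt e0 c0) = c0" by metis
    have pt_eq: "pt (l3 z1) (a3 z1) = z1" if z1: "z1 \<in> Src z" "pnorm z z1 = d" for z1
    proof (rule W3.src_eqI[OF z1(1)])
      have "pt (l3 z1) (a3 z1) \<in> Src z \<and> pnorm z (pt (l3 z1) (a3 z1)) = d \<and> l3 (pt (l3 z1) (a3 z1)) = l3 z1 \<and> a3 (pt (l3 z1) (a3 z1)) = a3 z1"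
        by (rule pt) (use z1 W3.l_norm[OF z1(1)] W3.a_norm[OF z1(1)] eqv_in[OF W3.l_eqv] eqv_in[OF W3.a_eqv] in auto)
      then show "pt (l3 z1) (a3 z1) \<in> Src z" "pnorm z (pt (l3 z1) (a3 z1)) = pnorm z z1" "l3 (pt (l3 z1) (a3 z1)) = l3 z1" "a3 (pt (l3 z1) (a3 z1)) = a3 z1"
        using z1 by auto
    qed
    have "\<exists>u. e0 \<in> Src e \<and> pnorm e e0 = q3 d \<longrightarrow> u \<in> Tgt x \<and> q1 u = ev3 d e0 \<and>
       (\<forall>c0\<in>Src c. pnorm c c0 = ev3 d e0 \<longrightarrow> ev1 u c0 = s (pt e0 c0))" for e0
    proof (cases "e0 \<in> Src e \<and> pnorm e e0 = q3 d")
      case e0: True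
      have "\<exists>!u. u \<in> Tgt x \<and> q1 u = ev3 d e0 \<and> (\<forall>c0\<in>Src c. pnorm c c0 = ev3 d e0 \<longrightarrow> ev1 u c0 = s (pt e0 c0))"
      proof (rule W1.section_ex1)
        show "ev3 d e0 \<in> Tgt c" using W3.ev_in[OF d] e0 by blast
        fix c0 assume c0: "c0 \<in> Src c" "pnorm c c0 = ev3 d e0"
        have p: "pt e0 c0 \<in> Src z" "pnorm z (pt e0 c0) = d" "a3 (pt e0 c0) = c0" using pt[OF _ _ c0] e0 by auto
        show "s (pt e0 c0) \<in> Tgt b \<and> ptran b (s (pt e0 c0)) = pres c c0"
          using s[OF p(1,2)] W3.a_res[OF p(1)] p(3) by simp
      qed
      then show ?thesis by blast
    qed blast
    then obtain U where U: "\<And>e0. \<lbrakk>e0 \<in> Src e; pnorm e e0 = q3 d\<rbrakk> \<Longrightarrow> U e0 \<in> Tgt x \<and> q1 (U e0) = ev3 d e0"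
      and Uev: "\<And>e0 c0. \<lbrakk>e0 \<in> Src e; pnorm e e0 = q3 d; c0 \<in> Src c; pnorm c c0 = ev3 d e0\<rbrakk> \<Longrightarrow> ev1 (U e0) c0 = s (pt e0 c0)"
      by metis
    have "\<exists>!w. w \<in> Tgt y \<and> q2 w = q3 d \<and> (\<forall>e0\<in>Src e. pnorm e e0 = q3 d \<longrightarrow> ev2 w e0 = U e0)"
    proof (rule W2.section_ex1)
      show "q3 d \<in> Tgt e" by (rule eqv_in[OF W3.q_eqv d])
      fix e0 assume e0: "e0 \<in> Src e" "pnorm e e0 = q3 d"
      show "U e0 \<in> Tgt x \<and> ptran x (U e0) = pres e e0"
        using U[OF e0] W1.q_tran[of "U e0"] W3.ev_tran[OF d e0] by simp
    qed
    then obtain w where w: "w \<in> Tgt y" "q2 w = q3 d" and wU: "\<And>e0. \<lbrakk>e0 \<in> Src e; pnorm e e0 = q3 d\<rbrakk> \<Longrightarrow> ev2 w e0 = U e0"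
      by blast
    have \<beta>w: "\<beta> w = d"
      by (rule W3.tgt_eqI[OF d \<beta>(1)[OF w(1)]]) (use \<beta>(2)[OF w(1)] w(2) \<beta>ev[OF w(1)] wU U in auto)
    show "\<exists>!w. w \<in> Tgt y \<and> \<beta> w = d \<and> (\<forall>z1\<in>Src z. pnorm z z1 = d \<longrightarrow> ev w z1 = s z1)"
    proof (rule ex1I[of _ w])
      have "ev w z1 = s z1" if z1: "z1 \<in> Src z" "pnorm z z1 = d" for z1
      proof -
        have f: "l3 z1 \<in> Src e" "a3 z1 \<in> Src c" "pnorm e (l3 z1) = q3 d" "pnorm c (a3 z1) = ev3 d (l3 z1)"
          using fib[OF w(1) z1(1)] z1 W3.l_norm[OF z1(1)] W3.a_norm[OF z1(1)] \<beta>w by auto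
        show ?thesis unfolding ev_def using wU[OF f(1,3)] Uev[OF f(1,3,2,4)] pt_eq[OF z1] by simp
      qed
      then show "w \<in> Tgt y \<and> \<beta> w = d \<and> (\<forall>z1\<in>Src z. pnorm z z1 = d \<longrightarrow> ev w z1 = s z1)"
        using w(1) \<beta>w by blast
      fix v assume v: "v \<in> Tgt y \<and> \<beta> v = d \<and> (\<forall>z1\<in>Src z. pnorm z z1 = d \<longrightarrow> ev v z1 = s z1)"
      have qv: "q2 v = q3 d" using \<beta>(2)[of v] v by simp
      show "v = w"
      proof (rule W2.tgt_eqI[OF w(1)])
        show "v \<in> Tgt y" "q2 v = q2 w" using v w qv by auto
        fix e0 assume e0: "e0 \<in> Src e" "pnorm e e0 = q2 w"
        have e0': "pnorm e e0 = q3 d" "pnorm e e0 = q2 v" using e0 w(2) qv by auto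
        have vin: "ev2 v e0 \<in> Tgt x" using W2.ev_in[of v e0] v e0 e0' by auto
        have qv3: "q1 (ev2 v e0) = ev3 d e0" using \<beta>ev[of v e0] v e0 e0' by auto
        have "ev2 v e0 = U e0"
        proof (rule W1.tgt_eqI)
          show "U e0 \<in> Tgt x" "ev2 v e0 \<in> Tgt x" "q1 (ev2 v e0) = q1 (U e0)" using U[OF e0(1) e0'(1)] vin qv3 by auto
          fix c0 assume c0: "c0 \<in> Src c" "pnorm c c0 = q1 (U e0)"
          then have c0': "pnorm c c0 = ev3 d e0" using U[OF e0(1) e0'(1)] by simp
          note p = pt[OF e0(1) e0'(1) c0(1) c0']
          have "ev v (pt e0 c0) = s (pt e0 c0)" using v p by blast
          then show "ev1 (ev2 v e0) c0 = ev1 (U e0) c0" using p Uev[OF e0(1) e0'(1) c0(1) c0'] by (simp add: ev_def)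
        qed
        then show "ev2 v e0 = ev2 w e0" using wU[OF e0(1) e0'(1)] by simp
      qed
    qed
  next
    show "eqv G (psrc y) (psrc z) \<mu>" by (rule \<mu>e)
    show "eqv G (psrc y) (psrc b) (a1 \<circ> a2)" by (rule eqv_comp[OF W2.a_eqv W1.a_eqv])
  next
    fix y0 assume y0: "y0 \<in> Src y"
    have a: "a2 y0 \<in> Src x" by (rule eqv_in[OF W2.a_eqv y0])
    show "pnorm z (\<mu> y0) = \<beta> (pnorm y y0)" by (rule \<mu>(2)[OF y0])
    show "pnorm b ((a1 \<circ> a2) y0) = ev (pnorm y y0) (\<mu> y0)"
      using W1.a_norm[OF a] W2.a_norm[OF y0] \<mu>(3,4)[OF y0] by (simp add: ev_def)
    show "pres b ((a1 \<circ> a2) y0) = pres y y0" using W1.a_res[OF a] W2.a_res[OF y0] by simp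
  next
    fix w z1 a0 assume w: "w \<in> Tgt y" and z1: "z1 \<in> Src z" and a0: "a0 \<in> Src b"
      and n: "pnorm z z1 = \<beta> w" and nb: "pnorm b a0 = ev w z1"
    note f = fib[OF w z1 n]
    have "\<exists>!x0. x0 \<in> Src x \<and> pnorm x x0 = ev2 w (l3 z1) \<and> l1 x0 = a3 z1 \<and> a1 x0 = a0"
      by (rule W1.point_ex1[OF f(4,2) a0 f(5)]) (use nb in \<open>simp add: ev_def\<close>)
    then obtain x0 where x0: "x0 \<in> Src x" "pnorm x x0 = ev2 w (l3 z1)" "l1 x0 = a3 z1" "a1 x0 = a0" by blast
    have "\<exists>!y0. y0 \<in> Src y \<and> pnorm y y0 = w \<and> l2 y0 = l3 z1 \<and> a2 y0 = x0"
      by (rule W2.point_ex1[OF w f(1) x0(1) f(3) x0(2)])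
    then obtain y0 where y0: "y0 \<in> Src y" "pnorm y y0 = w" "l2 y0 = l3 z1" "a2 y0 = x0" by blast
    show "\<exists>!y0. y0 \<in> Src y \<and> pnorm y y0 = w \<and> \<mu> y0 = z1 \<and> (a1 \<circ> a2) y0 = a0"
    proof (rule ex1I[of _ y0])
      have "\<mu> y0 = z1" by (rule W3.src_eqI[OF z1 \<mu>(1)[OF y0(1)]]) (use \<mu>(2-4)[OF y0(1)] y0 x0 n in auto)
      then show "y0 \<in> Src y \<and> pnorm y y0 = w \<and> \<mu> y0 = z1 \<and> (a1 \<circ> a2) y0 = a0" using y0 x0 by simp
      fix v assume v: "v \<in> Src y \<and> pnorm y v = w \<and> \<mu> v = z1 \<and> (a1 \<circ> a2) v = a0"
      have l: "l2 v = l3 z1" "l1 (a2 v) = a3 z1" using \<mu>(3,4)[of v] v by auto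
      have "a2 v = x0"
        by (rule W1.src_eqI[OF x0(1)]) (use v l x0 eqv_in[OF W2.a_eqv] W2.a_norm[of v] in auto)
      then show "v = y0" by (intro W2.src_eqI[OF y0(1)]) (use v y0 l in auto)
    qed
  qed
  then show ?thesis by blast
qed

context plain_group
begin

text \<open>Composites are unique up to isomorphism, so one witness determines the whole class.\<close>

lemma bispan_cat_comp:
  fixes X Y Z :: "('g, 'u::infinite) gset"
  assumes o: "X \<in> Fin G" "Y \<in> Fin G" "Z \<in> Fin G"
    and W: "comp_wit G X Y Z p p' p'' q ev l a"
  shows "BComp G X Y Z (cls G Y Z p') (cls G X Y p) = cls G X Z p''"
proof -
  interpret W: comp_wit G X Y Z p p' p'' q ev l a by (rule W)
  have "d \<in> cls G X Z p''" if d: "d \<in> bispans G X Z" and b: "b \<in> cls G X Y p" and c: "c \<in> cls G Y Z p'"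
    and comp: "is_bispan_composite G X Y Z b c d" for b c d
  proof -
    have b': "b \<in> bispans G X Y" "bisp_iso G p (of_bispan b)" and c': "c \<in> bispans G Y Z" "bisp_iso G p' (of_bispan c)"
      using b c by (auto simp: cls_def)
    obtain q1 ev1 l1 a1 where "comp_wit G X Y Z (of_bispan b) (of_bispan c) (of_bispan d) q1 ev1 l1 a1"
      using comp_wit_of_bispan_composite[OF b'(1) c'(1) d comp] by blast
    moreover obtain q2 ev2 l2 a2 where "comp_wit G X Y Z (of_bispan b) (of_bispan c) p'' q2 ev2 l2 a2"
      using comp_wit_transport[OF W b'(2) c'(2) bisp_iso_refl wf_of_bispan[OF b'(1)] wf_of_bispan[OF c'(1)] W.wf3] by blast
    ultimately have "bisp_iso G p'' (of_bispan d)" by (rule comp_wit_unique[rotated])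
    then show ?thesis using d by (simp add: cls_def)
  qed
  moreover have "\<exists>b\<in>cls G X Y p. \<exists>c\<in>cls G Y Z p'. is_bispan_composite G X Y Z b c d" if d: "d \<in> cls G X Z p''" for d
  proof -
    have d': "d \<in> bispans G X Z" "bisp_iso G p'' (of_bispan d)" using d by (auto simp: cls_def)
    obtain b where b: "b \<in> bispans G X Y" "bisp_iso G p (of_bispan b)" using ex_bispan_iso[OF W.wf1] by blast
    obtain c where c: "c \<in> bispans G Y Z" "bisp_iso G p' (of_bispan c)" using ex_bispan_iso[OF W.wf2] by blast
    obtain q2 ev2 l2 a2 where "comp_wit G X Y Z (of_bispan b) (of_bispan c) (of_bispan d) q2 ev2 l2 a2"
      using comp_wit_transport[OF W b(2) c(2) d'(2) wf_of_bispan[OF b(1)] wf_of_bispan[OF c(1)] wf_of_bispan[OF d'(1)]] by blast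
    then have "is_bispan_composite G X Y Z b c d" by (rule bispan_composite_of_comp_wit[OF b(1) c(1) d'(1) o])
    then show ?thesis using b c by (auto simp: cls_def)
  qed
  ultimately show ?thesis unfolding bispan_cat_def cat.simps by (auto simp: cls_def)
qed

lemma wf_id_bisp: "is_gset G X \<Longrightarrow> wf_bisp G X X (id_bisp X)"
  by (simp add: wf_bisp_def id_bisp_def eqv_id)

lemma comp_wit_id_left:
  assumes wf: "wf_bisp G X Y p" and X: "is_gset G X"
  shows "comp_wit G X X Y (id_bisp X) p p (\<lambda>w. w) (\<lambda>w c. pres p c) (\<lambda>x. x) (pres p)"
  by (unfold_locales) (use wf X wf_id_bisp[OF X] in \<open>auto simp: id_bisp_def eqv_id eqv_in wf_bisp_def eqv_act\<close>)

lemma comp_wit_id_right: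
  assumes wf: "wf_bisp G X Y p" and Y: "is_gset G Y"
  shows "comp_wit G X Y Y p (id_bisp Y) p (ptran p) (\<lambda>w c. w) (ptran p \<circ> pnorm p) (\<lambda>x. x)"
  by (unfold_locales) (use wf Y wf_id_bisp[OF Y] in \<open>auto simp: id_bisp_def eqv_id eqv_in wf_bisp_def eqv_act intro!: eqv_comp\<close>)

lemma Obj_bispan_cat [simp]: "Obj (bispan_cat G) = Fin G"
  by (simp add: bispan_cat_def)

lemma Ident_bispan_cat:
  fixes X :: "('g, 'u::infinite) gset"
  assumes X: "X \<in> Fin G"
  shows "BId G X = cls G X X (id_bisp X)"
proof -
  let ?b = "\<lparr>bsrc = X, btgt = X, bres = (\<lambda>x\<in>elts X. x), bnorm = (\<lambda>x\<in>elts X. x), btran = (\<lambda>x\<in>elts X. x)\<rparr>"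
  have gX: "is_gset G X" using X by (rule Fin_gset)
  have b: "?b \<in> bispans G X X" using X gX by (simp add: bispans_def ident_equivariant_maps)
  have "bisp_iso_maps G (of_bispan ?b) (id_bisp X) (\<lambda>x. x) (\<lambda>x. x)"
    by (simp add: bisp_iso_maps_def id_bisp_def eqv_id bij_betw_def)
  then have "cls G X X (of_bispan ?b) = cls G X X (id_bisp X)"
    using cls_eq[OF wf_of_bispan[OF b] wf_id_bisp[OF gX]] unfolding bisp_iso_def by blast
  then show ?thesis using bispan_class_eq_cls[OF b] by (simp add: bispan_cat_def)
qed

lemma bispan_cat_comp_cls:
  fixes X Y Z :: "('g, 'u::infinite) gset"
  assumes "X \<in> Fin G" "Y \<in> Fin G" "Z \<in> Fin G" and wf: "wf_bisp G X Y p" "wf_bisp G Y Z p'"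
  shows "BComp G X Y Z (cls G Y Z p') (cls G X Y p) = cls G X Z (comp_bisp G p p')"
    and "wf_bisp G X Z (comp_bisp G p p')"
  using bispan_cat_comp[OF assms(1-3) comp_bisp_wit[OF wf]] comp_wit.wf3[OF comp_bisp_wit[OF wf]] by auto

text \<open>Associativity follows by comparing two witnesses for the same pair of bispans: the composite constructed one way
  is a composite the other way by \<open>comp_wit_assoc\<close>.\<close>

lemma category_bispan_cat: "category (bispan_cat G :: (('g, 'u::infinite) gset, ('g, 'u) bispan set) cat)"
  unfolding category_def Obj_bispan_cat
proof (intro conjI ballI)
  fix X :: "('g, 'u) gset" assume X: "X \<in> Fin G"
  then show "BId G X \<in> BHom G X X"
    by (simp add: Ident_bispan_cat cls_in_Hom wf_id_bisp Fin_gset)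
next
  fix X Y Z :: "('g, 'u) gset" and f g assume o: "X \<in> Fin G" "Y \<in> Fin G" "Z \<in> Fin G"
    and f: "f \<in> BHom G X Y" and g: "g \<in> BHom G Y Z"
  from f g show "BComp G X Y Z g f \<in> BHom G X Z"
    by (elim Hom_bispan_catE) (simp add: bispan_cat_comp_cls[OF o] cls_in_Hom)
next
  fix X Y :: "('g, 'u) gset" and f assume o: "X \<in> Fin G" "Y \<in> Fin G" and f: "f \<in> BHom G X Y"
  note gs = o[THEN Fin_gset]
  obtain p :: "('g, 'u) ubisp" where p: "wf_bisp G X Y p" "f = cls G X Y p" using f by (rule Hom_bispan_catE)
  show "BComp G X X Y f (BId G X) = f"
    using bispan_cat_comp[OF o(1,1,2) comp_wit_id_left[OF p(1) gs(1)]] p by (simp add: Ident_bispan_cat o)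
  show "BComp G X Y Y (BId G Y) f = f"
    using bispan_cat_comp[OF o(1,2,2) comp_wit_id_right[OF p(1) gs(2)]] p by (simp add: Ident_bispan_cat o)
next
  fix W X Y Z :: "('g, 'u) gset" and f g h assume o: "W \<in> Fin G" "X \<in> Fin G" "Y \<in> Fin G" "Z \<in> Fin G"
    and f: "f \<in> BHom G W X" and g: "g \<in> BHom G X Y" and h: "h \<in> BHom G Y Z"
  obtain b :: "('g, 'u) ubisp" where b: "wf_bisp G W X b" "f = cls G W X b" using f by (rule Hom_bispan_catE)
  obtain c :: "('g, 'u) ubisp" where c: "wf_bisp G X Y c" "g = cls G X Y c" using g by (rule Hom_bispan_catE)
  obtain e :: "('g, 'u) ubisp" where e: "wf_bisp G Y Z e" "h = cls G Y Z e" using h by (rule Hom_bispan_catE)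
  let ?x = "comp_bisp G b c" and ?z = "comp_bisp G c e"
  note x = bispan_cat_comp_cls[OF o(1-3) b(1) c(1)] and z = bispan_cat_comp_cls[OF o(2-4) c(1) e(1)]
  note y = bispan_cat_comp_cls[OF o(1,3,4) x(2) e(1)]
  obtain q ev l a where "comp_wit G W X Z b ?z (comp_bisp G ?x e) q ev l a"
    using comp_wit_assoc[OF comp_bisp_wit[OF b(1) c(1)] comp_bisp_wit[OF x(2) e(1)] comp_bisp_wit[OF c(1) e(1)]] by blast
  from bispan_cat_comp[OF o(1,2,4) this]
  show "BComp G W X Z (BComp G X Y Z h g) f = BComp G W Y Z h (BComp G W X Y g f)"
    using b c e x y z by simp
qed

end

section \<open>Restrictions, transfers and products of bispans\<close>

definition res_bisp :: "('g, 'a) gset \<Rightarrow> ('a \<Rightarrow> 'x) \<Rightarrow> ('g, 'a, 'a, 'x, 'a) bisp" where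
  "res_bisp A f = \<lparr>psrc = A, ptgt = A, pres = f, pnorm = (\<lambda>x. x), ptran = (\<lambda>x. x)\<rparr>"

definition tran_bisp :: "('g, 'a) gset \<Rightarrow> ('a \<Rightarrow> 'y) \<Rightarrow> ('g, 'a, 'a, 'a, 'y) bisp" where
  "tran_bisp A f = \<lparr>psrc = A, ptgt = A, pres = (\<lambda>x. x), pnorm = (\<lambda>x. x), ptran = f\<rparr>"

definition pull_bisp :: "('g, 'a, 'b, 'x, 'y) bisp \<Rightarrow> ('g, 'z) gset \<Rightarrow> ('z \<Rightarrow> 'y) \<Rightarrow> ('g, 'a \<times> 'z, 'b \<times> 'z, 'x, 'z) bisp" where
  "pull_bisp p Z f = \<lparr>psrc = fibre_product (psrc p) Z (\<lambda>a. ptran p (pnorm p a)) f, ptgt = fibre_product (ptgt p) Z (ptran p) f,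
     pres = (\<lambda>z. pres p (fst z)), pnorm = (\<lambda>z. (pnorm p (fst z), snd z)), ptran = snd\<rparr>"

definition sum_bisp :: "('x \<Rightarrow> 'z) \<Rightarrow> ('y \<Rightarrow> 'z) \<Rightarrow> ('g, 'a, 'b, 'w, 'x) bisp \<Rightarrow> ('g, 'c, 'd, 'w, 'y) bisp \<Rightarrow> ('g, 'a + 'c, 'b + 'd, 'w, 'z) bisp" where
  "sum_bisp i j p p' = \<lparr>psrc = gset_sum (psrc p) (psrc p'), ptgt = gset_sum (ptgt p) (ptgt p'),
     pres = case_sum (pres p) (pres p'), pnorm = map_sum (pnorm p) (pnorm p'),
     ptran = case_sum (\<lambda>b. i (ptran p b)) (\<lambda>b. j (ptran p' b))\<rparr>"

definition rst :: "'g monoid \<Rightarrow> ('g, 'u) gset \<Rightarrow> ('g, 'u) gset \<Rightarrow> ('u \<Rightarrow> 'u) \<Rightarrow> ('g, 'u) bispan set" where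
  "rst G X Y f = cls G Y X (res_bisp X f)"

definition trn :: "'g monoid \<Rightarrow> ('g, 'u) gset \<Rightarrow> ('g, 'u) gset \<Rightarrow> ('u \<Rightarrow> 'u) \<Rightarrow> ('g, 'u) bispan set" where
  "trn G X Y f = cls G X Y (tran_bisp X f)"

lemma eqv_comp': "\<lbrakk>eqv G X Y f; eqv G Y Z g\<rbrakk> \<Longrightarrow> eqv G X Z (\<lambda>x. g (f x))"
  unfolding eqv_def by auto

lemma bisp_isoI:
  assumes "bij_betw \<alpha> (Src p) (Src p')" "bij_betw \<beta> (Tgt p) (Tgt p')"
     "eqv G (psrc p) (psrc p') \<alpha>" "eqv G (ptgt p) (ptgt p') \<beta>"
     "\<And>a. a \<in> Src p \<Longrightarrow> pres p' (\<alpha> a) = pres p a" "\<And>a. a \<in> Src p \<Longrightarrow> pnorm p' (\<alpha> a) = \<beta> (pnorm p a)"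
     "\<And>b. b \<in> Tgt p \<Longrightarrow> ptran p' (\<beta> b) = ptran p b"
  shows "bisp_iso G p p'"
  using assms unfolding bisp_iso_def bisp_iso_maps_def by blast

lemma elts_gset_sum: "elts (gset_sum X Y) = elts X <+> elts Y"
  by (simp add: gset_sum_def)

lemma eqv_map_sum: "\<lbrakk>eqv G X X' f; eqv G Y Y' f'\<rbrakk> \<Longrightarrow> eqv G (gset_sum X Y) (gset_sum X' Y') (map_sum f f')"
  unfolding eqv_gset_sum by (simp add: eqv_comp'[OF _ eqv_Inl] eqv_comp'[OF _ eqv_Inr])

context plain_group
begin

lemma wf_res_bisp: "\<lbrakk>is_gset G A; eqv G A X f\<rbrakk> \<Longrightarrow> wf_bisp G X A (res_bisp A f)"
  and wf_tran_bisp: "\<lbrakk>is_gset G A; eqv G A X f\<rbrakk> \<Longrightarrow> wf_bisp G A X (tran_bisp A f)"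
  by (auto simp: wf_bisp_def res_bisp_def tran_bisp_def eqv_id)

lemma wf_pull_bisp:
  assumes wf: "wf_bisp G X Y p" and Z: "is_gset G Z" and f: "eqv G Z Y f"
  shows "wf_bisp G X Z (pull_bisp p Z f)"
proof -
  note W = wf_bispD[OF wf]
  have "eqv G (psrc p) Y (\<lambda>a. ptran p (pnorm p a))" by (rule eqv_comp'[OF W(4,5)])
  then have "is_gset G (fibre_product (psrc p) Z (\<lambda>a. ptran p (pnorm p a)) f)" "is_gset G (fibre_product (ptgt p) Z (ptran p) f)"
    using W Z f by (auto intro: is_gset_fibre_product)
  then show ?thesis
    using W by (auto simp: wf_bisp_def pull_bisp_def eqv_snd eqv_comp'[OF eqv_fst] eqv_def fibre_product_elts fibre_product_act)
qed

lemma wf_sum_bisp: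
  assumes "wf_bisp G W X p" "wf_bisp G W Y p'" "eqv G X Z i" "eqv G Y Z j"
  shows "wf_bisp G W Z (sum_bisp i j p p')"
  using assms by (auto simp: wf_bisp_def sum_bisp_def is_gset_sum eqv_gset_sum eqv_comp' eqv_Inl eqv_Inr)

lemma pull_comp_wit:
  assumes wf: "wf_bisp G X Y p" and Z: "is_gset G Z" and f: "eqv G Z Y f"
  shows "comp_wit G X Y Z p (res_bisp Z f) (pull_bisp p Z f) snd (\<lambda>w c. fst w) snd fst"
proof (unfold_locales, rule wf, rule wf_res_bisp[OF Z f], rule wf_pull_bisp[OF wf Z f])
  show "eqv G (ptgt (pull_bisp p Z f)) (ptgt (res_bisp Z f)) snd" "eqv G (psrc (pull_bisp p Z f)) (psrc (res_bisp Z f)) snd"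
    "eqv G (psrc (pull_bisp p Z f)) (psrc p) fst"
    by (auto simp: pull_bisp_def res_bisp_def eqv_def fibre_product_elts fibre_product_act)
  fix w c assume "w \<in> elts (ptgt (pull_bisp p Z f))" "c \<in> elts (psrc (res_bisp Z f))" "pnorm (res_bisp Z f) c = snd w"
  then show "fst w \<in> Tgt p" "ptran p (fst w) = pres (res_bisp Z f) c"
    "\<And>g. fst (act (ptgt (pull_bisp p Z f)) g w) = act (ptgt p) g (fst w)"
    by (auto simp: pull_bisp_def res_bisp_def fibre_product_elts fibre_product_act)
next
  fix d s assume "d \<in> elts (ptgt (res_bisp Z f))" "\<And>c. \<lbrakk>c \<in> elts (psrc (res_bisp Z f)); pnorm (res_bisp Z f) c = d\<rbrakk> \<Longrightarrow> s c \<in> Tgt p \<and> ptran p (s c) = pres (res_bisp Z f) c"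
  then show "\<exists>!w. w \<in> elts (ptgt (pull_bisp p Z f)) \<and> snd w = d \<and> (\<forall>c\<in>elts (psrc (res_bisp Z f)). pnorm (res_bisp Z f) c = d \<longrightarrow> fst w = s c)"
    by (intro ex1I[of _ "(s d, d)"]) (auto simp: pull_bisp_def res_bisp_def)
next
  fix w c a0 assume "w \<in> elts (ptgt (pull_bisp p Z f))" "c \<in> elts (psrc (res_bisp Z f))" "a0 \<in> Src p"
     "pnorm (res_bisp Z f) c = snd w" "pnorm p a0 = fst w"
  then show "\<exists>!x. x \<in> elts (psrc (pull_bisp p Z f)) \<and> pnorm (pull_bisp p Z f) x = w \<and> snd x = c \<and> fst x = a0"
    by (intro ex1I[of _ "(a0, c)"]) (auto simp: pull_bisp_def res_bisp_def fibre_product_elts prod_eq_iff)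
qed (auto simp: pull_bisp_def res_bisp_def)

lemma tran_comp_wit:
  assumes wf: "wf_bisp G X Y p" and Y: "is_gset G Y" and h: "eqv G Y Z h"
  shows "comp_wit G X Y Z p (tran_bisp Y h) (p\<lparr>ptran := \<lambda>b. h (ptran p b)\<rparr>) (ptran p) (\<lambda>w c. w) (\<lambda>x. ptran p (pnorm p x)) (\<lambda>x. x)"
proof -
  have "wf_bisp G X Z (p\<lparr>ptran := \<lambda>b. h (ptran p b)\<rparr>)"
    using wf eqv_comp'[OF wf_bispD(5)[OF wf] h] by (simp add: wf_bisp_def)
  then show ?thesis
    by (unfold_locales)
      (use wf Y wf_tran_bisp[OF Y h] eqv_comp'[OF wf_bispD(4,5)[OF wf]] in \<open>auto simp: tran_bisp_def eqv_id eqv_in wf_bisp_def eqv_act\<close>)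
qed

lemma res_comp_wit:
  assumes Y: "is_gset G Y" and f: "eqv G Y X f" and wf: "wf_bisp G Y Z p"
  shows "comp_wit G X Y Z (res_bisp Y f) p (p\<lparr>pres := \<lambda>a. f (pres p a)\<rparr>) (\<lambda>w. w) (\<lambda>w c. pres p c) (\<lambda>x. x) (pres p)"
proof -
  have "wf_bisp G X Z (p\<lparr>pres := \<lambda>a. f (pres p a)\<rparr>)"
    using wf eqv_comp'[OF wf_bispD(3)[OF wf] f] by (simp add: wf_bisp_def)
  then show ?thesis
    by (unfold_locales) (use wf Y wf_res_bisp[OF Y f] in \<open>auto simp: res_bisp_def eqv_id eqv_in wf_bisp_def eqv_act\<close>)
qed

lemma comp_res_bispan:
  fixes X Y Z :: "('g, 'u::infinite) gset"
  assumes o: "X \<in> Fin G" "Y \<in> Fin G" "Z \<in> Fin G" and wf: "wf_bisp G X Y p" and f: "eqv G Z Y f"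
  shows "BComp G X Y Z (rst G Z Y f) (cls G X Y p) = cls G X Z (pull_bisp p Z f)"
  unfolding rst_def by (rule bispan_cat_comp[OF o pull_comp_wit[OF wf Fin_gset[OF o(3)] f]])

lemma comp_trn_bispan:
  fixes X Y Z :: "('g, 'u::infinite) gset"
  assumes o: "X \<in> Fin G" "Y \<in> Fin G" "Z \<in> Fin G" and wf: "wf_bisp G X Y p" and h: "eqv G Y Z h"
  shows "BComp G X Y Z (trn G Y Z h) (cls G X Y p) = cls G X Z (p\<lparr>ptran := \<lambda>b. h (ptran p b)\<rparr>)"
  unfolding trn_def by (rule bispan_cat_comp[OF o tran_comp_wit[OF wf Fin_gset[OF o(2)] h]])

lemma comp_bispan_rst:
  fixes X Y Z :: "('g, 'u::infinite) gset"
  assumes o: "X \<in> Fin G" "Y \<in> Fin G" "Z \<in> Fin G" and f: "eqv G Y X f" and wf: "wf_bisp G Y Z p"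
  shows "BComp G X Y Z (cls G Y Z p) (rst G Y X f) = cls G X Z (p\<lparr>pres := \<lambda>a. f (pres p a)\<rparr>)"
  unfolding rst_def by (rule bispan_cat_comp[OF o res_comp_wit[OF Fin_gset[OF o(2)] f wf]])

lemma rst_in_Hom:
  fixes X Y :: "('g, 'u::infinite) gset"
  shows "\<lbrakk>X \<in> Fin G; eqv G X Y f\<rbrakk> \<Longrightarrow> rst G X Y f \<in> BHom G Y X"
  unfolding rst_def by (intro cls_in_Hom wf_res_bisp Fin_gset)

lemma trn_in_Hom:
  fixes X Y :: "('g, 'u::infinite) gset"
  shows "\<lbrakk>X \<in> Fin G; eqv G X Y f\<rbrakk> \<Longrightarrow> trn G X Y f \<in> BHom G X Y"
  unfolding trn_def by (intro cls_in_Hom wf_tran_bisp Fin_gset)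

lemma rst_comp:
  fixes X Y Z :: "('g, 'u::infinite) gset"
  assumes o: "X \<in> Fin G" "Y \<in> Fin G" "Z \<in> Fin G" and f: "eqv G X Y f" and h: "eqv G Y Z h"
  shows "BComp G Z Y X (rst G X Y f) (rst G Y Z h) = rst G X Z (\<lambda>x. h (f x))"
  using comp_bispan_rst[OF o(3,2,1) h wf_res_bisp[OF Fin_gset[OF o(1)] f]] by (simp add: rst_def res_bisp_def)

lemma trn_comp:
  fixes X Y Z :: "('g, 'u::infinite) gset"
  assumes o: "X \<in> Fin G" "Y \<in> Fin G" "Z \<in> Fin G" and f: "eqv G X Y f" and h: "eqv G Y Z h"
  shows "BComp G X Y Z (trn G Y Z h) (trn G X Y f) = trn G X Z (\<lambda>x. h (f x))"
  using comp_trn_bispan[OF o wf_tran_bisp[OF Fin_gset[OF o(1)] f] h] by (simp add: trn_def tran_bisp_def)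

lemma rst_cong:
  fixes X Y :: "('g, 'u::infinite) gset"
  assumes X: "X \<in> Fin G" and "eqv G X Y f" "eqv G X Y f'" "\<And>x. x \<in> elts X \<Longrightarrow> f x = f' x"
  shows "rst G X Y f = rst G X Y f'"
proof -
  have "bisp_iso G (res_bisp X f) (res_bisp X f')"
    by (rule bisp_isoI[of "\<lambda>x. x" _ _ "\<lambda>x. x"]) (use assms(4) in \<open>simp_all add: res_bisp_def eqv_id bij_betw_def\<close>)
  then show ?thesis unfolding rst_def
    using cls_eq[OF wf_res_bisp[OF Fin_gset[OF X] assms(2)] wf_res_bisp[OF Fin_gset[OF X] assms(3)]] by simp
qed

lemma trn_cong:
  fixes X Y :: "('g, 'u::infinite) gset"
  assumes X: "X \<in> Fin G" and "eqv G X Y f" "eqv G X Y f'" "\<And>x. x \<in> elts X \<Longrightarrow> f x = f' x"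
  shows "trn G X Y f = trn G X Y f'"
proof -
  have "bisp_iso G (tran_bisp X f) (tran_bisp X f')"
    by (rule bisp_isoI[of "\<lambda>x. x" _ _ "\<lambda>x. x"]) (use assms(4) in \<open>simp_all add: tran_bisp_def eqv_id bij_betw_def\<close>)
  then show ?thesis unfolding trn_def
    using cls_eq[OF wf_tran_bisp[OF Fin_gset[OF X] assms(2)] wf_tran_bisp[OF Fin_gset[OF X] assms(3)]] by simp
qed

lemma rst_id: "X \<in> Fin G \<Longrightarrow> rst G X (X :: ('g, 'u::infinite) gset) (\<lambda>x. x) = BId G X"
  by (simp add: Ident_bispan_cat rst_def res_bisp_def id_bisp_def)

lemma trn_id: "X \<in> Fin G \<Longrightarrow> trn G X (X :: ('g, 'u::infinite) gset) (\<lambda>x. x) = BId G X"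
  by (simp add: Ident_bispan_cat trn_def tran_bisp_def id_bisp_def)

lemma restriction_eq_rst:
  fixes X Y :: "('g, 'u::infinite) gset"
  assumes X: "X \<in> Fin G" and f: "f \<in> EMap G X Y"
  shows "restriction G X Y f = rst G X Y f"
proof -
  let ?b = "\<lparr>bsrc = X, btgt = X, bres = f, bnorm = (\<lambda>x\<in>elts X. x), btran = (\<lambda>x\<in>elts X. x)\<rparr>"
  have gX: "is_gset G X" using X by (rule Fin_gset)
  have b: "?b \<in> bispans G Y X" using X gX f by (simp add: bispans_def ident_equivariant_maps)
  have "bisp_iso G (of_bispan ?b) (res_bisp X f)"
    by (rule bisp_isoI[of "\<lambda>x. x" _ _ "\<lambda>x. x"]) (simp_all add: res_bisp_def eqv_id bij_betw_def)
  then show ?thesis unfolding restriction_def rst_def bispan_class_eq_cls[OF b]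
    using cls_eq[OF wf_of_bispan[OF b] wf_res_bisp[OF gX EMap_eqv[OF f]]] by blast
qed

lemma transfer_eq_trn:
  fixes X Y :: "('g, 'u::infinite) gset"
  assumes X: "X \<in> Fin G" and f: "f \<in> EMap G X Y"
  shows "transfer G X Y f = trn G X Y f"
proof -
  let ?b = "\<lparr>bsrc = X, btgt = X, bres = (\<lambda>x\<in>elts X. x), bnorm = (\<lambda>x\<in>elts X. x), btran = f\<rparr>"
  have gX: "is_gset G X" using X by (rule Fin_gset)
  have b: "?b \<in> bispans G X Y" using X gX f by (simp add: bispans_def ident_equivariant_maps)
  have "bisp_iso G (of_bispan ?b) (tran_bisp X f)"
    by (rule bisp_isoI[of "\<lambda>x. x" _ _ "\<lambda>x. x"]) (simp_all add: tran_bisp_def eqv_id bij_betw_def)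
  then show ?thesis unfolding transfer_def trn_def bispan_class_eq_cls[OF b]
    using cls_eq[OF wf_of_bispan[OF b] wf_tran_bisp[OF gX EMap_eqv[OF f]]] by blast
qed

text \<open>Both composites are represented by \<open>A \<leftarrow> P = P \<rightarrow> X\<close>, since pulling back a bispan only changes it by a fibre product.\<close>

lemma base_change:
  fixes A X Y P :: "('g, 'u::infinite) gset"
  assumes o: "A \<in> Fin G" "X \<in> Fin G" "Y \<in> Fin G" "P \<in> Fin G"
    and t: "eqv G A Y t" and f: "eqv G X Y f" and r: "eqv G P A r" and s: "eqv G P X s"
    and comm: "\<And>z. z \<in> elts P \<Longrightarrow> t (r z) = f (s z)"
    and ex: "\<And>a x. \<lbrakk>a \<in> elts A; x \<in> elts X; t a = f x\<rbrakk> \<Longrightarrow> \<exists>!z. z \<in> elts P \<and> r z = a \<and> s z = x"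
  shows "BComp G A Y X (rst G X Y f) (trn G A Y t) = BComp G A P X (trn G P X s) (rst G P A r)"
proof -
  note gs = o[THEN Fin_gset]
  let ?p = "tran_bisp A t" and ?p' = "res_bisp P r"
  have wf: "wf_bisp G A Y ?p" "wf_bisp G A P ?p'" using gs t r by (auto intro: wf_tran_bisp wf_res_bisp)
  have wf': "wf_bisp G A X (?p'\<lparr>ptran := \<lambda>b. s (ptran ?p' b)\<rparr>)" using gs r s by (simp add: wf_bisp_def res_bisp_def eqv_id)
  have bij: "bij_betw (\<lambda>z. (r z, s z)) (elts P) (elts (fibre_product A X t f))"
    unfolding bij_betw_def
  proof
    show "inj_on (\<lambda>z. (r z, s z)) (elts P)"
    proof (rule inj_onI)
      fix z z' assume z: "z \<in> elts P" "z' \<in> elts P" "(r z, s z) = (r z', s z')"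
      have "\<exists>!v. v \<in> elts P \<and> r v = r z \<and> s v = s z" using ex[of "r z" "s z"] comm[OF z(1)] eqv_in[OF r z(1)] eqv_in[OF s z(1)] by simp
      then show "z = z'" using z by auto
    qed
    show "(\<lambda>z. (r z, s z)) ` elts P = elts (fibre_product A X t f)"
    proof
      show "(\<lambda>z. (r z, s z)) ` elts P \<subseteq> elts (fibre_product A X t f)" using comm eqv_in[OF r] eqv_in[OF s] by auto
      show "elts (fibre_product A X t f) \<subseteq> (\<lambda>z. (r z, s z)) ` elts P"
      proof
        fix v assume "v \<in> elts (fibre_product A X t f)"
        then obtain a x where v: "v = (a, x)" "a \<in> elts A" "x \<in> elts X" "t a = f x" by (cases v) auto
        then obtain z where "z \<in> elts P" "r z = a" "s z = x" using ex by blast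
        then show "v \<in> (\<lambda>z. (r z, s z)) ` elts P" using v by force
      qed
    qed
  qed
  have e: "eqv G P (fibre_product A X t f) (\<lambda>z. (r z, s z))"
    using comm r s by (auto simp: eqv_def)
  have "bisp_iso G (?p'\<lparr>ptran := \<lambda>b. s (ptran ?p' b)\<rparr>) (pull_bisp ?p X f)"
    by (rule bisp_isoI[of "\<lambda>z. (r z, s z)" _ _ "\<lambda>z. (r z, s z)"]) (use bij e in \<open>simp_all add: res_bisp_def tran_bisp_def pull_bisp_def\<close>)
  then have "cls G A X (pull_bisp ?p X f) = cls G A X (?p'\<lparr>ptran := \<lambda>b. s (ptran ?p' b)\<rparr>)"
    using cls_eq[OF wf' wf_pull_bisp[OF wf(1) gs(2) f]] by simp
  then show ?thesis
    using comp_res_bispan[OF o(1,3,2) wf(1) f] comp_trn_bispan[OF o(1,4,2) wf(2) s] by (simp add: trn_def rst_def)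
qed

text \<open>Base change for the square whose corner is \<open>A\<close> itself; it is a pullback because \<open>t\<close> is injective.\<close>

lemma rst_trn_inj:
  fixes A Y :: "('g, 'u::infinite) gset"
  assumes o: "A \<in> Fin G" "Y \<in> Fin G" and t: "eqv G A Y t" "inj_on t (elts A)"
  shows "BComp G A Y A (rst G A Y t) (trn G A Y t) = BId G A"
proof -
  have "BComp G A Y A (rst G A Y t) (trn G A Y t) = BComp G A A A (trn G A A (\<lambda>x. x)) (rst G A A (\<lambda>x. x))"
    by (rule base_change) (use o t in \<open>auto simp: eqv_id inj_on_def\<close>)
  then show ?thesis using o category_ident_left[OF category_bispan_cat, of A A] category_ident_in[OF category_bispan_cat, of A]
    by (simp add: rst_id trn_id)
qed

lemma sum_bisp_iso:
  assumes iso: "bisp_iso G p r" "bisp_iso G p' r'" and wf: "wf_bisp G W X p" "wf_bisp G W Y p'"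
  shows "bisp_iso G (sum_bisp i j p p') (sum_bisp i j r r')"
proof -
  obtain \<alpha> \<beta> where m: "bisp_iso_maps G p r \<alpha> \<beta>" using iso(1) unfolding bisp_iso_def by blast
  obtain \<alpha>' \<beta>' where m': "bisp_iso_maps G p' r' \<alpha>' \<beta>'" using iso(2) unfolding bisp_iso_def by blast
  have bij: "bij_betw (map_sum f f') (A <+> A') (B <+> B')" if "bij_betw f A B" "bij_betw f' A' B'" for f f' A A' B B'
  proof -
    have "map_sum f f' ` (A <+> A') = (f ` A) <+> (f' ` A')" unfolding Plus_def by (simp add: image_Un image_image)
    moreover have "inj_on (map_sum f f') (A <+> A')"
      using that[THEN bij_betw_imp_inj_on]
      by (intro inj_onI) (elim PlusE, auto dest: inj_onD)
    ultimately show ?thesis using that unfolding bij_betw_def by simp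
  qed
  show ?thesis
    by (rule bisp_isoI[of "map_sum \<alpha> \<alpha>'" _ _ "map_sum \<beta> \<beta>'"])
      (use m m' in \<open>auto simp: sum_bisp_def bisp_iso_maps_def eqv_map_sum elts_gset_sum bij\<close>)
qed

lemma pull_sum_bisp:
  assumes wf: "wf_bisp G W X p" "wf_bisp G W Y p'" and i: "eqv G X S i" and j: "eqv G Y S j"
    and S: "is_sum X Y S i j"
  shows "bisp_iso G p (pull_bisp (sum_bisp i j p p') X i)" and "bisp_iso G p' (pull_bisp (sum_bisp i j p p') Y j)"
proof -
  note W = wf_bispD[OF wf(1)] wf_bispD[OF wf(2)]
  have inj: "\<And>x x'. \<lbrakk>x \<in> elts X; x' \<in> elts X\<rbrakk> \<Longrightarrow> i x = i x' \<longleftrightarrow> x = x'" "\<And>y y'. \<lbrakk>y \<in> elts Y; y' \<in> elts Y\<rbrakk> \<Longrightarrow> j y = j y' \<longleftrightarrow> y = y'"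
    and disj: "\<And>x y. \<lbrakk>x \<in> elts X; y \<in> elts Y\<rbrakk> \<Longrightarrow> i x \<noteq> j y" "\<And>x y. \<lbrakk>x \<in> elts X; y \<in> elts Y\<rbrakk> \<Longrightarrow> j y \<noteq> i x"
    using S by (auto simp: joint_bij_def inj_on_def)
  note t = eqv_in[OF W(4)] eqv_in[OF W(5)] eqv_in[OF W(9)] eqv_in[OF W(10)]
  show "bisp_iso G p (pull_bisp (sum_bisp i j p p') X i)"
  proof (rule bisp_isoI[of "\<lambda>a. (Inl a, ptran p (pnorm p a))" _ _ "\<lambda>b. (Inl b, ptran p b)"])
    show "bij_betw (\<lambda>a. (Inl a, ptran p (pnorm p a))) (Src p) (elts (psrc (pull_bisp (sum_bisp i j p p') X i)))"
      by (rule bij_betw_byWitness[of _ "\<lambda>z. projl (fst z)"])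
        (auto simp: pull_bisp_def sum_bisp_def elts_gset_sum fibre_product_def t inj disj)
    show "bij_betw (\<lambda>b. (Inl b, ptran p b)) (Tgt p) (elts (ptgt (pull_bisp (sum_bisp i j p p') X i)))"
      by (rule bij_betw_byWitness[of _ "\<lambda>z. projl (fst z)"])
        (auto simp: pull_bisp_def sum_bisp_def elts_gset_sum fibre_product_def t inj disj)
  qed (auto simp: pull_bisp_def sum_bisp_def eqv_def t eqv_act[OF W(4)] eqv_act[OF W(5)])
  show "bisp_iso G p' (pull_bisp (sum_bisp i j p p') Y j)"
  proof (rule bisp_isoI[of "\<lambda>a. (Inr a, ptran p' (pnorm p' a))" _ _ "\<lambda>b. (Inr b, ptran p' b)"])
    show "bij_betw (\<lambda>a. (Inr a, ptran p' (pnorm p' a))) (Src p') (elts (psrc (pull_bisp (sum_bisp i j p p') Y j)))"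
      by (rule bij_betw_byWitness[of _ "\<lambda>z. projr (fst z)"])
        (auto simp: pull_bisp_def sum_bisp_def elts_gset_sum fibre_product_def t inj disj)
    show "bij_betw (\<lambda>b. (Inr b, ptran p' b)) (Tgt p') (elts (ptgt (pull_bisp (sum_bisp i j p p') Y j)))"
      by (rule bij_betw_byWitness[of _ "\<lambda>z. projr (fst z)"])
        (auto simp: pull_bisp_def sum_bisp_def elts_gset_sum fibre_product_def t inj disj)
  qed (auto simp: pull_bisp_def sum_bisp_def eqv_def t eqv_act[OF W(9)] eqv_act[OF W(10)])
qed

lemma sum_pull_bisp:
  assumes wf: "wf_bisp G W S p" and X: "is_gset G X" and Y: "is_gset G Y" and i: "eqv G X S i" and j: "eqv G Y S j"
    and S: "is_sum X Y S i j"
  shows "bisp_iso G (sum_bisp i j (pull_bisp p X i) (pull_bisp p Y j)) p"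
proof -
  note P = wf_bispD[OF wf]
  have inj: "\<And>x x'. \<lbrakk>x \<in> elts X; x' \<in> elts X\<rbrakk> \<Longrightarrow> i x = i x' \<longleftrightarrow> x = x'" "\<And>y y'. \<lbrakk>y \<in> elts Y; y' \<in> elts Y\<rbrakk> \<Longrightarrow> j y = j y' \<longleftrightarrow> y = y'"
    and disj: "\<And>x y. \<lbrakk>x \<in> elts X; y \<in> elts Y\<rbrakk> \<Longrightarrow> i x \<noteq> j y" "\<And>x y. \<lbrakk>x \<in> elts X; y \<in> elts Y\<rbrakk> \<Longrightarrow> j y \<noteq> i x"
    using S by (auto simp: joint_bij_def inj_on_def)
  have bij: "bij_betw (case_sum fst fst) (elts (fibre_product A X f i) <+> elts (fibre_product A Y f j)) (elts A)"
    if f: "\<And>a. a \<in> elts A \<Longrightarrow> f a \<in> elts S" for A :: "('g, 'h) gset" and f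
    unfolding bij_betw_def
  proof
    show "inj_on (case_sum fst fst) (elts (fibre_product A X f i) <+> elts (fibre_product A Y f j))"
      by (rule inj_onI) (auto simp: fibre_product_def inj disj)
    show "case_sum fst fst ` (elts (fibre_product A X f i) <+> elts (fibre_product A Y f j)) = elts A"
    proof
      show "case_sum fst fst ` (elts (fibre_product A X f i) <+> elts (fibre_product A Y f j)) \<subseteq> elts A"
        by (auto simp: fibre_product_def)
      show "elts A \<subseteq> case_sum fst fst ` (elts (fibre_product A X f i) <+> elts (fibre_product A Y f j))"
      proof
        fix a assume a: "a \<in> elts A"
        show "a \<in> case_sum fst fst ` (elts (fibre_product A X f i) <+> elts (fibre_product A Y f j))"
          using S f[OF a]
        proof (cases rule: joint_bijE)
          case (1 x)
          then show ?thesis using a by (intro image_eqI[of _ _ "Inl (a, x)"]) auto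
        next
          case (2 y)
          then show ?thesis using a by (intro image_eqI[of _ _ "Inr (a, y)"]) auto
        qed
      qed
    qed
  qed
  show ?thesis
  proof (rule bisp_isoI[of "case_sum fst fst" _ _ "case_sum fst fst"])
    show "bij_betw (case_sum fst fst) (elts (psrc (sum_bisp i j (pull_bisp p X i) (pull_bisp p Y j)))) (Src p)"
      using bij[of "psrc p" "\<lambda>a. ptran p (pnorm p a)"] P by (simp add: sum_bisp_def pull_bisp_def elts_gset_sum eqv_in)
    show "bij_betw (case_sum fst fst) (elts (ptgt (sum_bisp i j (pull_bisp p X i) (pull_bisp p Y j)))) (Tgt p)"
      using bij[of "ptgt p" "ptran p"] P by (simp add: sum_bisp_def pull_bisp_def elts_gset_sum eqv_in)
  qed (auto simp: sum_bisp_def pull_bisp_def eqv_gset_sum eqv_fst elts_gset_sum fibre_product_elts)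
qed

text \<open>Every bispan into a disjoint union splits according to the summand that its last map hits, so a bispan into it
  amounts to a pair of bispans, obtained by pulling back to the summands.\<close>

lemma is_product_bispan_cat:
  fixes X Y S :: "('g, 'u::infinite) gset"
  assumes o: "X \<in> Fin G" "Y \<in> Fin G" "S \<in> Fin G" and i: "eqv G X S i" and j: "eqv G Y S j"
    and S: "is_sum X Y S i j"
  shows "is_product (bispan_cat G) X Y S (rst G X S i) (rst G Y S j)"
  unfolding is_product_def Obj_bispan_cat
proof (intro conjI ballI)
  note gs = o[THEN Fin_gset]
  fix T and a b assume T: "T \<in> Fin G" and a: "a \<in> BHom G T X" and b: "b \<in> BHom G T Y"
  obtain p :: "('g, 'u) ubisp" where p: "wf_bisp G T X p" "a = cls G T X p" using a by (rule Hom_bispan_catE)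
  obtain p' :: "('g, 'u) ubisp" where p': "wf_bisp G T Y p'" "b = cls G T Y p'" using b by (rule Hom_bispan_catE)
  have wf: "wf_bisp G T S (sum_bisp i j p p')" by (rule wf_sum_bisp[OF p(1) p'(1) i j])
  note ps = pull_sum_bisp[OF p(1) p'(1) i j S]
  show "\<exists>!u. u \<in> BHom G T S \<and> BComp G T S X (rst G X S i) u = a \<and> BComp G T S Y (rst G Y S j) u = b"
  proof (rule ex1I[of _ "cls G T S (sum_bisp i j p p')"])
    show "cls G T S (sum_bisp i j p p') \<in> BHom G T S \<and> BComp G T S X (rst G X S i) (cls G T S (sum_bisp i j p p')) = a
       \<and> BComp G T S Y (rst G Y S j) (cls G T S (sum_bisp i j p p')) = b"
      using comp_res_bispan[OF T o(3,1) wf i] comp_res_bispan[OF T o(3,2) wf j]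
        cls_eq[OF p(1) wf_pull_bisp[OF wf gs(1) i]] cls_eq[OF p'(1) wf_pull_bisp[OF wf gs(2) j]] ps p(2) p'(2) cls_in_Hom[OF wf]
      by simp
    fix u assume u: "u \<in> BHom G T S \<and> BComp G T S X (rst G X S i) u = a \<and> BComp G T S Y (rst G Y S j) u = b"
    then obtain r :: "('g, 'u) ubisp" where r: "wf_bisp G T S r" "u = cls G T S r" using Hom_bispan_catE by metis
    note wr = wf_pull_bisp[OF r(1) gs(1) i] wf_pull_bisp[OF r(1) gs(2) j]
    have "bisp_iso G (pull_bisp r X i) p" "bisp_iso G (pull_bisp r Y j) p'"
      using u r(2) p(2) p'(2) comp_res_bispan[OF T o(3,1) r(1) i] comp_res_bispan[OF T o(3,2) r(1) j] cls_eq[OF wr(1) p(1)] cls_eq[OF wr(2) p'(1)]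
      by auto
    from sum_bisp_iso[OF this wr] have "cls G T S (sum_bisp i j (pull_bisp r X i) (pull_bisp r Y j)) = cls G T S (sum_bisp i j p p')"
      using cls_eq[OF wf_sum_bisp[OF wr i j] wf] by simp
    moreover have "cls G T S (sum_bisp i j (pull_bisp r X i) (pull_bisp r Y j)) = u"
      using sum_pull_bisp[OF r(1) gs(1,2) i j S] cls_eq[OF wf_sum_bisp[OF wr i j] r(1)] r(2) by simp
    ultimately show "u = cls G T S (sum_bisp i j p p')" by simp
  qed
qed (simp_all add: o i j rst_in_Hom)

lemma is_terminal_bispan_cat:
  fixes T :: "('g, 'u::infinite) gset"
  shows "is_terminal (bispan_cat G) T \<longleftrightarrow> T \<in> Fin G \<and> elts T = {}"
proof
  assume T: "is_terminal (bispan_cat G) T"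
  then have o: "T \<in> Fin G" by (simp add: is_terminal_def)
  obtain E :: "('g, 'u) gset" where E: "E \<in> Fin G" "elts E = {}" by (rule bexE[OF ex_empty_gset])
  have wf: "wf_bisp G E T \<lparr>psrc = E, ptgt = E, pres = id, pnorm = id, ptran = id\<rparr>" "wf_bisp G E T \<lparr>psrc = E, ptgt = T, pres = id, pnorm = id, ptran = id\<rparr>"
    using o E Fin_gset[OF E(1)] Fin_gset[OF o] by (auto simp: wf_bisp_def eqv_def)
  have "\<exists>!f. f \<in> BHom G E T" using T E(1) by (simp add: is_terminal_def)
  then have "bisp_iso G \<lparr>psrc = E, ptgt = E, pres = id, pnorm = id, ptran = id\<rparr> \<lparr>psrc = E, ptgt = T, pres = id, pnorm = id, ptran = id\<rparr>"
    using cls_eq[OF wf] wf[THEN cls_in_Hom] by blast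
  then show "T \<in> Fin G \<and> elts T = {}" using o E(2) unfolding bisp_iso_def bisp_iso_maps_def by (auto simp: bij_betw_def)
next
  assume T: "T \<in> Fin G \<and> elts T = {}"
  have "\<exists>!f. f \<in> BHom G X T" if X: "X \<in> Fin G" for X
  proof -
    let ?p = "\<lparr>psrc = T, ptgt = T, pres = id, pnorm = id, ptran = id\<rparr>"
    have wf: "wf_bisp G X T ?p" using T Fin_gset[of T] by (auto simp: wf_bisp_def eqv_def)
    show ?thesis
    proof (rule ex1I[of _ "cls G X T ?p"])
      show "cls G X T ?p \<in> BHom G X T" by (rule cls_in_Hom[OF wf])
      fix f assume "f \<in> BHom G X T"
      then obtain r :: "('g, 'u) ubisp" where r: "wf_bisp G X T r" "f = cls G X T r" by (rule Hom_bispan_catE)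
      have "Tgt r = {}" using eqv_in[OF wf_bispD(5)[OF r(1)]] T by auto
      moreover have "Src r = {}" using eqv_in[OF wf_bispD(4)[OF r(1)]] calculation by auto
      ultimately have "bisp_iso G r ?p"
        by (intro bisp_isoI[of id _ _ id]) (use T in \<open>auto simp: eqv_def\<close>)
      then show "f = cls G X T ?p" using cls_eq[OF r(1) wf] r(2) by simp
    qed
  qed
  then show "is_terminal (bispan_cat G) T" using T by (simp add: is_terminal_def)
qed

end

section \<open>Product-preserving functors and their addition\<close>

definition prod_functor :: "'g monoid \<Rightarrow> ('g, 'u, 'v) tambara \<Rightarrow> bool" where
  "prod_functor G R \<longleftrightarrow> BFun G R \<and> preserves_finite_products (bispan_cat G) set_cat R"

lemma group_of_surj_hom:
  assumes A: "group A" and surj: "f ` carrier A = carrier B"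
    and mult: "\<And>x y. \<lbrakk>x \<in> carrier A; y \<in> carrier A\<rbrakk> \<Longrightarrow> f (x \<otimes>\<^bsub>A\<^esub> y) = f x \<otimes>\<^bsub>B\<^esub> f y"
    and one: "f \<one>\<^bsub>A\<^esub> = \<one>\<^bsub>B\<^esub>"
  shows "group B"
proof -
  interpret A: group A by fact
  have ex: "\<exists>x\<in>carrier A. y = f x" if "y \<in> carrier B" for y using that surj by blast
  show ?thesis
  proof (rule groupI)
    fix x y assume "x \<in> carrier B" "y \<in> carrier B"
    then obtain a b where "a \<in> carrier A" "b \<in> carrier A" "x = f a" "y = f b" using ex by meson
    then show "x \<otimes>\<^bsub>B\<^esub> y \<in> carrier B" using mult surj by (metis A.m_closed imageI)
  next
    show "\<one>\<^bsub>B\<^esub> \<in> carrier B" using one surj by (metis A.one_closed imageI)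
  next
    fix x y z assume "x \<in> carrier B" "y \<in> carrier B" "z \<in> carrier B"
    then obtain a b c where "a \<in> carrier A" "b \<in> carrier A" "c \<in> carrier A" "x = f a" "y = f b" "z = f c" using ex by meson
    then show "x \<otimes>\<^bsub>B\<^esub> y \<otimes>\<^bsub>B\<^esub> z = x \<otimes>\<^bsub>B\<^esub> (y \<otimes>\<^bsub>B\<^esub> z)" by (simp add: mult[symmetric] A.m_assoc)
  next
    fix x assume "x \<in> carrier B"
    then obtain a where a: "a \<in> carrier A" "x = f a" using ex by meson
    then show "\<one>\<^bsub>B\<^esub> \<otimes>\<^bsub>B\<^esub> x = x" by (simp add: one[symmetric] mult[symmetric])
    have "f (inv\<^bsub>A\<^esub> a) \<otimes>\<^bsub>B\<^esub> x = \<one>\<^bsub>B\<^esub>" using a by (simp add: one[symmetric] mult[symmetric])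
    then show "\<exists>y\<in>carrier B. y \<otimes>\<^bsub>B\<^esub> x = \<one>\<^bsub>B\<^esub>" using a surj by (metis A.inv_closed imageI)
  qed
qed

context plain_group
begin

lemma apply_in:
  assumes "BFun G R" "X \<in> Fin G" "Y \<in> Fin G" "f \<in> BHom G X Y" "x \<in> on_obj R X"
  shows "on_hom R X Y f x \<in> on_obj R Y"
  using functor_hom[OF assms(1), of X Y f] assms(2-) by (auto simp: set_cat_def)

lemma apply_comp:
  assumes "BFun G R" "X \<in> Fin G" "Y \<in> Fin G" "Z \<in> Fin G"
    "f \<in> BHom G X Y" "g \<in> BHom G Y Z" "x \<in> on_obj R X"
  shows "on_hom R X Z (BComp G X Y Z g f) x = on_hom R Y Z g (on_hom R X Y f x)"
  using functor_compose[OF assms(1), of X Y Z f g] assms(2-) by (simp add: set_cat_def compose_def)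

lemma apply_id:
  assumes "BFun G R" "X \<in> Fin G" "x \<in> on_obj R X"
  shows "on_hom R X X (BId G X) x = x"
  using functor_ident[OF assms(1), of X] assms(2-) by (simp add: set_cat_def)

lemma prod_functor_functor: "prod_functor G R \<Longrightarrow> BFun G R"
  by (simp add: prod_functor_def)

lemma prod_functor_join:
  fixes X Y S :: "('g, 'u::infinite) gset"
  assumes R: "prod_functor G R" and o: "X \<in> Fin G" "Y \<in> Fin G" "S \<in> Fin G"
    and "eqv G X S i" "eqv G Y S j" "is_sum X Y S i j"
    and "x \<in> on_obj R X" "y \<in> on_obj R Y"
  shows "\<exists>!s. s \<in> on_obj R S \<and> on_hom R S X (rst G X S i) s = x \<and> on_hom R S Y (rst G Y S j) s = y"
  using is_product_bispan_cat[OF o assms(5-7)] R assms(8,9)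
  unfolding prod_functor_def preserves_finite_products_def is_product_set_cat by blast

lemma prod_functor_empty:
  fixes E :: "('g, 'u::infinite) gset"
  assumes R: "prod_functor G R" and "E \<in> Fin G" "elts E = {}"
  shows "\<exists>x. on_obj R E = {x}"
  using assms unfolding prod_functor_def preserves_finite_products_def is_terminal_bispan_cat is_terminal_set_cat by blast

lemma prod_functorI:
  fixes R :: "('g, 'u::infinite, 'v) tambara"
  assumes R: "BFun G R"
    and empty: "\<And>E. \<lbrakk>E \<in> Fin G; elts E = {}\<rbrakk> \<Longrightarrow> \<exists>x. on_obj R E = {x}"
    and prod: "\<And>X Y. \<lbrakk>X \<in> Fin G; Y \<in> Fin G\<rbrakk> \<Longrightarrow>
      \<exists>S i j. S \<in> Fin G \<and> eqv G X S i \<and> eqv G Y S j \<and> is_sum X Y S i j \<and>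
        (\<forall>x\<in>on_obj R X. \<forall>y\<in>on_obj R Y. \<exists>!s. s \<in> on_obj R S \<and> on_hom R S X (rst G X S i) s = x \<and> on_hom R S Y (rst G Y S j) s = y)"
  shows "prod_functor G R"
  unfolding prod_functor_def preserves_finite_products_def
proof (intro conjI allI impI R)
  fix T :: "('g, 'u) gset" assume "is_terminal (bispan_cat G) T"
  then show "is_terminal set_cat (on_obj R T)"
    using empty unfolding is_terminal_bispan_cat is_terminal_set_cat by blast
next
  fix X Y P :: "('g, 'u) gset" and p q assume P: "is_product (bispan_cat G) X Y P p q"
  then have o: "X \<in> Fin G" "Y \<in> Fin G" by (auto simp: is_product_def)
  obtain S i j where S: "S \<in> Fin G" "eqv G X S i" "eqv G Y S j" "is_sum X Y S i j"
    and j: "\<forall>x\<in>on_obj R X. \<forall>y\<in>on_obj R Y. \<exists>!s. s \<in> on_obj R S \<and> on_hom R S X (rst G X S i) s = x \<and> on_hom R S Y (rst G Y S j) s = y"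
    using prod[OF o] by blast
  have "is_product set_cat (on_obj R X) (on_obj R Y) (on_obj R S) (on_hom R S X (rst G X S i)) (on_hom R S Y (rst G Y S j))"
    unfolding is_product_set_cat
    using j functor_hom[OF R, of S X "rst G X S i"] functor_hom[OF R, of S Y "rst G Y S j"] rst_in_Hom[of X S i] rst_in_Hom[of Y S j] S o
    by (simp add: set_cat_def)
  then show "is_product set_cat (on_obj R X) (on_obj R Y) (on_obj R P) (on_hom R P X p) (on_hom R P Y q)"
    by (rule set_functor_product_transfer[OF category_bispan_cat R is_product_bispan_cat[OF o S] _ P])
qed

lemma trn_rst_bij:
  fixes S T :: "('g, 'u::infinite) gset"
  assumes o: "S \<in> Fin G" "T \<in> Fin G" and u: "eqv G S T u" "bij_betw u (elts S) (elts T)"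
  shows "BComp G T S T (trn G S T u) (rst G S T u) = BId G T"
proof -
  have "BComp G T T T (rst G T T (\<lambda>x. x)) (trn G T T (\<lambda>x. x)) = BComp G T S T (trn G S T u) (rst G S T u)"
  proof (rule base_change)
    fix a x assume "a \<in> elts T" "x \<in> elts T" "a = x"
    then have "a \<in> u ` elts S" by (simp add: bij_betw_imp_surj_on[OF u(2)])
    then obtain z where "z \<in> elts S" "u z = a" by blast
    then show "\<exists>!z. z \<in> elts S \<and> u z = a \<and> u z = x"
      using \<open>a = x\<close> bij_betw_imp_inj_on[OF u(2)] by (auto dest: inj_onD)
  qed (use o u in \<open>auto simp: eqv_id\<close>)
  then show ?thesis using o category_ident_left[OF category_bispan_cat, of T T] category_ident_in[OF category_bispan_cat, of T]
    by (simp add: rst_id trn_id)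
qed

text \<open>Two choices of the coproduct are compared by a bijection \<open>u\<close>; transfer along \<open>u\<close> is inverse to restriction along
  \<open>u\<close>, so the sum computed with one choice equals the sum computed with the other.\<close>

lemma tambara_add_eq:
  fixes X S :: "('g, 'u::infinite) gset"
  assumes R: "prod_functor G R" and o: "X \<in> Fin G" "S \<in> Fin G"
    and ij: "i \<in> EMap G X S" "j \<in> EMap G X S" and S: "is_sum X X S i j"
    and h: "h \<in> EMap G S X" "\<And>x. x \<in> elts X \<Longrightarrow> h (i x) = x" "\<And>x. x \<in> elts X \<Longrightarrow> h (j x) = x"
    and s: "s \<in> on_obj R S" "on_hom R S X (rst G X S i) s = a" "on_hom R S X (rst G X S j) s = b"
  shows "tambara_add G R X a b = on_hom R S X (trn G S X h) s"
  unfolding tambara_add_def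
proof (rule the_equality)
  note F = prod_functor_functor[OF R]
  note ijh = ij[THEN EMap_eqv] h(1)[THEN EMap_eqv]
  have "is_coproduct (gset_cat G) X X S i j" using o ij S by (simp add: is_coproduct_gset_cat)
  moreover have "compose (elts X) h i = (\<lambda>x\<in>elts X. x)" "compose (elts X) h j = (\<lambda>x\<in>elts X. x)"
    using h by (auto simp: compose_def fun_eq_iff)
  moreover have "restriction G X S i = rst G X S i" "restriction G X S j = rst G X S j" "transfer G S X h = trn G S X h"
    using restriction_eq_rst[OF o(1)] transfer_eq_trn[OF o(2)] ij h by auto
  ultimately show "\<exists>S' i' j' h' s'. is_coproduct (gset_cat G) X X S' i' j' \<and> h' \<in> EMap G S' X \<and>
        compose (elts X) h' i' = (\<lambda>x\<in>elts X. x) \<and> compose (elts X) h' j' = (\<lambda>x\<in>elts X. x) \<and> s' \<in> on_obj R S' \<and>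
        on_hom R S' X (restriction G X S' i') s' = a \<and> on_hom R S' X (restriction G X S' j') s' = b \<and>
        on_hom R S X (trn G S X h) s = on_hom R S' X (transfer G S' X h') s'"
    using h(1) s by (intro exI[of _ S] exI[of _ i] exI[of _ j] exI[of _ h] exI[of _ s]) simp
  fix c assume "\<exists>S' i' j' h' s'. is_coproduct (gset_cat G) X X S' i' j' \<and> h' \<in> EMap G S' X \<and>
        compose (elts X) h' i' = (\<lambda>x\<in>elts X. x) \<and> compose (elts X) h' j' = (\<lambda>x\<in>elts X. x) \<and> s' \<in> on_obj R S' \<and>
        on_hom R S' X (restriction G X S' i') s' = a \<and> on_hom R S' X (restriction G X S' j') s' = b \<and>
        c = on_hom R S' X (transfer G S' X h') s'"
  then obtain S' i' j' h' s' where S': "is_coproduct (gset_cat G) X X S' i' j'" and h'm: "h' \<in> EMap G S' X"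
      and h'i: "compose (elts X) h' i' = (\<lambda>x\<in>elts X. x)" "compose (elts X) h' j' = (\<lambda>x\<in>elts X. x)" and s': "s' \<in> on_obj R S'"
        "on_hom R S' X (restriction G X S' i') s' = a" "on_hom R S' X (restriction G X S' j') s' = b"
      and c: "c = on_hom R S' X (transfer G S' X h') s'" by (elim exE conjE) (rule that)
  have S'o: "S' \<in> Fin G" and ij': "i' \<in> EMap G X S'" "j' \<in> EMap G X S'"
    and jb': "is_sum X X S' i' j'" using S' by (auto simp: is_coproduct_gset_cat)
  note ijh' = ij'[THEN EMap_eqv] h'm[THEN EMap_eqv]
  have "is_coproduct (gset_cat G) X X S i j" using o ij S by (simp add: is_coproduct_gset_cat)
  then have "\<exists>!u. u \<in> EMap G S S' \<and> compose (elts X) u i = i' \<and> compose (elts X) u j = j'"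
    using S'o ij' by (simp add: is_coproduct_def gset_cat_def)
  then obtain u where um: "u \<in> EMap G S S'" and ui: "compose (elts X) u i = i'" "compose (elts X) u j = j'" by blast
  have u: "eqv G S S' u" using um by (rule EMap_eqv)
  have ui': "u (i x) = i' x" "u (j x) = j' x" if "x \<in> elts X" for x
    using fun_cong[OF ui(1), of x] fun_cong[OF ui(2), of x] that by (simp_all add: compose_def)
  have hi': "h' (i' x) = x" "h' (j' x) = x" if "x \<in> elts X" for x
    using fun_cong[OF h'i(1), of x] fun_cong[OF h'i(2), of x] that by (simp_all add: compose_def)
  have hu: "h' (u z) = h z" if z: "z \<in> elts S" for z
    by (rule joint_bijE[OF S z]) (simp_all add: ui' hi' h)
  have ub: "bij_betw u (elts S) (elts S')"
  proof (rule bij_betw_imageI)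
    have inj: "\<And>x y. \<lbrakk>x \<in> elts X; y \<in> elts X\<rbrakk> \<Longrightarrow> i' x = i' y \<longleftrightarrow> x = y" "\<And>x y. \<lbrakk>x \<in> elts X; y \<in> elts X\<rbrakk> \<Longrightarrow> j' x = j' y \<longleftrightarrow> x = y"
      "\<And>x y. \<lbrakk>x \<in> elts X; y \<in> elts X\<rbrakk> \<Longrightarrow> i' x \<noteq> j' y" "\<And>x y. \<lbrakk>x \<in> elts X; y \<in> elts X\<rbrakk> \<Longrightarrow> j' x \<noteq> i' y"
      using jb' by (auto simp: joint_bij_def inj_on_def)
    show "inj_on u (elts S)"
    proof (rule inj_onI)
      fix z w assume z: "z \<in> elts S" and w: "w \<in> elts S" and eq: "u z = u w"
      show "z = w"
        by (rule joint_bijE[OF S z]; rule joint_bijE[OF S w]) (use eq in \<open>simp_all add: ui' inj\<close>)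
    qed
    show "u ` elts S = elts S'"
    proof
      show "u ` elts S \<subseteq> elts S'" using eqv_in[OF u] by blast
      show "elts S' \<subseteq> u ` elts S"
      proof
        fix z assume z: "z \<in> elts S'"
        show "z \<in> u ` elts S"
          by (rule joint_bijE[OF jb' z])
            (use ui' eqv_in[OF ijh(1)] eqv_in[OF ijh(2)] in \<open>metis imageI\<close>)+
      qed
    qed
  qed
  have rs: "restriction G X S' i' = rst G X S' i'" "restriction G X S' j' = rst G X S' j'" "transfer G S' X h' = trn G S' X h'"
    using restriction_eq_rst[OF o(1)] transfer_eq_trn[OF S'o] ij' h'm by auto
  let ?t = "on_hom R S' S (rst G S S' u) s'"
  have t: "?t \<in> on_obj R S" using apply_in[OF F S'o o(2) rst_in_Hom[OF o(2) u] s'(1)] .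
  have ti: "on_hom R S X (rst G X S k) ?t = on_hom R S' X (rst G X S' k') s'"
    if k: "eqv G X S k" "eqv G X S' k'" "\<And>x. x \<in> elts X \<Longrightarrow> u (k x) = k' x" for k k'
  proof -
    have "on_hom R S X (rst G X S k) ?t = on_hom R S' X (rst G X S' (\<lambda>x. u (k x))) s'"
      using apply_comp[OF F S'o o(2,1) rst_in_Hom[OF o(2) u] rst_in_Hom[OF o(1) k(1)] s'(1)] rst_comp[OF o S'o k(1) u] by simp
    also have "rst G X S' (\<lambda>x. u (k x)) = rst G X S' k'"
      by (rule rst_cong[OF o(1) eqv_comp'[OF k(1) u] k(2,3)])
    finally show ?thesis .
  qed
  have "\<exists>!s. s \<in> on_obj R S \<and> on_hom R S X (rst G X S i) s = a \<and> on_hom R S X (rst G X S j) s = b"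
    using apply_in[OF F o(2,1) rst_in_Hom[OF o(1) ijh(1)] s(1)] apply_in[OF F o(2,1) rst_in_Hom[OF o(1) ijh(2)] s(1)] s
    by (intro prod_functor_join[OF R o(1,1,2) ijh(1,2) S]) auto
  moreover have "on_hom R S X (rst G X S i) ?t = a" "on_hom R S X (rst G X S j) ?t = b"
    using ti[OF ijh(1) ijh'(1) ui'(1)] ti[OF ijh(2) ijh'(2) ui'(2)] s' rs by auto
  ultimately have "?t = s" using s t by blast
  have "on_hom R S X (trn G S X h) s = on_hom R S X (BComp G S S' X (trn G S' X h') (trn G S S' u)) s"
  proof -
    have "trn G S X h = trn G S X (\<lambda>x. h' (u x))" by (rule trn_cong[OF o(2) ijh(3) eqv_comp'[OF u ijh'(3)]]) (simp add: hu)
    then show ?thesis using trn_comp[OF o(2) S'o o(1) u ijh'(3)] by simp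
  qed
  also have "\<dots> = on_hom R S' X (trn G S' X h') (on_hom R S S' (trn G S S' u) ?t)"
    using apply_comp[OF F o(2) S'o o(1) trn_in_Hom[OF o(2) u] trn_in_Hom[OF S'o ijh'(3)] s(1)] \<open>?t = s\<close> by simp
  also have "on_hom R S S' (trn G S S' u) ?t = s'"
    using apply_comp[OF F S'o o(2) S'o rst_in_Hom[OF o(2) u] trn_in_Hom[OF o(2) u] s'(1)] trn_rst_bij[OF o(2) S'o u ub]
      apply_id[OF F S'o s'(1)] by simp
  finally show "c = on_hom R S X (trn G S X h) s" using c rs by simp
qed

lemma tambara_zero_eq:
  fixes X E :: "('g, 'u::infinite) gset"
  assumes R: "prod_functor G R" and o: "X \<in> Fin G" "E \<in> Fin G" "elts E = {}" and s: "s \<in> on_obj R E"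
    and h: "eqv G E X h"
  shows "tambara_zero G R X = on_hom R E X (trn G E X h) s"
  unfolding tambara_zero_def
proof (rule the_equality)
  note F = prod_functor_functor[OF R]
  have tr: "transfer G I X h' = trn G I X h'" if "I \<in> Fin G" "h' \<in> EMap G I X" for I h'
    by (rule transfer_eq_trn[OF that])
  have hm: "restrict h (elts E) \<in> EMap G E X" by (rule restrict_equivariant_maps[OF Fin_gset[OF o(2)] h])
  have "trn G E X (restrict h (elts E)) = trn G E X h" by (rule trn_cong[OF o(2) EMap_eqv[OF hm] h]) simp
  then show "\<exists>I h' s'. is_initial (gset_cat G) I \<and> h' \<in> EMap G I X \<and> s' \<in> on_obj R I \<and>
      on_hom R E X (trn G E X h) s = on_hom R I X (transfer G I X h') s'"
    using o hm s tr[OF o(2) hm] by (intro exI[of _ E] exI[of _ "restrict h (elts E)"] exI[of _ s]) (simp add: is_initial_gset_cat)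
  fix z assume "\<exists>I h' s'. is_initial (gset_cat G) I \<and> h' \<in> EMap G I X \<and> s' \<in> on_obj R I \<and> z = on_hom R I X (transfer G I X h') s'"
  then obtain I h' s' where I: "I \<in> Fin G" "elts I = {}" and h': "h' \<in> EMap G I X" and s': "s' \<in> on_obj R I"
    and z: "z = on_hom R I X (transfer G I X h') s'" by (auto simp: is_initial_gset_cat)
  note h'e = EMap_eqv[OF h']
  have u: "eqv G I E id" using I by (simp add: eqv_def)
  have "trn G I X h' = trn G I X (\<lambda>x. h (id x))" by (rule trn_cong[OF I(1) h'e eqv_comp'[OF u h]]) (use I in simp)
  then have "z = on_hom R E X (trn G E X h) (on_hom R I E (trn G I E id) s')"
    using z tr[OF I(1) h'] trn_comp[OF I(1) o(2,1) u h] apply_comp[OF F I(1) o(2,1) trn_in_Hom[OF I(1) u] trn_in_Hom[OF o(2) h] s'] by simp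
  moreover have "on_hom R I E (trn G I E id) s' \<in> on_obj R E" by (rule apply_in[OF F I(1) o(2) trn_in_Hom[OF I(1) u] s'])
  ultimately show "z = on_hom R E X (trn G E X h) s" using prod_functor_empty[OF R o(2,3)] s by auto
qed

lemma ex_fold:
  fixes X S :: "('g, 'u::infinite) gset"
  assumes "is_coproduct (gset_cat G) X X S i j"
  shows "\<exists>h\<in>EMap G S X. (\<forall>x\<in>elts X. h (i x) = x \<and> h (j x) = x)"
proof -
  have X: "X \<in> Fin G" using assms by (simp add: is_coproduct_gset_cat)
  have "\<exists>!h. h \<in> EMap G S X \<and> compose (elts X) h i = (\<lambda>x\<in>elts X. x) \<and> compose (elts X) h j = (\<lambda>x\<in>elts X. x)"
    using assms X ident_equivariant_maps[OF Fin_gset[OF X]] by (simp add: is_coproduct_def gset_cat_def)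
  then obtain h where h: "h \<in> EMap G S X" "compose (elts X) h i = (\<lambda>x\<in>elts X. x)" "compose (elts X) h j = (\<lambda>x\<in>elts X. x)" by blast
  have "h (i x) = x \<and> h (j x) = x" if "x \<in> elts X" for x
    using fun_cong[OF h(2), of x] fun_cong[OF h(3), of x] that by (simp add: compose_def)
  then show ?thesis using h(1) by blast
qed

end

text \<open>A map \<open>f\<close> of underlying sets that lifts to the sum objects compatibly with restrictions and fold transfers is
  additive; being a group passes along a surjective additive map.\<close>

lemma additive_group_transfer:
  fixes G :: "'g monoid" and K :: "'k monoid" and X S E :: "('g, 'u::infinite) gset" and Y S' E' :: "('k, 'w::infinite) gset"
  assumes G: "plain_group G" and K: "plain_group K" and R: "prod_functor G R" and T: "prod_functor K T"
    and cp: "is_coproduct (gset_cat G) X X S i j" and cp': "is_coproduct (gset_cat K) Y Y S' i' j'"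
    and h: "h \<in> EMap G S X" "\<And>x. x \<in> elts X \<Longrightarrow> h (i x) = x \<and> h (j x) = x"
    and h': "h' \<in> EMap K S' Y" "\<And>x. x \<in> elts Y \<Longrightarrow> h' (i' x) = x \<and> h' (j' x) = x"
    and E: "E \<in> Fin G" "elts E = {}" "z \<in> on_obj R E" and E': "E' \<in> Fin K" "elts E' = {}" "z' \<in> on_obj T E'"
    and surj: "f ` on_obj R X = on_obj T Y"
    and fS: "\<And>s. s \<in> on_obj R S \<Longrightarrow> fS s \<in> on_obj T S' \<and> on_hom T S' Y (rst K Y S' i') (fS s) = f (on_hom R S X (rst G X S i) s) \<and>
       on_hom T S' Y (rst K Y S' j') (fS s) = f (on_hom R S X (rst G X S j) s) \<and>
       on_hom T S' Y (trn K S' Y h') (fS s) = f (on_hom R S X (trn G S X h) s)"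
    and fz: "f (on_hom R E X (trn G E X id) z) = on_hom T E' Y (trn K E' Y id) z'"
    and grp: "group (additive_monoid G R X)"
  shows "group (additive_monoid K T Y)"
proof -
  interpret G: plain_group G by fact
  interpret K: plain_group K by fact
  have o: "X \<in> Fin G" "S \<in> Fin G" and ij: "i \<in> EMap G X S" "j \<in> EMap G X S"
    and jb: "is_sum X X S i j" using cp by (auto simp: G.is_coproduct_gset_cat)
  have o': "Y \<in> Fin K" "S' \<in> Fin K" and ij': "i' \<in> EMap K Y S'" "j' \<in> EMap K Y S'"
    and jb': "is_sum Y Y S' i' j'" using cp' by (auto simp: K.is_coproduct_gset_cat)
  show ?thesis
  proof (rule group_of_surj_hom[OF grp, of f])
    show "f ` carrier (additive_monoid G R X) = carrier (additive_monoid K T Y)" using surj by (simp add: additive_monoid_def)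
    have "tambara_zero G R X = on_hom R E X (trn G E X id) z"
      by (rule G.tambara_zero_eq[OF R o(1) E]) (simp add: eqv_def E(2))
    moreover have "tambara_zero K T Y = on_hom T E' Y (trn K E' Y id) z'"
      by (rule K.tambara_zero_eq[OF T o'(1) E']) (simp add: eqv_def E'(2))
    ultimately show "f \<one>\<^bsub>additive_monoid G R X\<^esub> = \<one>\<^bsub>additive_monoid K T Y\<^esub>" using fz by (simp add: additive_monoid_def)
    fix a b assume "a \<in> carrier (additive_monoid G R X)" "b \<in> carrier (additive_monoid G R X)"
    then have ab: "a \<in> on_obj R X" "b \<in> on_obj R X" by (simp_all add: additive_monoid_def)
    have "\<exists>!s. s \<in> on_obj R S \<and> on_hom R S X (rst G X S i) s = a \<and> on_hom R S X (rst G X S j) s = b"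
      by (rule G.prod_functor_join[OF R o(1,1,2) ij[THEN EMap_eqv] jb ab])
    then obtain s where s: "s \<in> on_obj R S" "on_hom R S X (rst G X S i) s = a" "on_hom R S X (rst G X S j) s = b" by blast
    have "tambara_add G R X a b = on_hom R S X (trn G S X h) s"
      by (rule G.tambara_add_eq[OF R o ij jb h(1) _ _ s]) (use h(2) in auto)
    moreover have "tambara_add K T Y (f a) (f b) = on_hom T S' Y (trn K S' Y h') (fS s)"
      by (rule K.tambara_add_eq[OF T o' ij' jb' h'(1)]) (use h'(2) fS[OF s(1)] s(2,3) in auto)
    ultimately show "f (a \<otimes>\<^bsub>additive_monoid G R X\<^esub> b) = f a \<otimes>\<^bsub>additive_monoid K T Y\<^esub> f b"
      using fS[OF s(1)] by (simp add: additive_monoid_def)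
  qed
qed

section \<open>Restriction to a subgroup and coinduction\<close>

locale subgroup_pair = plain_group G for G :: "'g monoid" (structure) +
  fixes H :: "'g set"
  assumes sub: "subgroup H G" and fin: "finite (carrier G)"

sublocale subgroup_pair \<subseteq> K: plain_group "G\<lparr>carrier := H\<rparr>"
  unfolding plain_group_def using subgroup.subgroup_is_group[OF sub group_axioms] .

context subgroup_pair
begin

abbreviation K :: "'g monoid" where "K \<equiv> G\<lparr>carrier := H\<rparr>"

lemma H_sub: "h \<in> H \<Longrightarrow> h \<in> carrier G"
  using subgroup.subset[OF sub] by blast

lemma is_gset_sub: "is_gset G X \<Longrightarrow> is_gset K X"
  unfolding is_gset_def using H_sub by auto

lemma eqv_sub: "eqv G X Y f \<Longrightarrow> eqv K X Y f"
  unfolding eqv_def using H_sub by auto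

lemma wf_bisp_sub: "wf_bisp G X Y p \<Longrightarrow> wf_bisp K X Y p"
  unfolding wf_bisp_def by (auto simp: is_gset_sub eqv_sub)

lemma bisp_iso_sub: "bisp_iso G p p' \<Longrightarrow> bisp_iso K p p'"
  unfolding bisp_iso_def bisp_iso_maps_def using eqv_sub by metis

text \<open>The construction of composites does not involve the group beyond its action, so restriction preserves them.\<close>

lemma comp_wit_sub:
  assumes "comp_wit G X Y Z p p' p'' q ev l a" shows "comp_wit K X Y Z p p' p'' q ev l a"
proof -
  interpret W: comp_wit G X Y Z p p' p'' q ev l a by fact
  show ?thesis
    by unfold_locales
      (use H_sub in \<open>simp_all add: wf_bisp_sub W.wf1 W.wf2 W.wf3 eqv_sub W.q_eqv W.l_eqv W.a_eqv W.q_tran W.ev_in W.ev_tran W.ev_act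
        W.section_ex1 W.l_norm W.a_norm W.a_res W.point_ex1\<close>)
qed

lemma elts_res_gset [simp]: "elts (res_gset H X) = elts X"
  by (simp add: res_gset_def)

lemma act_res_gset [simp]: "h \<in> H \<Longrightarrow> act (res_gset H X) h = act X h"
  by (simp add: res_gset_def)

lemma is_gset_res [simp]: "is_gset K (res_gset H X) \<longleftrightarrow> is_gset K X"
  unfolding is_gset_def using subgroup.one_closed[OF sub] subgroup.m_closed[OF sub] by (auto cong: conj_cong)

lemma eqv_res_left [simp]: "eqv K (res_gset H X) Y f \<longleftrightarrow> eqv K X Y f"
  and eqv_res_right [simp]: "eqv K X (res_gset H Y) f \<longleftrightarrow> eqv K X Y f"
  unfolding eqv_def by auto

lemma wf_bisp_res_left [simp]: "wf_bisp K (res_gset H X) Y p \<longleftrightarrow> wf_bisp K X Y p"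
  and wf_bisp_res_right [simp]: "wf_bisp K X (res_gset H Y) p \<longleftrightarrow> wf_bisp K X Y p"
  unfolding wf_bisp_def by auto

lemma res_gset_in: assumes X: "X \<in> Fin G" shows "res_gset H X \<in> Fin K"
proof -
  have "group_action G (elts X) (act X)" using X by (simp add: finite_gsets_def)
  then have "act X g \<in> extensional (elts X)" if "g \<in> carrier G" for g
    using that unfolding group_action_def group_hom_def group_hom_axioms_def hom_def by (auto simp: BijGroup_def Bij_def)
  then have "res_gset H X = (elts X, \<lambda>g\<in>carrier K. \<lambda>x\<in>elts X. act X g x)"
    using H_sub by (auto simp: res_gset_def fun_eq_iff extensional_def)
  then show ?thesis using K.finite_gsets_of_is_gset[OF is_gset_sub[OF Fin_gset[OF X]]] by simp
qed

abbreviation res :: "('g, 'u) gset \<Rightarrow> ('g, 'u) gset" where "res \<equiv> res_gset H"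

abbreviation res_hom :: "('g, 'u) gset \<Rightarrow> ('g, 'u) gset \<Rightarrow> ('g, 'u) bispan set \<Rightarrow> ('g, 'u) bispan set" where
  "res_hom \<equiv> on_hom (res_functor G H)"

text \<open>Bispans of \<open>H\<close>-sets between restricted \<open>G\<close>-sets.\<close>

abbreviation (input) "RHom X Y \<equiv> BHom K (res X) (res Y)"
abbreviation (input) "RComp X Y Z \<equiv> BComp K (res X) (res Y) (res Z)"
abbreviation (input) "rcls X Y \<equiv> cls K (res X) (res Y)"
abbreviation (input) "rrst X Y \<equiv> rst K (res X) (res Y)"
abbreviation (input) "rtrn X Y \<equiv> trn K (res X) (res Y)"

text \<open>The class of bispans of \<open>H\<close>-sets is generated by any single restricted representative.\<close>

lemma res_hom_cls:
  fixes X Y :: "('g, 'u::infinite) gset"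
  assumes o: "X \<in> Fin G" "Y \<in> Fin G" and wf: "wf_bisp G X Y p"
  shows "res_hom X Y (cls G X Y p) = rcls X Y p"
proof -
  have wfK: "wf_bisp K (res X) (res Y) p" using wf by (simp add: wf_bisp_sub)
  have rb: "res_bispan H b \<in> bispans K (res X) (res Y)" if "b \<in> bispans G X Y" for b
    using that H_sub by (auto simp: bispans_def res_bispan_def res_gset_in equivariant_maps_def)
  have iso: "bisp_iso K p (of_bispan (res_bispan H b))" if b: "bisp_iso G p (of_bispan b)" for b
    by (rule bisp_iso_trans[OF bisp_iso_sub[OF b] _ wfK], rule bisp_isoI[of "\<lambda>x. x" _ _ "\<lambda>x. x"])
      (simp_all add: res_bispan_def eqv_id bij_betw_def)
  obtain b0 where b0: "b0 \<in> bispans G X Y" "bisp_iso G p (of_bispan b0)" using ex_bispan_iso[OF wf] by blast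
  have "c \<in> rcls X Y p" if "b \<in> cls G X Y p" "(res_bispan H b, c) \<in> bispan_iso K (res X) (res Y)" for b c
    using that bisp_iso_trans[OF iso _ wfK] by (auto simp: cls_def K.bispan_iso_iff)
  moreover have "(res_bispan H b0, c) \<in> bispan_iso K (res X) (res Y)" if "c \<in> rcls X Y p" for c
  proof -
    have c: "c \<in> bispans K (res X) (res Y)" "bisp_iso K p (of_bispan c)" using that by (simp_all add: cls_def)
    have "bisp_iso K (of_bispan (res_bispan H b0)) (of_bispan c)"
      by (rule bisp_iso_trans[OF K.bisp_iso_sym[OF iso[OF b0(2)] wfK] c(2) wf_of_bispan[OF rb[OF b0(1)]]])
    then show ?thesis using c(1) rb[OF b0(1)] by (simp add: K.bispan_iso_iff)
  qed
  moreover have "b0 \<in> cls G X Y p" using b0 by (simp add: cls_def)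
  ultimately show ?thesis by (auto simp: res_functor_def)
qed

lemma res_hom_rst:
  fixes X Y :: "('g, 'u::infinite) gset"
  assumes o: "X \<in> Fin G" "Y \<in> Fin G" and f: "eqv G X Y f"
  shows "res_hom Y X (rst G X Y f) = rrst X Y f"
proof -
  have "bisp_iso K (res_bisp X f) (res_bisp (res X) f)"
    by (rule bisp_isoI[of "\<lambda>x. x" _ _ "\<lambda>x. x"]) (simp_all add: res_bisp_def eqv_id bij_betw_def)
  moreover have "wf_bisp K (res Y) (res X) (res_bisp X f)" "wf_bisp K (res Y) (res X) (res_bisp (res X) f)"
    using K.wf_res_bisp[OF is_gset_sub[OF Fin_gset[OF o(1)]] eqv_sub[OF f]]
      K.wf_res_bisp[of "res X" Y f] is_gset_sub[OF Fin_gset[OF o(1)]] eqv_sub[OF f] by simp_all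
  ultimately show ?thesis
    using res_hom_cls[OF o(2,1) wf_res_bisp[OF Fin_gset[OF o(1)] f]] K.cls_eq unfolding rst_def by metis
qed

lemma res_hom_trn:
  fixes X Y :: "('g, 'u::infinite) gset"
  assumes o: "X \<in> Fin G" "Y \<in> Fin G" and f: "eqv G X Y f"
  shows "res_hom X Y (trn G X Y f) = rtrn X Y f"
proof -
  have "bisp_iso K (tran_bisp X f) (tran_bisp (res X) f)"
    by (rule bisp_isoI[of "\<lambda>x. x" _ _ "\<lambda>x. x"]) (simp_all add: tran_bisp_def eqv_id bij_betw_def)
  moreover have "wf_bisp K (res X) (res Y) (tran_bisp X f)" "wf_bisp K (res X) (res Y) (tran_bisp (res X) f)"
    using K.wf_tran_bisp[OF is_gset_sub[OF Fin_gset[OF o(1)]] eqv_sub[OF f]]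
      K.wf_tran_bisp[of "res X" Y f] is_gset_sub[OF Fin_gset[OF o(1)]] eqv_sub[OF f] by simp_all
  ultimately show ?thesis
    using res_hom_cls[OF o wf_tran_bisp[OF Fin_gset[OF o(1)] f]] K.cls_eq unfolding trn_def by metis
qed

lemma on_obj_res_functor [simp]: "on_obj (res_functor G H) X = res X"
  by (simp add: res_functor_def)

lemma is_functor_res:
  "is_functor (bispan_cat G) (bispan_cat K) (res_functor G H :: (('g, 'u::infinite) gset, _, _, _) cfunctor)"
  unfolding is_functor_def Obj_bispan_cat K.Obj_bispan_cat on_obj_res_functor
proof (intro conjI ballI)
  fix X :: "('g, 'u) gset" assume X: "X \<in> Fin G"
  show "res X \<in> Fin K" by (rule res_gset_in[OF X])
  show "res_hom X X (BId G X) = BId K (res X)"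
    using res_hom_rst[OF X X eqv_id] X by (simp add: rst_id K.rst_id res_gset_in)
next
  fix X Y :: "('g, 'u) gset" and f assume o: "X \<in> Fin G" "Y \<in> Fin G" and f: "f \<in> BHom G X Y"
  obtain p :: "('g, 'u) ubisp" where p: "wf_bisp G X Y p" "f = cls G X Y p" using f by (rule Hom_bispan_catE)
  show "res_hom X Y f \<in> RHom X Y"
    using p res_hom_cls[OF o p(1)] by (simp add: K.cls_in_Hom wf_bisp_sub)
next
  fix X Y Z :: "('g, 'u) gset" and f g assume o: "X \<in> Fin G" "Y \<in> Fin G" "Z \<in> Fin G"
    and f: "f \<in> BHom G X Y" and g: "g \<in> BHom G Y Z"
  obtain p :: "('g, 'u) ubisp" where p: "wf_bisp G X Y p" "f = cls G X Y p" using f by (rule Hom_bispan_catE)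
  obtain p' :: "('g, 'u) ubisp" where p': "wf_bisp G Y Z p'" "g = cls G Y Z p'" using g by (rule Hom_bispan_catE)
  note W = comp_bisp_wit[OF p(1) p'(1)]
  interpret W: comp_wit K X Y Z p p' "comp_bisp G p p'" fst snd "\<lambda>(w, c, a). c" "\<lambda>(w, c, a). a" by (rule comp_wit_sub[OF W])
  have "comp_wit K (res X) (res Y) (res Z) p p' (comp_bisp G p p') fst snd (\<lambda>(w, c, a). c) (\<lambda>(w, c, a). a)"
    using W.comp_wit_axioms unfolding comp_wit_def comp_wit_axioms_def by simp
  from K.bispan_cat_comp[OF res_gset_in[OF o(1)] res_gset_in[OF o(2)] res_gset_in[OF o(3)] this]
  show "res_hom X Z (BComp G X Y Z g f) = RComp X Y Z (res_hom Y Z g) (res_hom X Y f)"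
    using bispan_cat_comp[OF o W] p p' res_hom_cls[OF o(1,2) p(1)] res_hom_cls[OF o(2,3) p'(1)] res_hom_cls[OF o(1,3) comp_wit.wf3[OF W]] by simp
qed

lemma res_hom_in:
  fixes X Y :: "('g, 'u::infinite) gset"
  shows "\<lbrakk>X \<in> Fin G; Y \<in> Fin G; f \<in> BHom G X Y\<rbrakk> \<Longrightarrow> res_hom X Y f \<in> RHom X Y"
  using functor_hom[OF is_functor_res, of X Y f] by simp

lemma res_hom_comp:
  fixes X Y Z :: "('g, 'u::infinite) gset"
  shows "\<lbrakk>X \<in> Fin G; Y \<in> Fin G; Z \<in> Fin G; f \<in> BHom G X Y; g \<in> BHom G Y Z\<rbrakk> \<Longrightarrow>
    res_hom X Z (BComp G X Y Z g f) = RComp X Y Z (res_hom Y Z g) (res_hom X Y f)"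
  using functor_compose[OF is_functor_res, of X Y Z f g] by simp

lemma coind_obj: "X \<in> Fin G \<Longrightarrow> on_obj (coind G H T) X = on_obj T (res X)"
  by (simp add: coind_def restrict_functor_def functor_comp_def)

lemma coind_hom:
  "\<lbrakk>X \<in> Fin G; Y \<in> Fin G; f \<in> BHom G X Y\<rbrakk> \<Longrightarrow>
    on_hom (coind G H T) X Y f = on_hom T (res X) (res Y) (res_hom X Y f)"
  by (simp add: coind_def restrict_functor_def functor_comp_def)

lemma extensional_coind: "extensional_functor (bispan_cat G) (coind G H T)"
  by (auto simp: extensional_functor_def coind_def restrict_functor_def)

lemma coind_functor:
  fixes T :: "('g, 'u::infinite, 'v) tambara"
  assumes T: "BFun K T"
  shows "BFun G (coind G H T)"
  unfolding is_functor_def Obj_bispan_cat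
proof (intro conjI ballI)
  fix X :: "('g, 'u) gset" assume X: "X \<in> Fin G"
  show "on_obj (coind G H T) X \<in> Obj set_cat" by (simp add: set_cat_def)
  show "on_hom (coind G H T) X X (BId G X) = Ident set_cat (on_obj (coind G H T) X)"
    using X functor_ident[OF is_functor_res, of X] functor_ident[OF T, of "res X"] category_ident_in[OF category_bispan_cat, of X]
    by (simp add: coind_obj coind_hom res_gset_in)
next
  fix X Y :: "('g, 'u) gset" and f assume "X \<in> Fin G" "Y \<in> Fin G" "f \<in> BHom G X Y"
  then show "on_hom (coind G H T) X Y f \<in> Hom set_cat (on_obj (coind G H T) X) (on_obj (coind G H T) Y)"
    using functor_hom[OF T] by (simp add: coind_obj coind_hom res_gset_in res_hom_in)
next
  fix X Y Z :: "('g, 'u) gset" and f g assume o: "X \<in> Fin G" "Y \<in> Fin G" "Z \<in> Fin G"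
    and fg: "f \<in> BHom G X Y" "g \<in> BHom G Y Z"
  have c: "BComp G X Y Z g f \<in> BHom G X Z" using category_comp_in[OF category_bispan_cat, of X Y Z f g] o fg by simp
  show "on_hom (coind G H T) X Z (BComp G X Y Z g f) =
     Comp set_cat (on_obj (coind G H T) X) (on_obj (coind G H T) Y) (on_obj (coind G H T) Z) (on_hom (coind G H T) Y Z g) (on_hom (coind G H T) X Y f)"
    using o fg c functor_compose[OF T, of "res X" "res Y" "res Z" "res_hom X Y f" "res_hom Y Z g"]
    by (simp add: coind_obj coind_hom res_gset_in res_hom_in res_hom_comp)
qed

lemma is_coproduct_res:
  fixes X Y S :: "('g, 'u::infinite) gset"
  assumes "is_coproduct (gset_cat G) X Y S i j"
  shows "is_coproduct (gset_cat K) (res X) (res Y) (res S) i j"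
  using assms H_sub unfolding is_coproduct_gset_cat K.is_coproduct_gset_cat by (auto simp: res_gset_in equivariant_maps_def)

lemma prod_functor_coind:
  fixes T :: "('g, 'u::infinite, 'v) tambara"
  assumes T: "prod_functor K T"
  shows "prod_functor G (coind G H T)"
proof (rule prod_functorI)
  show "BFun G (coind G H T)" by (rule coind_functor[OF K.prod_functor_functor[OF T]])
  show "\<exists>x. on_obj (coind G H T) E = {x}" if "E \<in> Fin G" "elts E = {}" for E
    using K.prod_functor_empty[OF T res_gset_in[OF that(1)]] that by (simp add: coind_obj)
  fix X Y :: "('g, 'u) gset" assume o: "X \<in> Fin G" "Y \<in> Fin G"
  obtain S i j where "is_coproduct (gset_cat G) X Y S i j" using ex_coproduct_gset_cat[OF o] by blast
  then have S: "S \<in> Fin G" and ij: "eqv G X S i" "eqv G Y S j" and jb: "is_sum X Y S i j"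
    by (auto simp: is_coproduct_gset_cat intro: EMap_eqv)
  have "\<exists>!s. s \<in> on_obj T (res S) \<and> on_hom T (res S) (res X) (rrst X S i) s = x \<and> on_hom T (res S) (res Y) (rrst Y S j) s = y"
    if "x \<in> on_obj T (res X)" "y \<in> on_obj T (res Y)" for x y
    by (rule K.prod_functor_join[OF T]) (use o S ij jb that in \<open>auto simp: res_gset_in eqv_sub\<close>)
  then show "\<exists>S i j. S \<in> Fin G \<and> eqv G X S i \<and> eqv G Y S j \<and> is_sum X Y S i j \<and>
        (\<forall>x\<in>on_obj (coind G H T) X. \<forall>y\<in>on_obj (coind G H T) Y. \<exists>!s. s \<in> on_obj (coind G H T) S \<and>
          on_hom (coind G H T) S X (rst G X S i) s = x \<and> on_hom (coind G H T) S Y (rst G Y S j) s = y)"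
    using o S ij jb by (intro exI[of _ S] exI[of _ i] exI[of _ j]) (simp add: coind_obj coind_hom rst_in_Hom res_hom_rst)
qed

lemma coind_additive_group:
  fixes T :: "('g, 'u::infinite, 'v) tambara"
  assumes T: "prod_functor K T" and X: "X \<in> Fin G" and grp: "group (additive_monoid K T (res X))"
  shows "group (additive_monoid G (coind G H T) X)"
proof -
  obtain S i j where cp: "is_coproduct (gset_cat G) X X S i j" using ex_coproduct_gset_cat[OF X X] by blast
  then have S: "S \<in> Fin G" and ij: "eqv G X S i" "eqv G X S j"
    by (auto simp: is_coproduct_gset_cat intro: EMap_eqv)
  obtain h where h: "h \<in> EMap G S X" "\<And>x. x \<in> elts X \<Longrightarrow> h (i x) = x \<and> h (j x) = x" using ex_fold[OF cp] by blast
  obtain E :: "('g, 'u) gset" where E: "E \<in> Fin G" "elts E = {}" by (rule bexE[OF ex_empty_gset])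
  obtain z where z: "on_obj T (res E) = {z}" using K.prod_functor_empty[OF T res_gset_in[OF E(1)]] E(2) by auto
  have idE: "eqv G E X id" using E(2) by (simp add: eqv_def)
  show ?thesis
  proof (rule additive_group_transfer[OF K.plain_group_axioms plain_group_axioms T prod_functor_coind[OF T] is_coproduct_res[OF cp] cp, of h h "res E" z E z "\<lambda>x. x" "\<lambda>x. x"])
    show "h \<in> EMap K (res S) (res X)" using h(1) H_sub by (auto simp: equivariant_maps_def)
    fix s assume "s \<in> on_obj T (res S)"
    then show "s \<in> on_obj (coind G H T) S \<and>
         on_hom (coind G H T) S X (rst G X S i) s = on_hom T (res S) (res X) (rrst X S i) s \<and>
         on_hom (coind G H T) S X (rst G X S j) s = on_hom T (res S) (res X) (rrst X S j) s \<and>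
         on_hom (coind G H T) S X (trn G S X h) s = on_hom T (res S) (res X) (rtrn S X h) s"
      using X S ij EMap_eqv[OF h(1)]
      by (simp add: coind_obj coind_hom rst_in_Hom trn_in_Hom res_hom_rst res_hom_trn)
  qed (use X E z h grp idE in \<open>simp_all add: coind_obj coind_hom trn_in_Hom res_hom_trn res_gset_in\<close>)
qed

end

context plain_group
begin

lemma Obj_tambara_cat:
  fixes R :: "('g, 'u::infinite, 'v) tambara"
  shows "R \<in> Obj (tambara_cat G) \<longleftrightarrow> prod_functor G R \<and> extensional_functor (bispan_cat G) R \<and>
     (\<forall>X\<in>Fin G. group (additive_monoid G R X))"
  by (auto simp: tambara_cat_def full_subcat_def functor_cat_def prod_functor_def)

lemma category_tambara_cat: "category (tambara_cat G :: (('g, 'u, 'v) tambara, _) cat)"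
  unfolding tambara_cat_def by (intro category_full_subcat category_functor_cat category_set_cat)

lemma Hom_tambara_cat:
  fixes R R' :: "('g, 'u::infinite, 'v) tambara"
  assumes R: "BFun G R" and R': "BFun G R'"
  shows "\<eta> \<in> Hom (tambara_cat G) R R' \<longleftrightarrow> \<eta> \<in> extensional (Fin G) \<and>
     (\<forall>X\<in>Fin G. \<eta> X \<in> on_obj R X \<rightarrow>\<^sub>E on_obj R' X) \<and>
     (\<forall>X\<in>Fin G. \<forall>Y\<in>Fin G. \<forall>f\<in>BHom G X Y. \<forall>x\<in>on_obj R X.
        \<eta> Y (on_hom R X Y f x) = on_hom R' X Y f (\<eta> X x))"
proof -
  have *: "compose A u v = compose A u' v' \<longleftrightarrow> (\<forall>x\<in>A. u (v x) = u' (v' x))" for A :: "'v set" and u v u' v' :: "'v \<Rightarrow> 'v"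
    by (auto simp: compose_def fun_eq_iff)
  show ?thesis
    by (simp add: tambara_cat_def full_subcat_def functor_cat_def nat_trans_def set_cat_def *)
qed

lemma Comp_tambara_cat:
  "Comp (tambara_cat G) R R' R'' \<theta> \<eta> = (\<lambda>X\<in>Fin G. compose (on_obj R X) (\<theta> X) (\<eta> X))"
  by (simp add: tambara_cat_def full_subcat_def functor_cat_def set_cat_def)

lemma Ident_tambara_cat:
  "Ident (tambara_cat G) R = (\<lambda>X\<in>Fin G. \<lambda>x\<in>on_obj R X. x)"
  by (simp add: tambara_cat_def full_subcat_def functor_cat_def set_cat_def)

end

lemma under_cat_Obj: "X \<in> Obj (under_cat C k) \<longleftrightarrow> fst X \<in> Obj C \<and> snd X \<in> Hom C k (fst X)"
  and under_cat_Hom: "Hom (under_cat C k) X Y = {f \<in> Hom C (fst X) (fst Y). Comp C k (fst X) (fst Y) f (snd X) = snd Y}"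
  and under_cat_Ident: "Ident (under_cat C k) X = Ident C (fst X)"
  and under_cat_Comp: "Comp (under_cat C k) X Y Z = Comp C (fst X) (fst Y) (fst Z)"
  by (auto simp: under_cat_def split: prod.splits)

context subgroup_pair
begin

lemma coind_in_Obj:
  fixes T :: "('g, 'u::infinite, 'v) tambara"
  assumes "T \<in> Obj (tambara_cat K)" shows "coind G H T \<in> Obj (tambara_cat G)"
  using assms unfolding Obj_tambara_cat K.Obj_tambara_cat
  by (simp add: prod_functor_coind extensional_coind coind_additive_group res_gset_in)

lemma coind_trans_in_Hom:
  fixes T T' :: "('g, 'u::infinite, 'v) tambara"
  assumes T: "BFun K T" "BFun K T'" and \<eta>: "\<eta> \<in> Hom (tambara_cat K) T T'"
  shows "coind_trans G H \<eta> \<in> Hom (tambara_cat G) (coind G H T) (coind G H T')"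
  using \<eta> unfolding K.Hom_tambara_cat[OF T] Hom_tambara_cat[OF T[THEN coind_functor]]
  by (simp add: coind_trans_def coind_obj coind_hom res_gset_in res_hom_in)

lemma coind_trans_comp:
  fixes T :: "('g, 'u::infinite, 'v) tambara"
  shows "coind_trans G H (Comp (tambara_cat K) T T' T'' \<theta> \<eta>) =
    Comp (tambara_cat G) (coind G H T) (coind G H T') (coind G H T'') (coind_trans G H \<theta>) (coind_trans G H \<eta>)"
  by (auto simp: coind_trans_def Comp_tambara_cat K.Comp_tambara_cat coind_obj res_gset_in fun_eq_iff)

lemma coind_trans_ident:
  fixes T :: "('g, 'u::infinite, 'v) tambara"
  shows "coind_trans G H (Ident (tambara_cat K) T) = Ident (tambara_cat G) (coind G H T)"
  by (auto simp: coind_trans_def Ident_tambara_cat K.Ident_tambara_cat coind_obj res_gset_in fun_eq_iff)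

lemma tambara_functor:
  fixes T :: "('g, 'u::infinite, 'v) tambara"
  shows "T \<in> Obj (tambara_cat K) \<Longrightarrow> BFun K T"
  by (simp add: K.Obj_tambara_cat prod_functor_def)

lemma is_functor_coind_under:
  fixes k :: "('g, 'u::infinite, 'v) tambara"
  assumes k: "k \<in> Obj (tambara_cat K)"
  shows "is_functor (under_cat (tambara_cat K) k) (under_cat (tambara_cat G) (coind G H k)) (coind_under G H)"
proof -
  have oo: "on_obj (coind_under G H) X = (coind G H (fst X), coind_trans G H (snd X))"
    for X :: "('g, 'u, 'v) tambara \<times> (('g, 'u) gset \<Rightarrow> 'v \<Rightarrow> 'v)" by (cases X) (simp add: coind_under_def)
  have hh: "on_hom (coind_under G H) X Y = coind_trans G H"
    for X Y :: "('g, 'u, 'v) tambara \<times> (('g, 'u) gset \<Rightarrow> 'v \<Rightarrow> 'v)" by (simp add: coind_under_def)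
  show ?thesis
    unfolding is_functor_def under_cat_Hom under_cat_Ident under_cat_Comp oo hh
    by (intro conjI ballI)
      (simp_all add: k under_cat_Obj coind_in_Obj coind_trans_in_Hom tambara_functor coind_trans_ident coind_trans_comp[symmetric])
qed

end

section \<open>Operations of two variables and Frobenius reciprocity\<close>

text \<open>For \<open>m = (X \<leftarrow> A \<rightarrow> B \<rightarrow> X')\<close> this is the bispan \<open>X \<squnion> B \<leftarrow> A \<squnion> B \<rightarrow> B \<rightarrow> X'\<close>, the operation
  \<open>(x, b) \<mapsto> tran (b * norm (res x))\<close>. The disjoint union of \<open>X\<close> and \<open>B\<close> enters through maps \<open>i\<close> and \<open>j\<close>.\<close>

definition hat_bisp :: "('x \<Rightarrow> 's) \<Rightarrow> ('b \<Rightarrow> 's) \<Rightarrow> ('g, 'a, 'b, 'x, 'y) bisp \<Rightarrow> ('g, 'a + 'b, 'b, 's, 'y) bisp" where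
  "hat_bisp i j m = \<lparr>psrc = gset_sum (psrc m) (ptgt m), ptgt = ptgt m, pres = case_sum (\<lambda>a. i (pres m a)) j,
     pnorm = case_sum (pnorm m) (\<lambda>b. b), ptran = ptran m\<rparr>"

text \<open>The operation of \<open>hat_bisp\<close> with its second variable replaced by the value of the bispan \<open>\<nu>\<close>.\<close>

definition subst_bisp :: "('x \<Rightarrow> 's) \<Rightarrow> ('z \<Rightarrow> 's) \<Rightarrow> ('g, 'a, 'b, 'x, 'y) bisp \<Rightarrow> ('g, 'e, 'f, 'z, 'b) bisp \<Rightarrow> ('g, 'a \<times> 'f + 'e, 'f, 's, 'y) bisp" where
  "subst_bisp i j m \<nu> = \<lparr>psrc = gset_sum (fibre_product (psrc m) (ptgt \<nu>) (pnorm m) (ptran \<nu>)) (psrc \<nu>), ptgt = ptgt \<nu>,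
     pres = case_sum (\<lambda>z. i (pres m (fst z))) (\<lambda>e. j (pres \<nu> e)), pnorm = case_sum snd (pnorm \<nu>),
     ptran = (\<lambda>w. ptran m (ptran \<nu> w))\<rparr>"

text \<open>The part of \<open>m\<close> over \<open>h : B \<rightarrow> ptgt m\<close>, that is \<open>X \<leftarrow> A \<times> B \<rightarrow> B \<rightarrow> X'\<close> with the product formed over the middle set.\<close>

definition pullb :: "('g, 'a, 'b, 'x, 'y) bisp \<Rightarrow> ('g, 'c) gset \<Rightarrow> ('c \<Rightarrow> 'b) \<Rightarrow> ('g, 'a \<times> 'c, 'c, 'x, 'y) bisp" where
  "pullb m B h = \<lparr>psrc = fibre_product (psrc m) B (pnorm m) h, ptgt = B, pres = (\<lambda>z. pres m (fst z)), pnorm = snd,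
     ptran = (\<lambda>w. ptran m (h w))\<rparr>"

context plain_group
begin

lemma wf_hat_bisp:
  assumes m: "wf_bisp G X X' m" and i: "eqv G X S i" and j: "eqv G (ptgt m) S j"
  shows "wf_bisp G S X' (hat_bisp i j m)"
  using wf_bispD[OF m] i j by (simp add: wf_bisp_def hat_bisp_def is_gset_sum eqv_gset_sum eqv_comp' eqv_id)

lemma wf_subst_bisp:
  assumes m: "wf_bisp G X X' m" and \<nu>: "wf_bisp G Z (ptgt m) \<nu>" and i: "eqv G X S i" and j: "eqv G Z S j"
  shows "wf_bisp G S X' (subst_bisp i j m \<nu>)"
proof -
  note M = wf_bispD[OF m] and N = wf_bispD[OF \<nu>]
  have "is_gset G (fibre_product (psrc m) (ptgt \<nu>) (pnorm m) (ptran \<nu>))" by (rule is_gset_fibre_product[OF M(1) N(2) M(4) N(5)])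
  then show ?thesis
    using M N i j eqv_comp'[OF eqv_comp'[OF eqv_fst M(3)] i] eqv_comp'[OF N(3) j] eqv_comp'[OF N(5) M(5)]
    by (simp add: wf_bisp_def subst_bisp_def is_gset_sum eqv_gset_sum eqv_snd)
qed

lemma wf_pullb:
  assumes m: "wf_bisp G X X' m" and B: "is_gset G B" and h: "eqv G B (ptgt m) h"
  shows "wf_bisp G X X' (pullb m B h)"
proof -
  note M = wf_bispD[OF m]
  show ?thesis
    using M B eqv_comp'[OF eqv_fst M(3)] eqv_comp'[OF h M(5)] is_gset_fibre_product[OF M(1) B M(4) h]
    by (simp add: wf_bisp_def pullb_def eqv_snd)
qed

text \<open>Over a point of the middle set of \<open>\<nu>\<close>, the fibre of \<open>hat_bisp\<close> is the fibre of \<open>m\<close> and one extra point. On the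
  former a section is forced, because the other bispan is a restriction there; its value at the extra point is the point
  of \<open>\<nu>\<close>.\<close>

lemma subst_comp_wit:
  assumes m: "wf_bisp G X X' m" and \<nu>: "wf_bisp G Z (ptgt m) \<nu>" and X: "is_gset G X"
    and i: "eqv G X S i" and j: "eqv G (ptgt m) S j" and S: "is_sum X (ptgt m) S i j"
    and i': "eqv G X S' i'" and j': "eqv G Z S' j'"
  shows "comp_wit G S' S X' (sum_bisp i j (res_bisp X i') (\<nu>\<lparr>pres := \<lambda>e. j' (pres \<nu> e)\<rparr>)) (hat_bisp i j m) (subst_bisp i' j' m \<nu>)
     (ptran \<nu>) (\<lambda>w. case_sum (\<lambda>a. Inl (pres m a)) (\<lambda>b. Inr w))
     (case_sum (\<lambda>z. Inl (fst z)) (\<lambda>e. Inr (ptran \<nu> (pnorm \<nu> e)))) (case_sum (\<lambda>z. Inl (pres m (fst z))) Inr)"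
    (is "comp_wit G S' S X' ?p ?p' ?p'' ?q ?ev ?l ?a")
proof -
  note M = wf_bispD[OF m] and N = wf_bispD[OF \<nu>]
  note I = M(3-5)[THEN eqv_in] N(3-5)[THEN eqv_in] i[THEN eqv_in] j[THEN eqv_in]
  have inj: "\<And>x x'. \<lbrakk>x \<in> elts X; x' \<in> elts X\<rbrakk> \<Longrightarrow> i x = i x' \<longleftrightarrow> x = x'" "\<And>y y'. \<lbrakk>y \<in> Tgt m; y' \<in> Tgt m\<rbrakk> \<Longrightarrow> j y = j y' \<longleftrightarrow> y = y'"
    "\<And>x y. \<lbrakk>x \<in> elts X; y \<in> Tgt m\<rbrakk> \<Longrightarrow> i x \<noteq> j y" "\<And>x y. \<lbrakk>x \<in> elts X; y \<in> Tgt m\<rbrakk> \<Longrightarrow> j y \<noteq> i x"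
    using S by (auto simp: joint_bij_def inj_on_def)
  have wf\<nu>: "wf_bisp G S' (ptgt m) (\<nu>\<lparr>pres := \<lambda>e. j' (pres \<nu> e)\<rparr>)"
    using N eqv_comp'[OF N(3) j'] by (simp add: wf_bisp_def)
  have wf1: "wf_bisp G S' S ?p" by (rule wf_sum_bisp[OF wf_res_bisp[OF X i'] wf\<nu> i j])
  have wf2: "wf_bisp G S X' ?p'" by (rule wf_hat_bisp[OF m i j])
  have wf3: "wf_bisp G S' X' ?p''" by (rule wf_subst_bisp[OF m \<nu> i' j'])
  show ?thesis
  proof (unfold_locales, rule wf1, rule wf2, rule wf3)
    show "eqv G (ptgt ?p'') (ptgt ?p') ?q" using N by (simp add: subst_bisp_def hat_bisp_def)
    show "ptran ?p' (?q w) = ptran ?p'' w" for w by (simp add: subst_bisp_def hat_bisp_def)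
    show "eqv G (psrc ?p'') (psrc ?p') ?l" "eqv G (psrc ?p'') (psrc ?p) ?a"
      by (simp_all add: subst_bisp_def hat_bisp_def sum_bisp_def res_bisp_def eqv_gset_sum eqv_Inr
          eqv_comp'[OF eqv_fst eqv_Inl] eqv_comp'[OF eqv_comp'[OF N(4,5)] eqv_Inr] eqv_comp'[OF eqv_comp'[OF eqv_fst M(3)] eqv_Inl])
  next
    fix w c assume w: "w \<in> Tgt ?p''" and c: "c \<in> Src ?p'" and n: "pnorm ?p' c = ?q w"
    have w': "w \<in> Tgt \<nu>" using w by (simp add: subst_bisp_def)
    show "?ev w c \<in> Tgt ?p" "ptran ?p (?ev w c) = pres ?p' c"
      using w' c n I by (auto simp: hat_bisp_def sum_bisp_def res_bisp_def elts_gset_sum)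
    fix g assume "g \<in> carrier G"
    then show "?ev (act (ptgt ?p'') g w) (act (psrc ?p') g c) = act (ptgt ?p) g (?ev w c)"
      using w' c M(3) by (auto simp: hat_bisp_def sum_bisp_def res_bisp_def subst_bisp_def elts_gset_sum eqv_act)
  next
    fix d s assume d: "d \<in> Tgt ?p'" and s: "\<And>c. \<lbrakk>c \<in> Src ?p'; pnorm ?p' c = d\<rbrakk> \<Longrightarrow> s c \<in> Tgt ?p \<and> ptran ?p (s c) = pres ?p' c"
    have d': "d \<in> Tgt m" using d by (simp add: hat_bisp_def)
    have sa: "s (Inl a) = Inl (pres m a)" if "a \<in> Src m" "pnorm m a = d" for a
    proof -
      have "s (Inl a) \<in> elts X <+> Tgt \<nu>" "(case s (Inl a) of Inl x \<Rightarrow> i x | Inr b \<Rightarrow> j (ptran \<nu> b)) = i (pres m a)"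
        using s[of "Inl a"] that by (simp_all add: hat_bisp_def sum_bisp_def res_bisp_def elts_gset_sum InlI)
      then show ?thesis using inj(1,4) I(1,6) that(1) by (cases "s (Inl a)") auto
    qed
    obtain w where w: "w \<in> Tgt \<nu>" "s (Inr d) = Inr w" "ptran \<nu> w = d"
    proof -
      have *: "s (Inr d) \<in> elts X <+> Tgt \<nu>" "(case s (Inr d) of Inl x \<Rightarrow> i x | Inr b \<Rightarrow> j (ptran \<nu> b)) = j d"
        using s[of "Inr d"] d' by (simp_all add: hat_bisp_def sum_bisp_def res_bisp_def elts_gset_sum InrI)
      then have "\<exists>w. w \<in> Tgt \<nu> \<and> s (Inr d) = Inr w \<and> ptran \<nu> w = d"
        using inj(2,3) I(6) d' by (cases "s (Inr d)") auto
      then show ?thesis using that by blast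
    qed
    show "\<exists>!w. w \<in> Tgt ?p'' \<and> ?q w = d \<and> (\<forall>c\<in>Src ?p'. pnorm ?p' c = d \<longrightarrow> ?ev w c = s c)"
    proof (rule ex1I[of _ w])
      show "w \<in> Tgt ?p'' \<and> ?q w = d \<and> (\<forall>c\<in>Src ?p'. pnorm ?p' c = d \<longrightarrow> ?ev w c = s c)"
        using w sa by (auto simp: hat_bisp_def subst_bisp_def elts_gset_sum)
      fix v assume v: "v \<in> Tgt ?p'' \<and> ?q v = d \<and> (\<forall>c\<in>Src ?p'. pnorm ?p' c = d \<longrightarrow> ?ev v c = s c)"
      moreover have "Inr d \<in> Src ?p'" "pnorm ?p' (Inr d) = d" using d' by (simp_all add: hat_bisp_def)
      ultimately have "?ev v (Inr d) = s (Inr d)" by blast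
      then show "v = w" using w(2) by simp
    qed
  next
    fix x assume x: "x \<in> Src ?p''"
    show "pnorm ?p' (?l x) = ?q (pnorm ?p'' x)" "pnorm ?p (?a x) = ?ev (pnorm ?p'' x) (?l x)" "pres ?p (?a x) = pres ?p'' x"
      using x by (auto simp: hat_bisp_def subst_bisp_def sum_bisp_def res_bisp_def elts_gset_sum)
  next
    fix w c a0 assume w: "w \<in> Tgt ?p''" and c: "c \<in> Src ?p'" and a0: "a0 \<in> Src ?p"
      and n: "pnorm ?p' c = ?q w" and na: "pnorm ?p a0 = ?ev w c"
    show "\<exists>!x. x \<in> Src ?p'' \<and> pnorm ?p'' x = w \<and> ?l x = c \<and> ?a x = a0"
    proof (cases c)
      case (Inl a)
      then show ?thesis using w c a0 n na
        by (intro ex1I[of _ "Inl (a, w)"])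
          (auto simp: hat_bisp_def subst_bisp_def sum_bisp_def res_bisp_def elts_gset_sum split: sum.splits)
    next
      case (Inr b)
      then obtain e where "a0 = Inr e" using na by (cases a0) (auto simp: sum_bisp_def)
      then show ?thesis using Inr w c a0 n na
        by (intro ex1I[of _ "Inr e"])
          (auto simp: hat_bisp_def subst_bisp_def sum_bisp_def res_bisp_def elts_gset_sum split: sum.splits)
    qed
  qed
qed

lemma comp_subst_bisp:
  fixes X X' S S' Z :: "('g, 'u::infinite) gset"
  assumes o: "X \<in> Fin G" "X' \<in> Fin G" "S \<in> Fin G" "S' \<in> Fin G"
    and m: "wf_bisp G X X' m" and \<nu>: "wf_bisp G Z (ptgt m) \<nu>"
    and i: "eqv G X S i" and j: "eqv G (ptgt m) S j" and S: "is_sum X (ptgt m) S i j"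
    and i': "eqv G X S' i'" and j': "eqv G Z S' j'"
  shows "BComp G S' S X' (cls G S X' (hat_bisp i j m)) (cls G S' S (sum_bisp i j (res_bisp X i') (\<nu>\<lparr>pres := \<lambda>e. j' (pres \<nu> e)\<rparr>)))
     = cls G S' X' (subst_bisp i' j' m \<nu>)"
  by (rule bispan_cat_comp[OF o(4,3,2) subst_comp_wit[OF m \<nu> Fin_gset[OF o(1)] i j S i' j']])

lemma proj_sum_bisp:
  fixes W X Y S :: "('g, 'u::infinite) gset"
  assumes o: "W \<in> Fin G" "X \<in> Fin G" "Y \<in> Fin G" "S \<in> Fin G"
    and wf: "wf_bisp G W X p" "wf_bisp G W Y p'" and ij: "eqv G X S i" "eqv G Y S j" "is_sum X Y S i j"
  shows "BComp G W S X (rst G X S i) (cls G W S (sum_bisp i j p p')) = cls G W X p"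
    and "BComp G W S Y (rst G Y S j) (cls G W S (sum_bisp i j p p')) = cls G W Y p'"
proof -
  note gs = o[THEN Fin_gset]
  note wfs = wf_sum_bisp[OF wf ij(1,2)] and ps = pull_sum_bisp[OF wf ij]
  show "BComp G W S X (rst G X S i) (cls G W S (sum_bisp i j p p')) = cls G W X p"
    using comp_res_bispan[OF o(1,4,2) wfs ij(1)] cls_eq[OF wf(1) wf_pull_bisp[OF wfs gs(2) ij(1)]] ps(1) by simp
  show "BComp G W S Y (rst G Y S j) (cls G W S (sum_bisp i j p p')) = cls G W Y p'"
    using comp_res_bispan[OF o(1,4,3) wfs ij(2)] cls_eq[OF wf(2) wf_pull_bisp[OF wfs gs(3) ij(2)]] ps(2) by simp
qed

lemma subst_apply:
  fixes X X' S S' Z :: "('g, 'u::infinite) gset"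
  assumes R: "prod_functor G R" and o: "X \<in> Fin G" "X' \<in> Fin G" "S \<in> Fin G" "S' \<in> Fin G" "Z \<in> Fin G" "ptgt m \<in> Fin G"
    and m: "wf_bisp G X X' m" and \<nu>: "wf_bisp G Z (ptgt m) \<nu>"
    and S: "eqv G X S i" "eqv G (ptgt m) S j" "is_sum X (ptgt m) S i j"
    and ij': "eqv G X S' i'" "eqv G Z S' j'"
    and s: "s \<in> on_obj R S" and s': "s' \<in> on_obj R S'"
    and s1: "on_hom R S X (rst G X S i) s = on_hom R S' X (rst G X S' i') s'"
    and s2: "on_hom R S (ptgt m) (rst G (ptgt m) S j) s = on_hom R Z (ptgt m) (cls G Z (ptgt m) \<nu>) (on_hom R S' Z (rst G Z S' j') s')"
  shows "on_hom R S X' (cls G S X' (hat_bisp i j m)) s = on_hom R S' X' (cls G S' X' (subst_bisp i' j' m \<nu>)) s'"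
proof -
  note F = prod_functor_functor[OF R]
  note gs = o[THEN Fin_gset]
  have wf\<nu>: "wf_bisp G S' (ptgt m) (\<nu>\<lparr>pres := \<lambda>e. j' (pres \<nu> e)\<rparr>)"
    using wf_bispD[OF \<nu>] eqv_comp'[OF wf_bispD(3)[OF \<nu>] ij'(2)] by (simp add: wf_bisp_def)
  have wfr: "wf_bisp G S' X (res_bisp X i')" by (rule wf_res_bisp[OF gs(1) ij'(1)])
  let ?p = "sum_bisp i j (res_bisp X i') (\<nu>\<lparr>pres := \<lambda>e. j' (pres \<nu> e)\<rparr>)"
  have pH: "cls G S' S ?p \<in> BHom G S' S" by (rule cls_in_Hom[OF wf_sum_bisp[OF wfr wf\<nu> S(1,2)]])
  let ?t = "on_hom R S' S (cls G S' S ?p) s'"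
  have t: "?t \<in> on_obj R S" by (rule apply_in[OF F o(4,3) pH s'])
  have "on_hom R S X (rst G X S i) ?t = on_hom R S' X (cls G S' X (res_bisp X i')) s'"
    using apply_comp[OF F o(4,3,1) pH rst_in_Hom[OF o(1) S(1)] s'] proj_sum_bisp(1)[OF o(4,1,6,3) wfr wf\<nu> S] by simp
  then have t1: "on_hom R S X (rst G X S i) ?t = on_hom R S X (rst G X S i) s" using s1 by (simp add: rst_def)
  have "on_hom R S (ptgt m) (rst G (ptgt m) S j) ?t = on_hom R S' (ptgt m) (cls G S' (ptgt m) (\<nu>\<lparr>pres := \<lambda>e. j' (pres \<nu> e)\<rparr>)) s'"
    using apply_comp[OF F o(4,3,6) pH rst_in_Hom[OF o(6) S(2)] s'] proj_sum_bisp(2)[OF o(4,1,6,3) wfr wf\<nu> S] by simp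
  also have "\<dots> = on_hom R S (ptgt m) (rst G (ptgt m) S j) s"
    using apply_comp[OF F o(4,5,6) rst_in_Hom[OF o(5) ij'(2)] cls_in_Hom[OF \<nu>] s'] comp_bispan_rst[OF o(4,5,6) ij'(2) \<nu>] s2 by simp
  finally have t2: "on_hom R S (ptgt m) (rst G (ptgt m) S j) ?t = on_hom R S (ptgt m) (rst G (ptgt m) S j) s" .
  have "\<exists>!u. u \<in> on_obj R S \<and> on_hom R S X (rst G X S i) u = on_hom R S X (rst G X S i) s \<and>
      on_hom R S (ptgt m) (rst G (ptgt m) S j) u = on_hom R S (ptgt m) (rst G (ptgt m) S j) s"
    by (rule prod_functor_join[OF R o(1,6,3) S]) (rule apply_in[OF F o(3) _ _ s] o rst_in_Hom S)+
  then have "?t = s" using s t t1 t2 by blast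
  then show ?thesis
    using apply_comp[OF F o(4,3,2) pH cls_in_Hom[OF wf_hat_bisp[OF m S(1,2)]] s'] comp_subst_bisp[OF o(1-4) m \<nu> S ij'] by simp
qed

text \<open>The value at \<open>x\<close> and \<open>b\<close> of the operation of \<open>hat_bisp\<close>: the pair is joined to an element of the value at some disjoint
  union. By \<open>hval_eq\<close> the choice is immaterial.\<close>

definition hval :: "('g, 'u, 'v) tambara \<Rightarrow> ('g, 'u) gset \<Rightarrow> ('g, 'u) gset \<Rightarrow> ('g, 'a, 'u, 'u, 'u) bisp \<Rightarrow> 'v \<Rightarrow> 'v \<Rightarrow> 'v" where
  "hval R X X' m x b = (SOME y. \<exists>S i j s. S \<in> Fin G \<and> eqv G X S i \<and> eqv G (ptgt m) S j \<and>
     is_sum X (ptgt m) S i j \<and> s \<in> on_obj R S \<and>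
     on_hom R S X (rst G X S i) s = x \<and> on_hom R S (ptgt m) (rst G (ptgt m) S j) s = b \<and>
     y = on_hom R S X' (cls G S X' (hat_bisp i j m)) s)"

lemma subst_id_bisp:
  assumes m: "wf_bisp G X X' m"
  shows "bisp_iso G (hat_bisp i j m) (subst_bisp i j m (id_bisp (ptgt m)))"
proof -
  note M = wf_bispD[OF m]
  have "bij_betw (map_sum (\<lambda>a. (a, pnorm m a)) id) (Src m <+> Tgt m) (elts (fibre_product (psrc m) (ptgt m) (pnorm m) (\<lambda>x. x)) <+> Tgt m)"
    by (rule bij_betw_byWitness[of _ "map_sum fst id"]) (auto simp: fibre_product_def eqv_in[OF M(4)])
  moreover have "eqv G (psrc m) (fibre_product (psrc m) (ptgt m) (pnorm m) (\<lambda>x. x)) (\<lambda>a. (a, pnorm m a))"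
    using M by (simp add: eqv_def)
  ultimately show ?thesis
    by (intro bisp_isoI[of "map_sum (\<lambda>a. (a, pnorm m a)) id" _ _ "\<lambda>b. b"])
      (auto simp: hat_bisp_def subst_bisp_def id_bisp_def elts_gset_sum eqv_map_sum eqv_id eqv_id' bij_betw_def)
qed

text \<open>Two disjoint unions are compared by substituting the identity bispan for the second variable.\<close>

lemma hval_eq:
  fixes X X' S :: "('g, 'u::infinite) gset"
  assumes R: "prod_functor G R" and o: "X \<in> Fin G" "X' \<in> Fin G" "ptgt m \<in> Fin G"
    and m: "wf_bisp G X X' m" and S: "S \<in> Fin G" "eqv G X S i" "eqv G (ptgt m) S j" "is_sum X (ptgt m) S i j"
    and s: "s \<in> on_obj R S"
  shows "hval R X X' m (on_hom R S X (rst G X S i) s) (on_hom R S (ptgt m) (rst G (ptgt m) S j) s) = on_hom R S X' (cls G S X' (hat_bisp i j m)) s"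
    (is "hval R X X' m ?x ?b = ?y")
  unfolding hval_def
proof (rule some_equality)
  show "\<exists>S i j s. S \<in> Fin G \<and> eqv G X S i \<and> eqv G (ptgt m) S j \<and>
     is_sum X (ptgt m) S i j \<and> s \<in> on_obj R S \<and>
     on_hom R S X (rst G X S i) s = ?x \<and> on_hom R S (ptgt m) (rst G (ptgt m) S j) s = ?b \<and>
     ?y = on_hom R S X' (cls G S X' (hat_bisp i j m)) s"
    using S s by (intro exI[of _ S] exI[of _ i] exI[of _ j] exI[of _ s]) simp
  fix y assume "\<exists>S i j s. S \<in> Fin G \<and> eqv G X S i \<and> eqv G (ptgt m) S j \<and>
     is_sum X (ptgt m) S i j \<and> s \<in> on_obj R S \<and>
     on_hom R S X (rst G X S i) s = ?x \<and> on_hom R S (ptgt m) (rst G (ptgt m) S j) s = ?b \<and>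
     y = on_hom R S X' (cls G S X' (hat_bisp i j m)) s"
  then obtain S' i' j' s' where S': "S' \<in> Fin G" "eqv G X S' i'" "eqv G (ptgt m) S' j'" "is_sum X (ptgt m) S' i' j'"
    and s': "s' \<in> on_obj R S'" "on_hom R S' X (rst G X S' i') s' = ?x" "on_hom R S' (ptgt m) (rst G (ptgt m) S' j') s' = ?b"
    and y: "y = on_hom R S' X' (cls G S' X' (hat_bisp i' j' m)) s'" by (elim exE conjE) (rule that)
  note F = prod_functor_functor[OF R]
  have idB: "wf_bisp G (ptgt m) (ptgt m) (id_bisp (ptgt m))" by (rule wf_id_bisp[OF Fin_gset[OF o(3)]])
  have b: "?b \<in> on_obj R (ptgt m)" by (rule apply_in[OF F S(1) o(3) rst_in_Hom[OF o(3) S(3)] s])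
  have "on_hom R S' X' (cls G S' X' (hat_bisp i' j' m)) s' = on_hom R S X' (cls G S X' (subst_bisp i j m (id_bisp (ptgt m)))) s"
    using apply_id[OF F o(3) b]
    by (intro subst_apply[OF R o(1,2) S'(1) S(1) o(3,3) m idB S'(2-4) S(2,3) s'(1) s])
      (simp_all add: s' Ident_bispan_cat[OF o(3)])
  also have "cls G S X' (subst_bisp i j m (id_bisp (ptgt m))) = cls G S X' (hat_bisp i j m)"
    using cls_eq[OF wf_hat_bisp[OF m S(2,3)] wf_subst_bisp[OF m idB S(2,3)]] subst_id_bisp[OF m, of i j] by simp
  finally show "y = ?y" using y by simp
qed

lemma ex_join:
  fixes X B :: "('g, 'u::infinite) gset"
  assumes R: "prod_functor G R" and o: "X \<in> Fin G" "B \<in> Fin G" and xb: "x \<in> on_obj R X" "b \<in> on_obj R B"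
  shows "\<exists>S i j s. S \<in> Fin G \<and> eqv G X S i \<and> eqv G B S j \<and> is_sum X B S i j \<and>
    s \<in> on_obj R S \<and> on_hom R S X (rst G X S i) s = x \<and> on_hom R S B (rst G B S j) s = b"
proof -
  obtain S i j where "is_coproduct (gset_cat G) X B S i j" using ex_coproduct_gset_cat[OF o] by blast
  then have S: "S \<in> Fin G" "eqv G X S i" "eqv G B S j" "is_sum X B S i j"
    by (auto simp: is_coproduct_gset_cat intro: EMap_eqv)
  then obtain s where "s \<in> on_obj R S" "on_hom R S X (rst G X S i) s = x" "on_hom R S B (rst G B S j) s = b"
    using prod_functor_join[OF R o S xb] by blast
  then show ?thesis using S by blast
qed

lemma hval_subst:
  fixes X X' S' Z :: "('g, 'u::infinite) gset"
  assumes R: "prod_functor G R" and o: "X \<in> Fin G" "X' \<in> Fin G" "S' \<in> Fin G" "Z \<in> Fin G" "ptgt m \<in> Fin G"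
    and m: "wf_bisp G X X' m" and \<nu>: "wf_bisp G Z (ptgt m) \<nu>" and ij': "eqv G X S' i'" "eqv G Z S' j'" and s': "s' \<in> on_obj R S'"
  shows "hval R X X' m (on_hom R S' X (rst G X S' i') s') (on_hom R Z (ptgt m) (cls G Z (ptgt m) \<nu>) (on_hom R S' Z (rst G Z S' j') s'))
    = on_hom R S' X' (cls G S' X' (subst_bisp i' j' m \<nu>)) s'" (is "hval R X X' m ?x ?b = _")
proof -
  note F = prod_functor_functor[OF R]
  have x: "?x \<in> on_obj R X" by (rule apply_in[OF F o(3,1) rst_in_Hom[OF o(1) ij'(1)] s'])
  have b: "?b \<in> on_obj R (ptgt m)"
    by (rule apply_in[OF F o(4,5) cls_in_Hom[OF \<nu>] apply_in[OF F o(3,4) rst_in_Hom[OF o(4) ij'(2)] s']])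
  obtain S i j s where S: "S \<in> Fin G" "eqv G X S i" "eqv G (ptgt m) S j" "is_sum X (ptgt m) S i j"
    and s: "s \<in> on_obj R S" "on_hom R S X (rst G X S i) s = ?x" "on_hom R S (ptgt m) (rst G (ptgt m) S j) s = ?b"
    using ex_join[OF R o(1,5) x b] by (elim exE conjE) (rule that)
  show ?thesis
    using hval_eq[OF R o(1,2,5) m S s(1)] subst_apply[OF R o(1,2) S(1) o(3-5) m \<nu> S(2-4) ij' s(1) s'] s(2,3) by simp
qed

lemma hval_in:
  fixes X X' :: "('g, 'u::infinite) gset"
  assumes R: "prod_functor G R" and o: "X \<in> Fin G" "X' \<in> Fin G" "ptgt m \<in> Fin G"
    and m: "wf_bisp G X X' m" and xb: "x \<in> on_obj R X" "b \<in> on_obj R (ptgt m)"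
  shows "hval R X X' m x b \<in> on_obj R X'"
proof -
  obtain S i j s where S: "S \<in> Fin G" "eqv G X S i" "eqv G (ptgt m) S j" "is_sum X (ptgt m) S i j"
    and s: "s \<in> on_obj R S" "on_hom R S X (rst G X S i) s = x" "on_hom R S (ptgt m) (rst G (ptgt m) S j) s = b"
    using ex_join[OF R o(1,3) xb] by (elim exE conjE) (rule that)
  show ?thesis using hval_eq[OF R o m S s(1)] s apply_in[OF prod_functor_functor[OF R] S(1) o(2) cls_in_Hom[OF wf_hat_bisp[OF m S(2,3)]] s(1)] by simp
qed

text \<open>Frobenius reciprocity, \<open>tran h b * y = tran h (b * res h y)\<close>: substituting the transfer bispan of \<open>h\<close> for the second variable
  of \<open>m\<close> gives the same bispan as substituting the identity for that of the pullback along \<open>h\<close>.\<close>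

lemma hval_trn:
  fixes X X' B :: "('g, 'u::infinite) gset"
  assumes R: "prod_functor G R" and o: "X \<in> Fin G" "X' \<in> Fin G" "ptgt m \<in> Fin G" "B \<in> Fin G"
    and m: "wf_bisp G X X' m" and h: "eqv G B (ptgt m) h" and xb: "x \<in> on_obj R X" "b \<in> on_obj R B"
  shows "hval R X X' m x (on_hom R B (ptgt m) (trn G B (ptgt m) h) b) = hval R X X' (pullb m B h) x b"
proof -
  have B: "is_gset G B" using o(4) by (rule Fin_gset)
  have m': "wf_bisp G X X' (pullb m B h)" by (rule wf_pullb[OF m B h])
  have tB: "ptgt (pullb m B h) = B" by (simp add: pullb_def)
  obtain S i j s where S: "S \<in> Fin G" "eqv G X S i" "eqv G B S j" "is_sum X B S i j"
    and s: "s \<in> on_obj R S" "on_hom R S X (rst G X S i) s = x" "on_hom R S B (rst G B S j) s = b"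
    using ex_join[OF R o(1,4) xb] by (elim exE conjE) (rule that)
  have "subst_bisp i j m (tran_bisp B h) = hat_bisp i j (pullb m B h)"
    by (simp add: subst_bisp_def tran_bisp_def hat_bisp_def pullb_def)
  then show ?thesis
    using hval_subst[OF R o(1,2) S(1) o(4,3) m wf_tran_bisp[OF B h] S(2,3) s(1)] hval_eq[OF R o(1,2) _ m', unfolded tB, OF o(4) S s(1)] s(2,3)
    by (simp add: trn_def)
qed

lemma hat_bisp_iso:
  assumes "bisp_iso_maps G m m' \<alpha> (\<lambda>b. b)" "ptgt m' = ptgt m"
  shows "bisp_iso G (hat_bisp i j m) (hat_bisp i j m')"
proof -
  have "bij_betw (map_sum \<alpha> id) (Src m <+> Tgt m) (Src m' <+> Tgt m)"
  proof -
    have "bij_betw \<alpha> (Src m) (Src m')" using assms by (simp add: bisp_iso_maps_def)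
    then have im: "Src m' = \<alpha> ` Src m" by (simp add: bij_betw_imp_surj_on)
    have "map_sum \<alpha> id ` (Src m <+> Tgt m) = Src m' <+> Tgt m"
      unfolding Plus_def im by (simp add: image_Un image_image)
    moreover have "inj_on (map_sum \<alpha> id) (Src m <+> Tgt m)"
      using bij_betw_imp_inj_on[OF \<open>bij_betw \<alpha> _ _\<close>] by (intro inj_onI) (elim PlusE, auto dest: inj_onD)
    ultimately show ?thesis by (simp add: bij_betw_def)
  qed
  then show ?thesis
    by (intro bisp_isoI[of "map_sum \<alpha> id" _ _ "\<lambda>b. b"])
      (use assms in \<open>auto simp: hat_bisp_def bisp_iso_maps_def elts_gset_sum eqv_map_sum eqv_id' eqv_id\<close>)
qed

lemma hval_cong:
  fixes X X' :: "('g, 'u::infinite) gset"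
  assumes R: "prod_functor G R" and o: "X \<in> Fin G" "X' \<in> Fin G" "ptgt m \<in> Fin G"
    and m: "wf_bisp G X X' m" and m': "wf_bisp G X X' m'" and iso: "bisp_iso_maps G m m' \<alpha> (\<lambda>b. b)" and t: "ptgt m' = ptgt m"
    and xb: "x \<in> on_obj R X" "b \<in> on_obj R (ptgt m)"
  shows "hval R X X' m x b = hval R X X' m' x b"
proof -
  obtain S i j s where S: "S \<in> Fin G" "eqv G X S i" "eqv G (ptgt m) S j" "is_sum X (ptgt m) S i j"
    and s: "s \<in> on_obj R S" "on_hom R S X (rst G X S i) s = x" "on_hom R S (ptgt m) (rst G (ptgt m) S j) s = b"
    using ex_join[OF R o(1,3) xb] by (elim exE conjE) (rule that)
  have "cls G S X' (hat_bisp i j m) = cls G S X' (hat_bisp i j m')"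
    using cls_eq[OF wf_hat_bisp[OF m S(2,3)] wf_hat_bisp[OF m' S(2), unfolded t, OF S(3)]] hat_bisp_iso[OF iso t] by simp
  then show ?thesis
    using hval_eq[OF R o m S s(1)] hval_eq[OF R o(1,2) _ m', unfolded t, OF o(3) S s(1)] s by simp
qed

text \<open>The source of a bispan out of a disjoint union splits by the summand that its points map to. The part over \<open>X\<close>
  becomes \<open>m\<close>; the part over \<open>Z\<close> becomes \<open>\<nu>\<close>, with the same middle set and its last map replaced by the identity.\<close>

lemma normalise_bispan:
  fixes X Z S X' :: "('g, 'u::infinite) gset"
  assumes o: "X \<in> Fin G" "Z \<in> Fin G"
    and S: "eqv G X S i" "eqv G Z S j" "is_sum X Z S i j"
    and g: "g \<in> BHom G S X'"
  shows "\<exists>(m :: ('g, 'u) ubisp) (\<nu> :: ('g, 'u) ubisp). wf_bisp G X X' m \<and> ptgt m \<in> Fin G \<and>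
     wf_bisp G Z (ptgt m) \<nu> \<and> g = cls G S X' (subst_bisp i j m \<nu>)"
proof -
  note gs = o[THEN Fin_gset]
  obtain p :: "('g, 'u) ubisp" where p: "wf_bisp G S X' p" "g = cls G S X' p" "psrc p \<in> Fin G" "ptgt p \<in> Fin G"
    using g by (rule Hom_bispan_catE)
  note P = wf_bispD[OF p(1)]
  have part: "is_gset G ({a \<in> Src p. pres p a \<in> f ` elts A}, act (psrc p)) \<and>
       eqv G ({a \<in> Src p. pres p a \<in> f ` elts A}, act (psrc p)) A (\<lambda>a. inv_into (elts A) f (pres p a))"
    if A: "is_gset G A" and f: "eqv G A S f" "inj_on f (elts A)" for A :: "('g, 'u) gset" and f
  proof -
    have *: "pres p (act (psrc p) g a) \<in> f ` elts A \<and> inv_into (elts A) f (pres p (act (psrc p) g a)) = act A g (inv_into (elts A) f (pres p a))"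
      if g: "g \<in> carrier G" and a: "a \<in> Src p" and fa: "pres p a \<in> f ` elts A" for g a
    proof -
      obtain x where x: "x \<in> elts A" "pres p a = f x" using fa by blast
      have "pres p (act (psrc p) g a) = f (act A g x)" using eqv_act[OF P(3) g a] eqv_act[OF f(1) g x(1)] x by simp
      then show ?thesis using x f(2) is_gsetD(2)[OF A g x(1)] by simp
    qed
    show ?thesis
      using P(1) * inv_into_into[of _ f "elts A"] unfolding is_gset_def eqv_def by auto
  qed
  have inj: "inj_on i (elts X)" "inj_on j (elts Z)" using S(3) by (auto simp: joint_bij_def)
  let ?A = "({a \<in> Src p. pres p a \<in> i ` elts X}, act (psrc p))"
  let ?C = "({a \<in> Src p. pres p a \<in> j ` elts Z}, act (psrc p))"
  define m where "m = \<lparr>psrc = ?A, ptgt = ptgt p, pres = (\<lambda>a. inv_into (elts X) i (pres p a)), pnorm = pnorm p, ptran = ptran p\<rparr>"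
  define \<nu> where "\<nu> = \<lparr>psrc = ?C, ptgt = ptgt p, pres = (\<lambda>a. inv_into (elts Z) j (pres p a)), pnorm = pnorm p, ptran = (\<lambda>b. b)\<rparr>"
  have sub: "eqv G ({a \<in> Src p. Q a}, act (psrc p)) (ptgt p) (pnorm p)" for Q using P(4) by (simp add: eqv_def)
  have m: "wf_bisp G X X' m" unfolding m_def wf_bisp_def using part[OF gs(1) S(1) inj(1)] P sub by simp
  have \<nu>: "wf_bisp G Z (ptgt m) \<nu>" unfolding m_def \<nu>_def wf_bisp_def using part[OF gs(2) S(2) inj(2)] P sub by (simp add: eqv_id)
  have dj: "\<And>x z. \<lbrakk>x \<in> elts X; z \<in> elts Z\<rbrakk> \<Longrightarrow> i x \<noteq> j z" "\<And>x z. \<lbrakk>x \<in> elts X; z \<in> elts Z\<rbrakk> \<Longrightarrow> j z \<noteq> i x"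
    using S(3) by (auto simp: joint_bij_def)
  have cov: "pres p a \<in> i ` elts X \<or> pres p a \<in> j ` elts Z" if "a \<in> Src p" for a
    using S(3) eqv_in[OF P(3) that] by (auto simp: joint_bij_def)
  let ?\<alpha> = "case_sum fst (\<lambda>e. e)"
  let ?s = "subst_bisp i j m \<nu>"
  have "bij_betw ?\<alpha> (Src ?s) (Src p)"
    unfolding bij_betw_def
  proof
    show "inj_on ?\<alpha> (Src ?s)"
      by (intro inj_onI) (auto simp: subst_bisp_def m_def \<nu>_def elts_gset_sum fibre_product_def dj)
    show "?\<alpha> ` Src ?s = Src p"
    proof
      show "?\<alpha> ` Src ?s \<subseteq> Src p"
        by (auto simp: subst_bisp_def m_def \<nu>_def elts_gset_sum fibre_product_def)
      show "Src p \<subseteq> ?\<alpha> ` Src ?s"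
      proof
        fix a assume a: "a \<in> Src p"
        show "a \<in> ?\<alpha> ` Src ?s"
        proof (cases "pres p a \<in> i ` elts X")
          case True
          then show ?thesis using a eqv_in[OF P(4) a]
            by (intro image_eqI[of _ _ "Inl (a, pnorm p a)"]) (auto simp: subst_bisp_def m_def \<nu>_def elts_gset_sum fibre_product_def)
        next
          case False
          then show ?thesis using a cov[OF a]
            by (intro image_eqI[of _ _ "Inr a"]) (auto simp: subst_bisp_def m_def \<nu>_def elts_gset_sum fibre_product_def)
        qed
      qed
    qed
  qed
  then have "bisp_iso G ?s p"
    by (rule bisp_isoI[of _ _ _ "\<lambda>b. b"])
      (auto simp: subst_bisp_def m_def \<nu>_def elts_gset_sum eqv_gset_sum eqv_id bij_betw_def fibre_product_elts f_inv_into_f, auto simp: eqv_def fibre_product_elts fibre_product_act)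
  then have "g = cls G S X' ?s" using cls_eq[OF wf_subst_bisp[OF m \<nu> S(1,2)] p(1)] p(2) by simp
  moreover have "ptgt m \<in> Fin G" using p(4) by (simp add: m_def)
  ultimately show ?thesis using m \<nu> by blast
qed

end

section \<open>Induction of G-sets and bispans\<close>

context subgroup_pair
begin

text \<open>The class of \<open>(g, a)\<close> in \<open>G \<times>\<^sub>H A\<close>, the quotient of the product by \<open>(g, a) \<sim> (g h\<inverse>, h a)\<close>.\<close>

definition ind_pt :: "('g, 'a) gset \<Rightarrow> 'g \<Rightarrow> 'a \<Rightarrow> ('g \<times> 'a) set" where
  "ind_pt A g a = (\<lambda>h. (g \<otimes> inv h, act A h a)) ` H"

definition ind_gset :: "('g, 'a) gset \<Rightarrow> ('g, ('g \<times> 'a) set) gset" where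
  "ind_gset A = ((\<lambda>(g, a). ind_pt A g a) ` (carrier G \<times> elts A), \<lambda>g C. (\<lambda>(g', a). (g \<otimes> g', a)) ` C)"

text \<open>The extension of an \<open>H\<close>-map \<open>f\<close> from \<open>A\<close> to a \<open>G\<close>-map from the induced set, \<open>[g, a] \<mapsto> g (f a)\<close>.\<close>

definition ind_ext :: "('g, 'x) gset \<Rightarrow> ('a \<Rightarrow> 'x) \<Rightarrow> ('g \<times> 'a) set \<Rightarrow> 'x" where
  "ind_ext X f C = (case (SOME p. p \<in> C) of (g, a) \<Rightarrow> act X g (f a))"

lemma H_closed: "\<one> \<in> H" "h \<in> H \<Longrightarrow> inv h \<in> H" "h \<in> H \<Longrightarrow> h' \<in> H \<Longrightarrow> h \<otimes> h' \<in> H"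
  using sub by (auto simp: subgroup.one_closed subgroup.m_inv_closed subgroup.m_closed)

lemma K_gsetD:
  assumes "is_gset K A"
  shows "\<And>h a. \<lbrakk>h \<in> H; a \<in> elts A\<rbrakk> \<Longrightarrow> act A h a \<in> elts A" "\<And>a. a \<in> elts A \<Longrightarrow> act A \<one> a = a"
    "\<And>h h' a. \<lbrakk>h \<in> H; h' \<in> H; a \<in> elts A\<rbrakk> \<Longrightarrow> act A (h \<otimes> h') a = act A h (act A h' a)"
  using assms unfolding is_gset_def by auto

lemma ind_pt_shift:
  assumes A: "is_gset K A" and g: "g \<in> carrier G" and a: "a \<in> elts A" and h: "h \<in> H"
  shows "ind_pt A (g \<otimes> inv h) (act A h a) = ind_pt A g a"
proof -
  have 1: "ind_pt A (g \<otimes> inv h) (act A h a) \<subseteq> ind_pt A g a" if g: "g \<in> carrier G" and a: "a \<in> elts A" and h: "h \<in> H" for g a h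
  proof
    fix p assume "p \<in> ind_pt A (g \<otimes> inv h) (act A h a)"
    then obtain h' where h': "h' \<in> H" "p = (g \<otimes> inv h \<otimes> inv h', act A h' (act A h a))" by (auto simp: ind_pt_def)
    have "p = (g \<otimes> inv (h' \<otimes> h), act A (h' \<otimes> h) a)"
      using h' h a g H_sub K_gsetD[OF A] by (simp add: inv_mult_group m_assoc)
    then show "p \<in> ind_pt A g a" using H_closed(3)[OF h'(1) h] by (auto simp: ind_pt_def)
  qed
  have "ind_pt A g a = ind_pt A (g \<otimes> inv h \<otimes> inv (inv h)) (act A (inv h) (act A h a))"
    using g h a H_sub H_closed K_gsetD(3)[OF A, of "inv h" h a] K_gsetD(2)[OF A] by (simp add: m_assoc)
  also have "\<dots> \<subseteq> ind_pt A (g \<otimes> inv h) (act A h a)"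
    using g h a H_sub H_closed K_gsetD(1)[OF A] by (intro 1) auto
  finally show ?thesis using 1[OF g a h] by blast
qed

lemma ind_pt_mem: "\<lbrakk>is_gset K A; g \<in> carrier G; a \<in> elts A\<rbrakk> \<Longrightarrow> (g, a) \<in> ind_pt A g a"
  unfolding ind_pt_def using H_closed(1) K_gsetD(2)[of A a] by (intro image_eqI[of _ _ \<one>]) simp_all

lemma ind_pt_eqE:
  assumes "ind_pt A g a = ind_pt A g' a'" "is_gset K A" "g' \<in> carrier G" "a' \<in> elts A"
  obtains h where "h \<in> H" "g' = g \<otimes> inv h" "a' = act A h a"
proof -
  have "(g', a') \<in> ind_pt A g a" using ind_pt_mem[OF assms(2-4)] assms(1) by simp
  then show ?thesis using that by (auto simp: ind_pt_def)
qed

lemma ind_elts_iff: "C \<in> elts (ind_gset A) \<longleftrightarrow> (\<exists>g\<in>carrier G. \<exists>a\<in>elts A. C = ind_pt A g a)"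
  by (auto simp: ind_gset_def)

lemma ind_act_pt: "\<lbrakk>g \<in> carrier G; g' \<in> carrier G\<rbrakk> \<Longrightarrow> act (ind_gset A) g (ind_pt A g' a) = ind_pt A (g \<otimes> g') a"
  unfolding ind_gset_def ind_pt_def using H_sub by (auto simp: image_image m_assoc intro!: image_cong)

lemma is_gset_ind:
  assumes A: "is_gset K A" shows "is_gset G (ind_gset A)"
  unfolding is_gset_def
proof (intro conjI ballI)
  show "finite (elts (ind_gset A))" using fin is_gset_finite[OF A] by (simp add: ind_gset_def)
qed (auto simp: ind_elts_iff ind_act_pt m_assoc, metis m_closed)

lemma ind_ext_pt:
  assumes A: "is_gset K A" and X: "is_gset G X" and f: "eqv K A X f" and g: "g \<in> carrier G" and a: "a \<in> elts A"
  shows "ind_ext X f (ind_pt A g a) = act X g (f a)"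
proof -
  have "(SOME p. p \<in> ind_pt A g a) \<in> ind_pt A g a" by (rule someI[of _ "(g, a)"]) (rule ind_pt_mem[OF A g a])
  then obtain h where h: "h \<in> H" "(SOME p. p \<in> ind_pt A g a) = (g \<otimes> inv h, act A h a)" by (auto simp: ind_pt_def)
  have fa: "f a \<in> elts X" by (rule eqv_in[OF f a])
  have "ind_ext X f (ind_pt A g a) = act X (g \<otimes> inv h) (act X h (f a))"
    using h eqv_act[OF f _ a, of h] by (simp add: ind_ext_def)
  also have "\<dots> = act X g (f a)"
    using g H_sub[OF h(1)] fa is_gsetD[OF X] is_gset_inv(1)[OF X H_sub[OF h(1)] fa] by simp
  finally show ?thesis .
qed

lemma eqv_ind_ext:
  assumes A: "is_gset K A" and X: "is_gset G X" and f: "eqv K A X f"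
  shows "eqv G (ind_gset A) X (ind_ext X f)"
  unfolding eqv_def
  using eqv_in[OF f] is_gsetD[OF X] by (auto simp: ind_elts_iff ind_act_pt ind_ext_pt[OF A X f])

lemma eqv_ind_unit:
  assumes A: "is_gset K A" shows "eqv K A (ind_gset A) (ind_pt A \<one>)"
  unfolding eqv_def
proof (intro conjI ballI)
  fix h a assume h: "h \<in> carrier K" and a: "a \<in> elts A"
  then have "ind_pt A (h \<otimes> inv h) (act A h a) = ind_pt A h a" using H_sub by (intro ind_pt_shift[OF A]) auto
  then show "ind_pt A \<one> (act A h a) = act (ind_gset A) h (ind_pt A \<one> a)" using h H_sub by (simp add: ind_act_pt)
qed (auto simp: ind_elts_iff)

lemma inj_ind_unit:
  assumes A: "is_gset K A" shows "inj_on (ind_pt A \<one>) (elts A)"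
proof (rule inj_onI)
  fix a a' assume a: "a \<in> elts A" and a': "a' \<in> elts A" and eq: "ind_pt A \<one> a = ind_pt A \<one> a'"
  obtain h where h: "h \<in> H" "\<one> = \<one> \<otimes> inv h" "a' = act A h a" using ind_pt_eqE[OF eq A _ a'] by auto
  then have "h = \<one>" using H_sub by (metis inv_closed inv_inv inv_one l_one)
  then show "a = a'" using h K_gsetD(2)[OF A a] by simp
qed

text \<open>The unit \<open>a \<mapsto> [1, a]\<close> of induction is injective.\<close>

lemma ex_embedding:
  fixes Y :: "('g, 'u::infinite) gset"
  assumes Y: "Y \<in> Fin K"
  shows "\<exists>U i. U \<in> Fin G \<and> eqv K Y (U :: ('g, 'u) gset) i \<and> inj_on i (elts Y)"
proof -
  have g: "is_gset K Y" using Y by (rule Fin_gset)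
  obtain U :: "('g, 'u) gset" and \<theta> where U: "U \<in> Fin G" "bij_betw \<theta> (elts (ind_gset Y)) (elts U)" "eqv G (ind_gset Y) U \<theta>"
    using transport_finite_gset[OF is_gset_ind[OF g]] by blast
  have "eqv K Y U (\<lambda>y. \<theta> (ind_pt Y \<one> y))" by (rule eqv_comp'[OF eqv_ind_unit[OF g] eqv_sub[OF U(3)]])
  moreover have "inj_on (\<theta> \<circ> ind_pt Y \<one>) (elts Y)"
    using U(2) eqv_in[OF eqv_ind_unit[OF g]]
    by (intro comp_inj_on inj_ind_unit[OF g]) (auto simp: bij_betw_def intro: inj_on_subset)
  ultimately show ?thesis using U(1) unfolding comp_def by blast
qed

text \<open>\<open>X \<leftarrow> \<emptyset> \<rightarrow> B \<rightarrow> Y\<close>. It does not depend on the variable in \<open>X\<close>: for injective \<open>j\<close> it is the constant indicator of \<open>B\<close>.\<close>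

definition const_bisp :: "('g, 'c) gset \<Rightarrow> ('c \<Rightarrow> 'y) \<Rightarrow> ('g, unit, 'c, 'x, 'y) bisp" where
  "const_bisp B j = \<lparr>psrc = ({}, \<lambda>_ x. x), ptgt = B, pres = (\<lambda>_. undefined), pnorm = (\<lambda>_. undefined), ptran = j\<rparr>"

lemma wf_const_bisp: "\<lbrakk>is_gset K B0; eqv K B0 B j\<rbrakk> \<Longrightarrow> wf_bisp K X B (const_bisp B0 j)"
  by (simp add: wf_bisp_def const_bisp_def is_gset_empty eqv_def)

text \<open>A presentation of a bispan \<open>w\<close> of \<open>H\<close>-sets: a bispan \<open>m\<close> of \<open>G\<close>-sets of which \<open>w\<close> is the part over an \<open>H\<close>-map \<open>j\<close> into its
  middle set.\<close>

definition presents ::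
  "('g, 'u) gset \<Rightarrow> ('g, 'u) gset \<Rightarrow> ('g, 'u) bispan set \<Rightarrow> ('g, 'a, 'u, 'u, 'u) bisp \<Rightarrow> ('g, 'u) gset \<Rightarrow> ('u \<Rightarrow> 'u) \<Rightarrow> bool" where
  "presents X X' w m B j \<longleftrightarrow> wf_bisp G X X' m \<and> ptgt m \<in> Fin G \<and> is_gset K B \<and> eqv K B (ptgt m) j \<and>
     w = rcls X X' (pullb m B j)"

text \<open>The induced bispan. Its middle set is moved to \<open>U\<close> in the carrier type by \<open>\<theta>\<close>, as presentations require.\<close>

definition ind_bisp :: "('g, 'x) gset \<Rightarrow> ('g, 'y) gset \<Rightarrow> ('g, 'a, 'b, 'x, 'y) bisp \<Rightarrow> ('g, 'u) gset \<Rightarrow> (('g \<times> 'b) set \<Rightarrow> 'u) \<Rightarrow> ('g, ('g \<times> 'a) set, 'u, 'x, 'y) bisp" where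
  "ind_bisp X X' r U \<theta> = \<lparr>psrc = ind_gset (psrc r), ptgt = U, pres = ind_ext X (pres r),
     pnorm = (\<lambda>C. \<theta> (ind_ext (ind_gset (ptgt r)) (\<lambda>a. ind_pt (ptgt r) \<one> (pnorm r a)) C)),
     ptran = (\<lambda>u. ind_ext X' (ptran r) (inv_into (elts (ind_gset (ptgt r))) \<theta> u))\<rparr>"

context
  fixes X X' :: "('g, 'x) gset" and r :: "('g, 'a, 'b, 'x, 'x) bisp" and U :: "('g, 'u) gset" and \<theta>
  assumes X: "is_gset G X" and X': "is_gset G X'" and r: "wf_bisp K X X' r" and U: "is_gset G U"
    and \<theta>: "bij_betw \<theta> (elts (ind_gset (ptgt r))) (elts U)" "eqv G (ind_gset (ptgt r)) U \<theta>"
begin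

lemma ind_norm_eqv: "eqv K (psrc r) (ind_gset (ptgt r)) (\<lambda>a. ind_pt (ptgt r) \<one> (pnorm r a))"
  by (rule eqv_comp'[OF wf_bispD(4)[OF r] eqv_ind_unit[OF wf_bispD(2)[OF r]]])

lemma ind_bisp_norm: "\<lbrakk>g \<in> carrier G; a \<in> Src r\<rbrakk> \<Longrightarrow> pnorm (ind_bisp X X' r U \<theta>) (ind_pt (psrc r) g a) = \<theta> (ind_pt (ptgt r) g (pnorm r a))"
  using ind_ext_pt[OF wf_bispD(1)[OF r] is_gset_ind[OF wf_bispD(2)[OF r]] ind_norm_eqv] by (simp add: ind_bisp_def ind_act_pt)

lemma ind_bisp_res: "\<lbrakk>g \<in> carrier G; a \<in> Src r\<rbrakk> \<Longrightarrow> pres (ind_bisp X X' r U \<theta>) (ind_pt (psrc r) g a) = act X g (pres r a)"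
  using ind_ext_pt[OF wf_bispD(1)[OF r] X wf_bispD(3)[OF r]] by (simp add: ind_bisp_def)

lemma ind_bisp_tran: "\<lbrakk>g \<in> carrier G; b \<in> Tgt r\<rbrakk> \<Longrightarrow> ptran (ind_bisp X X' r U \<theta>) (\<theta> (ind_pt (ptgt r) g b)) = act X' g (ptran r b)"
  using ind_ext_pt[OF wf_bispD(2)[OF r] X' wf_bispD(5)[OF r]] \<theta>(1)
  by (simp add: ind_bisp_def bij_betw_inv_into_left ind_elts_iff) (metis bij_betw_inv_into_left ind_elts_iff)

lemma wf_ind_bisp: "wf_bisp G X X' (ind_bisp X X' r U \<theta>)"
proof -
  note R = wf_bispD[OF r]
  note Bg = is_gset_ind[OF R(2)]
  have "eqv G U X' (\<lambda>u. ind_ext X' (ptran r) (inv_into (elts (ind_gset (ptgt r))) \<theta> u))"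
    by (rule eqv_comp'[OF eqv_inv_into[OF Bg \<theta>] eqv_ind_ext[OF R(2) X' R(5)]])
  moreover have "eqv G (ind_gset (psrc r)) U (\<lambda>C. \<theta> (ind_ext (ind_gset (ptgt r)) (\<lambda>a. ind_pt (ptgt r) \<one> (pnorm r a)) C))"
    by (rule eqv_comp'[OF eqv_ind_ext[OF R(1) Bg ind_norm_eqv] \<theta>(2)])
  ultimately show ?thesis
    using eqv_ind_ext[OF R(1) X R(3)] is_gset_ind[OF R(1)] U by (simp add: wf_bisp_def ind_bisp_def)
qed

lemma eqv_unit_U: "eqv K (ptgt r) U (\<lambda>b. \<theta> (ind_pt (ptgt r) \<one> b))"
  by (rule eqv_comp'[OF eqv_ind_unit[OF wf_bispD(2)[OF r]] eqv_sub[OF \<theta>(2)]])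

lemma \<theta>_eq: "\<lbrakk>C \<in> elts (ind_gset (ptgt r)); C' \<in> elts (ind_gset (ptgt r))\<rbrakk> \<Longrightarrow> \<theta> C = \<theta> C' \<longleftrightarrow> C = C'"
  using \<theta>(1) by (auto simp: bij_betw_def inj_on_def)

lemma pt_in: "\<lbrakk>g \<in> carrier G; b \<in> elts A\<rbrakk> \<Longrightarrow> ind_pt A g b \<in> elts (ind_gset A)"
  by (auto simp: ind_elts_iff)

text \<open>The unit of induction identifies \<open>r\<close> with the part of its induced bispan over the classes \<open>[1, b]\<close>: if
  \<open>[g, n a] = [1, b]\<close> then \<open>g\<close> lies in \<open>H\<close>, so \<open>[g, a] = [1, g a]\<close>.\<close>

lemma pullb_ind_bisp: "bisp_iso K r (pullb (ind_bisp X X' r U \<theta>) (ptgt r) (\<lambda>b. \<theta> (ind_pt (ptgt r) \<one> b)))"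
proof (rule bisp_isoI[of "\<lambda>a. (ind_pt (psrc r) \<one> a, pnorm r a)" _ _ "\<lambda>b. b"])
  note R = wf_bispD[OF r]
  let ?F = "fibre_product (ind_gset (psrc r)) (ptgt r) (pnorm (ind_bisp X X' r U \<theta>)) (\<lambda>b. \<theta> (ind_pt (ptgt r) \<one> b))"
  have src: "psrc (pullb (ind_bisp X X' r U \<theta>) (ptgt r) (\<lambda>b. \<theta> (ind_pt (ptgt r) \<one> b))) = ?F"
    by (simp add: pullb_def ind_bisp_def)
  have in_F: "(ind_pt (psrc r) \<one> a, pnorm r a) \<in> elts ?F" if "a \<in> Src r" for a
    using that ind_bisp_norm[of \<one> a] pt_in[of \<one> a "psrc r"] eqv_in[OF R(4) that] by simp
  show "bij_betw (\<lambda>a. (ind_pt (psrc r) \<one> a, pnorm r a)) (Src r) (elts (psrc (pullb (ind_bisp X X' r U \<theta>) (ptgt r) (\<lambda>b. \<theta> (ind_pt (ptgt r) \<one> b)))))"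
    unfolding src bij_betw_def
  proof
    show "inj_on (\<lambda>a. (ind_pt (psrc r) \<one> a, pnorm r a)) (Src r)"
      using inj_ind_unit[OF R(1)] by (auto simp: inj_on_def)
    show "(\<lambda>a. (ind_pt (psrc r) \<one> a, pnorm r a)) ` Src r = elts ?F"
    proof
      show "(\<lambda>a. (ind_pt (psrc r) \<one> a, pnorm r a)) ` Src r \<subseteq> elts ?F" using in_F by auto
      show "elts ?F \<subseteq> (\<lambda>a. (ind_pt (psrc r) \<one> a, pnorm r a)) ` Src r"
      proof
        fix z assume z: "z \<in> elts ?F"
        obtain C b where zz: "z = (C, b)" by (cases z)
        then obtain g a where ga: "g \<in> carrier G" "a \<in> Src r" "C = ind_pt (psrc r) g a" and b: "b \<in> Tgt r"
          and n: "pnorm (ind_bisp X X' r U \<theta>) C = \<theta> (ind_pt (ptgt r) \<one> b)" using z by (auto simp: ind_elts_iff)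
        have na: "pnorm r a \<in> Tgt r" by (rule eqv_in[OF R(4) ga(2)])
        have "ind_pt (ptgt r) g (pnorm r a) = ind_pt (ptgt r) \<one> b"
          using n ind_bisp_norm[OF ga(1,2)] ga(3) \<theta>_eq[OF pt_in[OF ga(1) na] pt_in[OF one_closed b]] by simp
        then obtain h where h: "h \<in> H" "\<one> = g \<otimes> inv h" "b = act (ptgt r) h (pnorm r a)" by (rule ind_pt_eqE[OF _ R(2) one_closed b])
        have "C = ind_pt (psrc r) \<one> (act (psrc r) h a)" using ind_pt_shift[OF R(1) ga(1,2) h(1)] h(2) ga(3) by simp
        moreover have "pnorm r (act (psrc r) h a) = b" using eqv_act[OF R(4) _ ga(2), of h] h by simp
        moreover have "act (psrc r) h a \<in> Src r" using K_gsetD(1)[OF R(1) h(1) ga(2)] .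
        ultimately show "z \<in> (\<lambda>a. (ind_pt (psrc r) \<one> a, pnorm r a)) ` Src r" using zz by blast
      qed
    qed
  qed
  show "eqv K (psrc r) (psrc (pullb (ind_bisp X X' r U \<theta>) (ptgt r) (\<lambda>b. \<theta> (ind_pt (ptgt r) \<one> b)))) (\<lambda>a. (ind_pt (psrc r) \<one> a, pnorm r a))"
    unfolding src eqv_def using in_F eqv_act[OF eqv_ind_unit[OF R(1)]] eqv_act[OF R(4)] by simp
qed (use ind_bisp_res[of \<one>] ind_bisp_tran[of \<one>] is_gset_one[OF X] is_gset_one[OF X'] eqv_in[OF wf_bispD(3)[OF r]] eqv_in[OF wf_bispD(5)[OF r]]
    in \<open>auto simp: pullb_def eqv_id bij_betw_def\<close>)

text \<open>The induced presentation is universal. The \<open>G\<close>-map \<open>h\<close> adjoint to \<open>j\<close> sends \<open>[g, b]\<close> to \<open>g (j b)\<close>, and \<open>G \<times>\<^sub>H _\<close> sends a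
  pullback square along \<open>j\<close> to a pullback square along \<open>h\<close>, because \<open>[g, n a] = [g', n a']\<close> lets \<open>g\<close> be moved to \<open>g'\<close> by an
  element of \<open>H\<close>.\<close>

lemma ind_bisp_universal:
  assumes m: "wf_bisp G X X' (m :: ('g, 'c, 'd, 'x, 'x) bisp)" and B: "is_gset K B" and j: "eqv K B (ptgt m) j"
    and iso: "bisp_iso_maps K r (pullb m B j) \<alpha> \<beta>"
  defines "h \<equiv> \<lambda>u. ind_ext (ptgt m) (\<lambda>b. j (\<beta> b)) (inv_into (elts (ind_gset (ptgt r))) \<theta> u)"
  shows "eqv G U (ptgt m) h" and "\<And>b. b \<in> Tgt r \<Longrightarrow> h (\<theta> (ind_pt (ptgt r) \<one> b)) = j (\<beta> b)"
    and "\<exists>\<mu>. bisp_iso_maps G (ind_bisp X X' r U \<theta>) (pullb m U h) \<mu> (\<lambda>b. b)"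
proof -
  note R = wf_bispD[OF r] and M = wf_bispD[OF m]
  have I: "bij_betw \<alpha> (Src r) (elts (fibre_product (psrc m) B (pnorm m) j))" "bij_betw \<beta> (Tgt r) (elts B)"
      "eqv K (psrc r) (fibre_product (psrc m) B (pnorm m) j) \<alpha>" "eqv K (ptgt r) B \<beta>"
      "\<And>a. a \<in> Src r \<Longrightarrow> pres m (fst (\<alpha> a)) = pres r a" "\<And>a. a \<in> Src r \<Longrightarrow> snd (\<alpha> a) = \<beta> (pnorm r a)"
      "\<And>b. b \<in> Tgt r \<Longrightarrow> ptran m (j (\<beta> b)) = ptran r b"
    using iso by (auto simp: bisp_iso_maps_def pullb_def)
  have jb: "eqv K (ptgt r) (ptgt m) (\<lambda>b. j (\<beta> b))" by (rule eqv_comp'[OF I(4) j])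
  show he: "eqv G U (ptgt m) h" unfolding h_def
    by (rule eqv_comp'[OF eqv_inv_into[OF is_gset_ind[OF R(2)] \<theta>] eqv_ind_ext[OF R(2) M(2) jb]])
  have h_pt: "h (\<theta> (ind_pt (ptgt r) g b)) = act (ptgt m) g (j (\<beta> b))" if "g \<in> carrier G" "b \<in> Tgt r" for g b
    unfolding h_def using bij_betw_inv_into_left[OF \<theta>(1) pt_in[OF that]] ind_ext_pt[OF R(2) M(2) jb that] by simp
  show "h (\<theta> (ind_pt (ptgt r) \<one> b)) = j (\<beta> b)" if "b \<in> Tgt r" for b
    using h_pt[OF one_closed that] is_gset_one[OF M(2) eqv_in[OF jb that]] by simp
  have \<alpha>f: "fst (\<alpha> a) \<in> Src m" "pnorm m (fst (\<alpha> a)) = j (\<beta> (pnorm r a))" if "a \<in> Src r" for a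
    using eqv_in[OF I(3) that] I(6)[OF that] by (auto simp: fibre_product_elts)
  have \<alpha>e: "eqv K (psrc r) (psrc m) (\<lambda>a. fst (\<alpha> a))" by (rule eqv_comp'[OF I(3) eqv_fst])
  let ?m = "ind_bisp X X' r U \<theta>"
  \<comment> \<open>The first component extends \<open>fst \<circ> \<alpha>\<close>, the second is forced by the identity on the middle sets.\<close>
  define \<mu> where "\<mu> C = (ind_ext (psrc m) (\<lambda>a. fst (\<alpha> a)) C, pnorm ?m C)" for C
  have \<mu>_pt: "\<mu> (ind_pt (psrc r) g a) = (act (psrc m) g (fst (\<alpha> a)), \<theta> (ind_pt (ptgt r) g (pnorm r a)))"
    if "g \<in> carrier G" "a \<in> Src r" for g a
    using that ind_ext_pt[OF R(1) M(1) \<alpha>e that] ind_bisp_norm[OF that] by (simp add: \<mu>_def)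
  let ?F = "fibre_product (psrc m) U (pnorm m) h"
  have \<mu>F: "\<mu> (ind_pt (psrc r) g a) \<in> elts ?F" if ga: "g \<in> carrier G" "a \<in> Src r" for g a
  proof -
    have na: "pnorm r a \<in> Tgt r" by (rule eqv_in[OF R(4) ga(2)])
    have "pnorm m (act (psrc m) g (fst (\<alpha> a))) = act (ptgt m) g (j (\<beta> (pnorm r a)))"
      using eqv_act[OF M(4) ga(1) \<alpha>f(1)[OF ga(2)]] \<alpha>f(2)[OF ga(2)] by simp
    then show ?thesis
      unfolding \<mu>_pt[OF ga] using h_pt[OF ga(1) na] is_gset_closed[OF M(1) ga(1) \<alpha>f(1)[OF ga(2)]] eqv_in[OF \<theta>(2) pt_in[OF ga(1) na]] by simp
  qed
  have \<mu>_bij: "bij_betw \<mu> (elts (ind_gset (psrc r))) (elts ?F)"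
    unfolding bij_betw_def
  proof
    show "inj_on \<mu> (elts (ind_gset (psrc r)))"
    proof (rule inj_onI)
      fix C C' assume "C \<in> elts (ind_gset (psrc r))" "C' \<in> elts (ind_gset (psrc r))" and eq: "\<mu> C = \<mu> C'"
      then obtain g a g' a' where ga: "g \<in> carrier G" "a \<in> Src r" "C = ind_pt (psrc r) g a"
        and ga': "g' \<in> carrier G" "a' \<in> Src r" "C' = ind_pt (psrc r) g' a'" by (auto simp: ind_elts_iff)
      have na: "pnorm r a \<in> Tgt r" "pnorm r a' \<in> Tgt r" using eqv_in[OF R(4)] ga(2) ga'(2) by auto
      have eq1: "act (psrc m) g (fst (\<alpha> a)) = act (psrc m) g' (fst (\<alpha> a'))"
        and "\<theta> (ind_pt (ptgt r) g (pnorm r a)) = \<theta> (ind_pt (ptgt r) g' (pnorm r a'))"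
        using eq \<mu>_pt[OF ga(1,2)] \<mu>_pt[OF ga'(1,2)] ga(3) ga'(3) by auto
      then have "ind_pt (ptgt r) g (pnorm r a) = ind_pt (ptgt r) g' (pnorm r a')"
        using \<theta>_eq[OF pt_in[OF ga(1) na(1)] pt_in[OF ga'(1) na(2)]] by simp
      then obtain k where k: "k \<in> H" "g' = g \<otimes> inv k" "pnorm r a' = act (ptgt r) k (pnorm r a)"
        by (rule ind_pt_eqE[OF _ R(2) ga'(1) na(2)])
      let ?a = "act (psrc r) k a"
      have ka: "?a \<in> Src r" by (rule K_gsetD(1)[OF R(1) k(1) ga(2)])
      have C: "C = ind_pt (psrc r) g' ?a" using ind_pt_shift[OF R(1) ga(1,2) k(1)] k(2) ga(3) by simp
      have "act (psrc m) g' (fst (\<alpha> ?a)) = act (psrc m) g' (fst (\<alpha> a'))"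
        using eq1 \<mu>_pt[OF ga(1,2)] \<mu>_pt[OF ga'(1) ka] C ga(3) by simp
      then have "fst (\<alpha> ?a) = fst (\<alpha> a')" by (rule is_gset_inj[OF M(1) ga'(1) \<alpha>f(1)[OF ka] \<alpha>f(1)[OF ga'(2)]])
      moreover have "snd (\<alpha> ?a) = snd (\<alpha> a')" using I(6)[OF ka] I(6)[OF ga'(2)] k(3) eqv_act[OF R(4) _ ga(2), of k] k(1) by simp
      ultimately have "\<alpha> ?a = \<alpha> a'" by (simp add: prod_eq_iff)
      then have "?a = a'" using I(1) ka ga'(2) by (auto simp: bij_betw_def inj_on_def)
      then show "C = C'" using C ga'(3) by simp
    qed
    show "\<mu> ` elts (ind_gset (psrc r)) = elts ?F"
    proof
      show "\<mu> ` elts (ind_gset (psrc r)) \<subseteq> elts ?F" using \<mu>F by (auto simp: ind_elts_iff)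
      show "elts ?F \<subseteq> \<mu> ` elts (ind_gset (psrc r))"
      proof
        fix z assume z: "z \<in> elts ?F"
        obtain v u where zz: "z = (v, u)" by (cases z)
        then have v: "v \<in> Src m" and u: "u \<in> elts U" and n: "pnorm m v = h u" using z by auto
        have "u \<in> \<theta> ` elts (ind_gset (ptgt r))" using u by (simp add: bij_betw_imp_surj_on[OF \<theta>(1)])
        then obtain g b where gb: "g \<in> carrier G" "b \<in> Tgt r" "u = \<theta> (ind_pt (ptgt r) g b)" by (auto simp: ind_elts_iff)
        let ?v = "act (psrc m) (inv g) v"
        have v': "?v \<in> Src m" "act (psrc m) g ?v = v" using is_gset_closed[OF M(1) inv_closed[OF gb(1)] v] is_gset_inv(2)[OF M(1) gb(1) v] by auto
        have jbb: "j (\<beta> b) \<in> Tgt m" by (rule eqv_in[OF jb gb(2)])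
        have "pnorm m ?v = act (ptgt m) (inv g) (act (ptgt m) g (j (\<beta> b)))"
          using eqv_act[OF M(4) inv_closed[OF gb(1)] v] n h_pt[OF gb(1,2)] gb(3) by simp
        then have "pnorm m ?v = j (\<beta> b)" using is_gset_inv(1)[OF M(2) gb(1) jbb] by simp
        then have "(?v, \<beta> b) \<in> elts (fibre_product (psrc m) B (pnorm m) j)" using v'(1) eqv_in[OF I(4) gb(2)] by simp
        then have "(?v, \<beta> b) \<in> \<alpha> ` Src r" by (simp add: bij_betw_imp_surj_on[OF I(1)])
        then obtain a where a: "a \<in> Src r" "\<alpha> a = (?v, \<beta> b)" by force
        have "\<beta> (pnorm r a) = \<beta> b" using I(6)[OF a(1)] a(2) by simp
        then have "pnorm r a = b" using I(2) eqv_in[OF R(4) a(1)] gb(2) by (auto simp: bij_betw_def inj_on_def)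
        then have "\<mu> (ind_pt (psrc r) g a) = z" using \<mu>_pt[OF gb(1) a(1)] a(2) v'(2) gb(3) zz by simp
        then show "z \<in> \<mu> ` elts (ind_gset (psrc r))" using pt_in[OF gb(1) a(1)] by (metis imageI)
      qed
    qed
  qed
  have "bisp_iso_maps G ?m (pullb m U h) \<mu> (\<lambda>b. b)"
    unfolding bisp_iso_maps_def
  proof (intro conjI ballI)
    show "bij_betw \<mu> (Src ?m) (elts (psrc (pullb m U h)))" using \<mu>_bij by (simp add: ind_bisp_def pullb_def)
    show "bij_betw (\<lambda>b. b) (Tgt ?m) (elts (ptgt (pullb m U h)))" by (simp add: ind_bisp_def pullb_def bij_betw_def)
    have "eqv G (ind_gset (psrc r)) ?F \<mu>"
      unfolding eqv_def
      using \<mu>F eqv_act[OF eqv_ind_ext[OF R(1) M(1) \<alpha>e]] eqv_act[OF wf_bispD(4)[OF wf_ind_bisp]]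
      by (auto simp: ind_elts_iff \<mu>_def ind_bisp_def)
    then show "eqv G (psrc ?m) (psrc (pullb m U h)) \<mu>" by (simp add: ind_bisp_def pullb_def)
    show "eqv G (ptgt ?m) (ptgt (pullb m U h)) (\<lambda>b. b)" by (simp add: ind_bisp_def pullb_def eqv_id)
    fix C assume "C \<in> Src ?m"
    then obtain g a where ga: "g \<in> carrier G" "a \<in> Src r" "C = ind_pt (psrc r) g a" by (auto simp: ind_elts_iff ind_bisp_def)
    show "pres (pullb m U h) (\<mu> C) = pres ?m C"
      using \<mu>_pt[OF ga(1,2)] ga(3) ind_bisp_res[OF ga(1,2)] eqv_act[OF M(3) ga(1) \<alpha>f(1)[OF ga(2)]] I(5)[OF ga(2)] by (simp add: pullb_def)
    show "pnorm (pullb m U h) (\<mu> C) = pnorm ?m C" by (simp add: pullb_def \<mu>_def)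
  next
    fix u assume "u \<in> Tgt ?m"
    then have "u \<in> \<theta> ` elts (ind_gset (ptgt r))" by (simp add: bij_betw_imp_surj_on[OF \<theta>(1)] ind_bisp_def)
    then obtain g b where gb: "g \<in> carrier G" "b \<in> Tgt r" "u = \<theta> (ind_pt (ptgt r) g b)" by (auto simp: ind_elts_iff)
    show "ptran (pullb m U h) u = ptran ?m u"
      using gb ind_bisp_tran[OF gb(1,2)] h_pt[OF gb(1,2)] eqv_act[OF M(5) gb(1) eqv_in[OF jb gb(2)]] I(7)[OF gb(2)] by (simp add: pullb_def)
  qed
  then show "\<exists>\<mu>. bisp_iso_maps G ?m (pullb m U h) \<mu> (\<lambda>b. b)" by blast
qed

end

end

section \<open>Bispans between restricted sets\<close>

context plain_group
begin

lemma pullb_iso: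
  assumes iso: "bisp_iso_maps G m m' \<mu> (\<lambda>b. b)" and j: "eqv G B (ptgt m) j"
  shows "bisp_iso G (pullb m B j) (pullb m' B j)"
proof -
  have bij: "bij_betw \<mu> (Src m) (Src m')" and e: "eqv G (psrc m) (psrc m') \<mu>"
    and n: "\<And>a. a \<in> Src m \<Longrightarrow> pres m' (\<mu> a) = pres m a \<and> pnorm m' (\<mu> a) = pnorm m a"
    and tr: "\<And>b. b \<in> Tgt m \<Longrightarrow> ptran m' b = ptran m b"
    using iso by (auto simp: bisp_iso_maps_def)
  let ?f = "\<lambda>z. (\<mu> (fst z), snd z)" and ?F = "fibre_product (psrc m) B (pnorm m) j" and ?F' = "fibre_product (psrc m') B (pnorm m') j"
  have bij': "bij_betw ?f (elts ?F) (elts ?F')"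
    unfolding bij_betw_def
  proof
    show "inj_on ?f (elts ?F)"
      using bij_betw_imp_inj_on[OF bij] by (intro inj_onI) (auto simp: fibre_product_def dest: inj_onD)
    show "?f ` elts ?F = elts ?F'"
    proof
      show "?f ` elts ?F \<subseteq> elts ?F'" using n eqv_in[OF e] by (auto simp: fibre_product_def)
      show "elts ?F' \<subseteq> ?f ` elts ?F"
      proof
        fix z assume z: "z \<in> elts ?F'"
        then have "fst z \<in> \<mu> ` Src m" by (simp add: fibre_product_elts bij_betw_imp_surj_on[OF bij])
        then obtain a where a: "a \<in> Src m" "fst z = \<mu> a" by blast
        then have "(a, snd z) \<in> elts ?F" using z n[OF a(1)] by (simp add: fibre_product_elts)
        then show "z \<in> ?f ` elts ?F" using a(2) by (intro image_eqI[of _ _ "(a, snd z)"]) (simp_all add: prod_eq_iff)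
      qed
    qed
  qed
  have trB: "ptran m' (j b) = ptran m (j b)" if "b \<in> elts B" for b using tr eqv_in[OF j that] by blast
  show ?thesis
    by (rule bisp_isoI[of ?f _ _ "\<lambda>b. b"])
      (use bij' n e trB in \<open>auto simp: pullb_def eqv_id eqv_def bij_betw_def fibre_product_elts fibre_product_act\<close>)
qed

lemma replace_source:
  assumes m: "wf_bisp G X X' (m :: ('g, 'a, 'b, 'x, 'y) bisp)"
  shows "\<exists>(m' :: ('g, 'u::infinite, 'b, 'x, 'y) bisp) \<mu>. wf_bisp G X X' m' \<and> ptgt m' = ptgt m \<and> bisp_iso_maps G m m' \<mu> (\<lambda>b. b)"
proof -
  note M = wf_bispD[OF m]
  obtain A :: "('g, 'u) gset" and \<mu> where A: "A \<in> Fin G" "bij_betw \<mu> (Src m) (elts A)" "eqv G (psrc m) A \<mu>"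
    using transport_finite_gset[OF M(1)] by blast
  define \<mu>' where "\<mu>' = inv_into (Src m) \<mu>"
  have \<mu>': "eqv G A (psrc m) \<mu>'" unfolding \<mu>'_def by (rule eqv_inv_into[OF M(1) A(2,3)])
  have inv: "\<mu>' (\<mu> a) = a" if "a \<in> Src m" for a unfolding \<mu>'_def by (rule bij_betw_inv_into_left[OF A(2) that])
  let ?m = "\<lparr>psrc = A, ptgt = ptgt m, pres = (\<lambda>a. pres m (\<mu>' a)), pnorm = (\<lambda>a. pnorm m (\<mu>' a)), ptran = ptran m\<rparr>"
  have "wf_bisp G X X' ?m"
    using M Fin_gset[OF A(1)] eqv_comp'[OF \<mu>' M(3)] eqv_comp'[OF \<mu>' M(4)] by (simp add: wf_bisp_def)
  moreover have "bisp_iso_maps G m ?m \<mu> (\<lambda>b. b)" using A inv by (simp add: bisp_iso_maps_def eqv_id bij_betw_def)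
  ultimately show ?thesis by (intro exI[of _ ?m] exI[of _ \<mu>]) simp
qed

end

context subgroup_pair
begin

lemma bisp_iso_maps_sub: "bisp_iso_maps G p p' \<alpha> \<beta> \<Longrightarrow> bisp_iso_maps K p p' \<alpha> \<beta>"
  unfolding bisp_iso_maps_def by (auto simp: eqv_sub)

lemma ex_presentation:
  fixes X X' :: "('g, 'u::infinite) gset"
  assumes o: "X \<in> Fin G" "X' \<in> Fin G" and w: "w \<in> RHom X X'"
  shows "\<exists>(m :: ('g, 'u) ubisp) B j. presents X X' w m B j"
proof -
  note gs = o[THEN Fin_gset]
  obtain r :: "('g, 'u) ubisp" where r: "wf_bisp K (res X) (res X') r" "w = rcls X X' r" using w by (rule K.Hom_bispan_catE)
  then have r': "wf_bisp K X X' r" by simp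
  note rt = wf_bispD(2)[OF r']
  obtain U :: "('g, 'u) gset" and \<theta> where U: "U \<in> Fin G" and \<theta>: "bij_betw \<theta> (elts (ind_gset (ptgt r))) (elts U)" "eqv G (ind_gset (ptgt r)) U \<theta>"
    using transport_finite_gset[OF is_gset_ind[OF rt]] by blast
  note Ug = Fin_gset[OF U]
  let ?m = "ind_bisp X X' r U \<theta>" and ?j = "\<lambda>b. \<theta> (ind_pt (ptgt r) \<one> b)"
  note m = wf_ind_bisp[OF gs r' Ug \<theta>]
  have tm: "ptgt ?m = U" by (simp add: ind_bisp_def)
  have j: "eqv K (ptgt r) (ptgt ?m) ?j" unfolding tm by (rule eqv_unit_U[OF gs r' Ug \<theta>])
  obtain m' :: "('g, 'u) ubisp" and \<mu> where m': "wf_bisp G X X' m'" "ptgt m' = ptgt ?m" and \<mu>: "bisp_iso_maps G ?m m' \<mu> (\<lambda>b. b)"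
    using replace_source[OF m] by blast
  have "bisp_iso K (pullb ?m (ptgt r) ?j) (pullb m' (ptgt r) ?j)" by (rule K.pullb_iso[OF bisp_iso_maps_sub[OF \<mu>] j])
  then have "bisp_iso K r (pullb m' (ptgt r) ?j)"
    using bisp_iso_trans[OF pullb_ind_bisp[OF gs r' Ug \<theta>] _ r'] by blast
  moreover have "wf_bisp K (res X) (res X') (pullb m' (ptgt r) ?j)"
    using K.wf_pullb[OF wf_bisp_sub[OF m'(1)] rt] j m'(2) by simp
  ultimately have "w = rcls X X' (pullb m' (ptgt r) ?j)" using K.cls_eq r by blast
  then have "presents X X' w m' (ptgt r) ?j" unfolding presents_def using m' tm U rt j by simp
  then show ?thesis by blast
qed

text \<open>The map into the product \<open>res S\<close> of \<open>res X\<close> and \<open>res B\<close> with components the identity and a constant.\<close>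

definition dpair :: "('g, 'u) gset \<Rightarrow> ('g, 'u) gset \<Rightarrow> ('u \<Rightarrow> 'u) \<Rightarrow> ('u \<Rightarrow> 'u) \<Rightarrow> ('g, 'u) gset \<Rightarrow> ('u \<Rightarrow> 'u) \<Rightarrow> ('g, 'u) bispan set" where
  "dpair X S i l B j = rcls X S (sum_bisp i l (id_bisp (res X)) (const_bisp B j))"

lemma wf_const_res: "\<lbrakk>is_gset K B0; eqv K B0 B j\<rbrakk> \<Longrightarrow> wf_bisp K (res X) (res B) (const_bisp B0 j)"
  by (simp add: wf_const_bisp)

lemma const_in_Hom:
  fixes B :: "('g, 'u::infinite) gset"
  shows "\<lbrakk>is_gset K B0; eqv K B0 B j\<rbrakk> \<Longrightarrow> rcls X B (const_bisp B0 j) \<in> RHom X B"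
  by (rule K.cls_in_Hom[OF wf_const_res])

lemma dpair_facts:
  fixes X S B :: "('g, 'u::infinite) gset"
  assumes o: "X \<in> Fin G" "S \<in> Fin G" "B \<in> Fin G"
    and S: "eqv G X S i" "eqv G B S l" "is_sum X B S i l" and B0: "is_gset K B0" "eqv K B0 B j"
  shows "dpair X S i l B0 j \<in> RHom X S"
    and "RComp X S X (rrst X S i) (dpair X S i l B0 j) = BId K (res X)"
    and "RComp X S B (rrst B S l) (dpair X S i l B0 j) = rcls X B (const_bisp B0 j)"
proof -
  note ro = o[THEN res_gset_in]
  have idX: "wf_bisp K (res X) (res X) (id_bisp (res X))" by (rule K.wf_id_bisp[OF Fin_gset[OF ro(1)]])
  have S': "eqv K (res X) (res S) i" "eqv K (res B) (res S) l" "is_sum (res X) (res B) (res S) i l"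
    using S by (simp_all add: eqv_sub)
  show "dpair X S i l B0 j \<in> RHom X S"
    unfolding dpair_def by (rule K.cls_in_Hom[OF K.wf_sum_bisp[OF idX wf_const_res[OF B0] S'(1,2)]])
  show "RComp X S X (rrst X S i) (dpair X S i l B0 j) = BId K (res X)"
    unfolding dpair_def using K.proj_sum_bisp(1)[OF ro(1,1,3,2) idX wf_const_res[OF B0] S'] K.Ident_bispan_cat[OF ro(1)] by simp
  show "RComp X S B (rrst B S l) (dpair X S i l B0 j) = rcls X B (const_bisp B0 j)"
    unfolding dpair_def using K.proj_sum_bisp(2)[OF ro(1,1,3,2) idX wf_const_res[OF B0] S'] by simp
qed

text \<open>\<open>w\<close> is the operation of two variables of \<open>m\<close> with its second variable held constant: substituting a bispan with empty source for the
  second variable leaves just the pullback of \<open>m\<close>.\<close>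

lemma presents_factor:
  fixes X X' S :: "('g, 'u::infinite) gset" and m :: "('g, 'a, 'u, 'u, 'u) bisp"
  assumes o: "X \<in> Fin G" "X' \<in> Fin G" "S \<in> Fin G" and p: "presents X X' w m B0 j"
    and S: "eqv G X S i" "eqv G (ptgt m) S l" "is_sum X (ptgt m) S i l"
  shows "w = RComp X S X' (res_hom S X' (cls G S X' (hat_bisp i l m))) (dpair X S i l B0 j)"
proof -
  have m: "wf_bisp G X X' m" and tm: "ptgt m \<in> Fin G" and B0: "is_gset K B0" "eqv K B0 (ptgt m) j"
    and w: "w = rcls X X' (pullb m B0 j)" using p by (auto simp: presents_def)
  note ro = o[THEN res_gset_in] and mK = wf_bisp_sub[OF m]
  \<comment> \<open>The action on the middle set of \<open>m\<close> is not extensional over \<open>H\<close>, so it is cut down to give an object of the category.\<close>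
  let ?m = "m\<lparr>ptgt := res (ptgt m)\<rparr>"
  have m': "wf_bisp K (res X) (res X') ?m" using wf_bispD[OF mK] by (simp add: wf_bisp_def)
  have S': "eqv K (res X) (res S) i" "eqv K (ptgt ?m) (res S) l" "is_sum (res X) (ptgt ?m) (res S) i l"
    using S by (simp_all add: eqv_sub)
  have c: "wf_bisp K (res X) (ptgt ?m) (const_bisp B0 j)" using wf_const_res[OF B0] by simp
  have "RComp X S X' (rcls S X' (hat_bisp i l ?m))
      (rcls X S (sum_bisp i l (res_bisp (res X) (\<lambda>x. x)) ((const_bisp B0 j)\<lparr>pres := \<lambda>e. pres (const_bisp B0 j) e\<rparr>)))
     = rcls X X' (subst_bisp (\<lambda>x. x) (\<lambda>x. x) ?m (const_bisp B0 j))"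
    by (rule K.comp_subst_bisp[OF ro(1-3,1) m' c S' eqv_id eqv_id])
  moreover have "sum_bisp i l (res_bisp (res X) (\<lambda>x. x)) ((const_bisp B0 j)\<lparr>pres := \<lambda>e. pres (const_bisp B0 j) e\<rparr>)
      = sum_bisp i l (id_bisp (res X)) (const_bisp B0 j)"
    by (simp add: res_bisp_def id_bisp_def const_bisp_def)
  moreover have "rcls S X' (hat_bisp i l ?m) = res_hom S X' (cls G S X' (hat_bisp i l m))"
  proof -
    have "bisp_iso K (hat_bisp i l m) (hat_bisp i l ?m)"
      by (rule bisp_isoI[of "\<lambda>x. x" _ _ "\<lambda>x. x"]) (auto simp: hat_bisp_def elts_gset_sum bij_betw_def eqv_id eqv_def)
    moreover have "wf_bisp K (res S) (res X') (hat_bisp i l m)" using wf_bisp_sub[OF wf_hat_bisp[OF m S(1,2)]] by simp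
    ultimately show ?thesis
      using res_hom_cls[OF o(3,2) wf_hat_bisp[OF m S(1,2)]] K.cls_eq[OF _ K.wf_hat_bisp[OF m' S'(1,2)], of "hat_bisp i l m"] by simp
  qed
  moreover have "rcls X X' (subst_bisp (\<lambda>x. x) (\<lambda>x. x) ?m (const_bisp B0 j)) = w"
  proof -
    have "bisp_iso K (pullb m B0 j) (subst_bisp (\<lambda>x. x) (\<lambda>x. x) ?m (const_bisp B0 j))"
    proof (rule bisp_isoI[of Inl _ _ "\<lambda>x. x"])
      show "bij_betw Inl (elts (psrc (pullb m B0 j))) (elts (psrc (subst_bisp (\<lambda>x. x) (\<lambda>x. x) ?m (const_bisp B0 j))))"
        by (auto simp: pullb_def subst_bisp_def const_bisp_def elts_gset_sum bij_betw_def)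
    qed (auto simp: pullb_def subst_bisp_def const_bisp_def eqv_Inl eqv_id bij_betw_def)
    moreover have "wf_bisp K (res X) (res X') (pullb m B0 j)" using K.wf_pullb[OF mK B0] by simp
    ultimately show ?thesis using K.cls_eq[OF _ K.wf_subst_bisp[OF m' c eqv_id eqv_id], of "pullb m B0 j"] w by simp
  qed
  ultimately show ?thesis by (simp add: dpair_def)
qed

definition emptyG :: "('g, 'u) gset" where
  "emptyG = ({}, \<lambda>g\<in>carrier G. \<lambda>x\<in>{}. x)"

lemma emptyG: "emptyG \<in> Fin G" "elts emptyG = {}"
proof -
  have "(\<lambda>g\<in>carrier G. \<lambda>x\<in>{}. x) = (\<lambda>g\<in>carrier G. \<lambda>x\<in>({} :: 'a set). act ({}, \<lambda>g x. x) g x)" by (simp add: fun_eq_iff)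
  then show "(emptyG :: ('g, 'a) gset) \<in> Fin G"
    using finite_gsets_of_is_gset[OF is_gset_empty, of "\<lambda>g x. x :: 'a"] by (simp add: emptyG_def)
qed (simp add: emptyG_def)

text \<open>Constants need only be known out of the empty set: their sources are empty, so restricting to it first changes nothing.\<close>

lemma const_via_empty:
  fixes X B :: "('g, 'u::infinite) gset"
  assumes o: "X \<in> Fin G" "B \<in> Fin G" and B0: "is_gset K B0" "eqv K B0 B j"
  shows "rcls X B (const_bisp B0 j) =
    RComp X emptyG B (rcls emptyG B (const_bisp B0 j)) (rrst emptyG X (\<lambda>x. x))"
proof -
  have e: "eqv K (res emptyG) (res X) (\<lambda>x. x)" by (simp add: eqv_def emptyG)
  have "(const_bisp B0 j)\<lparr>pres := \<lambda>a. pres (const_bisp B0 j) a\<rparr> = const_bisp B0 j" by (simp add: const_bisp_def)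
  then show ?thesis
    using K.comp_bispan_rst[OF res_gset_in[OF o(1)] res_gset_in[OF emptyG(1)] res_gset_in[OF o(2)] e wf_const_res[OF B0]] by simp
qed

lemma rst_empty_comp:
  fixes X Y :: "('g, 'u::infinite) gset"
  assumes o: "X \<in> Fin G" "Y \<in> Fin G" and w: "w \<in> RHom X Y"
  shows "RComp X Y emptyG (rrst emptyG Y (\<lambda>x. x)) w = rrst emptyG X (\<lambda>x. x)"
proof -
  have t: "is_terminal (bispan_cat K) (res (emptyG :: ('g, 'u) gset))" by (simp add: K.is_terminal_bispan_cat res_gset_in emptyG)
  have e: "eqv K (res emptyG) (res A) (\<lambda>x. x)" for A :: "('g, 'u) gset" by (simp add: eqv_def emptyG)
  have "RComp X Y emptyG (rrst emptyG Y (\<lambda>x. x)) w \<in> RHom X emptyG"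
    using category_comp_in[OF K.category_bispan_cat, of "res X" "res Y" "res emptyG" w] o w e by (simp add: res_gset_in emptyG K.rst_in_Hom)
  moreover have "rrst emptyG X (\<lambda>x. x) \<in> RHom X emptyG"
    using e by (simp add: res_gset_in emptyG K.rst_in_Hom)
  moreover have "\<exists>!f. f \<in> BHom K (res X) (res (emptyG :: ('g, 'u) gset))"
    using t res_gset_in[OF o(1)] by (simp add: is_terminal_def)
  ultimately show ?thesis by blast
qed

text \<open>Both sides factor through the empty set, where there is only one morphism from \<open>res X\<close>.\<close>

lemma const_comp:
  fixes X Y B :: "('g, 'u::infinite) gset"
  assumes o: "X \<in> Fin G" "Y \<in> Fin G" "B \<in> Fin G" and B0: "is_gset K B0" "eqv K B0 B j"
    and w: "w \<in> RHom X Y"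
  shows "RComp X Y B (rcls Y B (const_bisp B0 j)) w = rcls X B (const_bisp B0 j)"
proof -
  have e: "eqv K (res emptyG) (res Y) (\<lambda>x. x)" by (simp add: eqv_def emptyG)
  show ?thesis
    unfolding const_via_empty[OF o(1,3) B0] const_via_empty[OF o(2,3) B0]
    using category_assoc[OF K.category_bispan_cat, of "res X" "res Y" "res emptyG" "res B" w "rrst emptyG Y (\<lambda>x. x)" "rcls emptyG B (const_bisp B0 j)"]
      rst_empty_comp[OF o(1,2) w] w o e K.rst_in_Hom[of "res emptyG" "res Y"] const_in_Hom[OF B0] by (simp add: res_gset_in emptyG)
qed

lemma const_post:
  fixes X B B' :: "('g, 'u::infinite) gset"
  assumes o: "X \<in> Fin G" "B \<in> Fin G" "B' \<in> Fin G" and B0: "is_gset K B0" "eqv K B0 B j" and B0': "is_gset K B0'" "eqv K B0' B' j'"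
    and \<gamma>: "\<gamma> \<in> RHom B B'"
    and eq: "RComp emptyG B B' \<gamma> (rcls emptyG B (const_bisp B0 j)) = rcls emptyG B' (const_bisp B0' j')"
  shows "RComp X B B' \<gamma> (rcls X B (const_bisp B0 j)) = rcls X B' (const_bisp B0' j')"
proof -
  have e: "eqv K (res emptyG) (res X) (\<lambda>x. x)" by (simp add: eqv_def emptyG)
  show ?thesis
    unfolding const_via_empty[OF o(1,2) B0] const_via_empty[OF o(1,3) B0'] eq[symmetric]
    using category_assoc[OF K.category_bispan_cat, of "res X" "res emptyG" "res B" "res B'" "rrst emptyG X (\<lambda>x. x)" "rcls emptyG B (const_bisp B0 j)" \<gamma>]
      \<gamma> o e K.rst_in_Hom[of "res emptyG" "res X"] const_in_Hom[OF B0] by (simp add: res_gset_in emptyG)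
qed

lemma ex_const:
  fixes B :: "('g, 'u::infinite) gset"
  assumes B: "B \<in> Fin G" and c: "c \<in> RHom emptyG B"
  shows "\<exists>(B0 :: ('g, 'u) gset) j. is_gset K B0 \<and> eqv K B0 B j \<and> c = rcls emptyG B (const_bisp B0 j)"
proof -
  obtain q :: "('g, 'u) ubisp" where q: "wf_bisp K (res emptyG) (res B) q" "c = rcls emptyG B q" using c by (rule K.Hom_bispan_catE)
  note Q = wf_bispD[OF q(1)]
  have e: "Src q = {}" using eqv_in[OF Q(3)] by (auto simp: emptyG)
  have B0: "is_gset K (ptgt q)" "eqv K (ptgt q) B (ptran q)" using Q(2,5) by auto
  have "bisp_iso K q (const_bisp (ptgt q) (ptran q))"
    by (rule bisp_isoI[of "\<lambda>_. ()" _ _ "\<lambda>b. b"]) (use e in \<open>auto simp: const_bisp_def eqv_def bij_betw_def\<close>)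
  then have "c = rcls emptyG B (const_bisp (ptgt q) (ptran q))" using K.cls_eq[OF q(1) wf_const_res[OF B0]] q(2) by simp
  then show ?thesis using B0 by blast
qed

end

section \<open>Extension of a functor under a coinduced one\<close>

locale under_coind = subgroup_pair G H for G :: "'g monoid" (structure) and H +
  fixes k R :: "('g, 'u::infinite, 'v) tambara" and \<phi> :: "('g, 'u) gset \<Rightarrow> 'v \<Rightarrow> 'v"
  assumes k: "prod_functor (G\<lparr>carrier := H\<rparr>) k" and R: "prod_functor G R"
    and \<phi>_in: "\<lbrakk>X \<in> Fin G; x \<in> on_obj k (res_gset H X)\<rbrakk> \<Longrightarrow> \<phi> X x \<in> on_obj R X"
    and \<phi>_nat: "\<lbrakk>X \<in> Fin G; Y \<in> Fin G; f \<in> BHom G X Y; x \<in> on_obj k (res_gset H X)\<rbrakk> \<Longrightarrow>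
      \<phi> Y (on_hom k (res_gset H X) (res_gset H Y) (on_hom (res_functor G H) X Y f) x) = on_hom R X Y f (\<phi> X x)"
begin

text \<open>The value of \<open>k\<close> at the empty set is a single element, as \<open>k\<close> preserves the terminal object.\<close>

definition k0 :: 'v where "k0 = (THE e. e \<in> on_obj k (res emptyG))"

text \<open>The image in \<open>R\<close> of the constant of \<open>k\<close> that belongs to \<open>const_bisp B0 j\<close>.\<close>

definition kval :: "('g, 'u) gset \<Rightarrow> ('g, 'u) gset \<Rightarrow> ('u \<Rightarrow> 'u) \<Rightarrow> 'v" where
  "kval B B0 j = \<phi> B (on_hom k (res emptyG) (res B) (rcls emptyG B (const_bisp B0 j)) k0)"

text \<open>The extension of \<open>R\<close> to bispans of \<open>H\<close>-sets between restricted \<open>G\<close>-sets, by evaluating any presentation.\<close>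

definition ext :: "('g, 'u) gset \<Rightarrow> ('g, 'u) gset \<Rightarrow> ('g, 'u) bispan set \<Rightarrow> 'v \<Rightarrow> 'v" where
  "ext X X' w x = (SOME y. \<exists>(m :: ('g, 'u) ubisp) B j. presents X X' w m B j \<and> y = hval R X X' m x (kval (ptgt m) B j))"

lemmas Rf = prod_functor_functor[OF R] and kf = K.prod_functor_functor[OF k]

lemma k_empty: "on_obj k (res emptyG) = {k0}"
proof -
  obtain e where "on_obj k (res emptyG) = {e}"
    using K.prod_functor_empty[OF k res_gset_in[OF emptyG(1)]] by (auto simp: emptyG)
  then show ?thesis by (simp add: k0_def)
qed

lemma kval_in: "\<lbrakk>B \<in> Fin G; is_gset K B0; eqv K B0 B j\<rbrakk> \<Longrightarrow> kval B B0 j \<in> on_obj R B"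
  unfolding kval_def
  by (intro \<phi>_in K.apply_in[OF kf] res_gset_in emptyG const_in_Hom) (simp_all add: k_empty)

text \<open>Constants of \<open>k\<close> are carried to constants of \<open>k\<close> by restricted bispans, and \<open>\<phi>\<close> is natural for these.\<close>

lemma kval_nat:
  assumes o: "B \<in> Fin G" "B' \<in> Fin G" and B0: "is_gset K B0" "eqv K B0 B j" and \<gamma>: "\<gamma> \<in> BHom G B B'"
    and eq: "RComp emptyG B B' (res_hom B B' \<gamma>) (rcls emptyG B (const_bisp B0 j)) =
       rcls emptyG B' (const_bisp B0' j')"
  shows "on_hom R B B' \<gamma> (kval B B0 j) = kval B' B0' j'"
proof -
  have c: "rcls emptyG B (const_bisp B0 j) \<in> RHom emptyG B" by (rule const_in_Hom[OF B0])
  let ?e = "on_hom k (res emptyG) (res B) (rcls emptyG B (const_bisp B0 j)) k0"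
  have k0: "k0 \<in> on_obj k (res emptyG)" by (simp add: k_empty)
  have e: "?e \<in> on_obj k (res B)" by (rule K.apply_in[OF kf res_gset_in[OF emptyG(1)] res_gset_in[OF o(1)] c k0])
  show ?thesis
    using \<phi>_nat[OF o \<gamma> e] K.apply_comp[OF kf res_gset_in[OF emptyG(1)] res_gset_in[OF o(1)] res_gset_in[OF o(2)] c res_hom_in[OF o \<gamma>] k0] eq
    by (simp add: kval_def)
qed

text \<open>By universality there is a map \<open>h\<close> from the induced presentation to the given one. It transfers the constant of the former to
  that of the latter, and Frobenius reciprocity replaces this transfer by the pullback along \<open>h\<close>, which is the induced bispan.\<close>

lemma hval_universal:
  fixes m :: "('g, 'u) ubisp"
  assumes o: "X \<in> Fin G" "X' \<in> Fin G" and r: "wf_bisp K X X' r" and U: "U \<in> Fin G"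
    and \<theta>: "bij_betw \<theta> (elts (ind_gset (ptgt r))) (elts U)" "eqv G (ind_gset (ptgt r)) U \<theta>"
    and p: "presents X X' (rcls X X' r) m B j" and x: "x \<in> on_obj R X"
  shows "hval R X X' m x (kval (ptgt m) B j) = hval R X X' (ind_bisp X X' r U \<theta>) x (kval U (ptgt r) (\<lambda>b. \<theta> (ind_pt (ptgt r) \<one> b)))"
proof -
  note gs = o[THEN Fin_gset] and Ug = Fin_gset[OF U]
  have m: "wf_bisp G X X' m" and tm: "ptgt m \<in> Fin G" and B: "is_gset K B" "eqv K B (ptgt m) j"
    and eq: "rcls X X' r = rcls X X' (pullb m B j)" using p by (auto simp: presents_def)
  have wfp: "wf_bisp K (res X) (res X') (pullb m B j)" using K.wf_pullb[OF wf_bisp_sub[OF m] B] by simp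
  have "bisp_iso K r (pullb m B j)" using eq r K.cls_eq[OF _ wfp, of r] by simp
  then obtain \<alpha> \<beta> where iso: "bisp_iso_maps K r (pullb m B j) \<alpha> \<beta>" unfolding bisp_iso_def by blast
  define h where "h = (\<lambda>u. ind_ext (ptgt m) (\<lambda>b. j (\<beta> b)) (inv_into (elts (ind_gset (ptgt r))) \<theta> u))"
  note univ = ind_bisp_universal[OF gs r Ug \<theta> m B iso, folded h_def]
  obtain \<mu> where \<mu>: "bisp_iso_maps G (ind_bisp X X' r U \<theta>) (pullb m U h) \<mu> (\<lambda>b. b)" using univ(3) by blast
  let ?j = "\<lambda>b. \<theta> (ind_pt (ptgt r) \<one> b)"
  note rt = wf_bispD(2)[OF r]
  have hj: "h (?j b) = j (\<beta> b)" if "b \<in> Tgt r" for b using univ(2)[OF that] by (simp add: h_def)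
  have ju: "eqv K (ptgt r) U ?j" by (rule eqv_unit_U[OF gs r Ug \<theta>])
  have "on_hom R U (ptgt m) (trn G U (ptgt m) h) (kval U (ptgt r) ?j) = kval (ptgt m) B j"
  proof (rule kval_nat[OF U tm rt ju trn_in_Hom[OF U univ(1)]])
    have wfc: "wf_bisp K (res (emptyG :: ('g, 'u) gset)) (res U) (const_bisp (ptgt r) ?j)" by (rule wf_const_res[OF rt ju])
    have hK: "eqv K (res U) (res (ptgt m)) h" using eqv_sub[OF univ(1)] by simp
    have "eqv K (ptgt r) (ptgt m) (\<lambda>b. h (?j b))" by (rule eqv_comp'[OF ju eqv_sub[OF univ(1)]])
    then have wfc': "wf_bisp K (res (emptyG :: ('g, 'u) gset)) (res (ptgt m)) (const_bisp (ptgt r) (\<lambda>b. h (?j b)))" by (rule wf_const_res[OF rt])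
    have "RComp emptyG U (ptgt m) (res_hom U (ptgt m) (trn G U (ptgt m) h)) (rcls emptyG U (const_bisp (ptgt r) ?j))
       = rcls emptyG (ptgt m) (const_bisp (ptgt r) (\<lambda>b. h (?j b)))"
      unfolding res_hom_trn[OF U tm univ(1)]
      using K.comp_trn_bispan[OF res_gset_in[OF emptyG(1)] res_gset_in[OF U] res_gset_in[OF tm] wfc hK] by (simp add: const_bisp_def)
    also have "rcls emptyG (ptgt m) (const_bisp (ptgt r) (\<lambda>b. h (?j b))) = rcls emptyG (ptgt m) (const_bisp B j)"
    proof -
      have "bisp_iso K (const_bisp (ptgt r) (\<lambda>b. h (?j b))) (const_bisp B j)"
        by (rule bisp_isoI[of "\<lambda>x. x" _ _ \<beta>]) (use iso hj in \<open>auto simp: const_bisp_def bisp_iso_maps_def pullb_def eqv_def bij_betw_def\<close>)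
      then show ?thesis using K.cls_eq[OF wfc' wf_const_res[OF B]] by blast
    qed
    finally show "RComp emptyG U (ptgt m) (res_hom U (ptgt m) (trn G U (ptgt m) h)) (rcls emptyG U (const_bisp (ptgt r) ?j))
       = rcls emptyG (ptgt m) (const_bisp B j)" .
  qed
  then have "hval R X X' m x (kval (ptgt m) B j) = hval R X X' (pullb m U h) x (kval U (ptgt r) ?j)"
    using hval_trn[OF R o tm U m univ(1) x kval_in[OF U rt ju]] by simp
  also have "\<dots> = hval R X X' (ind_bisp X X' r U \<theta>) x (kval U (ptgt r) ?j)"
  proof -
    have t: "ptgt (ind_bisp X X' r U \<theta>) = U" "ptgt (pullb m U h) = U" by (simp_all add: ind_bisp_def pullb_def)
    have "hval R X X' (ind_bisp X X' r U \<theta>) x (kval U (ptgt r) ?j) = hval R X X' (pullb m U h) x (kval U (ptgt r) ?j)"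
      by (rule hval_cong[OF R o _ wf_ind_bisp[OF gs r Ug \<theta>] wf_pullb[OF m Ug univ(1)] \<mu>])
        (use U t x kval_in[OF U rt ju] in auto)
    then show ?thesis by simp
  qed
  finally show ?thesis .
qed

lemma presents_in_Hom:
  fixes X X' :: "('g, 'u) gset"
  shows "presents X X' w m B j \<Longrightarrow> w \<in> RHom X X'"
  unfolding presents_def using K.cls_in_Hom[of "res X" "res X'" "pullb m B j"] K.wf_pullb[OF wf_bisp_sub, of X X' m B j] by simp

text \<open>All presentations give the same value, namely that of the induced one.\<close>

lemma ext_eq:
  fixes m :: "('g, 'u) ubisp"
  assumes o: "X \<in> Fin G" "X' \<in> Fin G" and p: "presents X X' w m B j" and x: "x \<in> on_obj R X"
  shows "ext X X' w x = hval R X X' m x (kval (ptgt m) B j)"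
proof -
  obtain r :: "('g, 'u) ubisp" where r: "wf_bisp K (res X) (res X') r" "w = rcls X X' r"
    using presents_in_Hom[OF p] by (rule K.Hom_bispan_catE)
  then have r': "wf_bisp K X X' r" by simp
  obtain U :: "('g, 'u) gset" and \<theta> where U: "U \<in> Fin G" and \<theta>: "bij_betw \<theta> (elts (ind_gset (ptgt r))) (elts U)" "eqv G (ind_gset (ptgt r)) U \<theta>"
    using transport_finite_gset[OF is_gset_ind[OF wf_bispD(2)[OF r']]] by blast
  note cmp = hval_universal[OF o r' U \<theta> _ x, folded r(2)]
  show ?thesis
    unfolding ext_def
  proof (rule some_equality)
    show "\<exists>(m' :: ('g, 'u) ubisp) B' j'. presents X X' w m' B' j' \<and> hval R X X' m x (kval (ptgt m) B j) = hval R X X' m' x (kval (ptgt m') B' j')"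
      using p by blast
    fix y assume "\<exists>(m' :: ('g, 'u) ubisp) B' j'. presents X X' w m' B' j' \<and> y = hval R X X' m' x (kval (ptgt m') B' j')"
    then show "y = hval R X X' m x (kval (ptgt m) B j)" using cmp[OF p] cmp by auto
  qed
qed

lemma ext_in:
  assumes o: "X \<in> Fin G" "X' \<in> Fin G" and w: "w \<in> RHom X X'" and x: "x \<in> on_obj R X"
  shows "ext X X' w x \<in> on_obj R X'"
proof -
  obtain m :: "('g, 'u) ubisp" and B j where p: "presents X X' w m B j" using ex_presentation[OF o w] by blast
  then have m: "wf_bisp G X X' m" and tm: "ptgt m \<in> Fin G" and B0: "is_gset K B" "eqv K B (ptgt m) j" by (auto simp: presents_def)
  show ?thesis using ext_eq[OF o p x] hval_in[OF R o tm m x kval_in[OF tm B0]] by simp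
qed

text \<open>Composing the operation of \<open>m\<close> with \<open>\<gamma>\<close> gives another bispan out of the disjoint union, which is normalised to an
  operation of \<open>m2\<close> whose second variable is the value of \<open>\<nu>\<close> at the old one. At a constant this value is again a constant, so the
  composite is presented by \<open>m2\<close> with the new constant.\<close>

lemma ext_post:
  assumes o: "X \<in> Fin G" "X' \<in> Fin G" "X'' \<in> Fin G" and w: "w \<in> RHom X X'"
    and \<gamma>: "\<gamma> \<in> BHom G X' X''" and x: "x \<in> on_obj R X"
  shows "ext X X'' (RComp X X' X'' (res_hom X' X'' \<gamma>) w) x = on_hom R X' X'' \<gamma> (ext X X' w x)"
proof -
  obtain m :: "('g, 'u) ubisp" and B0 j where p: "presents X X' w m B0 j" using ex_presentation[OF o(1,2) w] by blast
  then have m: "wf_bisp G X X' m" and tm: "ptgt m \<in> Fin G" and B0: "is_gset K B0" "eqv K B0 (ptgt m) j" by (auto simp: presents_def)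
  obtain S i l s where S: "S \<in> Fin G" and il: "eqv G X S i" "eqv G (ptgt m) S l" "is_sum X (ptgt m) S i l"
    and s: "s \<in> on_obj R S" "on_hom R S X (rst G X S i) s = x" "on_hom R S (ptgt m) (rst G (ptgt m) S l) s = kval (ptgt m) B0 j"
    using ex_join[OF R o(1) tm x kval_in[OF tm B0]] by (elim exE conjE) (rule that)
  let ?hat = "cls G S X' (hat_bisp i l m)"
  have hatH: "?hat \<in> BHom G S X'" by (rule cls_in_Hom[OF wf_hat_bisp[OF m il(1,2)]])
  let ?g = "BComp G S X' X'' \<gamma> ?hat"
  have gH: "?g \<in> BHom G S X''" using category_comp_in[OF category_bispan_cat, of S X' X''] S o hatH \<gamma> by simp
  obtain m2 \<nu> :: "('g, 'u) ubisp" where m2: "wf_bisp G X X'' m2" "ptgt m2 \<in> Fin G"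
    and \<nu>: "wf_bisp G (ptgt m) (ptgt m2) \<nu>" and g: "?g = cls G S X'' (subst_bisp i l m2 \<nu>)"
    using normalise_bispan[OF o(1) tm il gH] by blast
  have \<nu>H: "cls G (ptgt m) (ptgt m2) \<nu> \<in> BHom G (ptgt m) (ptgt m2)" by (rule cls_in_Hom[OF \<nu>])
  let ?r\<nu> = "res_hom (ptgt m) (ptgt m2) (cls G (ptgt m) (ptgt m2) \<nu>)"
  have r\<nu>: "?r\<nu> \<in> RHom (ptgt m) (ptgt m2)" by (rule res_hom_in[OF tm m2(2) \<nu>H])
  have "RComp emptyG (ptgt m) (ptgt m2) ?r\<nu> (rcls emptyG (ptgt m) (const_bisp B0 j)) \<in> RHom emptyG (ptgt m2)"
    using category_comp_in[OF K.category_bispan_cat, of "res emptyG" "res (ptgt m)" "res (ptgt m2)" "rcls emptyG (ptgt m) (const_bisp B0 j)" ?r\<nu>]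
      r\<nu> const_in_Hom[OF B0] tm m2(2) by (simp add: res_gset_in emptyG)
  then obtain B2 :: "('g, 'u) gset" and j2 where B2: "is_gset K B2" "eqv K B2 (ptgt m2) j2"
    and c2: "RComp emptyG (ptgt m) (ptgt m2) ?r\<nu> (rcls emptyG (ptgt m) (const_bisp B0 j)) =
       rcls emptyG (ptgt m2) (const_bisp B2 j2)" using ex_const[OF m2(2)] by blast
  \<comment> \<open>The composite that is to be evaluated, once it is known that \<open>?side\<close> carries the old pairing to the new one.\<close>
  define w2 where "w2 = rcls X X'' (pullb m2 B2 j2)"
  have p2: "presents X X'' w2 m2 B2 j2" using m2 B2 by (simp add: presents_def w2_def)
  obtain S2 i2 l2 where "is_coproduct (gset_cat G) X (ptgt m2) S2 i2 l2" using ex_coproduct_gset_cat[OF o(1) m2(2)] by blast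
  then have S2: "S2 \<in> Fin G" and il2: "eqv G X S2 i2" "eqv G (ptgt m2) S2 l2" "is_sum X (ptgt m2) S2 i2 l2"
    by (auto simp: is_coproduct_gset_cat intro: EMap_eqv)
  let ?hat2 = "cls G S2 X'' (hat_bisp i2 l2 m2)"
  have hat2H: "?hat2 \<in> BHom G S2 X''" by (rule cls_in_Hom[OF wf_hat_bisp[OF m2(1) il2(1,2)]])
  let ?\<nu>l = "\<nu>\<lparr>pres := \<lambda>e. l (pres \<nu> e)\<rparr>"
  let ?side = "cls G S S2 (sum_bisp i2 l2 (res_bisp X i) ?\<nu>l)"
  have wf\<nu>l: "wf_bisp G S (ptgt m2) ?\<nu>l" using wf_bispD[OF \<nu>] eqv_comp'[OF wf_bispD(3)[OF \<nu>] il(2)] by (simp add: wf_bisp_def)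
  have wfi: "wf_bisp G S X (res_bisp X i)" by (rule wf_res_bisp[OF Fin_gset[OF o(1)] il(1)])
  have sideH: "?side \<in> BHom G S S2" by (rule cls_in_Hom[OF wf_sum_bisp[OF wfi wf\<nu>l il2(1,2)]])
  have g2: "?g = BComp G S S2 X'' ?hat2 ?side"
    using comp_subst_bisp[OF o(1,3) S2 S m2(1) \<nu> il2 il(1,2)] g by simp
  note proj = proj_sum_bisp[OF S o(1) m2(2) S2 wfi wf\<nu>l il2]
  note ro = o[THEN res_gset_in] res_gset_in[OF S] res_gset_in[OF S2] res_gset_in[OF tm] res_gset_in[OF m2(2)]
  let ?d = "dpair X S i l B0 j" and ?d2 = "dpair X S2 i2 l2 B2 j2"
  note d = dpair_facts[OF o(1) S tm il B0] and d2 = dpair_facts[OF o(1) S2 m2(2) il2 B2]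
  let ?C = "bispan_cat K :: (('g, 'u) gset, ('g, 'u) bispan set) cat"
  note asc = category_assoc[OF K.category_bispan_cat, unfolded K.Obj_bispan_cat]
  have rS: "rrst X S2 i2 \<in> Hom ?C (res S2) (res X)" "rrst (ptgt m2) S2 l2 \<in> Hom ?C (res S2) (res (ptgt m2))"
    "rrst (ptgt m) S l \<in> Hom ?C (res S) (res (ptgt m))"
    using il2 il(2) ro by (simp_all add: K.rst_in_Hom eqv_sub)
  have "Comp ?C (res X) (res S) (res S2) (res_hom S S2 ?side) ?d = ?d2"
  proof -
    let ?u = "Comp ?C (res X) (res S) (res S2) (res_hom S S2 ?side) ?d"
    have uH: "?u \<in> Hom ?C (res X) (res S2)"
      using category_comp_in[OF K.category_bispan_cat] ro d(1) res_hom_in[OF S S2 sideH] by simp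
    have "Comp ?C (res S) (res S2) (res X) (rrst X S2 i2) (res_hom S S2 ?side) = rrst X S i"
      using res_hom_comp[OF S S2 o(1) sideH rst_in_Hom[OF o(1) il2(1)]] proj(1) res_hom_rst[OF o(1) S2 il2(1)] res_hom_rst[OF o(1) S il(1)]
      by (simp add: rst_def)
    then have 1: "Comp ?C (res X) (res S2) (res X) (rrst X S2 i2) ?u = Ident ?C (res X)"
      using asc[OF ro(1,4,5,1) d(1) res_hom_in[OF S S2 sideH] rS(1)] d(2) by simp
    have "BComp G S S2 (ptgt m2) (rst G (ptgt m2) S2 l2) ?side = BComp G S (ptgt m) (ptgt m2) (cls G (ptgt m) (ptgt m2) \<nu>) (rst G (ptgt m) S l)"
      using proj(2) comp_bispan_rst[OF S tm m2(2) il(2) \<nu>] by simp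
    then have "Comp ?C (res S) (res S2) (res (ptgt m2)) (rrst (ptgt m2) S2 l2) (res_hom S S2 ?side) =
        Comp ?C (res S) (res (ptgt m)) (res (ptgt m2)) ?r\<nu> (rrst (ptgt m) S l)"
      using res_hom_comp[OF S S2 m2(2) sideH rst_in_Hom[OF m2(2) il2(2)]] res_hom_comp[OF S tm m2(2) rst_in_Hom[OF tm il(2)] \<nu>H]
        res_hom_rst[OF m2(2) S2 il2(2)] res_hom_rst[OF tm S il(2)] by simp
    then have "Comp ?C (res X) (res S2) (res (ptgt m2)) (rrst (ptgt m2) S2 l2) ?u =
        Comp ?C (res X) (res (ptgt m)) (res (ptgt m2)) ?r\<nu> (rcls X (ptgt m) (const_bisp B0 j))"
      using asc[OF ro(1,4,5,7) d(1) res_hom_in[OF S S2 sideH] rS(2)] asc[OF ro(1,4,6,7) d(1) rS(3) r\<nu>] d(3) by simp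
    then have 2: "Comp ?C (res X) (res S2) (res (ptgt m2)) (rrst (ptgt m2) S2 l2) ?u = rcls X (ptgt m2) (const_bisp B2 j2)"
      using const_post[OF o(1) tm m2(2) B0 B2 r\<nu> c2] by simp
    have "is_product ?C (res X) (res (ptgt m2)) (res S2) (rrst X S2 i2) (rrst (ptgt m2) S2 l2)"
      by (rule K.is_product_bispan_cat[OF ro(1,7,5)]) (use il2 in \<open>simp_all add: eqv_sub\<close>)
    then have "\<exists>!v. v \<in> Hom ?C (res X) (res S2) \<and> Comp ?C (res X) (res S2) (res X) (rrst X S2 i2) v = Ident ?C (res X) \<and>
        Comp ?C (res X) (res S2) (res (ptgt m2)) (rrst (ptgt m2) S2 l2) v = rcls X (ptgt m2) (const_bisp B2 j2)"
      using ro(1) category_ident_in[OF K.category_bispan_cat, of "res X"] const_in_Hom[OF B2, of X] by (simp add: is_product_def)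
    then show ?thesis using uH 1 2 d2 by blast
  qed
  then have "w2 = Comp ?C (res X) (res S) (res X'') (res_hom S X'' ?g) ?d"
    using presents_factor[OF o(1,3) S2 p2 il2] asc[OF ro(1,4,5,3) d(1) res_hom_in[OF S S2 sideH] res_hom_in[OF S2 o(3) hat2H]]
      res_hom_comp[OF S S2 o(3) sideH hat2H] g2 by simp
  also have "\<dots> = Comp ?C (res X) (res X') (res X'') (res_hom X' X'' \<gamma>) w"
    using presents_factor[OF o(1,2) S p il] asc[OF ro(1,4,2,3) d(1) res_hom_in[OF S o(2) hatH] res_hom_in[OF o(2,3) \<gamma>]]
      res_hom_comp[OF S o(2,3) hatH \<gamma>] by simp
  finally have w2: "w2 = Comp ?C (res X) (res X') (res X'') (res_hom X' X'' \<gamma>) w" .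
  have "on_hom R X' X'' \<gamma> (ext X X' w x) = on_hom R S X'' (cls G S X'' (subst_bisp i l m2 \<nu>)) s"
    using ext_eq[OF o(1,2) p x] hval_eq[OF R o(1,2) tm m S il s(1)] s apply_comp[OF Rf S o(2,3) hatH \<gamma> s(1)] g by simp
  also have "\<dots> = hval R X X'' m2 x (on_hom R (ptgt m) (ptgt m2) (cls G (ptgt m) (ptgt m2) \<nu>) (kval (ptgt m) B0 j))"
    using hval_subst[OF R o(1,3) S tm m2(2,1) \<nu> il(1,2) s(1)] s by simp
  also have "\<dots> = ext X X'' w2 x"
    using kval_nat[OF tm m2(2) B0 \<nu>H c2] ext_eq[OF o(1,3) p2 x] by simp
  finally show ?thesis using w2 by simp
qed

text \<open>A constant is presented by a bispan with empty source, whose operation is the second projection.\<close>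

lemma ext_const:
  assumes o: "X \<in> Fin G" "B \<in> Fin G" and B0: "is_gset K B0" "eqv K B0 B j" and x: "x \<in> on_obj R X"
  shows "ext X B (rcls X B (const_bisp B0 j)) x = kval B B0 j"
proof -
  have gB: "is_gset G B" by (rule Fin_gset[OF o(2)])
  let ?m = "\<lparr>psrc = ({}, \<lambda>g x. x), ptgt = B, pres = (\<lambda>x. x), pnorm = (\<lambda>x. x), ptran = (\<lambda>x. x)\<rparr> :: ('g, 'u) ubisp"
  have m: "wf_bisp G X B ?m" using gB by (simp add: wf_bisp_def is_gset_empty eqv_def)
  have "bisp_iso K (const_bisp B0 j) (pullb ?m B0 j)"
    by (rule bisp_isoI[of "\<lambda>_. undefined" _ _ "\<lambda>b. b"]) (auto simp: const_bisp_def pullb_def fibre_product_def eqv_def bij_betw_def)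
  moreover have wfp: "wf_bisp K (res X) (res B) (pullb ?m B0 j)" using K.wf_pullb[OF wf_bisp_sub[OF m] B0(1)] B0(2) by simp
  ultimately have "rcls X B (const_bisp B0 j) = rcls X B (pullb ?m B0 j)"
    using K.cls_eq[OF wf_const_res[OF B0] wfp] by simp
  then have p: "presents X B (rcls X B (const_bisp B0 j)) ?m B0 j"
    unfolding presents_def using m o(2) B0 by simp
  obtain S i l s where S: "S \<in> Fin G" and il: "eqv G X S i" "eqv G B S l" "is_sum X B S i l"
    and s: "s \<in> on_obj R S" "on_hom R S X (rst G X S i) s = x" "on_hom R S B (rst G B S l) s = kval B B0 j"
    using ex_join[OF R o x kval_in[OF o(2) B0]] by (elim exE conjE) (rule that)
  have "bisp_iso G (hat_bisp i l ?m) (res_bisp B l)"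
    by (rule bisp_isoI[of "case_sum (\<lambda>x. x) (\<lambda>x. x)" _ _ "\<lambda>b. b"])
      (auto simp: hat_bisp_def res_bisp_def elts_gset_sum eqv_gset_sum eqv_def bij_betw_def inj_on_def intro!: image_eqI[of _ _ "Inr _"])
  then have "cls G S B (hat_bisp i l ?m) = rst G B S l"
    using cls_eq[OF wf_hat_bisp[OF m il(1)] wf_res_bisp[OF gB il(2)]] il(2) by (simp add: rst_def)
  then show ?thesis using ext_eq[OF o p x] hval_eq[OF R o _ m S il(1) _ _ s(1), of l] il s o(2) by simp
qed

text \<open>A restricted bispan is presented by itself with the identity of its middle set; the corresponding constant is the multiplicative unit,
  which already comes from a bispan of \<open>G\<close>-sets.\<close>

lemma ext_res:
  assumes o: "X \<in> Fin G" "X' \<in> Fin G" and \<gamma>: "\<gamma> \<in> BHom G X X'" and x: "x \<in> on_obj R X"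
  shows "ext X X' (res_hom X X' \<gamma>) x = on_hom R X X' \<gamma> x"
proof -
  obtain m :: "('g, 'u) ubisp" where m: "wf_bisp G X X' m" "\<gamma> = cls G X X' m" and tm: "ptgt m \<in> Fin G" using \<gamma> by (rule Hom_bispan_catE)
  note M = wf_bispD[OF m(1)]
  let ?B = "ptgt m" and ?j = "\<lambda>b. b"
  have B: "is_gset K ?B" "eqv K ?B ?B ?j" using is_gset_sub[OF M(2)] by (simp_all add: eqv_id)
  have iso: "bisp_iso Q m (pullb m ?B ?j)" if e: "eqv Q (psrc m) (ptgt m) (pnorm m)" for Q :: "'g monoid"
  proof (rule bisp_isoI[of "\<lambda>a. (a, pnorm m a)" _ _ "\<lambda>b. b"])
    show "bij_betw (\<lambda>a. (a, pnorm m a)) (Src m) (elts (psrc (pullb m ?B ?j)))"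
      by (rule bij_betw_byWitness[of _ fst]) (auto simp: pullb_def fibre_product_def eqv_in[OF M(4)])
  qed (use e in \<open>auto simp: pullb_def eqv_def bij_betw_def\<close>)
  have "wf_bisp K (res X) (res X') (pullb m ?B ?j)" using K.wf_pullb[OF wf_bisp_sub[OF m(1)] B] by simp
  moreover have "wf_bisp K (res X) (res X') m" using wf_bisp_sub[OF m(1)] by simp
  ultimately have "res_hom X X' \<gamma> = rcls X X' (pullb m ?B ?j)"
    using res_hom_cls[OF o m(1)] m(2) K.cls_eq iso[OF eqv_sub[OF M(4)]] by metis
  then have p: "presents X X' (res_hom X X' \<gamma>) m ?B ?j" using m tm B by (simp add: presents_def)
  let ?c = "const_bisp ?B ?j :: ('g, unit, 'u, 'u, 'u) bisp"
  have wfc: "wf_bisp G emptyG ?B ?c" using M(2) by (simp add: wf_bisp_def const_bisp_def is_gset_empty eqv_def)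
  have cH: "cls G emptyG ?B ?c \<in> BHom G emptyG ?B" by (rule cls_in_Hom[OF wfc])
  have k0: "k0 \<in> on_obj k (res emptyG)" by (simp add: k_empty)
  have kv: "kval ?B ?B ?j = on_hom R emptyG ?B (cls G emptyG ?B ?c) (\<phi> emptyG k0)"
    using \<phi>_nat[OF emptyG(1) tm cH k0] res_hom_cls[OF emptyG(1) tm wfc] by (simp add: kval_def)
  have e0: "eqv G emptyG X (\<lambda>x. x)" by (simp add: eqv_def emptyG)
  \<comment> \<open>The value of \<open>R\<close> at the empty set has only one element.\<close>
  have z: "on_hom R X emptyG (rst G emptyG X (\<lambda>x. x)) x = \<phi> emptyG k0"
    using prod_functor_empty[OF R emptyG] apply_in[OF Rf o(1) emptyG(1) rst_in_Hom[OF emptyG(1) e0] x] \<phi>_in[OF emptyG(1) k0] by auto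
  have xi: "on_hom R X X (rst G X X (\<lambda>x. x)) x = x" using apply_id[OF Rf o(1) x] by (simp add: rst_id[OF o(1)])
  have "hval R X X' m x (kval ?B ?B ?j) = on_hom R X X' (cls G X X' (subst_bisp (\<lambda>x. x) (\<lambda>x. x) m ?c)) x"
    using hval_subst[OF R o o(1) emptyG(1) tm m(1) wfc eqv_id e0 x] xi z kv by simp
  also have "cls G X X' (subst_bisp (\<lambda>x. x) (\<lambda>x. x) m ?c) = \<gamma>"
  proof -
    have "bisp_iso G (pullb m ?B ?j) (subst_bisp (\<lambda>x. x) (\<lambda>x. x) m ?c)"
    proof (rule bisp_isoI[of Inl _ _ "\<lambda>x. x"])
      show "bij_betw Inl (elts (psrc (pullb m ?B ?j))) (elts (psrc (subst_bisp (\<lambda>x. x) (\<lambda>x. x) m ?c)))"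
        by (auto simp: pullb_def subst_bisp_def const_bisp_def elts_gset_sum bij_betw_def)
    qed (auto simp: pullb_def subst_bisp_def const_bisp_def eqv_Inl eqv_id bij_betw_def)
    then have "bisp_iso G m (subst_bisp (\<lambda>x. x) (\<lambda>x. x) m ?c)" using bisp_iso_trans[OF iso[OF M(4)] _ m(1)] by blast
    then show ?thesis using cls_eq[OF m(1) wf_subst_bisp[OF m(1) wfc eqv_id e0]] m(2) by simp
  qed
  finally show ?thesis using ext_eq[OF o p x] by simp
qed

text \<open>The second factor is a restricted bispan after the pairing with a constant. The pairing is computed on its components,
  and \<open>ext_post\<close> deals with restricted bispans.\<close>

lemma ext_comp:
  assumes o: "X \<in> Fin G" "X' \<in> Fin G" "X'' \<in> Fin G" and w: "w \<in> RHom X X'"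
    and w': "w' \<in> RHom X' X''" and x: "x \<in> on_obj R X"
  shows "ext X X'' (RComp X X' X'' w' w) x = ext X' X'' w' (ext X X' w x)"
proof -
  obtain m :: "('g, 'u) ubisp" and B0 j where p: "presents X' X'' w' m B0 j" using ex_presentation[OF o(2,3) w'] by blast
  then have m: "wf_bisp G X' X'' m" and tm: "ptgt m \<in> Fin G" and B0: "is_gset K B0" "eqv K B0 (ptgt m) j" by (auto simp: presents_def)
  obtain S i l where "is_coproduct (gset_cat G) X' (ptgt m) S i l" using ex_coproduct_gset_cat[OF o(2) tm] by blast
  then have S: "S \<in> Fin G" and il: "eqv G X' S i" "eqv G (ptgt m) S l" "is_sum X' (ptgt m) S i l"
    by (auto simp: is_coproduct_gset_cat intro: EMap_eqv)
  let ?hat = "cls G S X'' (hat_bisp i l m)" and ?d = "dpair X' S i l B0 j"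
  have hatH: "?hat \<in> BHom G S X''" by (rule cls_in_Hom[OF wf_hat_bisp[OF m il(1,2)]])
  note d = dpair_facts[OF o(2) S tm il B0]
  note ro = o[THEN res_gset_in] res_gset_in[OF S] res_gset_in[OF tm]
  note asc = category_assoc[OF K.category_bispan_cat, unfolded K.Obj_bispan_cat]
  let ?C = "bispan_cat K :: (('g, 'u) gset, ('g, 'u) bispan set) cat"
  let ?dw = "Comp ?C (res X) (res X') (res S) ?d w"
  have dwH: "?dw \<in> Hom ?C (res X) (res S)" using category_comp_in[OF K.category_bispan_cat] ro w d(1) by simp
  let ?s = "ext X S ?dw x"
  have s: "?s \<in> on_obj R S" by (rule ext_in[OF o(1) S dwH x])
  have rH: "rrst X' S i \<in> Hom ?C (res S) (res X')" "rrst (ptgt m) S l \<in> Hom ?C (res S) (res (ptgt m))"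
    using il ro by (simp_all add: K.rst_in_Hom eqv_sub)
  have "on_hom R S X' (rst G X' S i) ?s = ext X X' w x"
    using ext_post[OF o(1) S o(2) dwH rst_in_Hom[OF o(2) il(1)] x] asc[OF ro(1,2,4,2) w d(1) rH(1)] d(2)
      category_ident_left[OF K.category_bispan_cat, of "res X" "res X'" w] ro w by (simp add: res_hom_rst[OF o(2) S il(1)])
  moreover have "on_hom R S (ptgt m) (rst G (ptgt m) S l) ?s = kval (ptgt m) B0 j"
    using ext_post[OF o(1) S tm dwH rst_in_Hom[OF tm il(2)] x] asc[OF ro(1,2,4,5) w d(1) rH(2)] d(3)
      const_comp[OF o(1,2) tm B0 w] ext_const[OF o(1) tm B0 x] by (simp add: res_hom_rst[OF tm S il(2)])
  ultimately have "ext X' X'' w' (ext X X' w x) = on_hom R S X'' ?hat ?s"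
    using ext_eq[OF o(2,3) p ext_in[OF o(1,2) w x]] hval_eq[OF R o(2,3) tm m S il s] by simp
  also have "\<dots> = ext X X'' (Comp ?C (res X) (res S) (res X'') (res_hom S X'' ?hat) ?dw) x"
    using ext_post[OF o(1) S o(3) dwH hatH x] by simp
  also have "Comp ?C (res X) (res S) (res X'') (res_hom S X'' ?hat) ?dw = Comp ?C (res X) (res X') (res X'') w' w"
    using presents_factor[OF o(2,3) S p il] asc[OF ro(1,2,4,3) w d(1) res_hom_in[OF S o(3) hatH]] by simp
  finally show ?thesis by simp
qed

end

section \<open>Full faithfulness\<close>

text \<open>The extension is built from operations of \<open>R\<close> and constants from \<open>k\<close>, and a transformation under \<open>k\<close> preserves both.\<close>

lemma under_coind_natural:
  fixes k R1 R2 :: "('g, 'u::infinite, 'v) tambara"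
  assumes U1: "under_coind G H k R1 \<phi>1" and U2: "under_coind G H k R2 \<phi>2"
    and \<psi>_in: "\<And>X x. \<lbrakk>X \<in> Fin G; x \<in> on_obj R1 X\<rbrakk> \<Longrightarrow> \<psi> X x \<in> on_obj R2 X"
    and \<psi>_nat: "\<And>X Y f x. \<lbrakk>X \<in> Fin G; Y \<in> Fin G; f \<in> BHom G X Y; x \<in> on_obj R1 X\<rbrakk> \<Longrightarrow>
      \<psi> Y (on_hom R1 X Y f x) = on_hom R2 X Y f (\<psi> X x)"
    and \<psi>\<phi>: "\<And>X x. \<lbrakk>X \<in> Fin G; x \<in> on_obj k (res_gset H X)\<rbrakk> \<Longrightarrow> \<psi> X (\<phi>1 X x) = \<phi>2 X x"
    and o: "X \<in> Fin G" "X' \<in> Fin G" and w: "w \<in> Hom (bispan_cat (G\<lparr>carrier := H\<rparr>)) (res_gset H X) (res_gset H X')"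
    and x: "x \<in> on_obj R1 X"
  shows "\<psi> X' (under_coind.ext G H k R1 \<phi>1 X X' w x) = under_coind.ext G H k R2 \<phi>2 X X' w (\<psi> X x)"
proof -
  interpret A: under_coind G H k R1 \<phi>1 by fact
  interpret B: under_coind G H k R2 \<phi>2 by fact
  obtain m :: "('g, 'u) ubisp" and B0 j where p: "A.presents X X' w m B0 j" using A.ex_presentation[OF o w] by blast
  then have m: "wf_bisp G X X' m" and tm: "ptgt m \<in> Fin G" and B0: "is_gset A.K B0" "eqv A.K B0 (ptgt m) j" by (auto simp: A.presents_def)
  obtain S i l s where S: "S \<in> Fin G" and il: "eqv G X S i" "eqv G (ptgt m) S l" "is_sum X (ptgt m) S i l"
    and s: "s \<in> on_obj R1 S" "on_hom R1 S X (rst G X S i) s = x" "on_hom R1 S (ptgt m) (rst G (ptgt m) S l) s = A.kval (ptgt m) B0 j"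
    using A.ex_join[OF A.R o(1) tm x A.kval_in[OF tm B0]] by (elim exE conjE) (rule that)
  have hatH: "cls G S X' (hat_bisp i l m) \<in> BHom G S X'" by (rule A.cls_in_Hom[OF A.wf_hat_bisp[OF m il(1,2)]])
  have k0: "A.k0 \<in> on_obj k (A.res A.emptyG)" by (simp add: A.k_empty)
  have "\<psi> (ptgt m) (A.kval (ptgt m) B0 j) = B.kval (ptgt m) B0 j"
    unfolding A.kval_def B.kval_def
    by (rule \<psi>\<phi>[OF tm]) (rule A.K.apply_in[OF A.kf A.res_gset_in[OF A.emptyG(1)] A.res_gset_in[OF tm] A.const_in_Hom[OF B0] k0])
  then have "on_hom R2 S (ptgt m) (rst G (ptgt m) S l) (\<psi> S s) = B.kval (ptgt m) B0 j"
    using \<psi>_nat[OF S tm A.rst_in_Hom[OF tm il(2)] s(1)] s(3) by simp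
  moreover have "on_hom R2 S X (rst G X S i) (\<psi> S s) = \<psi> X x"
    using \<psi>_nat[OF S o(1) A.rst_in_Hom[OF o(1) il(1)] s(1)] s(2) by simp
  ultimately have "B.ext X X' w (\<psi> X x) = on_hom R2 S X' (cls G S X' (hat_bisp i l m)) (\<psi> S s)"
    using B.ext_eq[OF o p \<psi>_in[OF o(1) x]] A.hval_eq[OF B.R o tm m S il \<psi>_in[OF S s(1)]] by simp
  then show ?thesis
    using A.ext_eq[OF o p x] A.hval_eq[OF A.R o tm m S il s(1)] s \<psi>_nat[OF S o(2) hatH s(1)] by simp
qed

context subgroup_pair
begin

lemma under_coind_of_Hom:
  fixes k R :: "('g, 'u::infinite, 'v) tambara"
  assumes k: "prod_functor K k" and R: "prod_functor G R" and \<phi>: "\<phi> \<in> Hom (tambara_cat G) (coind G H k) R"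
  shows "under_coind G H k R \<phi>"
proof -
  note h = Hom_tambara_cat[OF coind_functor[OF K.prod_functor_functor[OF k]] prod_functor_functor[OF R], THEN iffD1, OF \<phi>]
  show ?thesis
  proof (unfold_locales, rule k, rule R)
    fix X x assume X: "X \<in> Fin G" and x: "x \<in> on_obj k (res X)"
    then show "\<phi> X x \<in> on_obj R X" using h by (auto simp: coind_obj)
    fix Y f assume Y: "Y \<in> Fin G" and f: "f \<in> BHom G X Y"
    have "x \<in> on_obj (coind G H k) X" using X x by (simp add: coind_obj)
    then have "\<phi> Y (on_hom (coind G H k) X Y f x) = on_hom R X Y f (\<phi> X x)" using h X Y f by blast
    then show "\<phi> Y (on_hom k (res X) (res Y) (res_hom X Y f) x) = on_hom R X Y f (\<phi> X x)" by (simp add: coind_hom[OF X Y f])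
  qed
qed

text \<open>In a coinduced functor the element joining \<open>x\<close> to the constant is the value at \<open>x\<close> of the pairing, by uniqueness of joins; so
  the factorisation of \<open>w\<close> computes the value of \<open>T\<close>.\<close>

lemma ext_coind:
  fixes k T :: "('g, 'u::infinite, 'v) tambara"
  assumes U: "under_coind G H k (coind G H T) \<phi>" and T: "prod_functor K T"
    and \<tau>: "\<And>X x. \<lbrakk>X \<in> Fin G; x \<in> on_obj k (res X)\<rbrakk> \<Longrightarrow> \<phi> X x = \<tau> (res X) x"
    and \<tau>_in: "\<And>Y x. \<lbrakk>Y \<in> Fin K; x \<in> on_obj k Y\<rbrakk> \<Longrightarrow> \<tau> Y x \<in> on_obj T Y"
    and \<tau>_nat: "\<And>Y Z f x. \<lbrakk>Y \<in> Fin K; Z \<in> Fin K; f \<in> BHom K Y Z; x \<in> on_obj k Y\<rbrakk> \<Longrightarrow> \<tau> Z (on_hom k Y Z f x) = on_hom T Y Z f (\<tau> Y x)"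
    and o: "X \<in> Fin G" "X' \<in> Fin G" and w: "w \<in> RHom X X'" and x: "x \<in> on_obj T (res X)"
  shows "under_coind.ext G H k (coind G H T) \<phi> X X' w x = on_hom T (res X) (res X') w x"
proof -
  interpret A: under_coind G H k "coind G H T" \<phi> by fact
  note Tf = K.prod_functor_functor[OF T]
  have x': "x \<in> on_obj (coind G H T) X" using x o by (simp add: coind_obj)
  obtain m :: "('g, 'u) ubisp" and B0 j where p: "presents X X' w m B0 j" using ex_presentation[OF o w] by blast
  then have m: "wf_bisp G X X' m" and tm: "ptgt m \<in> Fin G" and B0: "is_gset K B0" "eqv K B0 (ptgt m) j" by (auto simp: presents_def)
  obtain S i l s where S: "S \<in> Fin G" and il: "eqv G X S i" "eqv G (ptgt m) S l" "is_sum X (ptgt m) S i l"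
    and s: "s \<in> on_obj (coind G H T) S" "on_hom (coind G H T) S X (rst G X S i) s = x" "on_hom (coind G H T) S (ptgt m) (rst G (ptgt m) S l) s = A.kval (ptgt m) B0 j"
    using ex_join[OF A.R o(1) tm x' A.kval_in[OF tm B0]] by (elim exE conjE) (rule that)
  have hatH: "cls G S X' (hat_bisp i l m) \<in> BHom G S X'" by (rule cls_in_Hom[OF wf_hat_bisp[OF m il(1,2)]])
  note ro = o[THEN res_gset_in] res_gset_in[OF S] res_gset_in[OF tm] res_gset_in[OF emptyG(1)]
  note d = dpair_facts[OF o(1) S tm il B0]
  have s': "s \<in> on_obj T (res S)" "on_hom T (res S) (res X) (rrst X S i) s = x"
    "on_hom T (res S) (res (ptgt m)) (rrst (ptgt m) S l) s = A.kval (ptgt m) B0 j"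
    using s il S o tm by (simp_all add: coind_obj coind_hom rst_in_Hom res_hom_rst)
  have il': "eqv K (res X) (res S) i" "eqv K (res (ptgt m)) (res S) l" "joint_bij (elts (res X)) (elts (res (ptgt m))) (elts (res S)) i l"
    using il by (simp_all add: eqv_sub)
  let ?t = "on_hom T (res X) (res S) (dpair X S i l B0 j) x"
  have t: "?t \<in> on_obj T (res S)" by (rule K.apply_in[OF Tf ro(1,3) d(1) x])
  have t1: "on_hom T (res S) (res X) (rrst X S i) ?t = x"
    using K.apply_comp[OF Tf ro(1,3,1) d(1) K.rst_in_Hom[OF ro(1) il'(1)] x] d(2) K.apply_id[OF Tf ro(1) x] by simp
  have e: "eqv K (res emptyG) (res X) (\<lambda>x. x)" by (simp add: eqv_def emptyG)
  have k0: "A.k0 \<in> on_obj k (res emptyG)" by (simp add: A.k_empty)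
  have "on_hom T (res X) (res emptyG) (rrst emptyG X (\<lambda>x. x)) x = \<tau> (res emptyG) A.k0"
    using K.prod_functor_empty[OF T ro(5)] K.apply_in[OF Tf ro(1,5) K.rst_in_Hom[OF ro(5) e] x] \<tau>_in[OF ro(5) k0] by (auto simp: emptyG)
  then have "on_hom T (res X) (res (ptgt m)) (rcls X (ptgt m) (const_bisp B0 j)) x =
      on_hom T (res emptyG) (res (ptgt m)) (rcls emptyG (ptgt m) (const_bisp B0 j)) (\<tau> (res emptyG) A.k0)"
    using K.apply_comp[OF Tf ro(1,5,4) K.rst_in_Hom[OF ro(5) e] const_in_Hom[OF B0] x] const_via_empty[OF o(1) tm B0] by simp
  also have "\<dots> = A.kval (ptgt m) B0 j"
    unfolding A.kval_def using \<tau>_nat[OF ro(5,4) const_in_Hom[OF B0] k0] \<tau>[OF tm K.apply_in[OF A.kf ro(5,4) const_in_Hom[OF B0] k0]] by simp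
  finally have t2: "on_hom T (res S) (res (ptgt m)) (rrst (ptgt m) S l) ?t = A.kval (ptgt m) B0 j"
    using K.apply_comp[OF Tf ro(1,3,4) d(1) K.rst_in_Hom[OF ro(4) il'(2)] x] d(3) by simp
  have "A.kval (ptgt m) B0 j \<in> on_obj T (res (ptgt m))" using A.kval_in[OF tm B0] by (simp add: coind_obj tm)
  then have "?t = s" using K.prod_functor_join[OF T ro(1,4,3) il' x] s' t t1 t2 by blast
  then have "on_hom T (res X) (res X') w x = on_hom T (res S) (res X') (res_hom S X' (cls G S X' (hat_bisp i l m))) s"
    using presents_factor[OF o S p il] K.apply_comp[OF Tf ro(1,3,2) d(1) res_hom_in[OF S o(2) hatH] x] by simp
  then show ?thesis
    using A.ext_eq[OF o p x'] hval_eq[OF A.R o tm m S il s(1)] s coind_hom[OF S o(2) hatH, of T] by simp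
qed

text \<open>A transformation of coinduced functors under \<open>k\<close> is natural even for bispans of \<open>H\<close>-sets, since these act by the
  extension.\<close>

lemma nat_coind_extends:
  fixes k T T' :: "('g, 'u::infinite, 'v) tambara"
  assumes k: "prod_functor K k" and T: "prod_functor K T" and T': "prod_functor K T'"
    and \<tau>: "\<tau> \<in> Hom (tambara_cat K) k T" and \<tau>': "\<tau>' \<in> Hom (tambara_cat K) k T'"
    and \<psi>: "\<psi> \<in> Hom (tambara_cat G) (coind G H T) (coind G H T')"
    and \<psi>\<tau>: "\<And>X x. \<lbrakk>X \<in> Fin G; x \<in> on_obj k (res X)\<rbrakk> \<Longrightarrow> \<psi> X (\<tau> (res X) x) = \<tau>' (res X) x"
    and o: "X \<in> Fin G" "X' \<in> Fin G" and w: "w \<in> RHom X X'" and x: "x \<in> on_obj T (res X)"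
  shows "\<psi> X' (on_hom T (res X) (res X') w x) = on_hom T' (res X) (res X') w (\<psi> X x)"
proof -
  note kf = K.prod_functor_functor[OF k] and Tf = K.prod_functor_functor[OF T] and Tf' = K.prod_functor_functor[OF T']
  note U = under_coind_of_Hom[OF k prod_functor_coind[OF T] coind_trans_in_Hom[OF kf Tf \<tau>]]
  note U' = under_coind_of_Hom[OF k prod_functor_coind[OF T'] coind_trans_in_Hom[OF kf Tf' \<tau>']]
  note \<tau>h = K.Hom_tambara_cat[OF kf Tf, THEN iffD1, OF \<tau>] and \<tau>h' = K.Hom_tambara_cat[OF kf Tf', THEN iffD1, OF \<tau>']
  note \<psi>h = Hom_tambara_cat[OF coind_functor[OF Tf] coind_functor[OF Tf'], THEN iffD1, OF \<psi>]
  have ct: "coind_trans G H \<eta> X = \<eta> (res X)" if "X \<in> Fin G" for \<eta> :: "('g, 'u) gset \<Rightarrow> 'v \<Rightarrow> 'v" and X using that by (simp add: coind_trans_def)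
  have e1: "under_coind.ext G H k (coind G H T) (coind_trans G H \<tau>) X X' w x = on_hom T (res X) (res X') w x"
    by (rule ext_coind[OF U T, of \<tau>]) (use \<tau>h o w x ct in auto)
  have \<psi>x: "\<psi> X x \<in> on_obj T' (res X)" using \<psi>h o(1) x by (auto simp: coind_obj)
  have e2: "under_coind.ext G H k (coind G H T') (coind_trans G H \<tau>') X X' w (\<psi> X x) = on_hom T' (res X) (res X') w (\<psi> X x)"
    by (rule ext_coind[OF U' T', of \<tau>']) (use \<tau>h' o w \<psi>x ct in auto)
  have "\<psi> X' (under_coind.ext G H k (coind G H T) (coind_trans G H \<tau>) X X' w x) =
      under_coind.ext G H k (coind G H T') (coind_trans G H \<tau>') X X' w (\<psi> X x)"
  proof (rule under_coind_natural[OF U U' _ _ _ o w])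
    show "x \<in> on_obj (coind G H T) X" using x o(1) by (simp add: coind_obj)
    show "\<And>X x. \<lbrakk>X \<in> Fin G; x \<in> on_obj k (res X)\<rbrakk> \<Longrightarrow> \<psi> X (coind_trans G H \<tau> X x) = coind_trans G H \<tau>' X x" using \<psi>\<tau> ct by simp
  qed (use \<psi>h in blast)+
  then show ?thesis using e1 e2 by simp
qed

definition emb :: "('g, 'u) gset \<Rightarrow> ('g, 'u) gset \<times> ('u \<Rightarrow> 'u)" where
  "emb Y = (SOME p. fst p \<in> Fin G \<and> eqv K Y (fst p) (snd p) \<and> inj_on (snd p) (elts Y))"

abbreviation U :: "('g, 'u) gset \<Rightarrow> ('g, 'u) gset" where "U Y \<equiv> fst (emb Y)"
abbreviation incl :: "('g, 'u) gset \<Rightarrow> 'u \<Rightarrow> 'u" where "incl Y \<equiv> snd (emb Y)"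

lemma emb:
  fixes Y :: "('g, 'u::infinite) gset"
  assumes "Y \<in> Fin K"
  shows "U Y \<in> Fin G" "eqv K Y (U Y) (incl Y)" "inj_on (incl Y) (elts Y)"
proof -
  have "\<exists>p :: ('g, 'u) gset \<times> ('u \<Rightarrow> 'u). fst p \<in> Fin G \<and> eqv K Y (fst p) (snd p) \<and> inj_on (snd p) (elts Y)"
    using ex_embedding[OF assms] by force
  from someI_ex[OF this] show "U Y \<in> Fin G" "eqv K Y (U Y) (incl Y)" "inj_on (incl Y) (elts Y)"
    unfolding emb_def by blast+
qed

definition IN :: "('g, 'u) gset \<Rightarrow> ('g, 'u) bispan set" where "IN Y = trn K Y (res (U Y)) (incl Y)"
definition PR :: "('g, 'u) gset \<Rightarrow> ('g, 'u) bispan set" where "PR Y = rst K Y (res (U Y)) (incl Y)"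

text \<open>Restricting a transfer along an injective map gives back the element.\<close>

lemma retract:
  fixes Y :: "('g, 'u::infinite) gset"
  assumes Y: "Y \<in> Fin K"
  shows "res (U Y) \<in> Fin K" "IN Y \<in> BHom K Y (res (U Y))" "PR Y \<in> BHom K (res (U Y)) Y"
    "BComp K Y (res (U Y)) Y (PR Y) (IN Y) = BId K Y"
  using emb[OF Y] Y by (simp_all add: res_gset_in IN_def PR_def K.trn_in_Hom K.rst_in_Hom K.rst_trn_inj)

lemma retract_apply:
  fixes T :: "('g, 'u::infinite, 'v) tambara"
  assumes T: "BFun K T" and Y: "Y \<in> Fin K" and y: "y \<in> on_obj T Y"
  shows "on_hom T Y (res (U Y)) (IN Y) y \<in> on_obj T (res (U Y))"
    and "on_hom T (res (U Y)) Y (PR Y) (on_hom T Y (res (U Y)) (IN Y) y) = y"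
  using retract[OF Y] K.apply_in[OF T Y _ _ y] K.apply_comp[OF T Y _ Y _ _ y] K.apply_id[OF T Y y] by metis+

text \<open>The bispan \<open>f\<close> transported to the ambient restricted sets; identities become the idempotents \<open>IN Y \<circ> PR Y\<close>.\<close>

definition J :: "('g, 'u) gset \<Rightarrow> ('g, 'u) gset \<Rightarrow> ('g, 'u) bispan set \<Rightarrow> ('g, 'u) bispan set" where
  "J Y Y' f = BComp K (res (U Y)) Y (res (U Y')) (BComp K Y Y' (res (U Y')) (IN Y') f) (PR Y)"

lemma J_facts:
  fixes Y Y' :: "('g, 'u::infinite) gset"
  assumes o: "Y \<in> Fin K" "Y' \<in> Fin K" and f: "f \<in> BHom K Y Y'"
  shows "J Y Y' f \<in> RHom (U Y) (U Y')"
    and "BComp K Y (res (U Y)) (res (U Y')) (J Y Y' f) (IN Y) = BComp K Y Y' (res (U Y')) (IN Y') f"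
    and "BComp K (res (U Y)) (res (U Y')) Y' (PR Y') (J Y Y' f) = BComp K (res (U Y)) Y Y' f (PR Y)"
proof -
  note asc = category_assoc[OF K.category_bispan_cat, unfolded K.Obj_bispan_cat] and cin = category_comp_in[OF K.category_bispan_cat, unfolded K.Obj_bispan_cat]
  note r = retract[OF o(1)] and r' = retract[OF o(2)]
  have INf: "BComp K Y Y' (res (U Y')) (IN Y') f \<in> BHom K Y (res (U Y'))" by (rule cin[OF o r'(1) f r'(2)])
  show "J Y Y' f \<in> RHom (U Y) (U Y')" unfolding J_def by (rule cin[OF r(1) o(1) r'(1) r(3) INf])
  show "BComp K Y (res (U Y)) (res (U Y')) (J Y Y' f) (IN Y) = BComp K Y Y' (res (U Y')) (IN Y') f"
    unfolding J_def using asc[OF o(1) r(1) o(1) r'(1) r(2,3) INf] r(4) category_ident_right[OF K.category_bispan_cat _ _ INf] o r'(1) by simp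
  have "BComp K (res (U Y)) (res (U Y')) Y' (PR Y') (J Y Y' f) =
     BComp K (res (U Y)) Y Y' (BComp K Y (res (U Y')) Y' (PR Y') (BComp K Y Y' (res (U Y')) (IN Y') f)) (PR Y)"
    unfolding J_def using asc[OF r(1) o(1) r'(1) o(2) r(3) INf r'(3)] by simp
  also have "BComp K Y (res (U Y')) Y' (PR Y') (BComp K Y Y' (res (U Y')) (IN Y') f) = f"
    using asc[OF o r'(1) o(2) f r'(2,3)] r'(4) category_ident_left[OF K.category_bispan_cat _ _ f] o by simp
  finally show "BComp K (res (U Y)) (res (U Y')) Y' (PR Y') (J Y Y' f) = BComp K (res (U Y)) Y Y' f (PR Y)" .
qed

text \<open>A component at \<open>Y\<close> is a retract of the component at \<open>res (U Y)\<close>.\<close>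

lemma coind_faithful:
  fixes T T' :: "('g, 'u::infinite, 'v) tambara"
  assumes T: "BFun K T" "BFun K T'"
    and \<theta>: "\<theta> \<in> Hom (tambara_cat K) T T'" "\<theta>' \<in> Hom (tambara_cat K) T T'" and eq: "coind_trans G H \<theta> = coind_trans G H \<theta>'"
  shows "\<theta> = \<theta>'"
proof
  note h = K.Hom_tambara_cat[OF T, THEN iffD1, OF \<theta>(1)] and h' = K.Hom_tambara_cat[OF T, THEN iffD1, OF \<theta>(2)]
  fix Y
  show "\<theta> Y = \<theta>' Y"
  proof (cases "Y \<in> Fin K")
    case Y: True
    show ?thesis
    proof
      fix y
      show "\<theta> Y y = \<theta>' Y y"
      proof (cases "y \<in> on_obj T Y")
        case y: True
        let ?y = "on_hom T Y (res (U Y)) (IN Y) y"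
        note ry = retract_apply[OF T(1) Y y] and r = retract[OF Y]
        have "\<theta> (res (U Y)) ?y = \<theta>' (res (U Y)) ?y" using fun_cong[OF eq, of "U Y"] emb(1)[OF Y] by (simp add: coind_trans_def)
        moreover have "\<theta> Y (on_hom T (res (U Y)) Y (PR Y) ?y) = on_hom T' (res (U Y)) Y (PR Y) (\<theta> (res (U Y)) ?y)"
          using h r(1,3) Y ry(1) by blast
        moreover have "\<theta>' Y (on_hom T (res (U Y)) Y (PR Y) ?y) = on_hom T' (res (U Y)) Y (PR Y) (\<theta>' (res (U Y)) ?y)"
          using h' r(1,3) Y ry(1) by blast
        ultimately show ?thesis using ry(2) by simp
      next
        case False
        have "\<theta> Y \<in> extensional (on_obj T Y)" "\<theta>' Y \<in> extensional (on_obj T Y)" using h h' Y by (auto simp: PiE_def)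
        then show ?thesis using False by (simp add: extensional_def)
      qed
    qed
  next
    case False
    then show ?thesis using h h' by (metis extensional_arb)
  qed
qed

text \<open>The component at \<open>Y\<close> is defined by the retraction from \<open>U Y\<close>; it is natural, and agrees with \<open>\<psi>\<close> on restricted sets, because
  \<open>\<psi>\<close> is natural for all bispans of \<open>H\<close>-sets between restricted sets.\<close>

lemma coind_full:
  fixes k T T' :: "('g, 'u::infinite, 'v) tambara"
  assumes k: "prod_functor K k" and T: "prod_functor K T" and T': "prod_functor K T'"
    and \<tau>: "\<tau> \<in> Hom (tambara_cat K) k T" and \<tau>': "\<tau>' \<in> Hom (tambara_cat K) k T'"
    and \<psi>: "\<psi> \<in> Hom (tambara_cat G) (coind G H T) (coind G H T')"
    and comm: "Comp (tambara_cat G) (coind G H k) (coind G H T) (coind G H T') \<psi> (coind_trans G H \<tau>) = coind_trans G H \<tau>'"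
  shows "\<exists>\<theta>\<in>Hom (tambara_cat K) T T'. Comp (tambara_cat K) k T T' \<theta> \<tau> = \<tau>' \<and> coind_trans G H \<theta> = \<psi>"
proof -
  note kf = K.prod_functor_functor[OF k] and Tf = K.prod_functor_functor[OF T] and Tf' = K.prod_functor_functor[OF T']
  note \<tau>h = K.Hom_tambara_cat[OF kf Tf, THEN iffD1, OF \<tau>] and \<tau>h' = K.Hom_tambara_cat[OF kf Tf', THEN iffD1, OF \<tau>']
  note \<psi>h = Hom_tambara_cat[OF coind_functor[OF Tf] coind_functor[OF Tf'], THEN iffD1, OF \<psi>]
  have \<psi>\<tau>: "\<psi> X (\<tau> (res X) x) = \<tau>' (res X) x" if X: "X \<in> Fin G" and x: "x \<in> on_obj k (res X)" for X x
    using fun_cong[OF fun_cong[OF comm, of X], of x] X x by (simp add: Comp_tambara_cat coind_trans_def coind_obj compose_def)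
  have nat: "\<psi> X' (on_hom T (res X) (res X') w x) = on_hom T' (res X) (res X') w (\<psi> X x)"
    if "X \<in> Fin G" "X' \<in> Fin G" "w \<in> RHom X X'" "x \<in> on_obj T (res X)" for X X' w x
    by (rule nat_coind_extends[OF k T T' \<tau> \<tau>' \<psi> \<psi>\<tau> that])
  have \<psi>_in: "\<psi> X x \<in> on_obj T' (res X)" if "X \<in> Fin G" "x \<in> on_obj T (res X)" for X x
    using \<psi>h that by (auto simp: coind_obj)
  note asc = K.apply_comp
  define \<theta> where "\<theta> = (\<lambda>Y\<in>Fin K. \<lambda>y\<in>on_obj T Y. on_hom T' (res (U Y)) Y (PR Y) (\<psi> (U Y) (on_hom T Y (res (U Y)) (IN Y) y)))"
  have \<theta>: "\<theta> Y y = on_hom T' (res (U Y)) Y (PR Y) (\<psi> (U Y) (on_hom T Y (res (U Y)) (IN Y) y))" if "Y \<in> Fin K" "y \<in> on_obj T Y" for Y y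
    using that by (simp add: \<theta>_def)
  have in1: "\<psi> (U Y) (on_hom T Y (res (U Y)) (IN Y) y) \<in> on_obj T' (res (U Y))" if "Y \<in> Fin K" "y \<in> on_obj T Y" for Y y
    using \<psi>_in[OF emb(1)[OF that(1)] retract_apply(1)[OF Tf that]] .
  have \<theta>_nat: "\<theta> Y' (on_hom T Y Y' f y) = on_hom T' Y Y' f (\<theta> Y y)"
    if o: "Y \<in> Fin K" "Y' \<in> Fin K" and f: "f \<in> BHom K Y Y'" and y: "y \<in> on_obj T Y" for Y Y' f y
  proof -
    note r = retract[OF o(1)] and r' = retract[OF o(2)] and Jf = J_facts[OF o f]
    let ?y = "on_hom T Y (res (U Y)) (IN Y) y"
    have fy: "on_hom T Y Y' f y \<in> on_obj T Y'" by (rule K.apply_in[OF Tf o f y])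
    have "on_hom T Y' (res (U Y')) (IN Y') (on_hom T Y Y' f y) = on_hom T (res (U Y)) (res (U Y')) (J Y Y' f) ?y"
      using asc[OF Tf o r'(1) f r'(2) y] asc[OF Tf o(1) r(1) r'(1) r(2) Jf(1) y] Jf(2) by simp
    then have "\<psi> (U Y') (on_hom T Y' (res (U Y')) (IN Y') (on_hom T Y Y' f y)) = on_hom T' (res (U Y)) (res (U Y')) (J Y Y' f) (\<psi> (U Y) ?y)"
      using nat[OF emb(1)[OF o(1)] emb(1)[OF o(2)] Jf(1) retract_apply(1)[OF Tf o(1) y]] by simp
    then show ?thesis
      using \<theta>[OF o(2) fy] \<theta>[OF o(1) y] asc[OF Tf' r(1) r'(1) o(2) Jf(1) r'(3) in1[OF o(1) y]] asc[OF Tf' r(1) o r(3) f in1[OF o(1) y]] Jf(3) by simp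
  qed
  have "\<theta> \<in> Hom (tambara_cat K) T T'"
    unfolding K.Hom_tambara_cat[OF Tf Tf']
  proof (intro conjI ballI)
    fix Y :: "('g, 'u) gset" assume Y: "Y \<in> Fin K"
    have "\<theta> Y y \<in> on_obj T' Y" if "y \<in> on_obj T Y" for y
      unfolding \<theta>[OF Y that] by (rule K.apply_in[OF Tf' retract(1)[OF Y] Y retract(3)[OF Y] in1[OF Y that]])
    then show "\<theta> Y \<in> on_obj T Y \<rightarrow>\<^sub>E on_obj T' Y" using Y by (auto simp: \<theta>_def)
  qed (use \<theta>_nat in \<open>auto simp: \<theta>_def\<close>)
  moreover have "Comp (tambara_cat K) k T T' \<theta> \<tau> = \<tau>'"
  proof
    fix Y
    show "Comp (tambara_cat K) k T T' \<theta> \<tau> Y = \<tau>' Y"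
    proof (cases "Y \<in> Fin K")
      case Y: True
      note r = retract[OF Y]
      have "\<theta> Y (\<tau> Y y) = \<tau>' Y y" if y: "y \<in> on_obj k Y" for y
      proof -
        let ?y = "on_hom k Y (res (U Y)) (IN Y) y"
        note ry = retract_apply[OF kf Y y]
        have "\<tau> Y y \<in> on_obj T Y" using \<tau>h Y y by blast
        moreover have "on_hom T Y (res (U Y)) (IN Y) (\<tau> Y y) = \<tau> (res (U Y)) ?y" using \<tau>h Y r(1,2) y by metis
        ultimately have "\<theta> Y (\<tau> Y y) = on_hom T' (res (U Y)) Y (PR Y) (\<tau>' (res (U Y)) ?y)"
          using \<theta>[OF Y] \<psi>\<tau>[OF emb(1)[OF Y] ry(1)] by simp
        also have "\<dots> = \<tau>' Y (on_hom k (res (U Y)) Y (PR Y) ?y)" using \<tau>h' Y r(1,3) ry(1) by metis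
        finally show ?thesis using ry(2) by simp
      qed
      moreover have "\<tau>' Y \<in> extensional (on_obj k Y)" using \<tau>h' Y by (auto simp: PiE_def)
      ultimately show ?thesis using Y by (auto simp: K.Comp_tambara_cat compose_def fun_eq_iff extensional_def)
    next
      case False
      then have "\<tau>' Y = undefined" using \<tau>h' by (metis extensional_arb)
      then show ?thesis using False by (simp add: K.Comp_tambara_cat)
    qed
  qed
  moreover have "coind_trans G H \<theta> = \<psi>"
  proof
    fix X
    show "coind_trans G H \<theta> X = \<psi> X"
    proof (cases "X \<in> Fin G")
      case X: True
      note rX = res_gset_in[OF X]
      note r = retract[OF rX]
      have eq: "\<theta> (res X) x = \<psi> X x" if x: "x \<in> on_obj T (res X)" for x
        using \<theta>[OF rX x] nat[OF X emb(1)[OF rX] r(2) x] retract_apply(2)[OF Tf' rX \<psi>_in[OF X x]] by simp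
      have 1: "\<psi> X \<in> extensional (on_obj T (res X))" using \<psi>h X by (auto simp: PiE_def coind_obj)
      have 2: "\<theta> (res X) \<in> extensional (on_obj T (res X))" using rX by (simp add: \<theta>_def)
      show ?thesis using extensionalityI[OF 2 1 eq] X by (simp add: coind_trans_def)
    next
      case False
      then have "\<psi> X = undefined" using \<psi>h by (metis extensional_arb)
      then show ?thesis using False by (simp add: coind_trans_def)
    qed
  qed
  ultimately show ?thesis by blast
qed

end

section \<open>Essential surjectivity\<close>

context under_coind
begin

text \<open>Apply \<open>under_coind_natural\<close> to \<open>\<phi>\<close> itself, as a transformation from \<open>Coind k\<close> with the identity as structure map; there the
  extension is \<open>k\<close>.\<close>

lemma \<phi>_ext:
  assumes o: "X \<in> Fin G" "X' \<in> Fin G" and w: "w \<in> RHom X X'" and x: "x \<in> on_obj k (res X)"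
  shows "\<phi> X' (on_hom k (res X) (res X') w x) = ext X X' w (\<phi> X x)"
proof -
  have U: "under_coind G H k (coind G H k) (\<lambda>X x. x)"
    by (unfold_locales) (use k prod_functor_coind[OF k] coind_hom[of _ _ _ k] in \<open>simp_all add: coind_obj\<close>)
  have e: "under_coind.ext G H k (coind G H k) (\<lambda>X x. x) X X' w x = on_hom k (res X) (res X') w x"
    by (rule ext_coind[OF U k, of "\<lambda>Y x. x"]) (use o w x in auto)
  have "\<phi> X' (under_coind.ext G H k (coind G H k) (\<lambda>X x. x) X X' w x) = under_coind.ext G H k R \<phi> X X' w (\<phi> X x)"
    by (rule under_coind_natural[OF U under_coind_axioms _ _ _ o w]) (use \<phi>_in \<phi>_nat x o in \<open>simp_all add: coind_obj coind_hom\<close>)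
  then show ?thesis using e by simp
qed

text \<open>The splitting of the idempotent of \<open>Y\<close> on \<open>R (U Y)\<close>, realised as its set of fixed points.\<close>

definition Lset :: "('g, 'u) gset \<Rightarrow> 'v set" where
  "Lset Y = {x \<in> on_obj R (U Y). ext (U Y) (U Y) (BComp K (res (U Y)) Y (res (U Y)) (IN Y) (PR Y)) x = x}"

definition L :: "('g, 'u, 'v) tambara" where
  "L = restrict_functor (bispan_cat K) \<lparr>on_obj = Lset, on_hom = (\<lambda>Y Y' f. \<lambda>x\<in>Lset Y. ext (U Y) (U Y') (J Y Y' f) x)\<rparr>"

lemma L_obj: "Y \<in> Fin K \<Longrightarrow> on_obj L Y = Lset Y"
  by (simp add: L_def restrict_functor_def)

lemma L_hom: "\<lbrakk>Y \<in> Fin K; Y' \<in> Fin K; f \<in> BHom K Y Y'\<rbrakk> \<Longrightarrow>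
    on_hom L Y Y' f = (\<lambda>x\<in>Lset Y. ext (U Y) (U Y') (J Y Y' f) x)"
  by (simp add: L_def restrict_functor_def)

lemmas Kas = category_assoc[OF K.category_bispan_cat, unfolded K.Obj_bispan_cat]
  and Kci = category_comp_in[OF K.category_bispan_cat, unfolded K.Obj_bispan_cat]
  and Kid = category_ident_in[OF K.category_bispan_cat, unfolded K.Obj_bispan_cat]
  and Kidl = category_ident_left[OF K.category_bispan_cat, unfolded K.Obj_bispan_cat]
  and Kidr = category_ident_right[OF K.category_bispan_cat, unfolded K.Obj_bispan_cat]

lemma J_ident:
  fixes Y :: "('g, 'u) gset"
  assumes Y: "Y \<in> Fin K"
  shows "J Y Y (BId K Y) = BComp K (res (U Y)) Y (res (U Y)) (IN Y) (PR Y)"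
  unfolding J_def using Kidr[OF Y retract(1)[OF Y] retract(2)[OF Y]] by simp

lemma J_comp:
  fixes Y Y' Y'' :: "('g, 'u) gset"
  assumes o: "Y \<in> Fin K" "Y' \<in> Fin K" "Y'' \<in> Fin K" and f: "f \<in> BHom K Y Y'" and g: "g \<in> BHom K Y' Y''"
  shows "RComp (U Y) (U Y') (U Y'') (J Y' Y'' g) (J Y Y' f) = J Y Y'' (BComp K Y Y' Y'' g f)"
proof -
  note r = retract[OF o(1)] and r' = retract[OF o(2)] and r'' = retract[OF o(3)]
  have INg: "BComp K Y' Y'' (res (U Y'')) (IN Y'') g \<in> BHom K Y' (res (U Y''))" by (rule Kci[OF o(2,3) r''(1) g r''(2)])
  have "RComp (U Y) (U Y') (U Y'') (J Y' Y'' g) (J Y Y' f) =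
     BComp K (res (U Y)) Y' (res (U Y'')) (BComp K Y' Y'' (res (U Y'')) (IN Y'') g) (BComp K (res (U Y)) Y Y' f (PR Y))"
    unfolding J_def[of Y' Y''] using Kas[OF r(1) r'(1) o(2) r''(1) J_facts(1)[OF o(1,2) f] r'(3) INg] J_facts(3)[OF o(1,2) f] by simp
  also have "\<dots> = J Y Y'' (BComp K Y Y' Y'' g f)"
    unfolding J_def using Kas[OF r(1) o(1,2) r''(1) r(3) f INg] Kas[OF o r''(1) f g r''(2)] by simp
  finally show ?thesis .
qed

lemma Lset_iff:
  fixes Y :: "('g, 'u) gset"
  assumes "Y \<in> Fin K"
  shows "x \<in> Lset Y \<longleftrightarrow> x \<in> on_obj R (U Y) \<and> ext (U Y) (U Y) (J Y Y (BId K Y)) x = x"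
  by (simp add: Lset_def J_ident[OF assms])

lemma ext_J_in:
  fixes Y Y' :: "('g, 'u) gset"
  assumes o: "Y \<in> Fin K" "Y' \<in> Fin K" and f: "f \<in> BHom K Y Y'" and x: "x \<in> on_obj R (U Y)"
  shows "ext (U Y) (U Y') (J Y Y' f) x \<in> Lset Y'"
  unfolding Lset_iff[OF o(2)]
  using ext_in[OF emb(1)[OF o(1)] emb(1)[OF o(2)] J_facts(1)[OF o f] x]
    ext_comp[OF emb(1)[OF o(1)] emb(1)[OF o(2)] emb(1)[OF o(2)] J_facts(1)[OF o f] J_facts(1)[OF o(2,2) Kid[OF o(2)]] x]
    J_comp[OF o(1,2,2) f Kid[OF o(2)]] Kidl[OF o f] by simp

lemma L_functor: "BFun K L"
  unfolding is_functor_def K.Obj_bispan_cat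
proof (intro conjI ballI)
  fix Y :: "('g, 'u) gset" assume Y: "Y \<in> Fin K"
  show "on_obj L Y \<in> Obj set_cat" by (simp add: set_cat_def)
  show "on_hom L Y Y (BId K Y) = Ident set_cat (on_obj L Y)"
    using Lset_iff[OF Y] by (auto simp: L_obj[OF Y] L_hom[OF Y Y Kid[OF Y]] set_cat_def fun_eq_iff)
next
  fix Y Y' :: "('g, 'u) gset" and f assume o: "Y \<in> Fin K" "Y' \<in> Fin K" and f: "f \<in> BHom K Y Y'"
  have "ext (U Y) (U Y') (J Y Y' f) x \<in> Lset Y'" if "x \<in> Lset Y" for x
    using ext_J_in[OF o f] that Lset_iff[OF o(1)] by blast
  then show "on_hom L Y Y' f \<in> Hom set_cat (on_obj L Y) (on_obj L Y')" by (auto simp: L_obj o L_hom[OF o f] set_cat_def)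
next
  fix Y Y' Y'' :: "('g, 'u) gset" and f g assume o: "Y \<in> Fin K" "Y' \<in> Fin K" "Y'' \<in> Fin K"
    and f: "f \<in> BHom K Y Y'" and g: "g \<in> BHom K Y' Y''"
  have gf: "BComp K Y Y' Y'' g f \<in> BHom K Y Y''" by (rule Kci[OF o f g])
  have "ext (U Y) (U Y'') (J Y Y'' (BComp K Y Y' Y'' g f)) x = ext (U Y') (U Y'') (J Y' Y'' g) (ext (U Y) (U Y') (J Y Y' f) x) \<and>
     ext (U Y) (U Y') (J Y Y' f) x \<in> Lset Y'" if "x \<in> Lset Y" for x
    using ext_comp[OF emb(1)[OF o(1)] emb(1)[OF o(2)] emb(1)[OF o(3)] J_facts(1)[OF o(1,2) f] J_facts(1)[OF o(2,3) g]] J_comp[OF o f g] that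
      Lset_iff[OF o(1)] ext_J_in[OF o(1,2) f] by simp
  then show "on_hom L Y Y'' (BComp K Y Y' Y'' g f) = Comp set_cat (on_obj L Y) (on_obj L Y') (on_obj L Y'') (on_hom L Y' Y'' g) (on_hom L Y Y' f)"
    by (auto simp: L_obj o L_hom[OF o(1,2) f] L_hom[OF o(2,3) g] L_hom[OF o(1,3) gf] set_cat_def compose_def fun_eq_iff)
qed

text \<open>The comparison between \<open>R X\<close> and \<open>L (res X)\<close>: \<open>res X\<close> has been embedded in a second \<open>G\<close>-set \<open>U (res X)\<close>, and \<open>ext\<close> supplies the passage
  between the two, which is not a bispan of \<open>G\<close>-sets.\<close>

definition aL :: "('g, 'u) gset \<Rightarrow> 'v \<Rightarrow> 'v" where "aL X x = ext X (U (res X)) (IN (res X)) x"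
definition bL :: "('g, 'u) gset \<Rightarrow> 'v \<Rightarrow> 'v" where "bL X z = ext (U (res X)) X (PR (res X)) z"

lemma ext_ident: "\<lbrakk>X \<in> Fin G; x \<in> on_obj R X\<rbrakk> \<Longrightarrow> ext X X (BId K (res X)) x = x"
  using ext_res[of X X "BId G X" x] functor_ident[OF is_functor_res, of X] category_ident_in[OF category_bispan_cat, of X]
    apply_id[OF Rf] by simp

lemma ab_facts:
  assumes X: "X \<in> Fin G"
  shows "x \<in> on_obj R X \<Longrightarrow> aL X x \<in> on_obj L (res X)" "z \<in> on_obj L (res X) \<Longrightarrow> bL X z \<in> on_obj R X"
    "x \<in> on_obj R X \<Longrightarrow> bL X (aL X x) = x" "z \<in> on_obj L (res X) \<Longrightarrow> aL X (bL X z) = z"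
proof -
  note rX = res_gset_in[OF X]
  note r = retract[OF rX] and UX = emb(1)[OF rX]
  have IP: "BComp K (res (U (res X))) (res X) (res (U (res X))) (IN (res X)) (PR (res X)) = J (res X) (res X) (BId K (res X))"
    using J_ident[OF rX] by simp
  show "aL X x \<in> on_obj L (res X)" if x: "x \<in> on_obj R X"
    unfolding L_obj[OF rX] Lset_iff[OF rX] aL_def
    using ext_in[OF X UX r(2) x] ext_comp[OF X UX UX r(2) J_facts(1)[OF rX rX Kid[OF rX]] x] J_facts(2)[OF rX rX Kid[OF rX]] Kidr[OF rX r(1,2)] by simp
  show "bL X z \<in> on_obj R X" if "z \<in> on_obj L (res X)"
    using that ext_in[OF UX X r(3)] by (simp add: L_obj[OF rX] Lset_iff[OF rX] bL_def)
  show "bL X (aL X x) = x" if x: "x \<in> on_obj R X"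
    unfolding aL_def bL_def using ext_comp[OF X UX X r(2,3) x] r(4) ext_ident[OF X x] by simp
  show "aL X (bL X z) = z" if "z \<in> on_obj L (res X)"
  proof -
    have z: "z \<in> on_obj R (U (res X))" and fixed: "ext (U (res X)) (U (res X)) (J (res X) (res X) (BId K (res X))) z = z"
      using that by (simp_all add: L_obj[OF rX] Lset_iff[OF rX])
    show ?thesis unfolding aL_def bL_def using ext_comp[OF UX X UX r(3,2) z] fixed unfolding IP by simp
  qed
qed

text \<open>More than naturality for \<open>Coind L\<close>: it shows that \<open>L\<close> acts on bispans of \<open>H\<close>-sets by the extension.\<close>

lemma aL_nat:
  assumes o: "X \<in> Fin G" "X' \<in> Fin G" and w: "w \<in> RHom X X'" and x: "x \<in> on_obj R X"
  shows "on_hom L (res X) (res X') w (aL X x) = aL X' (ext X X' w x)"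
proof -
  note ro = o[THEN res_gset_in]
  note r = retract[OF ro(1)] and r' = retract[OF ro(2)]
  have "aL X x \<in> Lset (res X)" using ab_facts(1)[OF o(1) x] by (simp add: L_obj[OF ro(1)])
  then show ?thesis
    using ext_comp[OF o(1) emb(1)[OF ro(1)] emb(1)[OF ro(2)] r(2) J_facts(1)[OF ro w] x] J_facts(2)[OF ro w] ext_comp[OF o emb(1)[OF ro(2)] w r'(2) x]
    by (simp add: L_hom[OF ro w] aL_def)
qed

lemma aL_nat_res:
  assumes o: "X \<in> Fin G" "X' \<in> Fin G" and \<gamma>: "\<gamma> \<in> BHom G X X'" and x: "x \<in> on_obj R X"
  shows "on_hom L (res X) (res X') (res_hom X X' \<gamma>) (aL X x) = aL X' (on_hom R X X' \<gamma> x)"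
  using aL_nat[OF o res_hom_in[OF o \<gamma>] x] ext_res[OF o \<gamma> x] by simp

lemma bL_nat_res:
  assumes o: "X \<in> Fin G" "X' \<in> Fin G" and \<gamma>: "\<gamma> \<in> BHom G X X'" and z: "z \<in> on_obj L (res X)"
  shows "bL X' (on_hom L (res X) (res X') (res_hom X X' \<gamma>) z) = on_hom R X X' \<gamma> (bL X z)"
proof -
  note b = ab_facts(2)[OF o(1) z]
  have "on_hom L (res X) (res X') (res_hom X X' \<gamma>) z = aL X' (on_hom R X X' \<gamma> (bL X z))"
    using aL_nat_res[OF o \<gamma> b] ab_facts(4)[OF o(1) z] by simp
  then show ?thesis using ab_facts(3)[OF o(2) apply_in[OF Rf o \<gamma> b]] by simp
qed

text \<open>All elements of \<open>R (U Y)\<close> have the same image under the idempotent, as it factors through the empty set.\<close>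

lemma L_empty:
  fixes Y :: "('g, 'u) gset"
  assumes Y: "Y \<in> Fin K" "elts Y = {}"
  shows "\<exists>z. on_obj L Y = {z}"
proof -
  let ?E = "res emptyG :: ('g, 'u) gset"
  have E: "?E \<in> Fin K" "elts ?E = {}" by (simp_all add: res_gset_in emptyG)
  obtain e where e: "on_obj R emptyG = {e}" using prod_functor_empty[OF R emptyG] by blast
  have LE: "on_obj L ?E = {aL emptyG e}"
  proof
    show "on_obj L ?E \<subseteq> {aL emptyG e}"
    proof
      fix z assume z: "z \<in> on_obj L ?E"
      then have "bL emptyG z = e" using ab_facts(2)[OF emptyG(1) z] e by simp
      then show "z \<in> {aL emptyG e}" using ab_facts(4)[OF emptyG(1) z] by simp
    qed
  qed (use ab_facts(1)[OF emptyG(1), of e] e in simp)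
  have f: "rst K ?E Y (\<lambda>x. x) \<in> BHom K Y ?E" "rst K Y ?E (\<lambda>x. x) \<in> BHom K ?E Y"
    using E Y by (auto intro!: K.rst_in_Hom simp: eqv_def)
  have "is_terminal (bispan_cat K) Y" using Y by (simp add: K.is_terminal_bispan_cat)
  then have "\<exists>!f. f \<in> BHom K Y Y" using Y by (simp add: is_terminal_def)
  then have id: "BComp K Y ?E Y (rst K Y ?E (\<lambda>x. x)) (rst K ?E Y (\<lambda>x. x)) = BId K Y"
    using Kci[OF Y(1) E(1) Y(1) f] Kid[OF Y(1)] by blast
  let ?z = "on_hom L ?E Y (rst K Y ?E (\<lambda>x. x)) (aL emptyG e)"
  have "z = ?z" if z: "z \<in> on_obj L Y" for z
  proof -
    have "on_hom L Y ?E (rst K ?E Y (\<lambda>x. x)) z = aL emptyG e" using K.apply_in[OF L_functor Y(1) E(1) f(1) z] LE by simp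
    then show ?thesis using K.apply_comp[OF L_functor Y(1) E(1) Y(1) f z] id K.apply_id[OF L_functor Y(1) z] by simp
  qed
  moreover have "?z \<in> on_obj L Y" using K.apply_in[OF L_functor E(1) Y(1) f(2)] LE by simp
  ultimately show ?thesis by blast
qed

text \<open>Embed the disjoint union of \<open>Y\<close> and \<open>Y'\<close> summand by summand into that of \<open>U Y\<close> and \<open>U Y'\<close>.\<close>

lemma sum_embedding:
  fixes Y Y' S V :: "('g, 'u) gset"
  assumes o: "Y \<in> Fin K" "Y' \<in> Fin K" "S \<in> Fin K" "V \<in> Fin G"
    and S: "is_coproduct (gset_cat K) Y Y' S i j" and V: "is_coproduct (gset_cat G) (U Y) (U Y') V iV jV"
  shows "\<exists>\<kappa>. eqv K S V \<kappa> \<and> inj_on \<kappa> (elts S) \<and> (\<forall>y\<in>elts Y. \<kappa> (i y) = iV (incl Y y)) \<and> (\<forall>y\<in>elts Y'. \<kappa> (j y) = jV (incl Y' y))"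
proof -
  note e = emb[OF o(1)] and e' = emb[OF o(2)] and ro = res_gset_in[OF o(4)]
  have ijV: "eqv G (U Y) V iV" "eqv G (U Y') V jV" and jbV: "is_sum (U Y) (U Y') V iV jV"
    using V by (auto simp: is_coproduct_gset_cat intro: EMap_eqv)
  have jb: "is_sum Y Y' S i j" using S by (simp add: K.is_coproduct_gset_cat)
  have a: "restrict (\<lambda>y. iV (incl Y y)) (elts Y) \<in> EMap K Y (res V)" "restrict (\<lambda>y. jV (incl Y' y)) (elts Y') \<in> EMap K Y' (res V)"
    using eqv_comp'[OF e(2) eqv_sub[OF ijV(1)]] eqv_comp'[OF e'(2) eqv_sub[OF ijV(2)]] o
    by (auto intro!: restrict_equivariant_maps Fin_gset)
  then obtain \<kappa> where \<kappa>: "\<kappa> \<in> EMap K S (res V)" "compose (elts Y) \<kappa> i = restrict (\<lambda>y. iV (incl Y y)) (elts Y)"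
    "compose (elts Y') \<kappa> j = restrict (\<lambda>y. jV (incl Y' y)) (elts Y')"
    using S ro unfolding is_coproduct_def gset_cat_def cat.simps by blast
  have ki: "\<kappa> (i y) = iV (incl Y y)" if "y \<in> elts Y" for y using fun_cong[OF \<kappa>(2), of y] that by (simp add: compose_def)
  have kj: "\<kappa> (j y) = jV (incl Y' y)" if "y \<in> elts Y'" for y using fun_cong[OF \<kappa>(3), of y] that by (simp add: compose_def)
  have in1: "incl Y y \<in> elts (U Y)" if "y \<in> elts Y" for y using eqv_in[OF e(2) that] .
  have in2: "incl Y' y \<in> elts (U Y')" if "y \<in> elts Y'" for y using eqv_in[OF e'(2) that] .
  have iV: "\<And>x x'. \<lbrakk>x \<in> elts (U Y); x' \<in> elts (U Y)\<rbrakk> \<Longrightarrow> iV x = iV x' \<longleftrightarrow> x = x'" "\<And>x x'. \<lbrakk>x \<in> elts (U Y'); x' \<in> elts (U Y')\<rbrakk> \<Longrightarrow> jV x = jV x' \<longleftrightarrow> x = x'"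
    "\<And>x x'. \<lbrakk>x \<in> elts (U Y); x' \<in> elts (U Y')\<rbrakk> \<Longrightarrow> iV x \<noteq> jV x'" "\<And>x x'. \<lbrakk>x \<in> elts (U Y); x' \<in> elts (U Y')\<rbrakk> \<Longrightarrow> jV x' \<noteq> iV x"
    using jbV by (auto simp: joint_bij_def inj_on_def)
  have ei: "\<And>y y'. \<lbrakk>y \<in> elts Y; y' \<in> elts Y\<rbrakk> \<Longrightarrow> incl Y y = incl Y y' \<longleftrightarrow> y = y'" "\<And>y y'. \<lbrakk>y \<in> elts Y'; y' \<in> elts Y'\<rbrakk> \<Longrightarrow> incl Y' y = incl Y' y' \<longleftrightarrow> y = y'"
    using e(3) e'(3) by (auto simp: inj_on_def)
  have "inj_on \<kappa> (elts S)"
  proof (rule inj_onI)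
    fix s t assume s: "s \<in> elts S" and t: "t \<in> elts S" and eq: "\<kappa> s = \<kappa> t"
    show "s = t"
      by (rule joint_bijE[OF jb s]; rule joint_bijE[OF jb t]) (use eq in \<open>simp_all add: ki kj iV in1 in2 ei\<close>)
  qed
  then show ?thesis using EMap_eqv[OF \<kappa>(1)] ki kj by auto
qed

lemma L_proj:
  fixes Y S V :: "('g, 'u) gset"
  assumes o: "Y \<in> Fin K" "S \<in> Fin K" "V \<in> Fin G" and i: "eqv K Y S i" and iV: "eqv G (U Y) V iV"
    and \<kappa>: "eqv K S V \<kappa>" "\<And>y. y \<in> elts Y \<Longrightarrow> \<kappa> (i y) = iV (incl Y y)" and v: "v \<in> on_obj R V"
  shows "on_hom L S Y (rst K Y S i) (on_hom L (res V) S (rst K S (res V) \<kappa>) (aL V v)) =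
    on_hom L (res (U Y)) Y (PR Y) (aL (U Y) (on_hom R V (U Y) (rst G (U Y) V iV) v))"
proof -
  note e = emb[OF o(1)] and r = retract[OF o(1)] and rV = res_gset_in[OF o(3)]
  have a: "aL V v \<in> on_obj L (res V)" by (rule ab_facts(1)[OF o(3) v])
  have \<kappa>': "eqv K S (res V) \<kappa>" and iV': "eqv K (res (U Y)) (res V) iV" and e2: "eqv K Y (res (U Y)) (incl Y)" using \<kappa>(1) eqv_sub[OF iV] e(2) by simp_all
  have "BComp K (res V) S Y (rst K Y S i) (rst K S (res V) \<kappa>) = rst K Y (res V) (\<lambda>y. \<kappa> (i y))"
    by (rule K.rst_comp[OF o(1,2) rV i \<kappa>'])
  also have "\<dots> = rst K Y (res V) (\<lambda>y. iV (incl Y y))"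
    by (rule K.rst_cong[OF o(1) eqv_comp'[OF i \<kappa>'] eqv_comp'[OF e2 iV']]) (rule \<kappa>(2))
  also have "\<dots> = BComp K (res V) (res (U Y)) Y (PR Y) (rrst (U Y) V iV)"
    unfolding PR_def by (rule K.rst_comp[OF o(1) r(1) rV e2 iV', symmetric])
  finally show ?thesis
    using K.apply_comp[OF L_functor rV o(2,1) K.rst_in_Hom[OF o(2) \<kappa>'] K.rst_in_Hom[OF o(1) i] a]
      K.apply_comp[OF L_functor rV r(1) o(1) K.rst_in_Hom[OF r(1) iV'] r(3) a]
      aL_nat_res[OF o(3) e(1) rst_in_Hom[OF e(1) iV] v] res_hom_rst[OF e(1) o(3) iV] by simp
qed

lemma L_PR_surj:
  fixes Y :: "('g, 'u) gset"
  assumes Y: "Y \<in> Fin K" and y: "y \<in> on_obj L Y"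
  shows "\<exists>x\<in>on_obj R (U Y). on_hom L (res (U Y)) Y (PR Y) (aL (U Y) x) = y"
  using retract_apply[OF L_functor Y y] ab_facts(2,4)[OF emb(1)[OF Y]] by metis

text \<open>A disjoint union \<open>S\<close> of \<open>Y\<close> and \<open>Y'\<close> is a retract of the disjoint union \<open>V\<close> of \<open>U Y\<close> and \<open>U Y'\<close>, compatibly with the summands.
  So elements can be joined in \<open>R V\<close> and projected to \<open>S\<close>; and an element over \<open>S\<close> is determined by its transfer to \<open>V\<close>, which
  is determined by its restrictions to \<open>U Y\<close> and \<open>U Y'\<close>, and these are transfers of its two components.\<close>

lemma L_prod: "prod_functor K L"
proof (rule K.prod_functorI[OF L_functor])
  show "\<exists>x. on_obj L E = {x}" if "E \<in> Fin K" "elts E = {}" for E using L_empty[OF that] .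
  fix Y Y' :: "('g, 'u) gset" assume o: "Y \<in> Fin K" "Y' \<in> Fin K"
  obtain S i j where cp: "is_coproduct (gset_cat K) Y Y' S i j" using K.ex_coproduct_gset_cat[OF o] by blast
  then have S: "S \<in> Fin K" and ij: "eqv K Y S i" "eqv K Y' S j" and jb: "is_sum Y Y' S i j"
    by (auto simp: K.is_coproduct_gset_cat intro: EMap_eqv)
  note e = emb[OF o(1)] and e' = emb[OF o(2)] and r = retract[OF o(1)] and r' = retract[OF o(2)]
  obtain V iV jV where cpV: "is_coproduct (gset_cat G) (U Y) (U Y') V iV jV" using ex_coproduct_gset_cat[OF e(1) e'(1)] by blast
  then have V: "V \<in> Fin G" and ijV: "eqv G (U Y) V iV" "eqv G (U Y') V jV" and jbV: "is_sum (U Y) (U Y') V iV jV"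
    by (auto simp: is_coproduct_gset_cat intro: EMap_eqv)
  obtain \<kappa> where \<kappa>: "eqv K S V \<kappa>" "inj_on \<kappa> (elts S)" "\<And>y. y \<in> elts Y \<Longrightarrow> \<kappa> (i y) = iV (incl Y y)" "\<And>y. y \<in> elts Y' \<Longrightarrow> \<kappa> (j y) = jV (incl Y' y)"
    using sum_embedding[OF o S V cp cpV] by blast
  note rV = res_gset_in[OF V]
  have \<kappa>': "eqv K S (res V) \<kappa>" using \<kappa>(1) by simp
  have RK: "rst K S (res V) \<kappa> \<in> BHom K (res V) S" and TK: "trn K S (res V) \<kappa> \<in> BHom K S (res V)"
    by (rule K.rst_in_Hom[OF S \<kappa>'] K.trn_in_Hom[OF S \<kappa>'])+
  have RT: "on_hom L (res V) S (rst K S (res V) \<kappa>) (on_hom L S (res V) (trn K S (res V) \<kappa>) s) = s" if s: "s \<in> on_obj L S" for s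
    using K.apply_comp[OF L_functor S rV S TK RK s] K.rst_trn_inj[OF S rV \<kappa>' \<kappa>(2)] K.apply_id[OF L_functor S s] by simp
  \<comment> \<open>Base change: restricting the transfer to one summand of \<open>V\<close> is transferring the restriction to that summand.\<close>
  have comp: "on_hom R V (U A) (rst G (U A) V kV) (bL V (on_hom L S (res V) (trn K S (res V) \<kappa>) s)) = bL (U A) (on_hom L A (res (U A)) (IN A) (on_hom L S A (rst K A S k) s))"
    if s: "s \<in> on_obj L S" and A: "A \<in> Fin K" and k: "eqv K A S k" and kV: "eqv G (U A) V kV"
      and pb: "\<And>y. y \<in> elts A \<Longrightarrow> \<kappa> (k y) = kV (incl A y)"
      and ex: "\<And>t u. \<lbrakk>t \<in> elts S; u \<in> elts (U A); \<kappa> t = kV u\<rbrakk> \<Longrightarrow> \<exists>!y. y \<in> elts A \<and> k y = t \<and> incl A y = u"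
    for s and A :: "('g, 'u) gset" and k kV
  proof -
    note eA = emb[OF A] and rA = retract[OF A]
    have kV': "eqv K (res (U A)) (res V) kV" and eA2: "eqv K A (res (U A)) (incl A)" using eqv_sub[OF kV] eA(2) by simp_all
    have t: "on_hom L S (res V) (trn K S (res V) \<kappa>) s \<in> on_obj L (res V)" by (rule K.apply_in[OF L_functor S rV TK s])
    have "BComp K S (res V) (res (U A)) (rrst (U A) V kV) (trn K S (res V) \<kappa>) = BComp K S A (res (U A)) (IN A) (rst K A S k)"
      unfolding IN_def by (rule K.base_change[OF S rA(1) rV A \<kappa>' kV' k eA2]) (use pb ex in auto)
    then have "on_hom L (res V) (res (U A)) (rrst (U A) V kV) (on_hom L S (res V) (trn K S (res V) \<kappa>) s) = on_hom L A (res (U A)) (IN A) (on_hom L S A (rst K A S k) s)"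
      using K.apply_comp[OF L_functor S rV rA(1) TK K.rst_in_Hom[OF rA(1) kV'] s] K.apply_comp[OF L_functor S A rA(1) K.rst_in_Hom[OF A k] rA(2) s] by simp
    then show ?thesis using bL_nat_res[OF V eA(1) rst_in_Hom[OF eA(1) kV] t] res_hom_rst[OF eA(1) V kV] by simp
  qed
  have ivi: "\<And>x x'. \<lbrakk>x \<in> elts (U Y); x' \<in> elts (U Y)\<rbrakk> \<Longrightarrow> iV x = iV x' \<longleftrightarrow> x = x'" "\<And>x x'. \<lbrakk>x \<in> elts (U Y'); x' \<in> elts (U Y')\<rbrakk> \<Longrightarrow> jV x = jV x' \<longleftrightarrow> x = x'"
    "\<And>x x'. \<lbrakk>x \<in> elts (U Y); x' \<in> elts (U Y')\<rbrakk> \<Longrightarrow> iV x \<noteq> jV x'" "\<And>x x'. \<lbrakk>x \<in> elts (U Y); x' \<in> elts (U Y')\<rbrakk> \<Longrightarrow> jV x' \<noteq> iV x"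
    using jbV by (auto simp: joint_bij_def inj_on_def)
  have ii: "\<And>x x'. \<lbrakk>x \<in> elts Y; x' \<in> elts Y\<rbrakk> \<Longrightarrow> i x = i x' \<longleftrightarrow> x = x'" "\<And>x x'. \<lbrakk>x \<in> elts Y'; x' \<in> elts Y'\<rbrakk> \<Longrightarrow> j x = j x' \<longleftrightarrow> x = x'"
    using jb by (auto simp: joint_bij_def inj_on_def)
  have in1: "incl Y y \<in> elts (U Y)" if "y \<in> elts Y" for y using eqv_in[OF e(2) that] .
  have in2: "incl Y' y \<in> elts (U Y')" if "y \<in> elts Y'" for y using eqv_in[OF e'(2) that] .
  have exi: "\<exists>!y. y \<in> elts Y \<and> i y = t \<and> incl Y y = u" if "t \<in> elts S" "u \<in> elts (U Y)" "\<kappa> t = iV u" for t u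
    using jb that(1)
  proof (cases rule: joint_bijE)
    case (1 y)
    then have "incl Y y = u" using that \<kappa>(3) ivi(1) in1 by simp
    then show ?thesis using 1 ii(1) by (intro ex1I[of _ y]) auto
  next
    case (2 y)
    then show ?thesis using that \<kappa>(4) ivi(4) in2 by simp
  qed
  have exj: "\<exists>!y. y \<in> elts Y' \<and> j y = t \<and> incl Y' y = u" if "t \<in> elts S" "u \<in> elts (U Y')" "\<kappa> t = jV u" for t u
    using jb that(1)
  proof (cases rule: joint_bijE)
    case (1 y)
    then show ?thesis using that \<kappa>(3) ivi(3) in1 by simp
  next
    case (2 y)
    then have "incl Y' y = u" using that \<kappa>(4) ivi(2) in2 by simp
    then show ?thesis using 2 ii(2) by (intro ex1I[of _ y]) auto
  qed
  have "\<exists>!s. s \<in> on_obj L S \<and> on_hom L S Y (rst K Y S i) s = y \<and> on_hom L S Y' (rst K Y' S j) s = y'"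
    if y: "y \<in> on_obj L Y" and y': "y' \<in> on_obj L Y'" for y y'
  proof -
    obtain x where x: "x \<in> on_obj R (U Y)" "on_hom L (res (U Y)) Y (PR Y) (aL (U Y) x) = y" using L_PR_surj[OF o(1) y] by blast
    obtain x' where x': "x' \<in> on_obj R (U Y')" "on_hom L (res (U Y')) Y' (PR Y') (aL (U Y') x') = y'" using L_PR_surj[OF o(2) y'] by blast
    obtain v where v: "v \<in> on_obj R V" "on_hom R V (U Y) (rst G (U Y) V iV) v = x" "on_hom R V (U Y') (rst G (U Y') V jV) v = x'"
      using prod_functor_join[OF R e(1) e'(1) V ijV jbV x(1) x'(1)] by blast
    let ?s = "on_hom L (res V) S (rst K S (res V) \<kappa>) (aL V v)"
    show ?thesis
    proof (rule ex1I[of _ ?s])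
      show "?s \<in> on_obj L S \<and> on_hom L S Y (rst K Y S i) ?s = y \<and> on_hom L S Y' (rst K Y' S j) ?s = y'"
        using K.apply_in[OF L_functor rV S RK ab_facts(1)[OF V v(1)]] L_proj[OF o(1) S V ij(1) ijV(1) \<kappa>(1,3) v(1)]
          L_proj[OF o(2) S V ij(2) ijV(2) \<kappa>(1,4) v(1)] v x x' by simp
      fix t assume t: "t \<in> on_obj L S \<and> on_hom L S Y (rst K Y S i) t = y \<and> on_hom L S Y' (rst K Y' S j) t = y'"
      let ?T = "\<lambda>s. bL V (on_hom L S (res V) (trn K S (res V) \<kappa>) s)"
      have s: "?s \<in> on_obj L S" "on_hom L S Y (rst K Y S i) ?s = y" "on_hom L S Y' (rst K Y' S j) ?s = y'"
        using \<open>?s \<in> on_obj L S \<and> on_hom L S Y (rst K Y S i) ?s = y \<and> on_hom L S Y' (rst K Y' S j) ?s = y'\<close> by auto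
      have Tin: "on_hom L S (res V) (trn K S (res V) \<kappa>) s \<in> on_obj L (res V)" "?T s \<in> on_obj R V" if "s \<in> on_obj L S" for s
        using K.apply_in[OF L_functor S rV TK that] ab_facts(2)[OF V] by auto
      have c1: "on_hom R V (U Y) (rst G (U Y) V iV) (?T t) = on_hom R V (U Y) (rst G (U Y) V iV) (?T ?s)"
        using comp[OF conjunct1[OF t] o(1) ij(1) ijV(1) \<kappa>(3) exi] comp[OF s(1) o(1) ij(1) ijV(1) \<kappa>(3) exi]
        by (simp only: conjunct1[OF conjunct2[OF t]] s(2))
      have c2: "on_hom R V (U Y') (rst G (U Y') V jV) (?T t) = on_hom R V (U Y') (rst G (U Y') V jV) (?T ?s)"
        using comp[OF conjunct1[OF t] o(2) ij(2) ijV(2) \<kappa>(4) exj] comp[OF s(1) o(2) ij(2) ijV(2) \<kappa>(4) exj]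
        by (simp only: conjunct2[OF conjunct2[OF t]] s(3))
      have "\<exists>!u. u \<in> on_obj R V \<and> on_hom R V (U Y) (rst G (U Y) V iV) u = on_hom R V (U Y) (rst G (U Y) V iV) (?T ?s) \<and>
          on_hom R V (U Y') (rst G (U Y') V jV) u = on_hom R V (U Y') (rst G (U Y') V jV) (?T ?s)"
        by (rule prod_functor_join[OF R e(1) e'(1) V ijV jbV]) (rule apply_in[OF Rf V e(1) rst_in_Hom[OF e(1) ijV(1)] Tin(2)[OF s(1)]] apply_in[OF Rf V e'(1) rst_in_Hom[OF e'(1) ijV(2)] Tin(2)[OF s(1)]])+
      then have "?T t = ?T ?s" using c1 c2 Tin(2)[of t] Tin(2)[OF s(1)] t by blast
      from arg_cong[OF this, of "aL V"] have "on_hom L S (res V) (trn K S (res V) \<kappa>) t = on_hom L S (res V) (trn K S (res V) \<kappa>) ?s"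
        by (simp only: ab_facts(4)[OF V Tin(1)[OF conjunct1[OF t]]] ab_facts(4)[OF V Tin(1)[OF s(1)]])
      from arg_cong[OF this, of "on_hom L (res V) S (rst K S (res V) \<kappa>)"] show "t = ?s" by (simp only: RT[OF conjunct1[OF t]] RT[OF s(1)])
    qed
  qed
  then show "\<exists>S i j. S \<in> Fin K \<and> eqv K Y S i \<and> eqv K Y' S j \<and> is_sum Y Y' S i j \<and>
        (\<forall>x\<in>on_obj L Y. \<forall>y\<in>on_obj L Y'. \<exists>!s. s \<in> on_obj L S \<and> on_hom L S Y (rst K Y S i) s = x \<and> on_hom L S Y' (rst K Y' S j) s = y)"
    using S ij jb by blast
qed

text \<open>The retraction makes the value at \<open>Y\<close> an additive quotient of the group \<open>R (U Y)\<close>: restriction along the embedding commutes with the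
  fold transfers by base change, as a disjoint union of two copies of \<open>Y\<close> is the preimage of \<open>Y\<close> under the fold map of \<open>U Y\<close>.\<close>

lemma L_additive_group:
  fixes Y :: "('g, 'u) gset"
  assumes Y: "Y \<in> Fin K" and grp: "group (additive_monoid G R (U Y))"
  shows "group (additive_monoid K L Y)"
proof -
  note e = emb[OF Y] and r = retract[OF Y]
  obtain V iV jV where cpV: "is_coproduct (gset_cat G) (U Y) (U Y) V iV jV" using ex_coproduct_gset_cat[OF e(1) e(1)] by blast
  then have V: "V \<in> Fin G" and ijV: "eqv G (U Y) V iV" "eqv G (U Y) V jV" and jbV: "is_sum (U Y) (U Y) V iV jV"
    by (auto simp: is_coproduct_gset_cat intro: EMap_eqv)
  obtain S i j where cp: "is_coproduct (gset_cat K) Y Y S i j" using K.ex_coproduct_gset_cat[OF Y Y] by blast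
  then have S: "S \<in> Fin K" and ij: "eqv K Y S i" "eqv K Y S j" and jb: "is_sum Y Y S i j"
    by (auto simp: K.is_coproduct_gset_cat intro: EMap_eqv)
  obtain h where h: "h \<in> EMap G V (U Y)" "\<And>x. x \<in> elts (U Y) \<Longrightarrow> h (iV x) = x \<and> h (jV x) = x" using ex_fold[OF cpV] by blast
  obtain h' where h': "h' \<in> EMap K S Y" "\<And>x. x \<in> elts Y \<Longrightarrow> h' (i x) = x \<and> h' (j x) = x" using K.ex_fold[OF cp] by blast
  note he = EMap_eqv[OF h(1)] and he' = EMap_eqv[OF h'(1)]
  obtain \<kappa> where \<kappa>: "eqv K S V \<kappa>" "inj_on \<kappa> (elts S)" "\<And>y. y \<in> elts Y \<Longrightarrow> \<kappa> (i y) = iV (incl Y y)" "\<And>y. y \<in> elts Y \<Longrightarrow> \<kappa> (j y) = jV (incl Y y)"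
    using sum_embedding[OF Y Y S V cp cpV] by blast
  note rV = res_gset_in[OF V]
  have \<kappa>': "eqv K S (res V) \<kappa>" and hK: "eqv K (res V) (res (U Y)) h" and eK: "eqv K Y (res (U Y)) (incl Y)" using \<kappa>(1) eqv_sub[OF he] e(2) by simp_all
  have in1: "incl Y y \<in> elts (U Y)" if "y \<in> elts Y" for y using eqv_in[OF e(2) that] .
  have hk: "h (\<kappa> s) = incl Y (h' s)" if s: "s \<in> elts S" for s
    by (rule joint_bijE[OF jb s]) (simp_all add: \<kappa>(3,4) h(2) h'(2) in1)
  have ex: "\<exists>!t. t \<in> elts S \<and> \<kappa> t = v \<and> h' t = y" if v: "v \<in> elts V" and y: "y \<in> elts Y" and eq: "h v = incl Y y" for v y
  proof -
    have "\<exists>t\<in>elts S. \<kappa> t = v \<and> h' t = y"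
      using jbV v
    proof (cases rule: joint_bijE)
      case (1 x)
      then show ?thesis using eq h(2) h'(2) \<kappa>(3) y eqv_in[OF ij(1) y] by (intro bexI[of _ "i y"]) auto
    next
      case (2 x)
      then show ?thesis using eq h(2) h'(2) \<kappa>(4) y eqv_in[OF ij(2) y] by (intro bexI[of _ "j y"]) auto
    qed
    then show ?thesis using \<kappa>(2) by (auto dest: inj_onD)
  qed
  obtain z where z: "z \<in> on_obj R emptyG" using prod_functor_empty[OF R emptyG] by blast
  note az = ab_facts(1)[OF emptyG(1) z] and rE = res_gset_in[OF emptyG(1)]
  have eE: "eqv G emptyG (U Y) id" "eqv K (res emptyG) (res (U Y)) id" "eqv K (res emptyG) Y id" "eqv K (res emptyG) (res emptyG) (\<lambda>x. x)" by (simp_all add: eqv_def emptyG)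
  show ?thesis
  proof (rule additive_group_transfer[OF plain_group_axioms K.plain_group_axioms R L_prod cpV cp h(1) _ h'(1) _ emptyG z rE _ az, where
        f = "\<lambda>x. on_hom L (res (U Y)) Y (PR Y) (aL (U Y) x)" and fS = "\<lambda>s. on_hom L (res V) S (rst K S (res V) \<kappa>) (aL V s)"])
    show "(\<lambda>x. on_hom L (res (U Y)) Y (PR Y) (aL (U Y) x)) ` on_obj R (U Y) = on_obj L Y"
    proof
      show "(\<lambda>x. on_hom L (res (U Y)) Y (PR Y) (aL (U Y) x)) ` on_obj R (U Y) \<subseteq> on_obj L Y"
        using K.apply_in[OF L_functor r(1) Y r(3) ab_facts(1)[OF e(1)]] by auto
      show "on_obj L Y \<subseteq> (\<lambda>x. on_hom L (res (U Y)) Y (PR Y) (aL (U Y) x)) ` on_obj R (U Y)" using L_PR_surj[OF Y] by fastforce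
    qed
    fix s assume s: "s \<in> on_obj R V"
    note as = ab_facts(1)[OF V s]
    let ?t = "on_hom L (res V) S (rst K S (res V) \<kappa>) (aL V s)"
    have "BComp K (res V) S Y (trn K S Y h') (rst K S (res V) \<kappa>) = BComp K (res V) (res (U Y)) Y (PR Y) (rtrn V (U Y) h)"
      unfolding PR_def by (rule K.base_change[OF rV Y r(1) S hK eK \<kappa>' he', symmetric]) (use hk ex in auto)
    then have "on_hom L S Y (trn K S Y h') ?t = on_hom L (res (U Y)) Y (PR Y) (aL (U Y) (on_hom R V (U Y) (trn G V (U Y) h) s))"
      using K.apply_comp[OF L_functor rV S Y K.rst_in_Hom[OF S \<kappa>'] K.trn_in_Hom[OF S he'] as]
        K.apply_comp[OF L_functor rV r(1) Y K.trn_in_Hom[OF rV hK] r(3) as]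
        aL_nat_res[OF V e(1) trn_in_Hom[OF V he] s] res_hom_trn[OF V e(1) he] by simp
    then show "?t \<in> on_obj L S \<and>
        on_hom L S Y (rst K Y S i) ?t = on_hom L (res (U Y)) Y (PR Y) (aL (U Y) (on_hom R V (U Y) (rst G (U Y) V iV) s)) \<and>
        on_hom L S Y (rst K Y S j) ?t = on_hom L (res (U Y)) Y (PR Y) (aL (U Y) (on_hom R V (U Y) (rst G (U Y) V jV) s)) \<and>
        on_hom L S Y (trn K S Y h') ?t = on_hom L (res (U Y)) Y (PR Y) (aL (U Y) (on_hom R V (U Y) (trn G V (U Y) h) s))"
      using K.apply_in[OF L_functor rV S K.rst_in_Hom[OF S \<kappa>'] as] L_proj[OF Y S V ij(1) ijV(1) \<kappa>(1,3) s] L_proj[OF Y S V ij(2) ijV(2) \<kappa>(1,4) s] by simp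
  next
    have "BComp K (res emptyG) (res (U Y)) Y (PR Y) (rtrn emptyG (U Y) id) =
        BComp K (res emptyG) (res emptyG) Y (trn K (res emptyG) Y id) (rrst emptyG emptyG (\<lambda>x. x))"
      unfolding PR_def by (rule K.base_change[OF rE Y r(1) rE eE(2) eK eE(4,3)]) (simp_all add: emptyG)
    then have "on_hom L (res (U Y)) Y (PR Y) (on_hom L (res emptyG) (res (U Y)) (rtrn emptyG (U Y) id) (aL emptyG z)) = on_hom L (res emptyG) Y (trn K (res emptyG) Y id) (aL emptyG z)"
      using K.apply_comp[OF L_functor rE r(1) Y K.trn_in_Hom[OF rE eE(2)] r(3) az]
        K.apply_comp[OF L_functor rE rE Y K.rst_in_Hom[OF rE eE(4)] K.trn_in_Hom[OF rE eE(3)] az] K.apply_id[OF L_functor rE az]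
      by (simp add: K.rst_id[OF rE])
    then show "on_hom L (res (U Y)) Y (PR Y) (aL (U Y) (on_hom R emptyG (U Y) (trn G emptyG (U Y) id) z)) = on_hom L (res emptyG) Y (trn K (res emptyG) Y id) (aL emptyG z)"
      using aL_nat_res[OF emptyG(1) e(1) trn_in_Hom[OF emptyG(1) eE(1)] z] res_hom_trn[OF emptyG(1) e(1) eE(1)] by simp
  qed (use h(2) h'(2) grp in \<open>auto simp: emptyG\<close>)
qed

text \<open>The structure map of \<open>L\<close> under \<open>k\<close>; \<open>\<phi>\<close> is only available at \<open>U Y\<close>, so \<open>Y\<close> is embedded first.\<close>

definition lamL :: "('g, 'u) gset \<Rightarrow> 'v \<Rightarrow> 'v" where
  "lamL = (\<lambda>Y\<in>Fin K. \<lambda>y\<in>on_obj k Y. \<phi> (U Y) (on_hom k Y (res (U Y)) (IN Y) y))"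

lemma lamL_Hom: "lamL \<in> Hom (tambara_cat K) k L"
  unfolding K.Hom_tambara_cat[OF kf L_functor]
proof (intro conjI ballI)
  have val: "lamL Y y = \<phi> (U Y) (on_hom k Y (res (U Y)) (IN Y) y)" if "Y \<in> Fin K" "y \<in> on_obj k Y" for Y y using that by (simp add: lamL_def)
  have inL: "\<phi> (U Y) (on_hom k Y (res (U Y)) (IN Y) y) \<in> Lset Y" if Y: "Y \<in> Fin K" and y: "y \<in> on_obj k Y" for Y y
  proof -
    note e = emb[OF Y] and r = retract[OF Y] and J = J_facts[OF Y Y Kid[OF Y]]
    note ky = retract_apply(1)[OF kf Y y]
    have "on_hom k (res (U Y)) (res (U Y)) (J Y Y (BId K Y)) (on_hom k Y (res (U Y)) (IN Y) y) = on_hom k Y (res (U Y)) (IN Y) y"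
      using K.apply_comp[OF kf Y r(1) r(1) r(2) J(1) y] J(2) Kidr[OF Y r(1,2)] by simp
    then show ?thesis using \<phi>_ext[OF e(1) e(1) J(1) ky] \<phi>_in[OF e(1) ky] by (simp add: Lset_iff[OF Y])
  qed
  show "lamL \<in> extensional (Fin K)" by (simp add: lamL_def)
  fix Y :: "('g, 'u) gset" assume Y: "Y \<in> Fin K"
  show "lamL Y \<in> on_obj k Y \<rightarrow>\<^sub>E on_obj L Y" using inL[OF Y] Y by (auto simp: lamL_def L_obj[OF Y])
  fix Y' :: "('g, 'u) gset" and f y assume Y': "Y' \<in> Fin K" and f: "f \<in> BHom K Y Y'" and y: "y \<in> on_obj k Y"
  note e = emb[OF Y] and r = retract[OF Y] and e' = emb[OF Y'] and r' = retract[OF Y'] and J = J_facts[OF Y Y' f]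
  have fy: "on_hom k Y Y' f y \<in> on_obj k Y'" by (rule K.apply_in[OF kf Y Y' f y])
  have "on_hom L Y Y' f (lamL Y y) = ext (U Y) (U Y') (J Y Y' f) (\<phi> (U Y) (on_hom k Y (res (U Y)) (IN Y) y))"
    using inL[OF Y y] val[OF Y y] by (simp add: L_hom[OF Y Y' f])
  also have "\<dots> = \<phi> (U Y') (on_hom k (res (U Y)) (res (U Y')) (J Y Y' f) (on_hom k Y (res (U Y)) (IN Y) y))"
    using \<phi>_ext[OF e(1) e'(1) J(1) retract_apply(1)[OF kf Y y]] by simp
  also have "on_hom k (res (U Y)) (res (U Y')) (J Y Y' f) (on_hom k Y (res (U Y)) (IN Y) y) = on_hom k Y' (res (U Y')) (IN Y') (on_hom k Y Y' f y)"
    using K.apply_comp[OF kf Y r(1) r'(1) r(2) J(1) y] J(2) K.apply_comp[OF kf Y Y' r'(1) f r'(2) y] by simp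
  finally show "lamL Y' (on_hom k Y Y' f y) = on_hom L Y Y' f (lamL Y y)" using val[OF Y' fy] by simp
qed

text \<open>The comparison maps are mutually inverse and natural; they respect the structure maps by \<open>\<phi>_ext\<close>.\<close>

lemma L_iso:
  assumes \<phi>: "\<phi> \<in> Hom (tambara_cat G) (coind G H k) R"
  shows "\<exists>\<beta>. is_iso (under_cat (tambara_cat G) (coind G H k)) (coind G H L, coind_trans G H lamL) (R, \<phi>) \<beta>"
proof -
  note cL = coind_functor[OF L_functor] and ck = coind_functor[OF kf]
  define \<alpha> \<beta> where "\<alpha> = (\<lambda>X\<in>Fin G. \<lambda>x\<in>on_obj R X. aL X x)" and "\<beta> = (\<lambda>X\<in>Fin G. \<lambda>z\<in>on_obj L (res X). bL X z)"
  have \<alpha>: "\<alpha> \<in> Hom (tambara_cat G) R (coind G H L)"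
    unfolding Hom_tambara_cat[OF Rf cL]
    using ab_facts(1) aL_nat_res apply_in[OF Rf] by (auto simp: \<alpha>_def coind_obj coind_hom)
  have \<beta>: "\<beta> \<in> Hom (tambara_cat G) (coind G H L) R"
    unfolding Hom_tambara_cat[OF cL Rf]
    using ab_facts(2) bL_nat_res K.apply_in[OF L_functor res_gset_in res_gset_in res_hom_in] by (auto simp: \<beta>_def coind_obj coind_hom)
  have \<phi>e: "\<phi> \<in> extensional (Fin G)" "\<And>X. X \<in> Fin G \<Longrightarrow> \<phi> X \<in> extensional (on_obj k (res X))"
    using Hom_tambara_cat[OF ck Rf, THEN iffD1, OF \<phi>] by (auto simp: PiE_def coind_obj)
  have lam: "bL X (lamL (res X) y) = \<phi> X y \<and> lamL (res X) y = aL X (\<phi> X y) \<and> lamL (res X) y \<in> on_obj L (res X)" if X: "X \<in> Fin G" and y: "y \<in> on_obj k (res X)" for X y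
  proof -
    note rX = res_gset_in[OF X]
    note e = emb[OF rX] and r = retract[OF rX]
    have l: "lamL (res X) y \<in> on_obj L (res X)" using K.Hom_tambara_cat[OF kf L_functor, THEN iffD1, OF lamL_Hom] rX y by blast
    have a: "lamL (res X) y = aL X (\<phi> X y)" using \<phi>_ext[OF X e(1) r(2) y] rX y by (simp add: lamL_def aL_def)
    then show ?thesis using l ab_facts(3)[OF X \<phi>_in[OF X y]] by simp
  qed
  have 1: "Comp (tambara_cat G) (coind G H k) (coind G H L) R \<beta> (coind_trans G H lamL) = \<phi>"
  proof
    fix X
    show "Comp (tambara_cat G) (coind G H k) (coind G H L) R \<beta> (coind_trans G H lamL) X = \<phi> X"
    proof (cases "X \<in> Fin G")
      case X: True
      show ?thesis
      proof
        fix y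
        show "Comp (tambara_cat G) (coind G H k) (coind G H L) R \<beta> (coind_trans G H lamL) X y = \<phi> X y"
          using conjunct1[OF lam[OF X, of y]] conjunct2[OF conjunct2[OF lam[OF X, of y]]] X extensional_arb[OF \<phi>e(2)[OF X], of y]
          by (cases "y \<in> on_obj k (res X)") (simp_all add: Comp_tambara_cat \<beta>_def coind_trans_def coind_obj compose_def)
      qed
    qed (use extensional_arb[OF \<phi>e(1)] in \<open>simp add: Comp_tambara_cat\<close>)
  qed
  have 2: "Comp (tambara_cat G) (coind G H k) R (coind G H L) \<alpha> \<phi> = coind_trans G H lamL"
  proof
    fix X
    show "Comp (tambara_cat G) (coind G H k) R (coind G H L) \<alpha> \<phi> X = coind_trans G H lamL X"
    proof (cases "X \<in> Fin G")
      case X: True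
      show ?thesis
      proof
        fix y
        show "Comp (tambara_cat G) (coind G H k) R (coind G H L) \<alpha> \<phi> X y = coind_trans G H lamL X y"
          using lam[OF X, of y] X res_gset_in[OF X] \<phi>_in[OF X, of y]
          by (cases "y \<in> on_obj k (res X)") (simp_all add: Comp_tambara_cat \<alpha>_def coind_trans_def coind_obj compose_def lamL_def)
      qed
    qed (simp add: Comp_tambara_cat coind_trans_def)
  qed
  have 3: "Comp (tambara_cat G) (coind G H L) R (coind G H L) \<alpha> \<beta> = Ident (tambara_cat G) (coind G H L)"
    using ab_facts(2,4) by (auto simp: Comp_tambara_cat Ident_tambara_cat \<alpha>_def \<beta>_def coind_obj compose_def fun_eq_iff)
  have 4: "Comp (tambara_cat G) R (coind G H L) R \<beta> \<alpha> = Ident (tambara_cat G) R"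
    using ab_facts(1,3) by (auto simp: Comp_tambara_cat Ident_tambara_cat \<alpha>_def \<beta>_def coind_obj compose_def fun_eq_iff)
  show ?thesis
    unfolding is_iso_def under_cat_Hom under_cat_Comp under_cat_Ident fst_conv snd_conv
    by (intro exI[of _ \<beta>] conjI bexI[of _ \<alpha>] CollectI) (use \<alpha> \<beta> 1 2 3 4 in simp_all)
qed

end

theorem corollary7:
  fixes G :: "'g monoid" and H :: "'g set" and k :: "('g, 'u::infinite, 'v) tambara"
  assumes "group G" and "finite (carrier G)" and "subgroup H G"
    and "k \<in> Obj (tambara_cat (G\<lparr>carrier := H\<rparr>))"
  shows "is_equivalence
           (under_cat (tambara_cat (G\<lparr>carrier := H\<rparr>)) k)
           (under_cat (tambara_cat G) (coind G H k))
           (coind_under G H)"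
proof -
  interpret group G by fact
  interpret subgroup H G by fact
  interpret subgroup_pair G H by unfold_locales (use assms(2,3) in auto)
  have k: "prod_functor K k" using assms(4) by (simp add: K.Obj_tambara_cat)
  have oo: "on_obj (coind_under G H) X = (coind G H (fst X), coind_trans G H (snd X))"
    and hh: "on_hom (coind_under G H) X Y = coind_trans G H"
    for X Y :: "('g, 'u, 'v) tambara \<times> (('g, 'u) gset \<Rightarrow> 'v \<Rightarrow> 'v)" by (cases X; simp add: coind_under_def)+
  show ?thesis
  proof (rule equivalence_if_fully_faithful_ess_surj)
    show "category (under_cat (tambara_cat K) k)" by (rule category_under_cat[OF K.category_tambara_cat assms(4)])
    show "category (under_cat (tambara_cat G) (coind G H k))" by (rule category_under_cat[OF category_tambara_cat coind_in_Obj[OF assms(4)]])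
    show "is_functor (under_cat (tambara_cat K) k) (under_cat (tambara_cat G) (coind G H k)) (coind_under G H)"
      by (rule is_functor_coind_under[OF assms(4)])
  next
    fix X Y :: "('g, 'u, 'v) tambara \<times> (('g, 'u) gset \<Rightarrow> 'v \<Rightarrow> 'v)" and f g
    assume "X \<in> Obj (under_cat (tambara_cat K) k)" "Y \<in> Obj (under_cat (tambara_cat K) k)"
      "f \<in> Hom (under_cat (tambara_cat K) k) X Y" "g \<in> Hom (under_cat (tambara_cat K) k) X Y"
      "on_hom (coind_under G H) X Y f = on_hom (coind_under G H) X Y g"
    then show "f = g" using coind_faithful[of "fst X" "fst Y" f g] by (simp add: under_cat_Obj under_cat_Hom hh tambara_functor)
  next
    fix X Y :: "('g, 'u, 'v) tambara \<times> (('g, 'u) gset \<Rightarrow> 'v \<Rightarrow> 'v)" and h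
    assume "X \<in> Obj (under_cat (tambara_cat K) k)" "Y \<in> Obj (under_cat (tambara_cat K) k)"
      "h \<in> Hom (under_cat (tambara_cat G) (coind G H k)) (on_obj (coind_under G H) X) (on_obj (coind_under G H) Y)"
    then show "\<exists>f\<in>Hom (under_cat (tambara_cat K) k) X Y. on_hom (coind_under G H) X Y f = h"
      using coind_full[OF k, of "fst X" "fst Y" "snd X" "snd Y" h] by (auto simp: under_cat_Obj under_cat_Hom hh oo K.Obj_tambara_cat)
  next
    fix Y :: "('g, 'u, 'v) tambara \<times> (('g, 'u) gset \<Rightarrow> 'v \<Rightarrow> 'v)"
    assume Y: "Y \<in> Obj (under_cat (tambara_cat G) (coind G H k))"
    obtain R \<phi> where RY: "Y = (R, \<phi>)" by (cases Y)
    have RO: "R \<in> Obj (tambara_cat G)" and \<phi>: "\<phi> \<in> Hom (tambara_cat G) (coind G H k) R" using Y by (simp_all add: RY under_cat_Obj)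
    interpret under_coind G H k R \<phi>
      by (rule under_coind_of_Hom[OF k _ \<phi>]) (use RO in \<open>simp add: Obj_tambara_cat\<close>)
    have "extensional_functor (bispan_cat K) L" by (auto simp: L_def extensional_functor_def restrict_functor_def)
    moreover have "group (additive_monoid K L X)" if X: "X \<in> Fin K" for X
      using L_additive_group[OF X] emb(1)[OF X] RO by (simp add: Obj_tambara_cat)
    ultimately have "L \<in> Obj (tambara_cat K)" unfolding K.Obj_tambara_cat using L_prod by simp
    then have "(L, lamL) \<in> Obj (under_cat (tambara_cat K) k)" using lamL_Hom by (simp add: under_cat_Obj)
    moreover have "\<exists>h. is_iso (under_cat (tambara_cat G) (coind G H k)) (on_obj (coind_under G H) (L, lamL)) Y h"
      using L_iso[OF \<phi>] by (simp add: oo RY)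
    ultimately show "\<exists>X\<in>Obj (under_cat (tambara_cat K) k). \<exists>h. is_iso (under_cat (tambara_cat G) (coind G H k)) (on_obj (coind_under G H) X) Y h" by blast
  qed
qed

end
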